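(* Assume that the controlled wave equation $$\Phi'+A\Phi+\mathbf F\,\mathbf 1_\omega+G(\Phi)=0\ \text{ on }(0,T),\qquad \Phi(0,\cdot)=\Phi_0,\quad \Phi(T,\cdot)=\Phi_T,$$ admits an exact solution $\Phi\in C([0,T];\mathcal E)$ corresponding to an internal control $\mathbf F\,\mathbf 1_\omega=(0,f\mathbf 1_\omega)\in L^2((0,T);\mathcal E)$. Suppose that $G(\Phi)=(0,g(u))$ for $\Phi=(u,z)$, where $g:H_0^1(\Omega)\to L^2(\Omega)$ is Lipschitz continuous with constant $L_g$. Let $\sigma\in C^2(\mathbb R)$ be not a polynomial. Then, for every $\epsilon>0$, there exist a truncation order $P\in\mathbb N^*$, a network width $m\in\mathbb N^*$, and parameters $\theta=(\theta_a,\theta_c)\in(\mathbb R^m)^{6P}$ such that the Neural-Spectral state-control pair $$\widetilde\Phi_\theta(t,x)=\sum_{j=1}^P\bigl(a_j(t;\theta),a_j'(t;\theta)\bigr)e_j(x),\qquad \widetilde{\mathbf F}_{\theta_c}(t,x)\mathbf 1_\omega=\Bigl(0,\ \mathbf 1_\omega\sum_{j=1}^Pc_j(t;\theta_c)e_j(x)\Bigr)$$ simultaneously satisfies $$\sup_{t\in[0,T]}\bigl\|\Phi(t,\cdot)-\widetilde\Phi_\theta(t,\cdot)\bigr\|_{\mathcal E}<\epsilon\qquad\text{and}\qquad \bigl\|\mathbf F\mathbf 1_\omega-\widetilde{\mathbf F}_{\theta_c}\mathbf 1_\omega\bigr\|_{L^2((0,T);\mathcal E)}<\epsilon .$$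
   Context: $\Omega=(0,1)^N$, $\omega\subset\Omega$ is a nonempty open subset with characteristic function $\mathbf 1_\omega$, $T>0$, $\alpha\ge 0$ is a real constant, $\mathbb N^*=\{1,2,\dots\}$. States and controls are real-valued. $H_0^1(\Omega)$ carries the norm $\|u\|_{H_0^1}^2=\int_\Omega(|\nabla u|^2+\alpha|u|^2)dx$, and the energy space $\mathcal E=H_0^1(\Omega)\times L^2(\Omega)$ the norm $\|(u,z)\|_{\mathcal E}^2=\|u\|_{H_0^1}^2+\|z\|_{L^2}^2$. The operator $A$ has domain $D(A)=(H^2(\Omega)\cap H^1_0(\Omega))\times H_0^1(\Omega)$ and $A(u,z)=(-z,\,-\Delta u+\alpha u)$; it is skew-adjoint and $e^{-tA}$ is a unitary group. Solutions in $C([0,T];\mathcal E)$ are understood in the mild sense, $\Phi(t)=e^{-tA}\Phi_0-\int_0^te^{-(t-s)A}[\mathbf F(s)\mathbf 1_\omega+G(\Phi(s))]ds$. The nonlinearity $g:\mathbb R\to\mathbb R$ is identified with its Nemytskii operator. $\Phi_0,\Phi_T\in\mathcal E$ are the prescribed initial and target states. Standing assumption: $(\omega,T)$ satisfies the Geometric Control Condition, i.e. every optical ray propagating in $\Omega$ and reflecting on $\partial\Omega$ enters $\omega$ within the time interval $(0,T)$. For $k\in(\mathbb N^* )^N$ the Dirichlet eigenfunctions of $-\Delta$ are $e_k(x)=2^{N/2}\prod_{j=1}^N\sin(k_j\pi x_j)$, with eigenvalues $\mu_k=\pi^2\sum_j k_j^2$; they are enumerated as $e_j,\mu_j$, $j\in\mathbb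 N^*$, by ordering the multi-indices by increasing $\sum_j k_j^2$, ties being broken lexicographically. The parameters are $\theta_a=(A_j^a,W_j^a,B_j^a)_{j=1}^P$ and $\theta_c=(A_j^c,W_j^c,B_j^c)_{j=1}^P$ with all vectors in $\mathbb R^m$; $a_j(t;\theta)=A_j^a\cdot\sigma(W_j^at+B_j^a)$, $c_j(t;\theta_c)=A_j^c\cdot\sigma(W_j^ct+B_j^c)$, where $\sigma$ acts componentwise and "$\cdot$" is the Euclidean inner product; $a_j'$ is the time derivative. *)

theory Defs
  imports "HOL-Analysis.Analysis" "HOL-Library.Function_Algebras"
begin

text \<open>Functions form a real vector space pointwise; together with the product instance this lets
  states \<open>(u, z)\<close> be added and scaled with the usual notation.\<close>

instantiation "fun" :: (type, real_vector) real_vector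
begin

definition scaleR_fun :: "real \<Rightarrow> ('a \<Rightarrow> 'b) \<Rightarrow> 'a \<Rightarrow> 'b" where
  "scaleR_fun c f = (\<lambda>x. c *\<^sub>R f x)"

instance
  by standard (auto simp: scaleR_fun_def plus_fun_def algebra_simps)

end

text \<open>Elements of \<open>L\<^sup>2\<close>, \<open>H\<^sup>1\<close>, ... are represented by functions on the whole space whose values
  outside the cube are irrelevant. Equality in these spaces is equality almost everywhere on the cube,
  expressed as vanishing of the (semi)norm of the difference.\<close>

definition \<Omega> :: "(real ^ 'n) set" where
  "\<Omega> = box 0 1"

definition L2 :: "(real ^ 'n \<Rightarrow> real) set" where
  "L2 = {u. u \<in> borel_measurable (lebesgue_on \<Omega>) \<and> integrable (lebesgue_on \<Omega>) (\<lambda>x. (u x)\<^sup>2)}"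

definition L2_norm :: "(real ^ 'n \<Rightarrow> real) \<Rightarrow> real" where
  "L2_norm u = sqrt (LINT x|lebesgue_on \<Omega>. (u x)\<^sup>2)"

definition partial_deriv :: "'n \<Rightarrow> (real ^ 'n \<Rightarrow> real) \<Rightarrow> real ^ 'n \<Rightarrow> real" where
  "partial_deriv i \<phi> x = frechet_derivative \<phi> (at x) (axis i 1)"

definition smooth :: "(real ^ 'n \<Rightarrow> real) \<Rightarrow> bool" where
  "smooth \<phi> \<longleftrightarrow> (\<forall>is x. foldr partial_deriv is \<phi> differentiable (at x))"

definition test_functions :: "(real ^ 'n \<Rightarrow> real) set" where
  "test_functions =
     {\<phi>. smooth \<phi> \<and> compact (closure {x. \<phi> x \<noteq> 0}) \<and> closure {x. \<phi> x \<noteq> 0} \<subseteq> \<Omega>}"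

definition has_weak_partial :: "'n \<Rightarrow> (real ^ 'n \<Rightarrow> real) \<Rightarrow> (real ^ 'n \<Rightarrow> real) \<Rightarrow> bool" where
  "has_weak_partial i u v \<longleftrightarrow>
     (\<forall>\<phi>\<in>test_functions. (LINT x|lebesgue_on \<Omega>. u x * partial_deriv i \<phi> x)
                        = - (LINT x|lebesgue_on \<Omega>. v x * \<phi> x))"

definition H1 :: "(real ^ 'n \<Rightarrow> real) set" where
  "H1 = {u \<in> L2. \<forall>i. \<exists>v\<in>L2. has_weak_partial i u v}"

text \<open>The chosen representative is unique up to null sets.\<close>

definition weak_partial :: "'n \<Rightarrow> (real ^ 'n \<Rightarrow> real) \<Rightarrow> real ^ 'n \<Rightarrow> real" where
  "weak_partial i u = (SOME v. v \<in> L2 \<and> has_weak_partial i u v)"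

definition H1_norm :: "(real ^ 'n \<Rightarrow> real) \<Rightarrow> real" where
  "H1_norm u = sqrt ((L2_norm u)\<^sup>2 + (\<Sum>i\<in>UNIV. (L2_norm (weak_partial i u))\<^sup>2))"

definition H01 :: "(real ^ 'n \<Rightarrow> real) set" where
  "H01 = {u \<in> H1. \<exists>\<phi>. (\<forall>k. \<phi> k \<in> test_functions) \<and> (\<lambda>k. H1_norm (\<phi> k - u)) \<longlonglongrightarrow> 0}"

definition H2 :: "(real ^ 'n \<Rightarrow> real) set" where
  "H2 = {u \<in> H1. \<forall>i. weak_partial i u \<in> H1}"

definition weak_laplacian :: "(real ^ 'n \<Rightarrow> real) \<Rightarrow> real ^ 'n \<Rightarrow> real" where
  "weak_laplacian u = (\<Sum>i\<in>UNIV. weak_partial i (weak_partial i u))"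

definition H01_norm :: "real \<Rightarrow> (real ^ 'n \<Rightarrow> real) \<Rightarrow> real" where
  "H01_norm \<alpha> u =
     sqrt (LINT x|lebesgue_on \<Omega>. (\<Sum>i\<in>UNIV. (weak_partial i u x)\<^sup>2) + \<alpha> * \<bar>u x\<bar>\<^sup>2)"

type_synonym 'n state = "(real ^ 'n \<Rightarrow> real) \<times> (real ^ 'n \<Rightarrow> real)"

definition energy_space :: "('n::finite) state set" where
  "energy_space = H01 \<times> L2"

definition energy_norm :: "real \<Rightarrow> ('n::finite) state \<Rightarrow> real" where
  "energy_norm \<alpha> \<Phi> = sqrt ((H01_norm \<alpha> (fst \<Phi>))\<^sup>2 + (L2_norm (snd \<Phi>))\<^sup>2)"

definition wave_domain :: "('n::finite) state set" where
  "wave_domain = (H2 \<inter> H01) \<times> H01"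

definition wave_op :: "real \<Rightarrow> ('n::finite) state \<Rightarrow> 'n state" where
  "wave_op \<alpha> = (\<lambda>(u, z). (- z, - weak_laplacian u + \<alpha> *\<^sub>R u))"

text \<open>\<open>S t\<close> is \<open>e\<^sup>-\<^sup>t\<^sup>A\<close>: the strongly continuous unitary group on the energy space whose
  infinitesimal generator is \<open>- A\<close> with exactly the domain of \<open>A\<close>. It is determined up to
  equality almost everywhere.\<close>

definition wave_group :: "real \<Rightarrow> (real \<Rightarrow> ('n::finite) state \<Rightarrow> 'n state) \<Rightarrow> bool" where
  "wave_group \<alpha> S \<longleftrightarrow>
     (\<forall>t. \<forall>\<Phi>\<in>energy_space. S t \<Phi> \<in> energy_space \<and> energy_norm \<alpha> (S t \<Phi>) = energy_norm \<alpha> \<Phi>) \<and>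
     (\<forall>t c. \<forall>\<Phi>\<in>energy_space. \<forall>\<Psi>\<in>energy_space.
        energy_norm \<alpha> (S t (\<Phi> + c *\<^sub>R \<Psi>) - (S t \<Phi> + c *\<^sub>R S t \<Psi>)) = 0) \<and>
     (\<forall>\<Phi>\<in>energy_space. energy_norm \<alpha> (S 0 \<Phi> - \<Phi>) = 0) \<and>
     (\<forall>s t. \<forall>\<Phi>\<in>energy_space. energy_norm \<alpha> (S (s + t) \<Phi> - S s (S t \<Phi>)) = 0) \<and>
     (\<forall>\<Phi>\<in>energy_space. ((\<lambda>t. energy_norm \<alpha> (S t \<Phi> - \<Phi>)) \<longlongrightarrow> 0) (at 0)) \<and>
     (\<forall>\<Phi>\<in>energy_space. \<Phi> \<in> wave_domain \<longleftrightarrow>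
        (\<exists>\<Psi>\<in>energy_space.
           ((\<lambda>h. energy_norm \<alpha> ((1 / h) *\<^sub>R (S h \<Phi> - \<Phi>) - \<Psi>)) \<longlongrightarrow> 0) (at 0))) \<and>
     (\<forall>\<Phi>\<in>wave_domain.
        ((\<lambda>h. energy_norm \<alpha> ((1 / h) *\<^sub>R (S h \<Phi> - \<Phi>) - (- wave_op \<alpha> \<Phi>))) \<longlongrightarrow> 0) (at 0))"

definition continuous_energy :: "real \<Rightarrow> real \<Rightarrow> (real \<Rightarrow> ('n::finite) state) \<Rightarrow> bool" where
  "continuous_energy \<alpha> T \<Phi> \<longleftrightarrow>
     (\<forall>t\<in>{0..T}. \<Phi> t \<in> energy_space \<and>
        ((\<lambda>s. energy_norm \<alpha> (\<Phi> s - \<Phi> t)) \<longlongrightarrow> 0) (at t within {0..T}))"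

definition strongly_measurable :: "real \<Rightarrow> real measure \<Rightarrow> (real \<Rightarrow> ('n::finite) state) \<Rightarrow> bool" where
  "strongly_measurable \<alpha> M h \<longleftrightarrow>
     (AE t in M. h t \<in> energy_space) \<and>
     (\<exists>s. (\<forall>n. simple_function M (s n) \<and> s n ` space M \<subseteq> energy_space) \<and>
          (AE t in M. (\<lambda>n. energy_norm \<alpha> (h t - s n t)) \<longlonglongrightarrow> 0))"

text \<open>The Bochner integral for the energy seminorm, following \<open>has_bochner_integral\<close>, which is not
  applicable since its codomain has to be a normed type.\<close>

definition has_energy_integral ::
  "real \<Rightarrow> real measure \<Rightarrow> (real \<Rightarrow> ('n::finite) state) \<Rightarrow> 'n state \<Rightarrow> bool" where
  "has_energy_integral \<alpha> M h I \<longleftrightarrow>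
     I \<in> energy_space \<and> strongly_measurable \<alpha> M h \<and>
     (\<exists>s. (\<forall>n. Bochner_Integration.simple_bochner_integrable M (s n) \<and> s n ` space M \<subseteq> energy_space) \<and>
          (\<lambda>n. \<integral>\<^sup>+ t. ennreal (energy_norm \<alpha> (h t - s n t)) \<partial>M) \<longlonglongrightarrow> 0 \<and>
          (\<lambda>n. energy_norm \<alpha> (Bochner_Integration.simple_bochner_integral M (s n) - I)) \<longlonglongrightarrow> 0)"

definition L2_energy :: "real \<Rightarrow> real \<Rightarrow> (real \<Rightarrow> ('n::finite) state) set" where
  "L2_energy \<alpha> T =
     {h. strongly_measurable \<alpha> (lebesgue_on {0<..<T}) h \<and>
         integrable (lebesgue_on {0<..<T}) (\<lambda>t. (energy_norm \<alpha> (h t))\<^sup>2)}"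

definition L2_energy_norm :: "real \<Rightarrow> real \<Rightarrow> (real \<Rightarrow> ('n::finite) state) \<Rightarrow> real" where
  "L2_energy_norm \<alpha> T h = sqrt (LINT t|lebesgue_on {0<..<T}. (energy_norm \<alpha> (h t))\<^sup>2)"

definition mild_solution ::
  "real \<Rightarrow> (real \<Rightarrow> 'n state \<Rightarrow> 'n state) \<Rightarrow> real \<Rightarrow> 'n state \<Rightarrow> (real \<Rightarrow> 'n state)
    \<Rightarrow> ('n state \<Rightarrow> 'n state) \<Rightarrow> (real \<Rightarrow> ('n::finite) state) \<Rightarrow> bool" where
  "mild_solution \<alpha> S T \<Phi>\<^sub>0 F G \<Phi> \<longleftrightarrow>
     continuous_energy \<alpha> T \<Phi> \<and>
     (\<forall>t\<in>{0..T}. \<exists>I.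
        has_energy_integral \<alpha> (lebesgue_on {0..t}) (\<lambda>s. S (t - s) (F s + G (\<Phi> s))) I \<and>
        energy_norm \<alpha> (\<Phi> t - (S t \<Phi>\<^sub>0 - I)) = 0)"

definition local_control :: "(real ^ 'n) set \<Rightarrow> (real \<Rightarrow> real ^ 'n \<Rightarrow> real) \<Rightarrow> real \<Rightarrow> ('n::finite) state" where
  "local_control \<omega> f t = (0, \<lambda>x. indicator \<omega> x * f t x)"

text \<open>Specular reflection: the velocity components normal to the faces containing \<open>x\<close> change sign.\<close>

definition reflect :: "real ^ 'n \<Rightarrow> real ^ 'n \<Rightarrow> real ^ 'n" where
  "reflect x v = (\<chi> i. if x $ i = 0 \<or> x $ i = 1 then - v $ i else v $ i)"

text \<open>A unit speed curve in the closed cube which is straight near each time, up to a specular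
  reflection when it is on the boundary. Curves gliding inside the boundary for all times are excluded,
  since they do not propagate in \<open>\<Omega>\<close> (and never meet a subset of \<open>\<Omega>\<close>).\<close>

definition optical_ray :: "(real \<Rightarrow> real ^ 'n) \<Rightarrow> bool" where
  "optical_ray \<gamma> \<longleftrightarrow>
     (\<forall>t. \<gamma> t \<in> closure \<Omega>) \<and> (\<exists>t. \<gamma> t \<in> \<Omega>) \<and>
     (\<forall>t. \<exists>\<delta>>0. \<exists>v. norm v = 1 \<and>
        (\<forall>s\<in>{t - \<delta><..t}. \<gamma> s = \<gamma> t + (s - t) *\<^sub>R v) \<and>
        (\<forall>s\<in>{t..<t + \<delta>}. \<gamma> s = \<gamma> t + (s - t) *\<^sub>R reflect (\<gamma> t) v))"

definition geometric_control_condition :: "(real ^ 'n) set \<Rightarrow> real \<Rightarrow> bool" where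
  "geometric_control_condition \<omega> T \<longleftrightarrow> (\<forall>\<gamma>. optical_ray \<gamma> \<longrightarrow> (\<exists>t\<in>{0<..<T}. \<gamma> t \<in> \<omega>))"

definition dirichlet_eigenfunction :: "('n::finite \<Rightarrow> nat) \<Rightarrow> real ^ 'n \<Rightarrow> real" where
  "dirichlet_eigenfunction k x =
     2 powr (real CARD('n) / 2) * (\<Prod>i\<in>UNIV. sin (real (k i) * pi * x $ i))"

definition multi_indices :: "('n \<Rightarrow> nat) set" where
  "multi_indices = {k. \<forall>i. k i \<ge> 1}"

definition mi_less :: "('n::{finite, linorder} \<Rightarrow> nat) \<Rightarrow> ('n \<Rightarrow> nat) \<Rightarrow> bool" where
  "mi_less k l \<longleftrightarrow>
     (\<Sum>i\<in>UNIV. (k i)\<^sup>2) < (\<Sum>i\<in>UNIV. (l i)\<^sup>2) \<or>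
     (\<Sum>i\<in>UNIV. (k i)\<^sup>2) = (\<Sum>i\<in>UNIV. (l i)\<^sup>2) \<and>
       (\<exists>i. k i < l i \<and> (\<forall>i'<i. k i' = l i'))"

text \<open>The \<open>j\<close>-th multi-index, counted from \<open>j = 1\<close>, is the one with \<open>j - 1\<close> predecessors.\<close>

definition mi_enum :: "nat \<Rightarrow> 'n::{finite, linorder} \<Rightarrow> nat" where
  "mi_enum j = (THE k. k \<in> multi_indices \<and> Suc (card {l \<in> multi_indices. mi_less l k}) = j)"

definition eigenfunction :: "nat \<Rightarrow> real ^ 'n::{finite, linorder} \<Rightarrow> real" where
  "eigenfunction j = dirichlet_eigenfunction (mi_enum j)"

definition C2_fun :: "(real \<Rightarrow> real) \<Rightarrow> bool" where
  "C2_fun \<sigma> \<longleftrightarrow>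
     (\<exists>\<sigma>' \<sigma>''. (\<forall>x. (\<sigma> has_real_derivative \<sigma>' x) (at x)) \<and>
              (\<forall>x. (\<sigma>' has_real_derivative \<sigma>'' x) (at x)) \<and> continuous_on UNIV \<sigma>'')"

text \<open>For each \<open>j\<close> a parameter family provides the triple \<open>(A\<^sub>j, W\<^sub>j, B\<^sub>j)\<close> of vectors in \<open>\<real>\<^sup>m\<close>,
  given by their components \<open>1, \<dots>, m\<close>; indices \<open>j\<close> outside \<open>1, \<dots>, P\<close> and components outside
  \<open>1, \<dots>, m\<close> are never used.\<close>

type_synonym params = "nat \<Rightarrow> (nat \<Rightarrow> real) \<times> (nat \<Rightarrow> real) \<times> (nat \<Rightarrow> real)"

definition net :: "(real \<Rightarrow> real) \<Rightarrow> nat \<Rightarrow> params \<Rightarrow> nat \<Rightarrow> real \<Rightarrow> real" where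
  "net \<sigma> m \<theta> j t = (case \<theta> j of (A, W, B) \<Rightarrow> \<Sum>i=1..m. A i * \<sigma> (W i * t + B i))"

definition ns_state ::
  "(real \<Rightarrow> real) \<Rightarrow> nat \<Rightarrow> nat \<Rightarrow> params \<Rightarrow> real \<Rightarrow> ('n::{finite, linorder}) state" where
  "ns_state \<sigma> P m \<theta> t =
     ((\<lambda>x. \<Sum>j=1..P. net \<sigma> m \<theta> j t * eigenfunction j x),
      (\<lambda>x. \<Sum>j=1..P. deriv (net \<sigma> m \<theta> j) t * eigenfunction j x))"

definition ns_control ::
  "(real \<Rightarrow> real) \<Rightarrow> nat \<Rightarrow> nat \<Rightarrow> params \<Rightarrow> real \<Rightarrow> real ^ 'n::{finite, linorder} \<Rightarrow> real" where
  "ns_control \<sigma> P m \<theta> t x = (\<Sum>j=1..P. net \<sigma> m \<theta> j t * eigenfunction j x)"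

end

theory Submission
  imports Defs "HOL-Computational_Algebra.Polynomial"
begin

text \<open>State and control are both expanded in the Dirichlet eigenfunctions \<open>e\<^sub>j\<close>, and the time-dependent
coefficients of the truncated expansions are replaced by networks. Two points need an argument: the first
component of the ansatz has coefficients \<open>a\<^sub>j\<close> and the second one has the \<^emph>\<open>derivatives\<close> \<open>a\<^sub>j'\<close> of the
same networks, and the error of the state has to be small uniformly in time.

The coefficients \<open>u\<^sub>j\<close> and \<open>z\<^sub>j\<close> of displacement and velocity of a mild solution satisfy \<open>u\<^sub>j' = z\<^sub>j\<close>
(\<open>mild_solution_modes\<close>), although the solution itself need not be differentiable in time. Indeed, the
generator maps the plane spanned by \<open>(e\<^sub>j, 0)\<close> and \<open>(0, e\<^sub>j)\<close> to itself, so the adjoint group solves a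
two-dimensional linear system there and the group rotates each pair of coefficients (\<open>group_modes\<close>).
Testing the mild formula with the two vectors turns it into explicit scalar Duhamel integrals of an
integrable forcing, and those can be differentiated (\<open>duhamel_derivative\<close>). Since \<open>z\<^sub>j\<close> is continuous,
\<open>u\<^sub>j\<close> is of class \<open>C\<^sup>1\<close>, and it suffices that networks approximate a \<open>C\<^sup>1\<close> function together with its
derivative (\<open>C1_approx_networks\<close>).

That the truncation error is small uniformly in time follows from compactness of \<open>[0, T]\<close>: orthogonal
projections are best approximations, so a good truncation order at one time remains good nearby
(\<open>proj_close_uniform\<close>). It requires completeness of the modes for both components. In \<open>L\<^sup>2\<close> this is the
Stone-Weierstrass theorem, applied to the continuous multipliers of the space of sine polynomials
(\<open>sine_span_dense_L2\<close>). In the energy norm it is enough to treat test functions \<open>\<phi>\<close>, for which the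
error \<open>r\<close> of the \<open>L\<^sup>2\<close> projection has energy \<open>\<langle>-\<Delta>\<phi> + \<alpha>\<phi>, r\<rangle>\<close>, hence is controlled by its
\<open>L\<^sup>2\<close> norm (\<open>test_function_sine_approx\<close>).

The control is only square integrable in time. Its truncation error tends to zero by dominated
convergence, its finitely many remaining coefficients are approximated in \<open>L\<^sup>2(0, T)\<close> by continuous functions
and these by networks (\<open>control_approx\<close>). Multiplication by \<open>\<one>\<^sub>\<omega>\<close> does not increase the error.

The network theorem rests on finite differences: if \<open>\<Delta>\<^sub>h\<^sup>k \<tau> (b) \<noteq> 0\<close>, then \<open>k\<close>-th differences in the weight
of \<open>\<tau>(w t + b)\<close>, smoothed by moving averages, converge uniformly to a multiple of \<open>t\<^sup>k\<close>, and if
\<open>\<Delta>\<^sub>h\<^sup>k \<tau>\<close> vanishes for all \<open>h\<close>, then \<open>\<tau>\<close> is a polynomial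
(\<open>monomial_in_ridge_closure\<close>, \<open>vanishing_differences_imp_poly\<close>).\<close>

type_synonym 'n func = "real ^ 'n \<Rightarrow> real"

section \<open>Finite differences and moving averages\<close>

text \<open>The closure of \<open>V\<close> in the topology of uniform convergence on \<open>K\<close>, for functions given on the
whole line; membership depends only on the restriction to \<open>K\<close>.\<close>

definition uniform_closure :: "real set \<Rightarrow> (real \<Rightarrow> real) set \<Rightarrow> (real \<Rightarrow> real) set" where
  "uniform_closure K V = {q. \<forall>\<epsilon>>0. \<exists>h\<in>V. \<forall>t\<in>K. \<bar>q t - h t\<bar> \<le> \<epsilon>}"

lemma uniform_closureI:
  assumes "\<And>\<epsilon>. \<epsilon> > 0 \<Longrightarrow> \<exists>h\<in>V. \<forall>t\<in>K. \<bar>q t - h t\<bar> \<le> \<epsilon>"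
  shows "q \<in> uniform_closure K V"
  using assms unfolding uniform_closure_def by auto

lemma uniform_closure_superset: "q \<in> V \<Longrightarrow> q \<in> uniform_closure K V"
  unfolding uniform_closure_def by (auto intro!: bexI[of _ q])

lemma subspace_uniform_closure:
  assumes "subspace V"
  shows "subspace (uniform_closure K V)"
proof (rule subspaceI)
  show "0 \<in> uniform_closure K V"
    using assms by (simp add: subspace_0 uniform_closure_superset)
next
  fix f g assume f: "f \<in> uniform_closure K V" and g: "g \<in> uniform_closure K V"
  show "f + g \<in> uniform_closure K V"
  proof (rule uniform_closureI)
    fix \<epsilon> :: real assume "\<epsilon> > 0"
    hence e: "\<epsilon>/2 > 0" by simp
    obtain a where a: "a \<in> V" "\<forall>t\<in>K. \<bar>f t - a t\<bar> \<le> \<epsilon>/2"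
      using f e unfolding uniform_closure_def by blast
    obtain b where b: "b \<in> V" "\<forall>t\<in>K. \<bar>g t - b t\<bar> \<le> \<epsilon>/2"
      using g e unfolding uniform_closure_def by blast
    have "\<forall>t\<in>K. \<bar>(f+g) t - (a+b) t\<bar> \<le> \<epsilon>"
    proof
      fix t assume "t \<in> K"
      thus "\<bar>(f+g) t - (a+b) t\<bar> \<le> \<epsilon>" using bspec[OF a(2), of t] bspec[OF b(2), of t]
        unfolding plus_fun_def by linarith
    qed
    thus "\<exists>h\<in>V. \<forall>t\<in>K. \<bar>(f+g) t - h t\<bar> \<le> \<epsilon>"
      using a(1) b(1) assms subspace_add by blast
  qed
next
  fix c :: real and f assume f: "f \<in> uniform_closure K V"
  show "c *\<^sub>R f \<in> uniform_closure K V"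
  proof (rule uniform_closureI)
    fix \<epsilon> :: real assume "\<epsilon> > 0"
    hence e: "\<epsilon>/(\<bar>c\<bar>+1) > 0" by simp
    obtain a where a: "a \<in> V" "\<forall>t\<in>K. \<bar>f t - a t\<bar> \<le> \<epsilon>/(\<bar>c\<bar>+1)"
      using f e unfolding uniform_closure_def by blast
    have "\<bar>(c *\<^sub>R f) t - (c *\<^sub>R a) t\<bar> \<le> \<epsilon>" if "t \<in> K" for t
    proof -
      have "\<bar>(c *\<^sub>R f) t - (c *\<^sub>R a) t\<bar> = \<bar>c\<bar> * \<bar>f t - a t\<bar>"
        by (simp add: scaleR_fun_def abs_mult flip: right_diff_distrib)
      also have "\<dots> \<le> (\<bar>c\<bar>+1) * (\<epsilon>/(\<bar>c\<bar>+1))"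
        using a(2) that by (intro mult_mono) auto
      finally show ?thesis by simp
    qed
    thus "\<exists>h\<in>V. \<forall>t\<in>K. \<bar>(c *\<^sub>R f) t - h t\<bar> \<le> \<epsilon>"
      using a(1) assms subspace_scale by blast
  qed
qed

lemma uniform_closure_limit:
  assumes "\<And>\<epsilon>. \<epsilon> > 0 \<Longrightarrow> \<exists>h\<in>uniform_closure K V. \<forall>t\<in>K. \<bar>q t - h t\<bar> \<le> \<epsilon>"
  shows "q \<in> uniform_closure K V"
proof (rule uniform_closureI)
  fix \<epsilon> :: real assume "\<epsilon> > 0"
  hence e: "\<epsilon>/2 > 0" by simp
  obtain a where a: "a \<in> uniform_closure K V" "\<forall>t\<in>K. \<bar>q t - a t\<bar> \<le> \<epsilon>/2"
    using assms[OF e] by blast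
  obtain b where b: "b \<in> V" "\<forall>t\<in>K. \<bar>a t - b t\<bar> \<le> \<epsilon>/2"
    using a(1) e unfolding uniform_closure_def by blast
  have "\<forall>t\<in>K. \<bar>q t - b t\<bar> \<le> \<epsilon>"
  proof
    fix t assume "t \<in> K"
    thus "\<bar>q t - b t\<bar> \<le> \<epsilon>" using bspec[OF a(2), of t] bspec[OF b(2), of t] by linarith
  qed
  thus "\<exists>h\<in>V. \<forall>t\<in>K. \<bar>q t - h t\<bar> \<le> \<epsilon>" using b(1) by blast
qed

definition fwd_diff :: "real \<Rightarrow> (real \<Rightarrow> real) \<Rightarrow> real \<Rightarrow> real" where
  "fwd_diff a f x = f (x + a) - f x"

text \<open>The average of \<open>f\<close> over the segment from \<open>x\<close> to \<open>x + h\<close>, parametrised so that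
\<open>h = 0\<close> gives \<open>f\<close> itself.\<close>

definition average :: "real \<Rightarrow> (real \<Rightarrow> real) \<Rightarrow> real \<Rightarrow> real" where
  "average h f x = integral {0..1} (\<lambda>s. f (x + h * s))"

lemma antiderivative_exists:
  fixes f :: "real \<Rightarrow> real"
  assumes "continuous_on UNIV f"
  obtains F where "\<And>x. (F has_real_derivative f x) (at x)"
proof -
  have "\<exists>F. \<forall>x. -\<infinity> < ereal x \<longrightarrow> ereal x < \<infinity> \<longrightarrow> (F has_vector_derivative f x) (at x)"
    using assms by (intro einterval_antiderivative) (auto simp: continuous_on_eq_continuous_at)
  thus ?thesis using that by (auto simp: has_real_derivative_iff_has_vector_derivative)
qed

text \<open>Writing averages as difference quotients of an antiderivative, also for \<open>h = 0\<close>, reduces all the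
algebra of averages to that of differences.\<close>

lemma average_antiderivative:
  assumes F: "\<And>x. (F has_real_derivative f x) (at x)"
  shows "h * average h f x = F (x + h) - F x"
proof -
  have "((\<lambda>s. h * f (x + h * s)) has_integral (F (x + h * 1) - F (x + h * 0))) {0..1}"
  proof (rule fundamental_theorem_of_calculus)
    fix s :: real
    have "((\<lambda>s. F (x + h * s)) has_real_derivative f (x + h * s) * h) (at s within {0..1})"
      by (rule DERIV_chain2[OF F]) (auto intro!: derivative_eq_intros)
    thus "((\<lambda>s. F (x + h * s)) has_vector_derivative h * f (x + h * s)) (at s within {0..1})"
      by (simp add: has_real_derivative_iff_has_vector_derivative mult.commute)
  qed simp
  hence "integral {0..1} (\<lambda>s. h * f (x + h * s)) = F (x + h * 1) - F (x + h * 0)"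
    by (rule integral_unique)
  thus ?thesis by (simp add: average_def)
qed

lemma average_0: "average 0 f = f"
  by (rule ext) (simp add: average_def)

lemma continuous_average:
  assumes "continuous_on UNIV f"
  shows "continuous_on UNIV (average h f)"
proof (cases "h = 0")
  case True thus ?thesis using assms by (simp add: average_0)
next
  case False
  obtain F where F: "\<And>x. (F has_real_derivative f x) (at x)"
    using antiderivative_exists[OF assms] by blast
  have cF: "continuous_on UNIV F" using F DERIV_continuous_on by blast
  have "average h f = (\<lambda>x. (F (x + h) - F x) / h)"
    using average_antiderivative[of F f h, OF F] False by (auto simp: field_simps)
  moreover have "continuous_on UNIV (\<lambda>x. (F (x + h) - F x) / h)"
    using False by (intro continuous_intros continuous_on_compose2[OF cF]) auto
  ultimately show ?thesis by simp
qed

lemma continuous_fwd_diff: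
  assumes "continuous_on UNIV f"
  shows "continuous_on UNIV (fwd_diff h f)"
  unfolding fwd_diff_def by (intro continuous_intros continuous_on_compose2[OF assms]) auto

lemma average_mean_value:
  assumes "continuous_on UNIV f"
  obtains \<xi> where "\<bar>\<xi> - x\<bar> \<le> \<bar>h\<bar>" "average h f x = f \<xi>"
proof -
  obtain F where F: "\<And>x. (F has_real_derivative f x) (at x)"
    using antiderivative_exists[OF assms] by blast
  consider "h = 0" | "h > 0" | "h < 0" by linarith
  thus ?thesis
  proof cases
    case 1 thus ?thesis using that[of x] by (simp add: average_0)
  next
    case 2
    obtain z where z: "x < z" "z < x + h" "F (x+h) - F x = h * f z"
      using MVT2[of x "x+h" F f] F 2 by auto
    have "h * average h f x = h * f z" using z(3) average_antiderivative[of F f h x, OF F] by linarith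
    hence "average h f x = f z" using 2 by simp
    thus ?thesis using that[of z] z 2 by simp
  next
    case 3
    obtain z where z: "x + h < z" "z < x" "F x - F (x+h) = (x - (x + h)) * f z"
      using MVT2[of "x+h" x F f] F 3 by auto
    have "F x - F (x+h) = - (h * f z)" using z(3) by simp
    hence "h * average h f x = h * f z" using average_antiderivative[of F f h x, OF F] by linarith
    hence "average h f x = f z" using 3 by simp
    thus ?thesis using that[of z] z 3 by simp
  qed
qed

lemma continuous_average_funpow: "continuous_on UNIV f \<Longrightarrow> continuous_on UNIV ((average h ^^ k) f)"
  by (induction k) (auto intro: continuous_average)

lemma continuous_fwd_diff_funpow: "continuous_on UNIV f \<Longrightarrow> continuous_on UNIV ((fwd_diff h ^^ k) f)"
  by (induction k) (auto intro: continuous_fwd_diff)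

lemma average_funpow_mean_value:
  assumes "continuous_on UNIV f"
  shows "\<exists>\<xi>. \<bar>\<xi> - x\<bar> \<le> real k * \<bar>a\<bar> \<and> (average a ^^ k) f x = f \<xi>"
proof (induction k arbitrary: x)
  case 0 show ?case by (intro exI[of _ x]) simp
next
  case (Suc k)
  obtain y where y: "\<bar>y - x\<bar> \<le> \<bar>a\<bar>" "average a ((average a ^^ k) f) x = (average a ^^ k) f y"
    using average_mean_value[OF continuous_average_funpow[OF assms]] by metis
  obtain z where z: "\<bar>z - y\<bar> \<le> real k * \<bar>a\<bar>" "(average a ^^ k) f y = f z" using Suc by blast
  show ?case
    using y z by (intro exI[of _ z]) (auto simp: algebra_simps)
qed

lemma average_continuous_integrable:
  assumes "continuous_on UNIV (f::real\<Rightarrow>real)"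
  shows "(\<lambda>s. f (x + h * s)) integrable_on {0..1}"
  by (intro integrable_continuous_interval continuous_on_compose2[OF assms] continuous_intros) auto

lemma fwd_diff_average_commute:
  assumes "continuous_on UNIV f"
  shows "fwd_diff a (average h f) = average h (fwd_diff a f)"
proof
  fix x
  have "average h (fwd_diff a f) x = integral {0..1} (\<lambda>s. f ((x + a) + h * s)) - integral {0..1} (\<lambda>s. f (x + h * s))"
    unfolding average_def fwd_diff_def
    using Henstock_Kurzweil_Integration.integral_diff[OF average_continuous_integrable[OF assms, of "x + a" h]
      average_continuous_integrable[OF assms, of x h]] by (simp add: add_ac)
  thus "fwd_diff a (average h f) x = average h (fwd_diff a f) x" by (simp add: average_def fwd_diff_def)
qed

lemma fwd_diff_fwd_diff_commute: "fwd_diff a (fwd_diff h f) = fwd_diff h (fwd_diff a f)"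
  by (rule ext) (simp add: fwd_diff_def algebra_simps)

text \<open>Both sides equal the second mixed difference with steps \<open>a\<close> and \<open>h\<close> of an antiderivative. The step
of the difference may thus be traded for that of the average, at the price of the factor \<open>a / h\<close>.\<close>

lemma fwd_diff_average_swap:
  assumes "continuous_on UNIV f"
  shows "h * fwd_diff a (average h f) x = a * average a (fwd_diff h f) x"
proof -
  obtain F where F: "\<And>x. (F has_real_derivative f x) (at x)"
    using antiderivative_exists[OF assms] by blast
  have D: "(fwd_diff h F has_real_derivative fwd_diff h f x) (at x)" for x
    unfolding fwd_diff_def by (rule DERIV_diff[OF DERIV_shift[THEN iffD1, OF F] F])
  have "a * average a (fwd_diff h f) x = fwd_diff h F (x + a) - fwd_diff h F x"
    by (rule average_antiderivative[OF D])
  moreover have "h * fwd_diff a (average h f) x = (F (x + a + h) - F (x + a)) - (F (x + h) - F x)"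
    using average_antiderivative[of F f h "x+a", OF F] average_antiderivative[of F f h x, OF F]
    by (simp add: fwd_diff_def right_diff_distrib)
  ultimately show ?thesis by (simp add: fwd_diff_def algebra_simps)
qed

lemma average_cmult: "average h (\<lambda>x. c * f x) = (\<lambda>x. c * average h f x)"
  by (rule ext) (simp add: average_def)

lemma fwd_diff_cmult: "fwd_diff h (\<lambda>x. c * f x) = (\<lambda>x. c * fwd_diff h f x)"
  by (rule ext) (simp add: fwd_diff_def algebra_simps)

lemma average_funpow_cmult: "(average h ^^ k) (\<lambda>x. c * f x) = (\<lambda>x. c * (average h ^^ k) f x)"
  by (induction k) (auto simp: average_cmult)

lemma fwd_diff_funpow_cmult: "(fwd_diff h ^^ k) (\<lambda>x. c * f x) = (\<lambda>x. c * (fwd_diff h ^^ k) f x)"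
  by (induction k) (auto simp: fwd_diff_cmult)

lemma fwd_diff_average_funpow_commute:
  assumes "continuous_on UNIV f"
  shows "fwd_diff a ((average h ^^ k) f) = (average h ^^ k) (fwd_diff a f)"
  by (induction k) (auto simp: fwd_diff_average_commute continuous_average_funpow assms)

lemma fwd_diff_funpow_average_commute:
  assumes "continuous_on UNIV f"
  shows "(fwd_diff a ^^ k) (average h f) = average h ((fwd_diff a ^^ k) f)"
  by (induction k) (auto simp: fwd_diff_average_commute continuous_fwd_diff_funpow assms)

lemma fwd_diff_fwd_diff_funpow_commute: "fwd_diff a ((fwd_diff h ^^ k) f) = (fwd_diff h ^^ k) (fwd_diff a f)"
  by (induction k) (auto simp: fwd_diff_fwd_diff_commute[of a h])

text \<open>The identity that replaces differentiation: after \<open>k\<close> averages with the fixed step \<open>h\<close>, a \<open>k\<close>-th difference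
with a small step \<open>a\<close> is \<open>(a / h)\<^sup>k\<close> times a mean of the \<open>k\<close>-th difference with step \<open>h\<close>.\<close>

lemma fwd_diff_average_funpow_swap:
  assumes "continuous_on UNIV f"
  shows "h ^ k * (fwd_diff a ^^ k) ((average h ^^ k) f) x = a ^ k * (average a ^^ k) ((fwd_diff h ^^ k) f) x"
  using assms
proof (induction k arbitrary: f x)
  case 0 show ?case by simp
next
  case (Suc k)
  note cf = Suc.prems
  have cA: "continuous_on UNIV (average h f)" by (rule continuous_average[OF cf])
  have e1: "(\<lambda>x. h ^ k * (fwd_diff a ^^ k) ((average h ^^ k) (average h f)) x)
          = (\<lambda>x. a ^ k * (average a ^^ k) ((fwd_diff h ^^ k) (average h f)) x)"
    using Suc.IH[OF cA] by blast
  have "h ^ Suc k * (fwd_diff a ^^ Suc k) ((average h ^^ Suc k) f) x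
      = h * fwd_diff a (\<lambda>x. h ^ k * (fwd_diff a ^^ k) ((average h ^^ k) (average h f)) x) x"
    by (simp add: fwd_diff_cmult funpow_swap1)
  also have "\<dots> = h * (a ^ k * fwd_diff a ((average a ^^ k) ((fwd_diff h ^^ k) (average h f))) x)"
    unfolding e1 by (simp add: fwd_diff_cmult)
  also have "fwd_diff a ((average a ^^ k) ((fwd_diff h ^^ k) (average h f)))
      = (average a ^^ k) ((fwd_diff h ^^ k) (fwd_diff a (average h f)))"
    by (simp add: fwd_diff_average_funpow_commute[OF continuous_fwd_diff_funpow[OF cA]] fwd_diff_fwd_diff_funpow_commute)
  also have "h * (a ^ k * (average a ^^ k) ((fwd_diff h ^^ k) (fwd_diff a (average h f))) x)
      = a ^ k * (average a ^^ k) ((fwd_diff h ^^ k) (\<lambda>x. h * fwd_diff a (average h f) x)) x"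
    by (simp add: fwd_diff_funpow_cmult average_funpow_cmult)
  also have "(\<lambda>x. h * fwd_diff a (average h f) x) = (\<lambda>x. a * average a (fwd_diff h f) x)"
    using fwd_diff_average_swap[OF cf] by blast
  also have "a ^ k * (average a ^^ k) ((fwd_diff h ^^ k) (\<lambda>x. a * average a (fwd_diff h f) x)) x
      = a ^ Suc k * (average a ^^ k) ((fwd_diff h ^^ k) (average a (fwd_diff h f))) x"
    by (simp add: fwd_diff_funpow_cmult average_funpow_cmult)
  also have "(fwd_diff h ^^ k) (average a (fwd_diff h f)) = average a ((fwd_diff h ^^ k) (fwd_diff h f))"
    by (rule fwd_diff_funpow_average_commute[OF continuous_fwd_diff[OF cf]])
  also have "(average a ^^ k) (average a ((fwd_diff h ^^ k) (fwd_diff h f))) = (average a ^^ Suc k) ((fwd_diff h ^^ Suc k) f)"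
    by (simp add: funpow_swap1)
  finally show ?case .
qed

lemma newton_forward_difference:
  "f (x + real n * h) = (\<Sum>i\<le>n. real (n choose i) * (fwd_diff h ^^ i) f x)"
proof (induction n arbitrary: x)
  case 0 show ?case by simp
next
  case (Suc n)
  have "f (x + real (Suc n) * h) = f ((x + h) + real n * h)"
    by (simp add: algebra_simps)
  also have "\<dots> = (\<Sum>i\<le>n. real (n choose i) * (fwd_diff h ^^ i) f (x + h))" by (rule Suc)
  also have "\<dots> = (\<Sum>i\<le>n. real (n choose i) * ((fwd_diff h ^^ i) f x + (fwd_diff h ^^ Suc i) f x))"
    by (intro sum.cong) (auto simp: fwd_diff_def)
  also have "\<dots> = (\<Sum>i\<le>n. real (n choose i) * (fwd_diff h ^^ i) f x)
      + (\<Sum>i\<le>n. real (n choose i) * (fwd_diff h ^^ Suc i) f x)"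
    by (simp add: distrib_left sum.distrib)
  also have "(\<Sum>i\<le>n. real (n choose i) * (fwd_diff h ^^ i) f x)
      = f x + (\<Sum>i\<le>n. real (n choose Suc i) * (fwd_diff h ^^ Suc i) f x)"
  proof -
    have "(\<Sum>i\<le>n. real (n choose i) * (fwd_diff h ^^ i) f x)
        = (\<Sum>i\<le>Suc n. real (n choose i) * (fwd_diff h ^^ i) f x)" by simp
    also have "\<dots> = f x + (\<Sum>i\<le>n. real (n choose Suc i) * (fwd_diff h ^^ Suc i) f x)"
      by (subst sum.atMost_Suc_shift) simp
    finally show ?thesis .
  qed
  also have "f x + (\<Sum>i\<le>n. real (n choose Suc i) * (fwd_diff h ^^ Suc i) f x)
      + (\<Sum>i\<le>n. real (n choose i) * (fwd_diff h ^^ Suc i) f x)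
      = f x + (\<Sum>i\<le>n. real (Suc n choose Suc i) * (fwd_diff h ^^ Suc i) f x)"
    by (simp add: sum.distrib[symmetric] algebra_simps del: funpow.simps)
  also have "\<dots> = (\<Sum>i\<le>Suc n. real (Suc n choose i) * (fwd_diff h ^^ i) f x)"
    by (subst sum.atMost_Suc_shift) simp
  finally show ?case .
qed

text \<open>Read as a function of the upper argument, a generalised binomial coefficient is a polynomial; this makes
the forward difference formula a polynomial in the number of steps.\<close>

lemma gbinomial_poly: "\<exists>p. \<forall>x::real. poly p x = x gchoose i"
proof -
  have "poly (smult (1 / fact i) (\<Prod>j<i. [:- real j, 1:])) x = x gchoose i" for x
    by (simp add: gbinomial_prod_rev poly_prod atLeast0LessThan)
  thus ?thesis by blast
qed

lemma poly_on_lattice: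
  assumes "\<And>x. (fwd_diff h ^^ k) f x = 0"
  shows "\<exists>p. \<forall>n. f (x + real n * h) = poly p (real n)"
proof -
  obtain G where G: "\<And>i (x::real). poly (G i) x = x gchoose i" 
  proof -
    have "\<forall>i. \<exists>p. \<forall>x::real. poly p x = x gchoose i" using gbinomial_poly by blast
    then obtain G :: "nat \<Rightarrow> real poly" where "\<forall>i x. poly (G i) x = x gchoose i" by metis
    thus ?thesis using that by blast
  qed
  have z: "(fwd_diff h ^^ i) f x = 0" if "i \<ge> k" for i x
    using that
  proof (induction i arbitrary: x rule: dec_induct)
    case base thus ?case using assms by simp
  next
    case (step i) thus ?case by (simp add: fwd_diff_def)
  qed
  have "f (x + real n * h) = poly (\<Sum>i<k. smult ((fwd_diff h ^^ i) f x) (G i)) (real n)" for n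
  proof -
    have "f (x + real n * h) = (\<Sum>i\<le>n. (real n gchoose i) * (fwd_diff h ^^ i) f x)"
      by (subst newton_forward_difference) (simp add: binomial_gbinomial)
    also have "\<dots> = (\<Sum>i\<in>{..n} \<inter> {..<k}. (real n gchoose i) * (fwd_diff h ^^ i) f x)"
      by (rule sum.mono_neutral_right) (auto simp: z not_less)
    also have "\<dots> = (\<Sum>i<k. (real n gchoose i) * (fwd_diff h ^^ i) f x)"
      by (rule sum.mono_neutral_left) (auto simp: not_le simp flip: binomial_gbinomial)
    finally show ?thesis by (simp add: poly_sum G mult.commute)
  qed
  thus ?thesis by blast
qed

lemma poly_eqI_infinite:
  fixes p q :: "real poly"
  assumes "infinite {x. poly p x = poly q x}"
  shows "p = q"
proof (rule ccontr)
  assume "p \<noteq> q"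
  hence "finite {x. poly (p - q) x = 0}" by (intro poly_roots_finite) simp
  thus False using assms by simp
qed

text \<open>On each lattice \<open>x0 + \<nat>/(N + 1)\<close> the function agrees with a polynomial. All these polynomials agree
on \<open>x0 + \<nat>\<close>, so they coincide, and the union of the lattices is dense in the ray.\<close>

lemma vanishing_differences_imp_poly_ray:
  assumes f: "continuous_on UNIV f" and D: "\<And>h x. (fwd_diff h ^^ k) f x = 0"
  shows "\<exists>q. \<forall>x\<ge>x0. f x = poly q x"
proof -
  have "\<exists>q. \<forall>n. f (x0 + real n * (1 / real (Suc N))) = poly q (x0 + real n * (1 / real (Suc N)))" for N
  proof -
    obtain p where p: "\<And>n. f (x0 + real n * (1 / real (Suc N))) = poly p (real n)"
      using poly_on_lattice[where h="1 / real (Suc N)" and k=k and f=f and x=x0, OF D] by auto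
    have "poly (pcompose p [: - x0 * real (Suc N), real (Suc N) :]) (x0 + real n * (1 / real (Suc N)))
        = poly p (real n)" for n
    proof -
      have "- x0 * real (Suc N) + (x0 + real n * (1 / real (Suc N))) * real (Suc N) = real n"
        by (simp add: field_simps del: of_nat_Suc)
      thus ?thesis by (simp add: poly_pcompose del: of_nat_Suc)
    qed
    thus ?thesis using p by metis
  qed
  then obtain q where q: "\<And>N n. f (x0 + real n * (1 / real (Suc N))) = poly (q N) (x0 + real n * (1 / real (Suc N)))"
    by metis
  have eq: "q N = q 0" for N
  proof (rule poly_eqI_infinite)
    have "poly (q N) (x0 + real n) = poly (q 0) (x0 + real n)" for n
    proof -
      have "x0 + real (n * Suc N) * (1 / real (Suc N)) = x0 + real n" by (simp del: of_nat_Suc mult_Suc_right)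
      thus ?thesis using q[of "n * Suc N" N] q[of n 0] by simp
    qed
    hence "range (\<lambda>n. x0 + real n) \<subseteq> {x. poly (q N) x = poly (q 0) x}" by auto
    moreover have "infinite (range (\<lambda>n. x0 + real n))"
      by (intro range_inj_infinite injI) simp
    ultimately show "infinite {x. poly (q N) x = poly (q 0) x}" using infinite_super by blast
  qed
  have "f x = poly (q 0) x" if "x \<ge> x0" for x
  proof -
    define y where "y N = x0 + real (nat \<lfloor>(x - x0) * real (Suc N)\<rfloor>) * (1 / real (Suc N))" for N
    have b: "\<bar>y N - x\<bar> \<le> 1 / real (Suc N)" for N
    proof -
      have "real (nat \<lfloor>(x - x0) * real (Suc N)\<rfloor>) = of_int \<lfloor>(x - x0) * real (Suc N)\<rfloor>"
        using that by simp
      hence "\<bar>real (nat \<lfloor>(x - x0) * real (Suc N)\<rfloor>) - (x - x0) * real (Suc N)\<bar> \<le> 1"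
        by linarith
      hence "\<bar>real (nat \<lfloor>(x - x0) * real (Suc N)\<rfloor>) - (x - x0) * real (Suc N)\<bar> / real (Suc N) \<le> 1 / real (Suc N)"
        by (intro divide_right_mono) auto
      moreover have "y N - x = (real (nat \<lfloor>(x - x0) * real (Suc N)\<rfloor>) - (x - x0) * real (Suc N)) / real (Suc N)"
        by (simp add: y_def field_simps)
      ultimately show ?thesis by simp
    qed
    have "y \<longlonglongrightarrow> x"
    proof (rule LIM_zero_cancel, rule Lim_null_comparison)
      show "\<forall>\<^sub>F N in sequentially. norm (y N - x) \<le> 1 / real (Suc N)" using b by simp
      show "(\<lambda>N. 1 / real (Suc N)) \<longlonglongrightarrow> 0" by (rule LIMSEQ_Suc[OF lim_1_over_n])
    qed
    hence "(\<lambda>N. f (y N)) \<longlonglongrightarrow> f x" "(\<lambda>N. poly (q 0) (y N)) \<longlonglongrightarrow> poly (q 0) x"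
      using f by (auto simp: continuous_on_eq_continuous_at intro!: isCont_tendsto_compose[of _ f] tendsto_poly)
    moreover have "f (y N) = poly (q 0) (y N)" for N 
      unfolding y_def using q[of _ N] eq[of N] by (metis (no_types))
    ultimately show ?thesis using LIMSEQ_unique by auto
  qed
  thus ?thesis by blast
qed

text \<open>The polynomials obtained on two rays agree on their intersection.\<close>

lemma vanishing_differences_imp_poly:
  assumes "continuous_on UNIV f" and "\<And>h x. (fwd_diff h ^^ k) f x = 0"
  shows "\<exists>q. f = poly q"
proof -
  obtain q where q: "\<And>x0 x. x \<ge> x0 \<Longrightarrow> f x = poly (q x0) x"
    using vanishing_differences_imp_poly_ray[OF assms] by metis
  have "q x = q 0" for x
  proof (rule poly_eqI_infinite)
    have "{max 0 x..} \<subseteq> {y. poly (q x) y = poly (q 0) y}"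
    proof
      fix y assume "y \<in> {max 0 x..}"
      hence "f y = poly (q x) y" "f y = poly (q 0) y" by (auto intro!: q)
      thus "y \<in> {y. poly (q x) y = poly (q 0) y}" by simp
    qed
    thus "infinite {y. poly (q x) y = poly (q 0) y}" using infinite_super infinite_Ici by blast
  qed
  hence "f x = poly (q 0) x" for x using q[of x x] by (metis order_refl)
  thus ?thesis by blast
qed

section \<open>Uniform density of ridge functions\<close>

text \<open>The property to be preserved by moving averages: if \<open>C\<close> is a uniform closure, replacing \<open>f\<close> by one of its
averages gains smoothness and stays within what the ridge functions of \<open>f\<close> can approximate.\<close>

definition ridge_closed :: "(real \<Rightarrow> real) set \<Rightarrow> (real \<Rightarrow> real) \<Rightarrow> bool" where
  "ridge_closed C f \<longleftrightarrow> continuous_on UNIV f \<and> (\<forall>w b. (\<lambda>t. f (w * t + b)) \<in> C)"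

text \<open>Riemann sums whose terms are averages over the short pieces, so that the sum is exact and the mean
value theorem compares it with a sum of values of \<open>f\<close>.\<close>

lemma average_split:
  assumes "continuous_on UNIV f" "n > 0"
  shows "average h f x = (1 / real n) * (\<Sum>i<n. average (h / real n) f (x + real i * (h / real n)))"
proof (cases "h = 0")
  case True thus ?thesis using assms by (simp add: average_0)
next
  case False
  obtain F where F: "\<And>x. (F has_real_derivative f x) (at x)"
    using antiderivative_exists[OF assms(1)] by blast
  define d where "d = h / real n"
  have hd: "h = real n * d" and d0: "d \<noteq> 0" using assms(2) False by (auto simp: d_def)
  have "d * (\<Sum>i<n. average d f (x + real i * d)) = (\<Sum>i<n. F (x + real (Suc i) * d) - F (x + real i * d))"
    unfolding sum_distrib_left
    by (intro sum.cong) (auto simp: average_antiderivative[of F f d, OF F] algebra_simps)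
  also have "\<dots> = F (x + real n * d) - F x"
    by (subst sum_lessThan_telescope) simp
  also have "\<dots> = h * average h f x" using average_antiderivative[of F f h x, OF F] hd by simp
  finally show ?thesis using hd d0 assms(2) by (auto simp: d_def[symmetric] field_simps)
qed

lemma subspace_cmult_in: "subspace C \<Longrightarrow> f \<in> C \<Longrightarrow> (\<lambda>t. c * f t) \<in> C" for f :: "real \<Rightarrow> real"
  using subspace_scale[of C f c] by (simp add: scaleR_fun_def)

lemma subspace_sum_in:
  fixes f :: "'i \<Rightarrow> real \<Rightarrow> real"
  shows "subspace C \<Longrightarrow> (\<And>i. i \<in> I \<Longrightarrow> f i \<in> C) \<Longrightarrow> (\<lambda>t. \<Sum>i\<in>I. f i t) \<in> C"
proof (induction I rule: infinite_finite_induct)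
  case (insert i I)
  hence "f i + (\<lambda>t. \<Sum>i\<in>I. f i t) \<in> C" by (intro subspace_add) auto
  thus ?case using insert by (simp add: plus_fun_def)
qed (auto dest: subspace_0 simp: zero_fun_def)

text \<open>The average is a limit of Riemann sums, which are combinations of translates of \<open>f\<close>; uniform continuity on
a compact interval makes the convergence uniform in \<open>t\<close>.\<close>

lemma ridge_closed_average:
  assumes V: "subspace V" and f: "ridge_closed (uniform_closure {0..T} V) f"
  shows "ridge_closed (uniform_closure {0..T} V) (average h f)"
  unfolding ridge_closed_def
proof (intro conjI allI)
  have cf: "continuous_on UNIV f" using f by (simp add: ridge_closed_def)
  thus "continuous_on UNIV (average h f)" by (rule continuous_average)
  note sub = subspace_uniform_closure[OF V, of "{0..T}"]
  fix w b
  show "(\<lambda>t. average h f (w * t + b)) \<in> uniform_closure {0..T} V"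
  proof (rule uniform_closure_limit)
    fix \<epsilon> :: real assume e: "\<epsilon> > 0"
    define R where "R = \<bar>w\<bar> * \<bar>T\<bar> + \<bar>b\<bar> + 2 * \<bar>h\<bar>"
    have "uniformly_continuous_on {-R..R} f"
      by (rule compact_uniformly_continuous) (auto intro: continuous_on_subset[OF cf])
    then obtain d where d: "d > 0" "\<And>x y. x \<in> {-R..R} \<Longrightarrow> y \<in> {-R..R} \<Longrightarrow> dist y x < d \<Longrightarrow> dist (f y) (f x) < \<epsilon>"
      using e unfolding uniformly_continuous_on_def by metis
    obtain n where n: "n > 0" "\<bar>h\<bar> / real n < d"
    proof -
      obtain n where "\<bar>h\<bar> / d < real n" using reals_Archimedean2 by blast
      thus ?thesis using that[of "Suc n"] d(1) by (auto simp: field_simps) 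
    qed
    define g where "g t = (1 / real n) * (\<Sum>i<n. f (w * t + (b + real i * (h / real n))))" for t
    have "g \<in> uniform_closure {0..T} V"
      unfolding g_def using f unfolding ridge_closed_def
      by (intro subspace_cmult_in[OF sub] subspace_sum_in[OF sub]) auto
    moreover have "\<bar>average h f (w * t + b) - g t\<bar> \<le> \<epsilon>" if t: "t \<in> {0..T}" for t
    proof -
      have term_bound: "\<bar>average (h / real n) f (w * t + b + real i * (h / real n)) - f (w * t + (b + real i * (h / real n)))\<bar> \<le> \<epsilon>"
        if i: "i < n" for i
      proof -
        define y where "y = w * t + b + real i * (h / real n)"
        obtain z where z: "\<bar>z - y\<bar> \<le> \<bar>h / real n\<bar>" "average (h / real n) f y = f z"
          using average_mean_value[OF cf] by metis
        have "real i / real n \<le> 1" using i by simp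
        hence "\<bar>h\<bar> * (real i / real n) \<le> \<bar>h\<bar> * 1" by (intro mult_left_mono) auto
        hence a1: "\<bar>real i * (h / real n)\<bar> \<le> \<bar>h\<bar>" by (simp add: abs_mult mult.commute)
        have "\<bar>h\<bar> * 1 \<le> \<bar>h\<bar> * real n" using n by (intro mult_left_mono) auto
        hence a2: "\<bar>h / real n\<bar> \<le> \<bar>h\<bar>" using n(1) by (simp add: field_simps)
        have "\<bar>t\<bar> \<le> \<bar>T\<bar>" using t by auto
        hence a3: "\<bar>w * t\<bar> \<le> \<bar>w\<bar> * \<bar>T\<bar>" by (simp add: abs_mult mult_left_mono)
        have "\<bar>y\<bar> \<le> \<bar>w * t\<bar> + \<bar>b\<bar> + \<bar>real i * (h / real n)\<bar>"
          unfolding y_def by (intro order.trans[OF abs_triangle_ineq] add_mono order_refl abs_triangle_ineq)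
        hence yb: "\<bar>y\<bar> + \<bar>h\<bar> \<le> R" using a1 a3 unfolding R_def by linarith
        have "\<bar>z\<bar> \<le> \<bar>y\<bar> + \<bar>z - y\<bar>" using abs_triangle_ineq[of y "z - y"] by simp
        hence "\<bar>z\<bar> \<le> R" using z(1) a2 yb by linarith
        hence yR: "y \<in> {-R..R}" "z \<in> {-R..R}" using yb abs_ge_zero[of h] by (auto simp: abs_le_iff)
        have "dist z y < d" using z(1) n by (simp add: dist_real_def)
        hence "dist (f z) (f y) < \<epsilon>" using d(2) yR by blast
        thus ?thesis using z(2) by (simp add: y_def dist_real_def add.assoc)
      qed
      have "average h f (w * t + b) - g t = (1 / real n) * (\<Sum>i<n. average (h / real n) f (w * t + b + real i * (h / real n)) - f (w * t + (b + real i * (h / real n))))"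
        unfolding g_def average_split[OF cf n(1), of h] by (simp add: sum_subtractf right_diff_distrib)
      also have "\<bar>\<dots>\<bar> \<le> (1 / real n) * (\<Sum>i<n. \<epsilon>)"
        unfolding abs_mult using term_bound
        by (intro mult_mono order.trans[OF sum_abs] sum_mono) auto
      also have "\<dots> = \<epsilon>" using n by simp
      finally show ?thesis .
    qed
    ultimately show "\<exists>g\<in>uniform_closure {0..T} V. \<forall>t\<in>{0..T}. \<bar>average h f (w * t + b) - g t\<bar> \<le> \<epsilon>" by blast
  qed
qed

lemma ridge_closed_fwd_diff:
  assumes C: "subspace C" and g: "ridge_closed C g"
  shows "(\<lambda>t. (fwd_diff (\<delta> * t) ^^ k) g (w * t + b)) \<in> C"
proof (induction k arbitrary: w b)
  case 0 show ?case using g by (simp add: ridge_closed_def)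
next
  case (Suc k)
  have "(\<lambda>t. (fwd_diff (\<delta> * t) ^^ k) g ((w + \<delta>) * t + b)) - (\<lambda>t. (fwd_diff (\<delta> * t) ^^ k) g (w * t + b)) \<in> C"
    by (intro subspace_diff C Suc)
  moreover have "(fwd_diff (\<delta> * t) ^^ Suc k) g (w * t + b)
      = (fwd_diff (\<delta> * t) ^^ k) g ((w + \<delta>) * t + b) - (fwd_diff (\<delta> * t) ^^ k) g (w * t + b)" for t
  proof -
    have "w * t + b + \<delta> * t = (w + \<delta>) * t + b" by (simp add: algebra_simps)
    hence "(fwd_diff (\<delta> * t) ^^ k) g (w * t + b + \<delta> * t) = (fwd_diff (\<delta> * t) ^^ k) g ((w + \<delta>) * t + b)" by (rule arg_cong)
    thus ?thesis by (simp add: fwd_diff_def[of _ "(fwd_diff (\<delta> * t) ^^ k) g"])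
  qed
  ultimately show ?case by (simp only: fun_diff_def)
qed

text \<open>Choose \<open>h\<close> and \<open>b\<close> with \<open>\<Delta>\<^sub>h\<^sup>k f (b) \<noteq> 0\<close> and let \<open>g\<close> be the \<open>k\<close>-fold average of \<open>f\<close>. The function
\<open>t \<mapsto> \<Delta>\<^sub>\<delta>\<^sub>t\<^sup>k g (b)\<close> is a combination of ridge functions with weights \<open>0, \<delta>, \<dots>, k\<delta>\<close>, and it equals
\<open>(\<delta>t / h)\<^sup>k\<close> times a mean of \<open>\<Delta>\<^sub>h\<^sup>k f\<close> near \<open>b\<close>.\<close>

lemma monomial_in_ridge_closure:
  assumes V: "subspace V" and f: "ridge_closed (uniform_closure {0..T} V) f"
    and np: "\<nexists>p. f = poly p"
  shows "(\<lambda>t. t ^ k) \<in> uniform_closure {0..T} V"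
proof -
  let ?C = "uniform_closure {0..T} V"
  note sub = subspace_uniform_closure[OF V, of "{0..T}"]
  have cf: "continuous_on UNIV f" using f by (simp add: ridge_closed_def)
  obtain h b where hb: "(fwd_diff h ^^ k) f b \<noteq> 0"
    using vanishing_differences_imp_poly[OF cf] np by blast
  define D where "D = (fwd_diff h ^^ k) f"
  have cD: "continuous_on UNIV D" unfolding D_def by (rule continuous_fwd_diff_funpow[OF cf])
  define g where "g = (average h ^^ k) f"
  have g: "ridge_closed ?C g" unfolding g_def
    by (induction k) (auto intro: f ridge_closed_average[OF V])
  have "(\<lambda>t. t ^ k * D b) \<in> ?C"
  proof (rule uniform_closure_limit)
    fix \<epsilon> :: real assume "\<epsilon> > 0"
    define \<epsilon>' where "\<epsilon>' = \<epsilon> / (\<bar>T\<bar> ^ k + 1)"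
    have e': "\<epsilon>' > 0" using \<open>\<epsilon> > 0\<close> by (simp add: \<epsilon>'_def add_nonneg_pos)
    obtain d where d: "d > 0" "\<And>z. \<bar>z - b\<bar> < d \<Longrightarrow> \<bar>D z - D b\<bar> < \<epsilon>'"
      using cD[unfolded continuous_on_iff, rule_format, OF UNIV_I e', of b] by (auto simp: dist_real_def)
    \<comment> \<open>\<open>k\<close> averages with steps up to \<open>\<delta> T\<close> move the point \<open>b\<close> by at most \<open>d / 2\<close>\<close>
    define \<delta> where "\<delta> = d / (2 * (real k + 1) * (\<bar>T\<bar> + 1))"
    have \<delta>: "\<delta> > 0" using d by (simp add: \<delta>_def)
    define q where "q t = (h ^ k / \<delta> ^ k) * (fwd_diff (\<delta> * t) ^^ k) g (0 * t + b)" for t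
    have "q \<in> ?C" unfolding q_def
      by (intro subspace_cmult_in[OF sub] ridge_closed_fwd_diff[OF sub g])
    moreover have "\<bar>t ^ k * D b - q t\<bar> \<le> \<epsilon>" if t: "t \<in> {0..T}" for t
    proof -
      have "h ^ k * (fwd_diff (\<delta> * t) ^^ k) g b = (\<delta> * t) ^ k * (average (\<delta> * t) ^^ k) D b"
        unfolding g_def D_def by (rule fwd_diff_average_funpow_swap[OF cf])
      hence qt: "q t = t ^ k * (average (\<delta> * t) ^^ k) D b"
        using \<delta> by (simp add: q_def power_mult_distrib field_simps)
      obtain z where z: "\<bar>z - b\<bar> \<le> real k * \<bar>\<delta> * t\<bar>" "(average (\<delta> * t) ^^ k) D b = D z"
        using average_funpow_mean_value[OF cD] by blast
      have "real k * \<bar>\<delta> * t\<bar> \<le> (real k + 1) * (\<delta> * (\<bar>T\<bar> + 1))"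
        using \<delta> t by (intro mult_mono) (auto simp: abs_mult)
      also have "\<dots> = d / 2"
      proof -
        have "real k + 1 \<noteq> 0" "\<bar>T\<bar> + 1 \<noteq> 0" by linarith+
        thus ?thesis unfolding \<delta>_def by (simp add: divide_simps)
      qed
      also have "\<dots> < d" using d by simp
      finally have "\<bar>D z - D b\<bar> < \<epsilon>'" using z(1) d(2) by force
      hence "\<bar>t ^ k * D b - q t\<bar> \<le> \<bar>t\<bar> ^ k * \<epsilon>'"
        unfolding qt z(2) by (simp add: abs_mult power_abs mult_left_mono flip: right_diff_distrib)
      also have "\<dots> \<le> (\<bar>T\<bar> ^ k + 1) * \<epsilon>'"
        using t e' by (intro mult_right_mono) (auto intro!: order.trans[OF power_mono[of t T]])
      also have "\<dots> = \<epsilon>" unfolding \<epsilon>'_def by (simp add: add_nonneg_eq_0_iff)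
      finally show ?thesis .
    qed
    ultimately show "\<exists>q\<in>?C. \<forall>t\<in>{0..T}. \<bar>t ^ k * D b - q t\<bar> \<le> \<epsilon>" by blast
  qed
  from subspace_cmult_in[OF sub this, of "1 / D b"] show ?thesis using hb by (simp add: D_def)
qed

lemma continuous_in_ridge_closure:
  assumes V: "subspace V" and f: "ridge_closed (uniform_closure {0..T} V) f"
    and np: "\<nexists>p. f = poly p" and q: "continuous_on {0..T} q"
  shows "q \<in> uniform_closure {0..T} V"
proof (rule uniform_closure_limit)
  note sub = subspace_uniform_closure[OF V, of "{0..T}"]
  fix \<epsilon> :: real assume "\<epsilon> > 0"
  then obtain p where p: "real_polynomial_function p" "\<forall>t\<in>{0..T}. \<bar>q t - p t\<bar> < \<epsilon>"
    using Stone_Weierstrass_real_polynomial_function[OF compact_Icc q] by metis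
  then obtain a n where "p = (\<lambda>x. \<Sum>i\<le>n. a i * x ^ i)"
    unfolding real_polynomial_function_iff_sum by blast
  hence "p \<in> uniform_closure {0..T} V"
    by (auto intro!: subspace_sum_in[OF sub] subspace_cmult_in[OF sub] monomial_in_ridge_closure[OF V f np])
  thus "\<exists>h\<in>uniform_closure {0..T} V. \<forall>t\<in>{0..T}. \<bar>q t - h t\<bar> \<le> \<epsilon>"
    using p(2) by (force intro: less_imp_le)
qed

section \<open>Approximation by networks together with the derivative\<close>

definition networks :: "(real \<Rightarrow> real) \<Rightarrow> (real \<Rightarrow> real) set" where
  "networks \<sigma> = span {\<lambda>t. \<sigma> (w * t + b) | w b. True}"

lemma subspace_networks: "subspace (networks \<sigma>)"
  unfolding networks_def by (rule subspace_span)

lemma ridge_in_networks: "(\<lambda>t. \<sigma> (w * t + b)) \<in> networks \<sigma>"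
  unfolding networks_def by (rule span_base) auto

lemma networks_induct [consumes 1, case_names zero step]:
  assumes "h \<in> networks \<sigma>" "P (\<lambda>t. 0)"
    and "\<And>c w b h. h \<in> networks \<sigma> \<Longrightarrow> P h \<Longrightarrow> P (\<lambda>t. c * \<sigma> (w * t + b) + h t)"
  shows "P h"
proof -
  have "h \<in> networks \<sigma> \<and> P h"
    using assms(1) unfolding networks_def
  proof (induction rule: span_induct_alt)
    case base
    show ?case using assms(2) by (simp add: zero_fun_def span_zero flip: zero_fun_def)
  next
    case (step c x y)
    then obtain w b where x: "x = (\<lambda>t. \<sigma> (w * t + b))" by blast
    have "c *\<^sub>R x + y = (\<lambda>t. c * \<sigma> (w * t + b) + y t)"
      by (simp add: x scaleR_fun_def plus_fun_def)
    moreover have "c *\<^sub>R x + y \<in> span {\<lambda>t. \<sigma> (w * t + b) | w b. True}"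
      using step by (intro span_add span_scale span_base[of x]) auto
    ultimately show ?case using assms(3)[of y c w b] step by (simp add: networks_def)
  qed
  thus ?thesis by simp
qed

text \<open>The width can be any sufficiently large number, so that finitely many networks may be given a common one.\<close>

lemma networks_width:
  assumes "h \<in> networks \<sigma>"
  shows "\<exists>m0. \<forall>m::nat\<ge>m0. \<exists>A W B. h = (\<lambda>t. \<Sum>i=1..m. A i * \<sigma> (W i * t + B i))"
  using assms
proof (induction rule: networks_induct)
  case zero
  have z: "\<exists>A W B. (\<lambda>t. 0) = (\<lambda>t. \<Sum>i=1..m. A i * \<sigma> (W i * t + B i))" for m :: nat
    by (intro exI[of _ "\<lambda>_. 0::real"]) simp
  show ?case by (intro exI[of _ "0::nat"] allI impI z)
next
  case (step c w b h)
  then obtain m0 where m0: "\<And>m::nat. m \<ge> m0 \<Longrightarrow> \<exists>A W B. h = (\<lambda>t. \<Sum>i=1..m. A i * \<sigma> (W i * t + B i))"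
    by blast
  show ?case
  proof (intro exI[of _ "Suc m0"] allI impI)
    fix m assume "m \<ge> Suc m0"
    then obtain m' where m: "m = Suc m'" "m' \<ge> m0" by (cases m) auto
    then obtain A W B where h: "h = (\<lambda>t. \<Sum>i=1..m'. A i * \<sigma> (W i * t + B i))" using m0 by blast
    have "(\<lambda>t. c * \<sigma> (w * t + b) + h t)
        = (\<lambda>t. \<Sum>i=1..m. (A(m := c)) i * \<sigma> ((W(m := w)) i * t + (B(m := b)) i))"
      unfolding h m by (auto simp: sum.cl_ivl_Suc add.commute intro!: ext sum.cong)
    thus "\<exists>A W B. (\<lambda>t. c * \<sigma> (w * t + b) + h t) = (\<lambda>t. \<Sum>i=1..m. A i * \<sigma> (W i * t + B i))" by blast
  qed
qed

lemma poly_antiderivative: "\<exists>P. pderiv P = (p :: real poly)"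
proof -
  have "pderiv (\<Sum>i\<le>degree p. monom (coeff p i / real (Suc i)) (Suc i)) = p"
  proof -
    have "pderiv (sum f A) = (\<Sum>x\<in>A. pderiv (f x))" for f :: "nat \<Rightarrow> real poly" and A
      using higher_pderiv_sum[of 1 f A] by simp
    thus ?thesis by (simp add: pderiv_monom poly_as_sum_of_monoms)
  qed
  thus ?thesis by blast
qed

lemma derivative_not_poly:
  assumes "\<And>x. (\<sigma> has_real_derivative \<sigma>' x) (at x)" and "\<nexists>p. \<sigma> = poly p"
  shows "\<nexists>p. \<sigma>' = poly p"
proof
  assume "\<exists>p. \<sigma>' = poly p"
  then obtain p P where p: "\<sigma>' = poly p" "pderiv P = p" using poly_antiderivative by metis
  have "((\<lambda>x. \<sigma> x - poly P x) has_real_derivative 0) (at x)" for x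
    using DERIV_diff[OF assms(1)[of x] poly_DERIV[of P x]] p by simp
  hence "\<sigma> x - poly P x = \<sigma> 0 - poly P 0" for x
    by (intro DERIV_isconst_all allI)
  hence "\<sigma> x = poly (P + [: \<sigma> 0 - poly P 0 :]) x" for x by (simp add: algebra_simps)
  thus False using assms(2) by blast
qed

lemma continuous_approx_networks:
  assumes "continuous_on UNIV \<sigma>" "\<nexists>p. \<sigma> = poly p" "continuous_on {0..T} q" "\<epsilon> > 0"
  shows "\<exists>h\<in>networks \<sigma>. \<forall>t\<in>{0..T}. \<bar>q t - h t\<bar> \<le> \<epsilon>"
proof -
  have "ridge_closed (uniform_closure {0..T} (networks \<sigma>)) \<sigma>"
    using assms(1) by (auto simp: ridge_closed_def intro: uniform_closure_superset ridge_in_networks)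
  hence "q \<in> uniform_closure {0..T} (networks \<sigma>)"
    using assms(2,3) by (intro continuous_in_ridge_closure subspace_networks)
  thus ?thesis using assms(4) by (auto simp: uniform_closure_def)
qed

text \<open>The derivative is required on the whole line, so that \<open>deriv\<close> of the network is this function.\<close>

definition network_derivatives :: "(real \<Rightarrow> real) \<Rightarrow> (real \<Rightarrow> real) set" where
  "network_derivatives \<sigma> = {q. \<exists>h\<in>networks \<sigma>. \<forall>t. (h has_real_derivative q t) (at t)}"

lemma subspace_network_derivatives: "subspace (network_derivatives \<sigma>)"
proof (rule subspaceI)
  show "0 \<in> network_derivatives \<sigma>"
    unfolding network_derivatives_def
    using subspace_0[OF subspace_networks] by (force simp: zero_fun_def)
next
  fix x y assume "x \<in> network_derivatives \<sigma>" "y \<in> network_derivatives \<sigma>"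
  then obtain f g where "f \<in> networks \<sigma>" "g \<in> networks \<sigma>"
    "\<And>t. (f has_real_derivative x t) (at t)" "\<And>t. (g has_real_derivative y t) (at t)"
    unfolding network_derivatives_def by blast
  thus "x + y \<in> network_derivatives \<sigma>"
    unfolding network_derivatives_def
    using DERIV_add[of f _ _ UNIV g] subspace_add[OF subspace_networks, of f \<sigma> g]
    by (intro CollectI bexI[of _ "f + g"] allI) (auto simp: plus_fun_def)
next
  fix c :: real and x assume "x \<in> network_derivatives \<sigma>"
  then obtain f where "f \<in> networks \<sigma>" "\<And>t. (f has_real_derivative x t) (at t)"
    unfolding network_derivatives_def by blast
  hence "(\<lambda>t. c * f t) \<in> networks \<sigma>" "\<And>t. ((\<lambda>t. c * f t) has_real_derivative (c *\<^sub>R x) t) (at t)"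
    by (auto intro!: subspace_cmult_in subspace_networks DERIV_cmult simp: scaleR_fun_def)
  thus "c *\<^sub>R x \<in> network_derivatives \<sigma>"
    unfolding network_derivatives_def by blast
qed

lemma ridge_derivative:
  assumes "\<And>x. (\<sigma> has_real_derivative \<sigma>' x) (at x)"
  shows "((\<lambda>t. \<sigma> (w * t + b)) has_real_derivative w * \<sigma>' (w * t + b)) (at t)"
proof -
  have "((\<lambda>t. \<sigma> (w * t + b)) has_real_derivative \<sigma>' (w * t + b) * w) (at t)"
    by (rule DERIV_chain2[OF assms]) (auto intro!: derivative_eq_intros)
  thus ?thesis by (simp add: mult.commute)
qed

text \<open>A ridge function of \<open>\<sigma>'\<close> with weight \<open>w \<noteq> 0\<close> is the derivative of a network divided by \<open>w\<close>. Only the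
constant \<open>\<sigma>'(b)\<close>, the case \<open>w = 0\<close>, calls for a limit.\<close>

lemma ridge_closed_derivative:
  assumes \<sigma>': "\<And>x. (\<sigma> has_real_derivative \<sigma>' x) (at x)" and c: "continuous_on UNIV \<sigma>'"
  shows "ridge_closed (uniform_closure {0..T} (network_derivatives \<sigma>)) \<sigma>'"
  unfolding ridge_closed_def
proof (intro conjI allI c)
  let ?C = "uniform_closure {0..T} (network_derivatives \<sigma>)"
  have nz: "(\<lambda>t. \<sigma>' (w * t + b)) \<in> network_derivatives \<sigma>" if "w \<noteq> 0" for w b
  proof -
    have "(\<lambda>t. (1/w) * \<sigma> (w * t + b)) \<in> networks \<sigma>"
      by (intro subspace_cmult_in subspace_networks ridge_in_networks)
    moreover have "((\<lambda>t. (1/w) * \<sigma> (w * t + b)) has_real_derivative \<sigma>' (w * t + b)) (at t)" for t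
      using DERIV_cmult[OF ridge_derivative[of \<sigma> \<sigma>' w b t, OF \<sigma>'], of "1/w"] that by simp
    ultimately show ?thesis unfolding network_derivatives_def by blast
  qed
  fix w b
  show "(\<lambda>t. \<sigma>' (w * t + b)) \<in> ?C"
  proof (cases "w = 0")
    case False thus ?thesis by (intro uniform_closure_superset nz)
  next
    case True
    show ?thesis
    proof (rule uniform_closureI)
      fix \<epsilon> :: real assume "\<epsilon> > 0"
      then obtain d where d: "d > 0" "\<And>z. \<bar>z - b\<bar> < d \<Longrightarrow> \<bar>\<sigma>' z - \<sigma>' b\<bar> < \<epsilon>"
        using c[unfolded continuous_on_iff, rule_format, OF UNIV_I, of \<epsilon> b] by (auto simp: dist_real_def)
      define v where "v = d / (\<bar>T\<bar> + 1)"
      have v: "v > 0" using d by (simp add: v_def)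
      have "\<bar>\<sigma>' b - \<sigma>' (v * t + b)\<bar> \<le> \<epsilon>" if "t \<in> {0..T}" for t
      proof -
        have "\<bar>v * t\<bar> < v * (\<bar>T\<bar> + 1)" using v that by (auto simp: abs_mult)
        also have "\<dots> = d" by (simp add: v_def)
        finally show ?thesis using d(2)[of "v * t + b"] by simp
      qed
      thus "\<exists>h\<in>network_derivatives \<sigma>. \<forall>t\<in>{0..T}. \<bar>\<sigma>' (w * t + b) - h t\<bar> \<le> \<epsilon>"
        using True nz[of v b] v by (intro bexI[of _ "\<lambda>t. \<sigma>' (v * t + b)"]) auto
    qed
  qed
qed

text \<open>Approximate the derivative \<open>z\<close> by derivatives of networks, match the value at \<open>0\<close> by adding a constant, and
integrate the error.\<close>

lemma C1_approx_networks:
  assumes \<sigma>: "C2_fun \<sigma>" "\<nexists>p. \<sigma> = poly p" and T: "T > 0"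
    and u: "\<And>t. t \<in> {0..T} \<Longrightarrow> (u has_real_derivative z t) (at t within {0..T})"
    and z: "continuous_on {0..T} z" and \<epsilon>: "\<epsilon> > 0"
  shows "\<exists>h\<in>networks \<sigma>. \<forall>t\<in>{0..T}. \<bar>u t - h t\<bar> \<le> \<epsilon> \<and> \<bar>z t - deriv h t\<bar> \<le> \<epsilon>"
proof -
  obtain \<sigma>' \<sigma>'' where s: "\<And>x. (\<sigma> has_real_derivative \<sigma>' x) (at x)" "\<And>x. (\<sigma>' has_real_derivative \<sigma>'' x) (at x)"
    using \<sigma>(1) unfolding C2_fun_def by blast
  have c: "continuous_on UNIV \<sigma>'" using s(2) DERIV_continuous_on by blast
  define \<delta> where "\<delta> = \<epsilon> / (T + 1)"
  have \<delta>: "\<delta> > 0" using \<epsilon> T by (simp add: \<delta>_def)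
  have "z \<in> uniform_closure {0..T} (network_derivatives \<sigma>)"
    by (rule continuous_in_ridge_closure[OF subspace_network_derivatives ridge_closed_derivative[OF s(1) c] derivative_not_poly[OF s(1) \<sigma>(2)] z])
  then obtain q where q: "q \<in> network_derivatives \<sigma>" "\<forall>t\<in>{0..T}. \<bar>z t - q t\<bar> \<le> \<delta>"
    using \<delta> unfolding uniform_closure_def by blast
  then obtain k where k: "k \<in> networks \<sigma>" "\<And>t. (k has_real_derivative q t) (at t)"
    unfolding network_derivatives_def by blast
  \<comment> \<open>with weight \<open>w = 0\<close> a network produces any constant, provided that \<open>\<sigma>\<close> does not vanish identically\<close>
  have "\<exists>b. \<sigma> b \<noteq> 0"
  proof (rule ccontr)
    assume "\<not> ?thesis"
    hence "\<sigma> = poly 0" by auto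
    thus False using \<sigma>(2) by blast
  qed
  then obtain b where b: "\<sigma> b \<noteq> 0" by blast
  define c where "c = u 0 - k 0"
  define h where "h t = k t + c" for t
  have "k + (\<lambda>t. c / \<sigma> b * \<sigma> (0 * t + b)) \<in> networks \<sigma>"
    by (intro subspace_add subspace_networks k subspace_cmult_in ridge_in_networks)
  hence hN: "h \<in> networks \<sigma>" using b by (simp add: h_def[abs_def] plus_fun_def)
  have hd: "(h has_real_derivative q t) (at t)" for t
    unfolding h_def by (auto intro!: derivative_eq_intros k)
  have "\<bar>u t - h t\<bar> \<le> \<epsilon> \<and> \<bar>z t - deriv h t\<bar> \<le> \<epsilon>" if t: "t \<in> {0..T}" for t
  proof
    have le: "\<delta> \<le> \<epsilon>" using \<epsilon> T by (simp add: \<delta>_def field_simps)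
    show "\<bar>z t - deriv h t\<bar> \<le> \<epsilon>"
      using q(2) t le DERIV_imp_deriv[OF hd] by force
    have "norm ((u t - h t) - (u 0 - h 0)) \<le> \<delta> * norm (t - 0)"
    proof (rule field_differentiable_bound[of "{0..T}" "\<lambda>t. u t - h t" "\<lambda>t. z t - q t"])
      show "((\<lambda>t. u t - h t) has_field_derivative z s - q s) (at s within {0..T})" if "s \<in> {0..T}" for s
        by (intro DERIV_diff u that has_field_derivative_at_within[OF hd])
      show "norm (z s - q s) \<le> \<delta>" if "s \<in> {0..T}" for s using q(2) that by simp
    qed (use t T in auto)
    also have "\<delta> * norm (t - 0) \<le> \<delta> * (T + 1)" using t \<delta> by (intro mult_left_mono) auto
    also have "\<dots> = \<epsilon>" using T by (simp add: \<delta>_def)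
    finally show "\<bar>u t - h t\<bar> \<le> \<epsilon>" by (simp add: h_def c_def)
  qed
  thus ?thesis using hN by blast
qed

section \<open>Semi-inner products and orthogonal bases\<close>

text \<open>The spaces of the problem consist of functions rather than of classes modulo null sets, so their inner
products are only semidefinite and are defined on a subspace of a larger type. Elements of norm zero take the
place of null functions.\<close>

locale semi_inner =
  fixes E :: "'v::real_vector set" and B :: "'v \<Rightarrow> 'v \<Rightarrow> real"
  assumes subspace_E: "subspace E"
    and sym: "x \<in> E \<Longrightarrow> y \<in> E \<Longrightarrow> B x y = B y x"
    and add_left: "x \<in> E \<Longrightarrow> y \<in> E \<Longrightarrow> z \<in> E \<Longrightarrow> B (x + y) z = B x z + B y z"
    and scale_left: "x \<in> E \<Longrightarrow> y \<in> E \<Longrightarrow> B (c *\<^sub>R x) y = c * B x y"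
    and nonneg: "x \<in> E \<Longrightarrow> 0 \<le> B x x"
begin

definition N :: "'v \<Rightarrow> real" where "N x = sqrt (B x x)"

lemma zero_E [simp, intro]: "0 \<in> E" by (rule subspace_0[OF subspace_E])
lemma add_E [simp, intro]: "x \<in> E \<Longrightarrow> y \<in> E \<Longrightarrow> x + y \<in> E" by (rule subspace_add[OF subspace_E])
lemma diff_E [simp, intro]: "x \<in> E \<Longrightarrow> y \<in> E \<Longrightarrow> x - y \<in> E" by (rule subspace_diff[OF subspace_E])
lemma minus_E [simp, intro]: "x \<in> E \<Longrightarrow> - x \<in> E" by (rule subspace_neg[OF subspace_E])
lemma scale_E [simp, intro]: "x \<in> E \<Longrightarrow> c *\<^sub>R x \<in> E" by (rule subspace_scale[OF subspace_E])
lemma sum_E: "(\<And>i. i \<in> I \<Longrightarrow> x i \<in> E) \<Longrightarrow> (\<Sum>i\<in>I. x i) \<in> E" by (rule subspace_sum[OF subspace_E])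

lemma add_right: "x \<in> E \<Longrightarrow> y \<in> E \<Longrightarrow> z \<in> E \<Longrightarrow> B z (x + y) = B z x + B z y"
  by (simp add: sym[of z] add_left)
lemma scale_right: "x \<in> E \<Longrightarrow> y \<in> E \<Longrightarrow> B y (c *\<^sub>R x) = c * B y x"
  by (simp add: sym[of y] scale_left)
lemma zero_left: "y \<in> E \<Longrightarrow> B 0 y = 0"
  using scale_left[of 0 y 0] by simp
lemma minus_left: "x \<in> E \<Longrightarrow> y \<in> E \<Longrightarrow> B (- x) y = - B x y"
  using scale_left[of x y "-1"] by simp
lemma diff_left: "x \<in> E \<Longrightarrow> y \<in> E \<Longrightarrow> z \<in> E \<Longrightarrow> B (x - y) z = B x z - B y z"
  using add_left[of x "- y" z] minus_left[of y z] by simp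
lemma diff_right: "x \<in> E \<Longrightarrow> y \<in> E \<Longrightarrow> z \<in> E \<Longrightarrow> B z (x - y) = B z x - B z y"
  by (simp add: sym[of z] diff_left)
lemma sum_left: "(\<And>i. i \<in> I \<Longrightarrow> x i \<in> E) \<Longrightarrow> y \<in> E \<Longrightarrow> B (\<Sum>i\<in>I. x i) y = (\<Sum>i\<in>I. B (x i) y)"
proof (induction I rule: infinite_finite_induct)
  case (insert i I)
  thus ?case by (simp add: add_left sum_E)
qed (auto simp: zero_left)

lemma N_nonneg: "x \<in> E \<Longrightarrow> 0 \<le> N x" by (simp add: N_def nonneg)
lemma N_sq: "x \<in> E \<Longrightarrow> (N x)\<^sup>2 = B x x" by (simp add: N_def nonneg)
lemma N_zero: "N 0 = 0" by (simp add: N_def zero_left)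

lemma quadratic: "x \<in> E \<Longrightarrow> y \<in> E \<Longrightarrow> B (x + t *\<^sub>R y) (x + t *\<^sub>R y) = B x x + 2 * t * B x y + t\<^sup>2 * B y y"
  by (simp add: add_left add_right scale_left scale_right sym[of y x] algebra_simps power2_eq_square)

text \<open>From nonnegativity of the quadratic polynomial \<open>t \<mapsto> B (x + t y) (x + t y)\<close>.\<close>

lemma cauchy_schwarz:
  assumes x: "x \<in> E" and y: "y \<in> E"
  shows "\<bar>B x y\<bar> \<le> N x * N y"
proof -
  have q: "0 \<le> B x x + 2 * t * B x y + t\<^sup>2 * B y y" for t
    using nonneg[of "x + t *\<^sub>R y"] quadratic[OF x y] x y by simp
  have "(B x y)\<^sup>2 \<le> B x x * B y y"
  proof (cases "B y y = 0")
    case True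
    have "B x y = 0"
    proof (rule ccontr)
      assume "B x y \<noteq> 0"
      thus False using q[of "- (B x x + 1) / (2 * B x y)"] True by (simp add: field_simps)
    qed
    thus ?thesis using True by simp
  next
    case False
    hence p: "B y y > 0" using nonneg[OF y] by simp
    have "0 \<le> B y y * (B x x + 2 * (- B x y / B y y) * B x y + (- B x y / B y y)\<^sup>2 * B y y)"
      by (intro mult_nonneg_nonneg q less_imp_le[OF p])
    also have "\<dots> = B x x * B y y - (B x y)\<^sup>2"
      using p by (simp add: field_simps power2_eq_square)
    finally show ?thesis by simp
  qed
  hence "sqrt ((B x y)\<^sup>2) \<le> sqrt (B x x * B y y)" by (rule real_sqrt_le_mono)
  thus ?thesis by (simp add: N_def real_sqrt_mult)
qed

lemma N_triangle: assumes x: "x \<in> E" and y: "y \<in> E" shows "N (x + y) \<le> N x + N y"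
proof -
  have "(N (x + y))\<^sup>2 = B x x + 2 * B x y + B y y"
    using quadratic[OF x y, of 1] x y by (simp add: N_sq)
  also have "\<dots> \<le> (N x)\<^sup>2 + 2 * (N x * N y) + (N y)\<^sup>2"
    using cauchy_schwarz[OF x y] x y by (simp add: N_sq)
  also have "\<dots> = (N x + N y)\<^sup>2" by (simp add: power2_sum)
  finally show ?thesis using N_nonneg x y by (auto intro: power2_le_imp_le[of "N (x + y)"])
qed

lemma N_scale: "x \<in> E \<Longrightarrow> N (c *\<^sub>R x) = \<bar>c\<bar> * N x"
proof -
  assume x: "x \<in> E"
  have "B (c *\<^sub>R x) (c *\<^sub>R x) = c\<^sup>2 * B x x"
    using x by (simp add: scale_left scale_right power2_eq_square)
  thus ?thesis by (simp add: N_def real_sqrt_mult)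
qed

lemma N_sum_le: "(\<And>i. i \<in> I \<Longrightarrow> x i \<in> E) \<Longrightarrow> N (\<Sum>i\<in>I. x i) \<le> (\<Sum>i\<in>I. N (x i))"
proof (induction I rule: infinite_finite_induct)
  case (insert i I)
  hence "N (x i + (\<Sum>i\<in>I. x i)) \<le> N (x i) + N (\<Sum>i\<in>I. x i)" by (intro N_triangle sum_E) auto
  thus ?case using insert by simp
qed (auto simp: N_zero)

lemma N_diff_commute: "x \<in> E \<Longrightarrow> y \<in> E \<Longrightarrow> N (x - y) = N (y - x)"
  using N_scale[of "y - x" "-1"] by simp

lemma N_diff_triangle: "x \<in> E \<Longrightarrow> y \<in> E \<Longrightarrow> z \<in> E \<Longrightarrow> N (x - z) \<le> N (x - y) + N (y - z)"
  using N_triangle[of "x - y" "y - z"] by simp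

lemma null_left: "x \<in> E \<Longrightarrow> y \<in> E \<Longrightarrow> N x = 0 \<Longrightarrow> B x y = 0"
  using cauchy_schwarz[of x y] by simp

lemma null_cong_left: "x \<in> E \<Longrightarrow> x' \<in> E \<Longrightarrow> y \<in> E \<Longrightarrow> N (x - x') = 0 \<Longrightarrow> B x y = B x' y"
  using null_left[of "x - x'" y] by (simp add: diff_left)

lemma null_cong_right: "x \<in> E \<Longrightarrow> x' \<in> E \<Longrightarrow> y \<in> E \<Longrightarrow> N (x - x') = 0 \<Longrightarrow> B y x = B y x'"
  using null_cong_left[of x x' y] sym[of y x] sym[of y x'] by simp

lemma null_cong_N: "x \<in> E \<Longrightarrow> x' \<in> E \<Longrightarrow> N (x - x') = 0 \<Longrightarrow> N x = N x'"
  using null_cong_left[of x x' x] null_cong_right[of x x' x'] unfolding N_def by metis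

lemma tendsto_form:
  assumes "\<And>i. x i \<in> E" "y \<in> E" "z \<in> E" "((\<lambda>i. N (x i - y)) \<longlongrightarrow> 0) F"
  shows "((\<lambda>i. B (x i) z) \<longlongrightarrow> B y z) F"
proof (rule LIM_zero_cancel, rule Lim_null_comparison)
  show "((\<lambda>i. N (x i - y) * N z) \<longlongrightarrow> 0) F" by (rule tendsto_mult_left_zero[OF assms(4)])
  show "\<forall>\<^sub>F i in F. norm (B (x i) z - B y z) \<le> N (x i - y) * N z"
    using cauchy_schwarz[of "x _ - y" z] assms by (intro always_eventually) (auto simp: diff_left)
qed

end

text \<open>A complete orthogonal system indexed from \<open>1\<close>, like the enumerated eigenfunctions. It is not normalised, since one
system serves two forms: the eigenfunctions are orthogonal both in \<open>L\<^sup>2\<close> and in the energy.\<close>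

locale orthogonal_basis = semi_inner E B for E :: "'v::real_vector set" and B +
  fixes b :: "nat \<Rightarrow> 'v"
  assumes b_E: "j \<ge> 1 \<Longrightarrow> b j \<in> E"
    and orthogonal: "i \<ge> 1 \<Longrightarrow> j \<ge> 1 \<Longrightarrow> i \<noteq> j \<Longrightarrow> B (b i) (b j) = 0"
    and b_pos: "j \<ge> 1 \<Longrightarrow> B (b j) (b j) > 0"
    and dense: "x \<in> E \<Longrightarrow> \<epsilon> > 0 \<Longrightarrow> \<exists>P c. N (x - (\<Sum>j=1..P. c j *\<^sub>R b j)) < \<epsilon>"
begin

definition coef :: "'v \<Rightarrow> nat \<Rightarrow> real" where "coef x j = B x (b j) / B (b j) (b j)"

definition proj :: "nat \<Rightarrow> 'v \<Rightarrow> 'v" where "proj P x = (\<Sum>j=1..P. coef x j *\<^sub>R b j)"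

lemma lincomb_E: "(\<Sum>j=1..P. c j *\<^sub>R b j) \<in> E" by (intro sum_E scale_E b_E) auto

lemma proj_E: "proj P x \<in> E" unfolding proj_def by (rule lincomb_E)

lemma form_lincomb: "x \<in> E \<Longrightarrow> B (\<Sum>j=1..P. c j *\<^sub>R b j) x = (\<Sum>j=1..P. c j * B x (b j))"
  by (subst sum_left) (auto intro!: sum.cong simp: b_E scale_left sym[of "b _" x])

lemma form_lincomb_b: "j \<in> {1..P} \<Longrightarrow> B (\<Sum>i=1..P. c i *\<^sub>R b i) (b j) = c j * B (b j) (b j)"
proof -
  assume j: "j \<in> {1..P}"
  have "B (\<Sum>i=1..P. c i *\<^sub>R b i) (b j) = (\<Sum>i=1..P. c i * B (b j) (b i))"
    using j by (intro form_lincomb b_E) auto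
  also have "\<dots> = (\<Sum>i=1..P. if i = j then c j * B (b j) (b j) else 0)"
    using j by (intro sum.cong) (auto simp: orthogonal)
  finally show ?thesis using j by simp
qed

lemma N_lincomb: "(N (\<Sum>j=1..P. c j *\<^sub>R b j))\<^sup>2 = (\<Sum>j=1..P. (c j)\<^sup>2 * B (b j) (b j))"
proof -
  let ?s = "\<Sum>j=1..P. c j *\<^sub>R b j"
  have "(N ?s)\<^sup>2 = (\<Sum>j=1..P. c j * B ?s (b j))"
    unfolding N_sq[OF lincomb_E] by (rule form_lincomb[OF lincomb_E])
  also have "\<dots> = (\<Sum>j=1..P. (c j)\<^sup>2 * B (b j) (b j))"
  proof (intro sum.cong refl)
    fix j assume j: "j \<in> {1..P}"
    show "c j * B ?s (b j) = (c j)\<^sup>2 * B (b j) (b j)"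
      unfolding form_lincomb_b[OF j] by (simp add: power2_eq_square)
  qed
  finally show ?thesis .
qed

text \<open>The exact error of an arbitrary combination: the error of the projection plus that of the coefficients.\<close>

lemma N_diff_lincomb:
  assumes "x \<in> E"
  shows "(N (x - (\<Sum>j=1..P. c j *\<^sub>R b j)))\<^sup>2
    = B x x - (\<Sum>j=1..P. (coef x j)\<^sup>2 * B (b j) (b j)) + (\<Sum>j=1..P. (c j - coef x j)\<^sup>2 * B (b j) (b j))"
proof -
  let ?s = "\<Sum>j=1..P. c j *\<^sub>R b j"
  have s: "?s \<in> E" by (rule lincomb_E)
  have "(N (x - s))\<^sup>2 = B x x - 2 * B s x + B s s" if "s \<in> E" for s
    using assms that by (simp add: N_sq diff_left diff_right sym[of x s])
  hence "(N (x - ?s))\<^sup>2 = B x x - 2 * B ?s x + B ?s ?s" using s by blast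
  also have "B ?s x = (\<Sum>j=1..P. c j * B x (b j))" by (rule form_lincomb[OF assms])
  also have "B ?s ?s = (\<Sum>j=1..P. (c j)\<^sup>2 * B (b j) (b j))" using N_lincomb[of c P] unfolding N_sq[OF s] .
  also have "B x x - 2 * (\<Sum>j=1..P. c j * B x (b j)) + (\<Sum>j=1..P. (c j)\<^sup>2 * B (b j) (b j))
      = B x x + (\<Sum>j=1..P. (c j)\<^sup>2 * B (b j) (b j) - 2 * (c j * B x (b j)))"
    by (simp add: sum_subtractf sum_distrib_left)
  also have "\<dots> = B x x + (\<Sum>j=1..P. (c j - coef x j)\<^sup>2 * B (b j) (b j) - (coef x j)\<^sup>2 * B (b j) (b j))"
  proof -
    have "(c j)\<^sup>2 * B (b j) (b j) - 2 * (c j * B x (b j))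
        = (c j - coef x j)\<^sup>2 * B (b j) (b j) - (coef x j)\<^sup>2 * B (b j) (b j)" if "j \<in> {1..P}" for j
    proof -
      have "B x (b j) = coef x j * B (b j) (b j)" using b_pos[of j] that by (simp add: coef_def)
      thus ?thesis by (simp add: power2_eq_square algebra_simps)
    qed
    from sum.cong[OF refl this] show ?thesis by (rule arg_cong)
  qed
  finally show ?thesis by (simp add: sum_subtractf)
qed

lemma N_diff_proj: "x \<in> E \<Longrightarrow> (N (x - proj P x))\<^sup>2 = B x x - (\<Sum>j=1..P. (coef x j)\<^sup>2 * B (b j) (b j))"
  unfolding proj_def by (subst N_diff_lincomb) auto

lemma proj_best:
  assumes "x \<in> E"
  shows "N (x - proj P x) \<le> N (x - (\<Sum>j=1..P. c j *\<^sub>R b j))"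
proof (rule power2_le_imp_le)
  have "0 \<le> (\<Sum>j=1..P. (c j - coef x j)\<^sup>2 * B (b j) (b j))"
    by (intro sum_nonneg mult_nonneg_nonneg nonneg b_E) auto
  thus "(N (x - proj P x))\<^sup>2 \<le> (N (x - (\<Sum>j=1..P. c j *\<^sub>R b j)))\<^sup>2"
    unfolding N_diff_proj[OF assms] N_diff_lincomb[OF assms] by linarith
  show "0 \<le> N (x - (\<Sum>j=1..P. c j *\<^sub>R b j))" using assms lincomb_E by (intro N_nonneg diff_E)
qed

lemma proj_antimono:
  assumes "x \<in> E" "P \<le> Q"
  shows "N (x - proj Q x) \<le> N (x - proj P x)"
proof (rule power2_le_imp_le)
  have "(\<Sum>j=1..P. (coef x j)\<^sup>2 * B (b j) (b j)) \<le> (\<Sum>j=1..Q. (coef x j)\<^sup>2 * B (b j) (b j))"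
    using assms(2) by (intro sum_mono2 mult_nonneg_nonneg nonneg b_E) auto
  thus "(N (x - proj Q x))\<^sup>2 \<le> (N (x - proj P x))\<^sup>2"
    by (simp add: N_diff_proj assms)
  show "0 \<le> N (x - proj P x)" using assms proj_E by (intro N_nonneg diff_E)
qed

lemma proj_close:
  assumes "x \<in> E" "\<epsilon> > 0"
  shows "\<exists>P0. \<forall>P\<ge>P0. N (x - proj P x) < \<epsilon>"
proof -
  obtain P c where "N (x - (\<Sum>j=1..P. c j *\<^sub>R b j)) < \<epsilon>" using dense[OF assms] by blast
  hence "N (x - proj P x) < \<epsilon>" using proj_best[OF assms(1), of P c] by linarith
  thus ?thesis using proj_antimono[OF assms(1)] by (meson le_less_trans)
qed

lemma proj_tendsto:
  assumes "x \<in> E"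
  shows "(\<lambda>P. N (x - proj P x)) \<longlonglongrightarrow> 0"
  using proj_close[OF assms] N_nonneg assms proj_E
  by (intro LIMSEQ_I) (simp add: diff_E)

text \<open>Fix an order that is good at the time \<open>t\<close>. At a nearby time the projection of \<open>x t\<close> is still close to
\<open>x s\<close>, and the projection of \<open>x s\<close> is at least as good; compactness then leaves finitely many orders.\<close>

lemma proj_close_uniform:
  fixes x :: "real \<Rightarrow> 'v"
  assumes K: "compact K" and xE: "\<And>t. t \<in> K \<Longrightarrow> x t \<in> E"
    and cont: "\<And>t. t \<in> K \<Longrightarrow> ((\<lambda>s. N (x s - x t)) \<longlongrightarrow> 0) (at t within K)"
    and \<epsilon>: "\<epsilon> > 0"
  shows "\<exists>P0. \<forall>P\<ge>P0. \<forall>t\<in>K. N (x t - proj P (x t)) < \<epsilon>"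
proof -
  have "\<exists>\<delta> P0. \<delta> > 0 \<and> (\<forall>P\<ge>P0. \<forall>s\<in>K. dist s t < \<delta> \<longrightarrow> N (x s - proj P (x s)) < \<epsilon>)" if t: "t \<in> K" for t
  proof -
    obtain P0 where P0: "\<forall>P\<ge>P0. N (x t - proj P (x t)) < \<epsilon> / 2"
      using proj_close[OF xE[OF t], of "\<epsilon>/2"] \<epsilon> by auto
    have "\<forall>\<^sub>F s in at t within K. N (x s - x t) < \<epsilon> / 2"
      using cont[OF t] \<epsilon> by (intro order_tendstoD(2)) auto
    then obtain \<delta> where \<delta>: "\<delta> > 0" "\<And>s. s \<in> K \<Longrightarrow> s \<noteq> t \<Longrightarrow> dist s t < \<delta> \<Longrightarrow> N (x s - x t) < \<epsilon> / 2"
      unfolding eventually_at by blast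
    have "N (x s - proj P (x s)) < \<epsilon>" if P: "P \<ge> P0" and s: "s \<in> K" "dist s t < \<delta>" for P s
    proof -
      have st: "N (x s - x t) < \<epsilon> / 2"
        using \<delta>(2)[OF s(1) _ s(2)] \<epsilon> by (cases "s = t") (auto simp: N_zero)
      have "N (x s - proj P (x s)) \<le> N (x s - proj P (x t))"
        unfolding proj_def[of P "x t"] by (rule proj_best[OF xE[OF s(1)]])
      also have "\<dots> \<le> N (x s - x t) + N (x t - proj P (x t))"
        using xE s(1) t proj_E by (intro N_diff_triangle) auto
      also have "\<dots> < \<epsilon> / 2 + \<epsilon> / 2" using st P0 P by (intro add_strict_mono) auto
      finally show ?thesis by simp
    qed
    thus ?thesis using \<delta>(1) by blast
  qed
  then obtain \<delta> P0 where \<delta>: "\<And>t. t \<in> K \<Longrightarrow> \<delta> t > 0"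
    and P0: "\<And>t P s. t \<in> K \<Longrightarrow> P \<ge> P0 t \<Longrightarrow> s \<in> K \<Longrightarrow> dist s t < \<delta> t \<Longrightarrow> N (x s - proj P (x s)) < \<epsilon>"
    by metis
  have "K \<subseteq> (\<Union>t\<in>K. ball t (\<delta> t))" using \<delta> by force
  then obtain C where C: "C \<subseteq> K" "finite C" "K \<subseteq> (\<Union>t\<in>C. ball t (\<delta> t))"
    using compactE_image[OF K, of K "\<lambda>t. ball t (\<delta> t)"] by auto
  have "N (x s - proj P (x s)) < \<epsilon>" if P: "P \<ge> Max (insert 0 (P0 ` C))" and s: "s \<in> K" for P s
  proof -
    obtain t where t: "t \<in> C" "s \<in> ball t (\<delta> t)" using C(3) s by blast
    have "P0 t \<le> Max (insert 0 (P0 ` C))" using t C(2) by (intro Max_ge) auto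
    thus ?thesis using t C(1) P s by (intro P0[of t]) (auto simp: dist_commute)
  qed
  thus ?thesis by blast
qed

end

section \<open>Smooth functions and test functions on the cube\<close>

text \<open>Recursion on the order makes the closure under sums, products and compositions a simple induction.\<close>

fun differentiable_times :: "nat \<Rightarrow> (real \<Rightarrow> real) \<Rightarrow> bool" where
  "differentiable_times 0 f \<longleftrightarrow> True"
| "differentiable_times (Suc n) f \<longleftrightarrow> (\<exists>f'. (\<forall>x. (f has_real_derivative f' x) (at x)) \<and> differentiable_times n f')"

definition smooth_real :: "(real \<Rightarrow> real) \<Rightarrow> bool" where
  "smooth_real f \<longleftrightarrow> (\<forall>n. differentiable_times n f)"

lemma differentiable_times_SucI: "(\<And>x. (f has_real_derivative f' x) (at x)) \<Longrightarrow> differentiable_times n f' \<Longrightarrow> differentiable_times (Suc n) f"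
  by auto

lemma differentiable_times_Suc_imp: "differentiable_times (Suc n) f \<Longrightarrow> differentiable_times n f"
  by (induction n arbitrary: f) (simp, metis differentiable_times.simps(2))

lemma differentiable_times_const: "differentiable_times n (\<lambda>x. c)"
  by (induction n arbitrary: c) (auto intro!: exI[of _ "\<lambda>_. 0"])

lemma differentiable_times_add: "differentiable_times n f \<Longrightarrow> differentiable_times n g \<Longrightarrow> differentiable_times n (\<lambda>x. f x + g x)"
proof (induction n arbitrary: f g)
  case (Suc n)
  then obtain f' g' where "\<And>x. (f has_real_derivative f' x) (at x)" "differentiable_times n f'"
    "\<And>x. (g has_real_derivative g' x) (at x)" "differentiable_times n g'" by auto
  thus ?case using Suc.IH by (intro differentiable_times_SucI[of _ "\<lambda>x. f' x + g' x"] DERIV_add) auto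
qed simp

lemma differentiable_times_mult: "differentiable_times n f \<Longrightarrow> differentiable_times n g \<Longrightarrow> differentiable_times n (\<lambda>x. f x * g x)"
proof (induction n arbitrary: f g)
  case (Suc n)
  then obtain f' g' where d: "\<And>x. (f has_real_derivative f' x) (at x)" "differentiable_times n f'"
    "\<And>x. (g has_real_derivative g' x) (at x)" "differentiable_times n g'" by auto
  have "differentiable_times n f" "differentiable_times n g" using Suc.prems differentiable_times_Suc_imp by blast+
  thus ?case using Suc.IH d
    by (intro differentiable_times_SucI[of _ "\<lambda>x. f' x * g x + g' x * f x"] DERIV_mult differentiable_times_add) auto
qed simp

lemma differentiable_times_compose: "differentiable_times n f \<Longrightarrow> differentiable_times n g \<Longrightarrow> differentiable_times n (\<lambda>x. f (g x))"
proof (induction n arbitrary: f g)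
  case (Suc n)
  then obtain f' g' where d: "\<And>x. (f has_real_derivative f' x) (at x)" "differentiable_times n f'"
    "\<And>x. (g has_real_derivative g' x) (at x)" "differentiable_times n g'" by auto
  have "differentiable_times n g" using Suc.prems differentiable_times_Suc_imp by blast
  thus ?case using Suc.IH d
    by (intro differentiable_times_SucI[of _ "\<lambda>x. f' (g x) * g' x"] DERIV_chain2 differentiable_times_mult) auto
qed simp

lemma differentiable_times_ident: "differentiable_times n (\<lambda>x. x)"
  by (cases n) (auto intro!: exI[of _ "\<lambda>_. 1"] differentiable_times_const)

lemma differentiable_times_sin_cos: "differentiable_times n sin \<and> differentiable_times n cos"
proof (induction n)
  case (Suc n)
  have "differentiable_times n (\<lambda>x. (-1) * sin x)" using Suc by (intro differentiable_times_mult differentiable_times_const) auto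
  hence "differentiable_times (Suc n) cos" by (intro differentiable_times_SucI[of _ "\<lambda>x. (-1) * sin x"]) (auto intro!: derivative_eq_intros)
  moreover have "differentiable_times (Suc n) sin" using Suc by (intro differentiable_times_SucI[of _ cos]) (auto intro!: derivative_eq_intros)
  ultimately show ?case by blast
qed simp

lemma smooth_realD:
  assumes "smooth_real f"
  obtains f' where "\<And>x. (f has_real_derivative f' x) (at x)" "smooth_real f'"
proof -
  obtain f' where f': "\<And>x. (f has_real_derivative f' x) (at x)"
    using assms[unfolded smooth_real_def, rule_format, of 1] by auto
  have "differentiable_times n f'" for n
  proof -
    obtain f'' where "\<And>x. (f has_real_derivative f'' x) (at x)" "differentiable_times n f''"
      using assms[unfolded smooth_real_def, rule_format, of "Suc n"] by auto
    moreover from this have "f'' = f'" using f' DERIV_unique by blast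
    ultimately show ?thesis by simp
  qed
  thus ?thesis using that f' by (auto simp: smooth_real_def)
qed

text \<open>The functions \<open>x\<^sup>-\<^sup>m exp (-1/x)\<close>, extended by \<open>0\<close> to \<open>x \<le> 0\<close>. Derivatives of the standard flat function
\<open>flat_exp 0\<close> are combinations of these.\<close>

definition flat_exp :: "nat \<Rightarrow> real \<Rightarrow> real" where
  "flat_exp m x = (if x > 0 then (1 / x) ^ m * exp (- 1 / x) else 0)"

lemma flat_exp_tendsto_0: "((flat_exp m) \<longlongrightarrow> 0) (at 0)"
proof (rule filterlim_split_at)
  show "(flat_exp m \<longlongrightarrow> 0) (at_left 0)"
    by (rule tendsto_eventually) (auto simp: flat_exp_def eventually_at_filter)
  have "((\<lambda>x::real. (inverse x) ^ m / exp (inverse x)) \<longlongrightarrow> 0) (at_right 0)"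
    by (rule filterlim_compose[OF tendsto_power_div_exp_0 filterlim_inverse_at_top_right])
  thus "(flat_exp m \<longlongrightarrow> 0) (at_right 0)"
    by (rule Lim_transform_eventually)
       (auto simp: flat_exp_def eventually_at_filter exp_minus field_simps)
qed

lemma flat_exp_derivative:
  "(flat_exp m has_real_derivative (- real m * flat_exp (m+1) x + flat_exp (m+2) x)) (at x)"
proof -
  consider "x > 0" | "x < 0" | "x = 0" by linarith
  thus ?thesis
  proof cases
    case 1
    have "((\<lambda>x. (1 / x) ^ m * exp (- 1 / x)) has_real_derivative
            (- real m * ((1/x) ^ (m+1) * exp (- 1 / x)) + (1/x)^(m+2) * exp (- 1 / x))) (at x)"
    proof -
      have i: "((\<lambda>x. 1 / x) has_real_derivative - ((1/x)^2)) (at x)"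
        using 1 by (auto intro!: derivative_eq_intros simp: power2_eq_square)
      have e: "((\<lambda>x. exp (- 1 / x)) has_real_derivative exp (- 1 / x) * (1/x)^2) (at x)"
        using 1 by (auto intro!: derivative_eq_intros simp: power2_eq_square)
      have "real m * (1/x) ^ (m - 1) * (1/x)^2 = real m * (1/x)^(m+1)"
        by (cases m) (auto simp: power2_eq_square power_add mult_ac)
      hence k: "real m * (- ((1/x)^2) * (1/x) ^ (m - Suc 0)) = - real m * (1/x)^(m+1)" by (simp add: mult_ac)
      show ?thesis
        by (rule DERIV_cong[OF DERIV_mult[OF DERIV_power[OF i, of m] e]], unfold k)
           (simp only: power_add mult_minus_left mult_minus_right mult.assoc mult.commute mult.left_commute)
    qed
    hence "((\<lambda>x. (1 / x) ^ m * exp (- 1 / x)) has_real_derivative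
            (- real m * flat_exp (m+1) x + flat_exp (m+2) x)) (at x)"
      using 1 by (simp add: flat_exp_def)
    note D = this
    have ev: "eventually (\<lambda>y. (1 / y) ^ m * exp (- 1 / y) = flat_exp m y) (nhds x)"
      using eventually_nhds_in_open[of "{0<..}" x] 1
      by (auto elim!: eventually_mono simp: flat_exp_def)
    show ?thesis by (rule iffD1[OF DERIV_cong_ev[OF refl ev refl] D])
  next
    case 2
    have D: "((\<lambda>x. 0) has_real_derivative (- real m * flat_exp (m+1) x + flat_exp (m+2) x)) (at x)"
      using 2 by (simp add: flat_exp_def)
    have ev: "eventually (\<lambda>y. 0 = flat_exp m y) (nhds x)"
      using eventually_nhds_in_open[of "{..<0}" x] 2
      by (auto elim!: eventually_mono simp: flat_exp_def)
    show ?thesis by (rule iffD1[OF DERIV_cong_ev[OF refl ev refl] D])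
  next
    case 3
    have "((\<lambda>h. (flat_exp m (0 + h) - flat_exp m 0) / h) \<longlongrightarrow> 0) (at 0)"
      by (rule Lim_transform_eventually[OF flat_exp_tendsto_0[of "m+1"]])
         (auto simp: flat_exp_def eventually_at_filter)
    thus ?thesis unfolding DERIV_def 3 by (simp add: flat_exp_def)
  qed
qed

text \<open>The family is closed under differentiation up to linear combinations, so the induction runs over all \<open>m\<close>
at once.\<close>

lemma differentiable_times_flat_exp: "differentiable_times n (flat_exp m)"
proof (induction n arbitrary: m)
  case (Suc n)
  have "differentiable_times n (\<lambda>x. (- real m) * flat_exp (m+1) x + flat_exp (m+2) x)"
    by (intro differentiable_times_add differentiable_times_mult differentiable_times_const Suc)
  thus ?case using flat_exp_derivative by (intro differentiable_times_SucI) auto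
qed simp

lemma flat_exp_bounds: "0 \<le> flat_exp 0 x" "flat_exp 0 x \<le> 1" "0 \<le> flat_exp 2 x" "\<bar>x + 1\<bar> * flat_exp 2 x \<le> 2"
proof -
  show "0 \<le> flat_exp 0 x" "flat_exp 0 x \<le> 1" "0 \<le> flat_exp 2 x" by (auto simp: flat_exp_def)
  show "\<bar>x + 1\<bar> * flat_exp 2 x \<le> 2"
  proof (cases "x > 0")
    case True
    define y where "y = 1 / x"
    have y: "y > 0" "x = 1 / y" using True by (auto simp: y_def)
    have "1 + y + y\<^sup>2 / 2 \<le> exp y" using exp_lower_Taylor_quadratic[of y] y by simp
    hence "y + y\<^sup>2 \<le> 2 * exp y" using y(1) by linarith
    hence "(y + y\<^sup>2) / exp y \<le> 2" by (simp add: field_simps)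
    moreover have "\<bar>x + 1\<bar> * flat_exp 2 x = (y + y\<^sup>2) / exp y"
    proof -
      have "\<bar>x + 1\<bar> = 1 / y + 1" using y by simp
      moreover have "flat_exp 2 x = y\<^sup>2 * exp (- y)" using True by (simp add: flat_exp_def y_def)
      ultimately have "\<bar>x + 1\<bar> * flat_exp 2 x = ((1 / y + 1) * y\<^sup>2) * exp (- y)" by simp
      also have "(1 / y + 1) * y\<^sup>2 = y + y\<^sup>2" using y(1) by (simp add: field_simps power2_eq_square)
      finally show ?thesis by (simp add: exp_minus divide_inverse)
    qed
    ultimately show ?thesis by simp
  qed (simp add: flat_exp_def)
qed

lemma flat_exp_at_top: "(flat_exp 0 \<longlongrightarrow> 1) at_top" "((\<lambda>x. \<bar>x + 1\<bar> * flat_exp 2 x) \<longlongrightarrow> 0) at_top"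
proof -
  have i: "((\<lambda>x::real. 1 / x) \<longlongrightarrow> 0) at_top"
    using tendsto_inverse_0_at_top[OF filterlim_ident] by (simp add: inverse_eq_divide)
  have "((\<lambda>x::real. exp (- (1 / x))) \<longlongrightarrow> exp (- 0)) at_top"
    by (intro tendsto_intros i)
  thus "(flat_exp 0 \<longlongrightarrow> 1) at_top"
    by (rule Lim_transform_eventually[THEN tendsto_eq_rhs])
       (auto simp: flat_exp_def intro!: eventually_mono[OF eventually_gt_at_top[of 0]])
  have "((\<lambda>x::real. (1/x + (1/x)^2) * exp (- (1 / x))) \<longlongrightarrow> (0 + 0^2) * exp (- 0)) at_top"
    by (intro tendsto_intros i)
  thus "((\<lambda>x. \<bar>x + 1\<bar> * flat_exp 2 x) \<longlongrightarrow> 0) at_top"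
    by (rule Lim_transform_eventually[THEN tendsto_eq_rhs])
       (auto simp: flat_exp_def field_simps power2_eq_square intro!: eventually_mono[OF eventually_gt_at_top[of 0]])
qed

text \<open>A smooth cut-off of the sine that is supported in the open unit interval. The argument of the cut-off is built
from \<open>t (1 - t)\<close>, which is positive exactly on that interval and comparable with the distance to its ends.\<close>

definition cut_sine :: "nat \<Rightarrow> nat \<Rightarrow> real \<Rightarrow> real" where
  "cut_sine n k t = sin (real k * pi * t) * flat_exp 0 (real n * (t * (1 - t)) - 1)"

text \<open>The derivative of \<open>cut_sine\<close>, with the term that comes from the cut-off kept apart.\<close>

definition cut_sine' :: "nat \<Rightarrow> nat \<Rightarrow> real \<Rightarrow> real" where
  "cut_sine' n k t = real k * pi * cos (real k * pi * t) * flat_exp 0 (real n * (t * (1 - t)) - 1)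
     + sin (real k * pi * t) * (real n * (1 - 2 * t) * flat_exp 2 (real n * (t * (1 - t)) - 1))"

lemma cut_sine_derivative: "(cut_sine n k has_real_derivative cut_sine' n k t) (at t)"
proof -
  have r: "((\<lambda>t. flat_exp 0 (real n * (t * (1 - t)) - 1)) has_real_derivative
      flat_exp 2 (real n * (t * (1 - t)) - 1) * (real n * (1 - 2 * t))) (at t)"
  proof (rule DERIV_chain2[where f="flat_exp 0"])
    show "(flat_exp 0 has_real_derivative flat_exp 2 (real n * (t * (1 - t)) - 1)) (at (real n * (t * (1 - t)) - 1))"
      using flat_exp_derivative[of 0] by (simp add: numeral_2_eq_2)
    show "((\<lambda>t. real n * (t * (1 - t)) - 1) has_real_derivative real n * (1 - 2 * t)) (at t)"
      by (auto intro!: derivative_eq_intros simp: algebra_simps)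
  qed
  have s: "((\<lambda>t. sin (real k * pi * t)) has_real_derivative cos (real k * pi * t) * (real k * pi)) (at t)"
    by (auto intro!: derivative_eq_intros)
  show ?thesis unfolding cut_sine_def[abs_def] cut_sine'_def
    by (rule DERIV_cong[OF DERIV_mult[OF s r]]) (simp add: mult_ac)
qed

lemma smooth_cut_sine: "smooth_real (cut_sine n k)"
proof -
  have "differentiable_times N (\<lambda>t. (real n * (t * (1 + (-1) * t)) + (-1)))" for N
    by (intro differentiable_times_mult differentiable_times_add differentiable_times_const differentiable_times_ident)
  hence "differentiable_times N (\<lambda>t. flat_exp 0 (real n * (t * (1 + (-1) * t)) + (-1)))" for N
    by (rule differentiable_times_compose[OF differentiable_times_flat_exp])
  moreover have "differentiable_times N (\<lambda>t. sin (real k * pi * t))" for N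
    by (rule differentiable_times_compose[OF conjunct1[OF differentiable_times_sin_cos]]) (intro differentiable_times_mult differentiable_times_const differentiable_times_ident)
  ultimately have "differentiable_times N (\<lambda>t. sin (real k * pi * t) * flat_exp 0 (real n * (t * (1 + (-1) * t)) + (-1)))" for N
    by (intro differentiable_times_mult)
  thus ?thesis unfolding smooth_real_def cut_sine_def[abs_def] by simp
qed

lemma cut_sine_bound: "\<bar>cut_sine n k t\<bar> \<le> 1"
  unfolding cut_sine_def abs_mult using flat_exp_bounds(1,2)[of "real n * (t * (1 - t)) - 1"]
  by (intro mult_le_one) auto

text \<open>The sine vanishes at both ends of the interval. This linear decay compensates the factor \<open>n\<close> produced by
differentiating the cut-off.\<close>

lemma sin_near_boundary:
  assumes "0 \<le> t" "t \<le> 1"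
  shows "\<bar>sin (real k * pi * t)\<bar> \<le> 2 * real k * pi * (t * (1 - t))"
proof (cases "t \<le> 1/2")
  case True
  have "\<bar>sin (real k * pi * t)\<bar> \<le> \<bar>real k * pi * t\<bar>" by (rule abs_sin_x_le_abs_x)
  also have "\<dots> = real k * pi * (t * 1)" using assms by simp
  also have "\<dots> \<le> real k * pi * (t * (2 * (1 - t)))" using assms True
    by (intro mult_left_mono) auto
  finally show ?thesis by (simp add: mult_ac)
next
  case False
  have "sin (real k * pi * (1 - t)) = sin (real k * pi) * cos (real k * pi * t) - cos (real k * pi) * sin (real k * pi * t)"
    by (simp add: right_diff_distrib sin_diff)
  also have "\<bar>\<dots>\<bar> = \<bar>sin (real k * pi * t)\<bar>"
    by (simp add: abs_mult cos_npi)
  finally have "\<bar>sin (real k * pi * t)\<bar> = \<bar>sin (real k * pi * (1 - t))\<bar>" by simp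
  also have "\<dots> \<le> \<bar>real k * pi * (1 - t)\<bar>" by (rule abs_sin_x_le_abs_x)
  also have "\<dots> = real k * pi * (1 * (1 - t))" using assms by simp
  also have "\<dots> \<le> real k * pi * ((2 * t) * (1 - t))" using assms False
    by (intro mult_left_mono mult_right_mono) auto
  finally show ?thesis by (simp add: mult_ac)
qed

text \<open>With \<open>r = n t (1 - t) - 1\<close> the term is dominated by \<open>(r + 1) flat_exp 2 r\<close>, which is bounded and tends to
\<open>0\<close> as \<open>r\<close> grows.\<close>

lemma cut_sine'_second_term:
  assumes "0 \<le> t" "t \<le> 1"
  shows "\<bar>sin (real k * pi * t) * (real n * (1 - 2 * t) * flat_exp 2 (real n * (t * (1 - t)) - 1))\<bar>
    \<le> 2 * real k * pi * (\<bar>(real n * (t * (1 - t)) - 1) + 1\<bar> * flat_exp 2 (real n * (t * (1 - t)) - 1))"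
proof -
  let ?r = "real n * (t * (1 - t)) - 1"
  have "\<bar>sin (real k * pi * t) * (real n * (1 - 2 * t) * flat_exp 2 ?r)\<bar>
      = \<bar>sin (real k * pi * t)\<bar> * (real n * \<bar>1 - 2 * t\<bar> * flat_exp 2 ?r)"
    using flat_exp_bounds(3)[of ?r] by (simp add: abs_mult)
  also have "\<dots> \<le> (2 * real k * pi * (t * (1 - t))) * (real n * 1 * flat_exp 2 ?r)"
    using assms flat_exp_bounds(3)[of ?r]
    by (intro mult_mono sin_near_boundary mult_nonneg_nonneg) auto
  also have "\<dots> = 2 * real k * pi * (\<bar>?r + 1\<bar> * flat_exp 2 ?r)"
    using assms by (simp add: abs_mult mult_ac)
  finally show ?thesis .
qed

lemma cut_sine'_bound:
  assumes "0 \<le> t" "t \<le> 1"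
  shows "\<bar>cut_sine' n k t\<bar> \<le> 5 * real k * pi"
proof -
  let ?r = "real n * (t * (1 - t)) - 1"
  have "\<bar>real k * pi * cos (real k * pi * t) * flat_exp 0 ?r\<bar> = (real k * pi) * (\<bar>cos (real k * pi * t)\<bar> * flat_exp 0 ?r)"
    using flat_exp_bounds(1)[of ?r] by (simp add: abs_mult)
  also have "\<dots> \<le> (real k * pi) * (1 * 1)"
    using flat_exp_bounds(1,2)[of ?r] by (intro mult_left_mono mult_mono) auto
  finally have "\<bar>real k * pi * cos (real k * pi * t) * flat_exp 0 ?r\<bar> \<le> real k * pi" by simp
  moreover have "2 * real k * pi * (\<bar>?r + 1\<bar> * flat_exp 2 ?r) \<le> 2 * real k * pi * 2"
    using flat_exp_bounds(4)[of ?r] by (intro mult_left_mono) auto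
  ultimately show ?thesis using cut_sine'_second_term[OF assms, of k n]
    unfolding cut_sine'_def by linarith
qed

text \<open>Together with the bounds this is what dominated convergence needs to approximate sines in the norm of
\<open>H\<^sup>1\<close> by functions with compact support.\<close>

lemma cut_sine_lim:
  assumes "0 < t" "t < 1"
  shows "(\<lambda>n. cut_sine n k t) \<longlonglongrightarrow> sin (real k * pi * t)"
    "(\<lambda>n. cut_sine' n k t) \<longlonglongrightarrow> real k * pi * cos (real k * pi * t)"
proof -
  have pos: "t * (1 - t) > 0" using assms by simp
  have r: "filterlim (\<lambda>n. real n * (t * (1 - t)) - 1) at_top sequentially"
    using filterlim_tendsto_add_at_top[OF tendsto_const[of "-1"]
      filterlim_at_top_mult_tendsto_pos[OF tendsto_const pos filterlim_real_sequentially]] by simp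
  have r0: "(\<lambda>n. flat_exp 0 (real n * (t * (1 - t)) - 1)) \<longlonglongrightarrow> 1"
    by (rule filterlim_compose[OF flat_exp_at_top(1) r])
  have r2: "(\<lambda>n. \<bar>(real n * (t * (1 - t)) - 1) + 1\<bar> * flat_exp 2 (real n * (t * (1 - t)) - 1)) \<longlonglongrightarrow> 0"
    by (rule filterlim_compose[OF flat_exp_at_top(2) r])
  have "(\<lambda>n. sin (real k * pi * t) * flat_exp 0 (real n * (t * (1 - t)) - 1)) \<longlonglongrightarrow> sin (real k * pi * t) * 1"
    by (intro tendsto_intros r0)
  thus "(\<lambda>n. cut_sine n k t) \<longlonglongrightarrow> sin (real k * pi * t)" by (simp add: cut_sine_def)
  have "(\<lambda>n. sin (real k * pi * t) * (real n * (1 - 2 * t) * flat_exp 2 (real n * (t * (1 - t)) - 1))) \<longlonglongrightarrow> 0"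
  proof (rule Lim_null_comparison)
    show "(\<lambda>n. 2 * real k * pi * (\<bar>(real n * (t * (1 - t)) - 1) + 1\<bar> * flat_exp 2 (real n * (t * (1 - t)) - 1))) \<longlonglongrightarrow> 0"
      by (rule tendsto_mult_right_zero[OF r2])
    show "\<forall>\<^sub>F n in sequentially. norm (sin (real k * pi * t) * (real n * (1 - 2 * t) * flat_exp 2 (real n * (t * (1 - t)) - 1)))
        \<le> 2 * real k * pi * (\<bar>(real n * (t * (1 - t)) - 1) + 1\<bar> * flat_exp 2 (real n * (t * (1 - t)) - 1))"
      using cut_sine'_second_term[of t k] assms by (intro always_eventually) auto
  qed
  hence "(\<lambda>n. real k * pi * cos (real k * pi * t) * flat_exp 0 (real n * (t * (1 - t)) - 1)
     + sin (real k * pi * t) * (real n * (1 - 2 * t) * flat_exp 2 (real n * (t * (1 - t)) - 1)))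
     \<longlonglongrightarrow> real k * pi * cos (real k * pi * t) * 1 + 0"
    by (intro tendsto_add tendsto_mult tendsto_const r0)
  thus "(\<lambda>n. cut_sine' n k t) \<longlonglongrightarrow> real k * pi * cos (real k * pi * t)"
    by (simp add: cut_sine'_def)
qed

text \<open>Products of functions of one coordinate each: their partial derivatives are again of this form, so that smoothness
and all limits are one-dimensional questions.\<close>

definition prod_fun :: "('n::finite \<Rightarrow> real \<Rightarrow> real) \<Rightarrow> 'n func" where
  "prod_fun F x = (\<Prod>i\<in>UNIV. F i (x $ i))"

lemma prod_fun_has_derivative:
  fixes x :: "real ^ 'n::finite"
  assumes "\<And>i t. (F i has_real_derivative F' i t) (at t)"
  shows "(prod_fun F has_derivative (\<lambda>h. \<Sum>i\<in>UNIV. (F' i (x $ i) * h $ i) * (\<Prod>j\<in>UNIV - {i}. F j (x $ j)))) (at x)"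
  unfolding prod_fun_def[abs_def]
proof (rule has_derivative_prod)
  fix i :: 'n
  have "((\<lambda>x. x $ i) has_derivative (\<lambda>h. h $ i)) (at x)"
    by (rule bounded_linear_imp_has_derivative[OF bounded_linear_vec_nth])
  from has_derivative_compose[OF this assms[of i "x $ i", unfolded has_field_derivative_def]]
  show "((\<lambda>x. F i (x $ i)) has_derivative (\<lambda>h. F' i (x $ i) * h $ i)) (at x)" .
qed

lemma partial_deriv_eq:
  assumes "(f has_derivative D) (at x)"
  shows "partial_deriv i f x = D (axis i 1)"
  using frechet_derivative_at[OF assms] by (simp add: partial_deriv_def)

lemma partial_deriv_prod_fun:
  fixes F :: "'n::finite \<Rightarrow> real \<Rightarrow> real"
  assumes "\<And>i t. (F i has_real_derivative F' i t) (at t)"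
  shows "partial_deriv i (prod_fun F) = prod_fun (F(i := F' i))"
proof
  fix x :: "real ^ 'n"
  have "partial_deriv i (prod_fun F) x
      = (\<Sum>l\<in>UNIV. (F' l (x $ l) * axis i 1 $ l) * (\<Prod>j\<in>UNIV - {l}. F j (x $ j)))"
    by (rule partial_deriv_eq[OF prod_fun_has_derivative[OF assms]])
  also have "\<dots> = (\<Sum>l\<in>UNIV. if l = i then F' i (x $ i) * (\<Prod>j\<in>UNIV - {i}. F j (x $ j)) else 0)"
    by (intro sum.cong) (auto simp: axis_def)
  also have "\<dots> = F' i (x $ i) * (\<Prod>j\<in>UNIV - {i}. F j (x $ j))" by simp
  also have "\<dots> = prod_fun (F(i := F' i)) x"
    unfolding prod_fun_def by (subst prod.remove[of UNIV i]) (auto intro!: prod.cong)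
  finally show "partial_deriv i (prod_fun F) x = prod_fun (F(i := F' i)) x" .
qed

lemma smooth_prod_fun:
  fixes F :: "'n::finite \<Rightarrow> real \<Rightarrow> real"
  assumes "\<And>i. smooth_real (F i)"
  shows "smooth (prod_fun F)"
proof -
  have deriv: "\<exists>F'. (\<forall>i. smooth_real (F' i)) \<and> (\<forall>i t. (F i has_real_derivative F' i t) (at t))"
    if "\<And>i. smooth_real (F i)" for F :: "'n \<Rightarrow> real \<Rightarrow> real"
  proof -
    have "\<exists>f'. smooth_real f' \<and> (\<forall>t. (F i has_real_derivative f' t) (at t))" for i
      using smooth_realD[OF that[of i]] by blast
    then obtain F' where "\<And>i. smooth_real (F' i) \<and> (\<forall>t. (F i has_real_derivative F' i t) (at t))" by metis
    thus ?thesis by blast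
  qed
  have ex: "\<exists>G. (\<forall>i. smooth_real (G i)) \<and> foldr partial_deriv is (prod_fun F) = prod_fun G" for "is"
  proof (induction "is")
    case Nil show ?case using assms by auto
  next
    case (Cons i "is")
    then obtain G where G: "\<forall>i. smooth_real (G i)" "foldr partial_deriv is (prod_fun F) = prod_fun G" by blast
    obtain G' where G': "\<forall>i. smooth_real (G' i)" "\<forall>i t. (G i has_real_derivative G' i t) (at t)"
      using deriv G(1) by blast
    have "foldr partial_deriv (i # is) (prod_fun F) = prod_fun (G(i := G' i))"
      using G(2) partial_deriv_prod_fun[of G G' i] G'(2) by simp
    moreover have "\<forall>j. smooth_real ((G(i := G' i)) j)" using G(1) G'(1) by simp
    ultimately show ?case by blast
  qed
  show ?thesis unfolding smooth_def
  proof (intro allI)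
    fix "is" and x :: "real ^ 'n"
    obtain G where G: "\<forall>i. smooth_real (G i)" "foldr partial_deriv is (prod_fun F) = prod_fun G" using ex by blast
    obtain G' where G': "\<forall>i t. (G i has_real_derivative G' i t) (at t)" using deriv G(1) by blast
    show "foldr partial_deriv is (prod_fun F) differentiable (at x)"
      unfolding G(2) using prod_fun_has_derivative[of G G' x] G' differentiableI by blast
  qed
qed

lemma partial_deriv_linear:
  assumes "f differentiable (at x)" "g differentiable (at x)"
  shows "partial_deriv i (f + c *\<^sub>R g) x = partial_deriv i f x + c * partial_deriv i g x"
proof -
  have "((\<lambda>x. f x + c *\<^sub>R g x) has_derivative (\<lambda>h. frechet_derivative f (at x) h + c *\<^sub>R frechet_derivative g (at x) h)) (at x)"
    using assms by (intro has_derivative_add has_derivative_scaleR_right) (auto simp: frechet_derivative_works)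
  moreover have "f + c *\<^sub>R g = (\<lambda>x. f x + c *\<^sub>R g x)" by (auto simp: scaleR_fun_def)
  ultimately have "((f + c *\<^sub>R g) has_derivative (\<lambda>h. frechet_derivative f (at x) h + c *\<^sub>R frechet_derivative g (at x) h)) (at x)"
    by simp
  from partial_deriv_eq[OF this, of i] show ?thesis
    by (simp add: partial_deriv_def)
qed

lemma smooth_linear:
  fixes \<phi> \<psi> :: "'n::finite func"
  assumes "smooth \<phi>" and "smooth \<psi>"
  shows "smooth (\<phi> + c *\<^sub>R \<psi>)"
proof -
  have d: "foldr partial_deriv is \<phi> differentiable (at x)" "foldr partial_deriv is \<psi> differentiable (at x)" for "is" x
    using assms unfolding smooth_def by auto
  have eq: "foldr partial_deriv is (\<phi> + c *\<^sub>R \<psi>) = foldr partial_deriv is \<phi> + c *\<^sub>R foldr partial_deriv is \<psi>" for "is"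
  proof (induction "is")
    case (Cons i "is")
    show ?case
    proof
      fix x
      have "foldr partial_deriv (i # is) (\<phi> + c *\<^sub>R \<psi>) x
          = partial_deriv i (foldr partial_deriv is \<phi> + c *\<^sub>R foldr partial_deriv is \<psi>) x"
        by (simp only: foldr.simps o_apply Cons)
      also have "\<dots> = partial_deriv i (foldr partial_deriv is \<phi>) x + c * partial_deriv i (foldr partial_deriv is \<psi>) x"
        by (rule partial_deriv_linear[OF d])
      finally show "foldr partial_deriv (i # is) (\<phi> + c *\<^sub>R \<psi>) x
          = (foldr partial_deriv (i # is) \<phi> + c *\<^sub>R foldr partial_deriv (i # is) \<psi>) x"
        by (simp add: scaleR_fun_def)
    qed
  qed simp
  show ?thesis
    unfolding smooth_def eq
    by (auto simp: plus_fun_def scaleR_fun_def intro!: differentiable_add differentiable_scaleR d differentiable_const)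
qed

lemma smooth_differentiable: "smooth f \<Longrightarrow> f differentiable (at x)"
proof -
  assume "smooth f"
  hence "\<forall>is x. foldr partial_deriv is f differentiable (at x)" by (simp add: smooth_def)
  from this[rule_format, of "[]"] show ?thesis by simp
qed

lemma smooth_continuous: "smooth f \<Longrightarrow> continuous_on UNIV f"
  by (intro continuous_at_imp_continuous_on ballI differentiable_imp_continuous_within smooth_differentiable)

lemma smooth_partial_deriv: "smooth f \<Longrightarrow> smooth (partial_deriv i f)"
  unfolding smooth_def
proof (intro allI)
  fix "is" x assume "\<forall>is x. foldr partial_deriv is f differentiable (at x)"
  hence "foldr partial_deriv (is @ [i]) f differentiable (at x)" by blast
  thus "foldr partial_deriv is (partial_deriv i f) differentiable (at x)" by simp
qed

lemma partial_deriv_linear_smooth: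
  "smooth f \<Longrightarrow> smooth g \<Longrightarrow> partial_deriv i (f + c *\<^sub>R g) = partial_deriv i f + c *\<^sub>R partial_deriv i g"
  by (rule ext, subst partial_deriv_linear) (auto intro: smooth_differentiable simp: scaleR_fun_def)

lemma mem_Omega: "x \<in> \<Omega> \<longleftrightarrow> (\<forall>i. 0 < x $ i \<and> x $ i < 1)"
  by (simp add: \<Omega>_def mem_box_cart)

lemma cut_sine_prod_test: "prod_fun (\<lambda>i. cut_sine n (k i)) \<in> test_functions"
proof -
  let ?\<phi> = "prod_fun (\<lambda>i. cut_sine n (k i)) :: 'a func"
  define K where "K = {x :: real ^ 'a. \<forall>i. 1 \<le> real n * (x $ i * (1 - x $ i))}"
  have "closed K" unfolding K_def
    by (intro closed_Collect_all closed_Collect_le continuous_intros)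
  have sub: "{x. ?\<phi> x \<noteq> 0} \<subseteq> K"
  proof
    fix x assume "x \<in> {x. ?\<phi> x \<noteq> 0}"
    hence "cut_sine n (k i) (x $ i) \<noteq> 0" for i by (simp add: prod_fun_def)
    hence "flat_exp 0 (real n * (x $ i * (1 - x $ i)) - 1) \<noteq> 0" for i by (simp add: cut_sine_def)
    hence "0 < real n * (x $ i * (1 - x $ i)) - 1" for i unfolding flat_exp_def by metis
    thus "x \<in> K" unfolding K_def by (simp add: less_imp_le)
  qed
  have in01: "0 < t \<and> t < 1" if "1 \<le> real n * (t * (1 - t))" for t
  proof -
    have "t * (1 - t) > 0"
    proof (rule ccontr)
      assume "\<not> ?thesis"
      hence "real n * (t * (1 - t)) \<le> 0" using mult_nonneg_nonpos[of "real n" "t * (1 - t)"] by simp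
      thus False using that by simp
    qed
    thus ?thesis by (auto simp: zero_less_mult_iff)
  qed
  hence KO: "K \<subseteq> \<Omega>" by (auto simp: K_def mem_Omega)
  have cl: "closure {x. ?\<phi> x \<noteq> 0} \<subseteq> K" using sub \<open>closed K\<close> by (rule closure_minimal)
  have "bounded (closure {x. ?\<phi> x \<noteq> 0})"
    using cl KO by (intro bounded_subset[OF bounded_box[of 0 1]]) (simp add: \<Omega>_def)
  hence "compact (closure {x. ?\<phi> x \<noteq> 0})" by (simp add: compact_eq_bounded_closed)
  thus ?thesis using cl KO unfolding test_functions_def
    by (auto intro!: smooth_prod_fun smooth_cut_sine)
qed

lemma test_smooth: "\<phi> \<in> test_functions \<Longrightarrow> smooth \<phi>"
  by (simp add: test_functions_def)

lemma test_partial_deriv: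
  assumes "\<phi> \<in> test_functions"
  shows "partial_deriv i \<phi> \<in> test_functions"
proof -
  have "smooth (partial_deriv i \<phi>)" by (intro smooth_partial_deriv test_smooth assms)
  moreover have sub: "{x. partial_deriv i \<phi> x \<noteq> 0} \<subseteq> closure {x. \<phi> x \<noteq> 0}"
  proof (rule ccontr)
    assume "\<not> ?thesis"
    then obtain x where x: "partial_deriv i \<phi> x \<noteq> 0" "x \<in> - closure {x. \<phi> x \<noteq> 0}" by auto
    have "(\<phi> has_derivative (\<lambda>h. 0)) (at x)"
    proof (rule has_derivative_transform_within_open)
      show "((\<lambda>x. 0) has_derivative (\<lambda>h. 0)) (at x)" by simp
      show "0 = \<phi> y" if "y \<in> - closure {x. \<phi> x \<noteq> 0}" for y
        using that closure_subset[of "{x. \<phi> x \<noteq> 0}"] by auto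
    qed (use x in auto)
    hence "partial_deriv i \<phi> x = 0" by (simp add: partial_deriv_eq)
    thus False using x by simp
  qed
  moreover have cl: "closure {x. partial_deriv i \<phi> x \<noteq> 0} \<subseteq> closure {x. \<phi> x \<noteq> 0}"
    by (rule closure_minimal[OF sub closed_closure])
  moreover have "compact (closure {x. partial_deriv i \<phi> x \<noteq> 0})"
    using assms cl unfolding test_functions_def
    by (auto simp: compact_eq_bounded_closed intro: bounded_subset)
  ultimately show ?thesis using assms unfolding test_functions_def by blast
qed

lemma test_linear:
  fixes \<phi> \<psi> :: "'n::finite func"
  assumes \<phi>: "\<phi> \<in> test_functions" and \<psi>: "\<psi> \<in> test_functions"
  shows "\<phi> + c *\<^sub>R \<psi> \<in> test_functions"
proof -
  have "smooth (\<phi> + c *\<^sub>R \<psi>)"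
    using assms by (intro smooth_linear test_smooth)
  moreover have "{x. (\<phi> + c *\<^sub>R \<psi>) x \<noteq> 0} \<subseteq> {x. \<phi> x \<noteq> 0} \<union> {x. \<psi> x \<noteq> 0}"
    by (auto simp: scaleR_fun_def)
  hence cl: "closure {x. (\<phi> + c *\<^sub>R \<psi>) x \<noteq> 0} \<subseteq> closure {x. \<phi> x \<noteq> 0} \<union> closure {x. \<psi> x \<noteq> 0}"
    by (metis closure_Un closure_mono)
  moreover have "compact (closure {x. (\<phi> + c *\<^sub>R \<psi>) x \<noteq> 0})"
  proof -
    have "bounded (closure {x. \<phi> x \<noteq> 0} \<union> closure {x. \<psi> x \<noteq> 0})"
      using assms by (auto simp: test_functions_def compact_eq_bounded_closed)
    hence "bounded (closure {x. (\<phi> + c *\<^sub>R \<psi>) x \<noteq> 0})" using cl by (rule bounded_subset)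
    thus ?thesis by (simp only: compact_eq_bounded_closed closed_closure simp_thms)
  qed
  ultimately show ?thesis using assms unfolding test_functions_def by blast
qed

lemma zero_test: "0 \<in> test_functions"
proof -
  have "foldr partial_deriv is (0 :: 'a func) = 0" for "is"
  proof (induction "is")
    case (Cons i "is")
    have "((0 :: 'a func) has_derivative (\<lambda>h. 0)) (at x)" for x
      by (simp add: zero_fun_def)
    hence p0: "partial_deriv i (0 :: 'a func) = 0"
    proof (intro ext)
      fix x :: "real ^ 'a"
      have "partial_deriv i 0 x = (\<lambda>h. 0) (axis i 1)" by (rule partial_deriv_eq) fact
      thus "partial_deriv i 0 x = 0 x" by simp
    qed
    show ?case by (simp only: foldr.simps o_apply Cons p0)
  qed simp
  thus ?thesis unfolding test_functions_def smooth_def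
    by (simp add: zero_fun_def)
qed

section \<open>Integration by parts against test functions\<close>

lemma compact_support_integrable:
  fixes w :: "'n::finite func"
  assumes "continuous_on UNIV w" "compact K" "\<And>x. x \<notin> K \<Longrightarrow> w x = 0"
  shows "integrable lborel w"
proof -
  have "integrable lborel (\<lambda>x. indicator K x *\<^sub>R w x)"
    using assms by (intro borel_integrable_compact continuous_on_subset[OF assms(1)]) auto
  moreover have "(\<lambda>x. indicator K x *\<^sub>R w x) = w" using assms(3) by (fastforce simp: indicator_def)
  ultimately show ?thesis by simp
qed

lemma lborel_integral_shift:
  fixes w :: "'n::finite func"
  assumes "w \<in> borel_measurable borel"
  shows "(LINT x|lborel. w (x + a)) = (LINT x|lborel. w x)"
proof -
  have "(LINT x|lborel. w x) = (LINT x|distr lborel borel ((+) a). w x)"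
    by (simp add: lborel_distr_plus)
  also have "\<dots> = (LINT x|lborel. w (a + x))"
    using assms by (intro integral_distr) auto
  finally show ?thesis by (simp add: add.commute)
qed

lemma lborel_integrable_shift:
  fixes w :: "'n::finite func"
  assumes "integrable lborel w"
  shows "integrable lborel (\<lambda>x. w (x + a))"
proof -
  have "integrable (distr lborel borel ((+) a)) w" using assms by (simp add: lborel_distr_plus)
  hence "integrable lborel (\<lambda>x. w (a + x))"
    using assms by (subst (asm) integrable_distr_eq) auto
  thus ?thesis by (simp add: add.commute)
qed

lemma line_derivative:
  fixes w :: "'n::finite func"
  assumes "w differentiable (at (x + s *\<^sub>R axis i 1))"
  shows "((\<lambda>s. w (x + s *\<^sub>R axis i 1)) has_real_derivative partial_deriv i w (x + s *\<^sub>R axis i 1)) (at s)"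
proof -
  let ?D = "frechet_derivative w (at (x + s *\<^sub>R axis i 1))"
  have D: "(w has_derivative ?D) (at (x + s *\<^sub>R axis i 1))" using assms by (simp add: frechet_derivative_works)
  have l: "((\<lambda>s. x + s *\<^sub>R axis i 1) has_derivative (\<lambda>h. h *\<^sub>R axis i 1)) (at s)"
    by (auto intro!: derivative_eq_intros)
  from has_derivative_compose[OF l D]
  have "((\<lambda>s. w (x + s *\<^sub>R axis i 1)) has_derivative (\<lambda>h. ?D (h *\<^sub>R axis i 1))) (at s)" .
  moreover have "?D (h *\<^sub>R axis i 1) = partial_deriv i w (x + s *\<^sub>R axis i 1) * h" for h
    using linear_cmul[OF has_derivative_linear[OF D], of h "axis i 1"] by (simp add: partial_deriv_def mult.commute)
  ultimately show ?thesis by (simp add: has_field_derivative_def)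
qed

text \<open>By translation invariance of Lebesgue measure the difference quotients in the direction \<open>i\<close> have integral zero;
they converge to the derivative and are dominated because \<open>w\<close> is Lipschitz with compact support.\<close>

lemma integral_partial_deriv_eq_0:
  fixes w :: "'n::finite func"
  assumes d: "\<And>x. w differentiable (at x)" and c: "continuous_on UNIV (partial_deriv i w)"
    and K: "compact K" "\<And>x. x \<notin> K \<Longrightarrow> w x = 0" "\<And>x. x \<notin> K \<Longrightarrow> partial_deriv i w x = 0"
  shows "(LINT x|lborel. partial_deriv i w x) = 0"
proof -
  let ?e = "axis i 1 :: real ^ 'n"
  have cw: "continuous_on UNIV w"
    by (intro continuous_at_imp_continuous_on ballI differentiable_imp_continuous_within d)
  have mw: "w \<in> borel_measurable borel" using cw by (rule borel_measurable_continuous_onI)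
  have iw: "integrable lborel w" by (rule compact_support_integrable[OF cw K(1,2)])
  obtain C where C: "C > 0" "\<And>x. \<bar>partial_deriv i w x\<bar> \<le> C"
  proof -
    have "compact (partial_deriv i w ` K)"
      by (intro compact_continuous_image continuous_on_subset[OF c] K) auto
    then obtain C where "C > 0" "\<forall>y\<in>partial_deriv i w ` K. norm y \<le> C"
      using compact_imp_bounded bounded_pos by metis
    thus ?thesis using that[of C] K(3) by (metis abs_zero image_eqI less_imp_le real_norm_def)
  qed
  have lip: "\<bar>w (x + s *\<^sub>R ?e) - w x\<bar> \<le> C * s" if "s \<ge> 0" for x s
  proof -
    have "norm (w (x + s *\<^sub>R ?e) - w (x + 0 *\<^sub>R ?e)) \<le> C * norm (s - 0)"
      by (rule field_differentiable_bound[of UNIV "\<lambda>s. w (x + s *\<^sub>R ?e)" "\<lambda>s. partial_deriv i w (x + s *\<^sub>R ?e)"])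
         (auto intro!: line_derivative d C)
    thus ?thesis using that by simp
  qed
  obtain R where R: "\<And>x. x \<in> K \<Longrightarrow> norm x \<le> R"
    using K(1) compact_imp_bounded bounded_iff by metis
  define q where "q n x = real (Suc n) * (w (x + (1 / real (Suc n)) *\<^sub>R ?e) - w x)" for n x
  have "(\<lambda>n. LINT x|lborel. q n x) \<longlonglongrightarrow> (LINT x|lborel. partial_deriv i w x)"
  proof (rule integral_dominated_convergence)
    show "partial_deriv i w \<in> borel_measurable lborel"
      using borel_measurable_continuous_onI[OF c] by simp
    show "q n \<in> borel_measurable lborel" for n
      unfolding q_def using mw by measurable
    show "integrable lborel (\<lambda>x. indicator (cball 0 (R + 1)) x *\<^sub>R C)"
      by (intro borel_integrable_compact) auto
    show "AE x in lborel. (\<lambda>n. q n x) \<longlonglongrightarrow> partial_deriv i w x"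
    proof (intro AE_I2)
      fix x
      have "((\<lambda>h. (w (x + (0 + h) *\<^sub>R ?e) - w (x + 0 *\<^sub>R ?e)) / h) \<longlongrightarrow> partial_deriv i w (x + 0 *\<^sub>R ?e)) (at 0)"
        using line_derivative[of w x 0 i] d by (simp add: DERIV_def)
      moreover have "filterlim (\<lambda>n. 1 / real (Suc n)) (at 0) sequentially"
        unfolding filterlim_at using LIMSEQ_Suc[OF lim_1_over_n] by auto
      ultimately have "(\<lambda>n. (w (x + (0 + 1 / real (Suc n)) *\<^sub>R ?e) - w (x + 0 *\<^sub>R ?e)) / (1 / real (Suc n)))
          \<longlonglongrightarrow> partial_deriv i w (x + 0 *\<^sub>R ?e)" by (rule filterlim_compose)
      thus "(\<lambda>n. q n x) \<longlonglongrightarrow> partial_deriv i w x" by (simp add: q_def mult.commute)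
    qed
    show "AE x in lborel. norm (q n x) \<le> indicator (cball 0 (R + 1)) x *\<^sub>R C" for n
    proof (intro AE_I2)
      fix x
      show "norm (q n x) \<le> indicator (cball 0 (R + 1)) x *\<^sub>R C"
      proof (cases "x \<in> cball 0 (R + 1)")
        case True
        have "norm (q n x) = real (Suc n) * \<bar>w (x + (1 / real (Suc n)) *\<^sub>R ?e) - w x\<bar>"
          by (simp add: q_def abs_mult)
        also have "\<dots> \<le> real (Suc n) * (C * (1 / real (Suc n)))"
          by (intro mult_left_mono lip) auto
        finally show ?thesis using True by simp
      next
        case False
        have "x \<notin> K" using R[of x] False by auto
        moreover have "x + (1 / real (Suc n)) *\<^sub>R ?e \<notin> K"
        proof
          assume "x + (1 / real (Suc n)) *\<^sub>R ?e \<in> K"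
          hence "norm (x + (1 / real (Suc n)) *\<^sub>R ?e) \<le> R" by (rule R)
          moreover have "norm x \<le> norm (x + (1 / real (Suc n)) *\<^sub>R ?e) + norm ((1 / real (Suc n)) *\<^sub>R ?e)"
            using norm_triangle_ineq4[of "x + (1 / real (Suc n)) *\<^sub>R ?e" "(1 / real (Suc n)) *\<^sub>R ?e"] by simp
          moreover have "norm ((1 / real (Suc n)) *\<^sub>R ?e) \<le> 1" by simp
          ultimately have "norm x \<le> R + 1" by linarith
          thus False using False by simp
        qed
        ultimately show ?thesis using K(2) C(1) by (simp add: q_def indicator_def)
      qed
    qed
  qed
  moreover have "(LINT x|lborel. q n x) = 0" for n
    unfolding q_def using lborel_integral_shift[OF mw] lborel_integrable_shift[OF iw] iw
    by (simp add: Bochner_Integration.integral_diff)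
  ultimately show ?thesis by (simp add: LIMSEQ_const_iff)
qed

lemma integral_lebesgue_on_Omega:
  fixes w :: "'n::finite func"
  assumes "w \<in> borel_measurable borel" "\<And>x. x \<notin> \<Omega> \<Longrightarrow> w x = 0"
  shows "(LINT x|lebesgue_on \<Omega>. w x) = (LINT x|lborel. w x)"
proof -
  have "(LINT x|lebesgue_on \<Omega>. w x) = (LINT x|lebesgue. indicator \<Omega> x *\<^sub>R w x)"
    by (rule integral_restrict_space) (auto simp: \<Omega>_def)
  also have "(\<lambda>x. indicator \<Omega> x *\<^sub>R w x) = w" using assms(2) by (fastforce simp: indicator_def)
  finally show ?thesis using assms(1) by (simp add: integral_completion)
qed

text \<open>The product rule, and the vanishing integral of the derivative of the compactly supported product.\<close>

lemma classical_imp_weak_partial: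
  fixes v :: "'n::finite func"
  assumes d: "\<And>x. v differentiable (at x)" and c: "continuous_on UNIV (partial_deriv i v)"
  shows "has_weak_partial i v (partial_deriv i v)"
  unfolding has_weak_partial_def
proof
  fix \<phi> :: "'n func" assume \<phi>: "\<phi> \<in> test_functions"
  define K where "K = closure {x. \<phi> x \<noteq> 0}"
  have K: "compact K" "K \<subseteq> \<Omega>" "\<And>x. x \<notin> K \<Longrightarrow> \<phi> x = 0"
    using \<phi> closure_subset[of "{x. \<phi> x \<noteq> 0}"] by (auto simp: K_def test_functions_def)
  have K': "partial_deriv i \<phi> x = 0" if "x \<notin> K" for x
  proof -
    have "(\<phi> has_derivative (\<lambda>h. 0)) (at x)"
      by (rule has_derivative_transform_within_open[of "\<lambda>x. 0" _ _ _ "- K"])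
         (use that K in \<open>auto intro: compact_imp_closed\<close>)
    thus ?thesis by (simp add: partial_deriv_eq)
  qed
  have cv: "continuous_on UNIV v"
    by (intro continuous_at_imp_continuous_on ballI differentiable_imp_continuous_within d)
  define w where "w x = v x * \<phi> x" for x
  have pd: "partial_deriv i w x = v x * partial_deriv i \<phi> x + partial_deriv i v x * \<phi> x" for x
  proof -
    have "(v has_derivative frechet_derivative v (at x)) (at x)" using d frechet_derivative_works by blast
    moreover have "(\<phi> has_derivative frechet_derivative \<phi> (at x)) (at x)"
      using smooth_differentiable[OF test_smooth[OF \<phi>]] frechet_derivative_works by blast
    ultimately have "((\<lambda>x. v x * \<phi> x) has_derivative
        (\<lambda>h. v x * frechet_derivative \<phi> (at x) h + frechet_derivative v (at x) h * \<phi> x)) (at x)"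
      by (rule has_derivative_mult)
    thus ?thesis
      unfolding w_def[abs_def] by (subst partial_deriv_eq) (auto simp: partial_deriv_def)
  qed
  have cpd: "continuous_on UNIV (\<lambda>x. v x * partial_deriv i \<phi> x)" "continuous_on UNIV (\<lambda>x. partial_deriv i v x * \<phi> x)"
    by (intro continuous_intros cv c smooth_continuous test_smooth test_partial_deriv \<phi>)+
  have "(LINT x|lborel. partial_deriv i w x) = 0"
  proof (rule integral_partial_deriv_eq_0[OF _ _ K(1)])
    show "w differentiable (at x)" for x
      unfolding w_def[abs_def] by (intro differentiable_mult d smooth_differentiable test_smooth \<phi>)
    show "continuous_on UNIV (partial_deriv i w)"
      using continuous_on_add[OF cpd] by (simp add: pd[abs_def])
  qed (auto simp: pd w_def K(3) K')
  moreover have i: "integrable lborel (\<lambda>x. v x * partial_deriv i \<phi> x)" "integrable lborel (\<lambda>x. partial_deriv i v x * \<phi> x)"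
    by (auto intro!: compact_support_integrable[OF _ K(1)] cpd simp: K(3) K')
  ultimately have "(LINT x|lborel. v x * partial_deriv i \<phi> x) + (LINT x|lborel. partial_deriv i v x * \<phi> x) = 0"
    by (simp add: pd)
  moreover have "(LINT x|lebesgue_on \<Omega>. v x * partial_deriv i \<phi> x) = (LINT x|lborel. v x * partial_deriv i \<phi> x)"
    "(LINT x|lebesgue_on \<Omega>. partial_deriv i v x * \<phi> x) = (LINT x|lborel. partial_deriv i v x * \<phi> x)"
  proof -
    have "\<phi> x = 0" "partial_deriv i \<phi> x = 0" if "x \<notin> \<Omega>" for x using K(2,3) K' that by blast+
    thus "(LINT x|lebesgue_on \<Omega>. v x * partial_deriv i \<phi> x) = (LINT x|lborel. v x * partial_deriv i \<phi> x)"
      "(LINT x|lebesgue_on \<Omega>. partial_deriv i v x * \<phi> x) = (LINT x|lborel. partial_deriv i v x * \<phi> x)"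
      by (auto intro!: integral_lebesgue_on_Omega borel_measurable_continuous_onI cpd)
  qed
  ultimately show "(LINT x|lebesgue_on \<Omega>. v x * partial_deriv i \<phi> x) = - (LINT x|lebesgue_on \<Omega>. partial_deriv i v x * \<phi> x)"
    by simp
qed

lemma square_add_le: "(a + b)\<^sup>2 \<le> 2 * a\<^sup>2 + 2 * b\<^sup>2" for a b :: real
  using sum_squares_bound[of a b] by (simp add: power2_sum)

lemma half_quotient_mult_le:
  fixes C \<epsilon> :: real
  assumes "C \<ge> 0" "\<epsilon> \<ge> 0"
  shows "\<epsilon> / (2 * (C + 1)) * C \<le> \<epsilon> / 2"
proof -
  have "C / (C + 1) \<le> 1" using assms(1) by simp
  from mult_left_mono[OF this, of "\<epsilon> / 2"] show ?thesis using assms(2) by (simp add: mult.commute)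
qed

section \<open>Density of sine polynomials in the square-integrable functions\<close>

text \<open>Truncate \<open>u / s\<close>, and use that a measurable function is the limit almost everywhere of continuous functions;
both steps are instances of dominated convergence. The weight allows \<open>u\<close> to be approximated by multiples of a given
function \<open>s\<close> that degenerates at the boundary.\<close>

lemma weighted_L2_approx:
  fixes u s :: "'a::euclidean_space \<Rightarrow> real"
  assumes S: "S \<in> lmeasurable"
    and u: "u \<in> borel_measurable (lebesgue_on S)" "integrable (lebesgue_on S) (\<lambda>x. (u x)\<^sup>2)"
    and s: "s \<in> borel_measurable (lebesgue_on S)" "\<And>x. x \<in> S \<Longrightarrow> 0 < s x \<and> s x \<le> 1"
    and e: "e > 0"
  shows "\<exists>h. continuous_on UNIV h \<and> (LINT x|lebesgue_on S. (u x - s x * h x)\<^sup>2) < e"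
proof -
  define clip where "clip n y = max (- real n) (min (real n) y)" for n :: nat and y :: real
  note [measurable] = u(1) s(1)
  have clip_m [measurable]: "clip n \<in> borel_measurable borel" for n unfolding clip_def by measurable
  have clip_abs: "\<bar>clip n y\<bar> \<le> real n" "\<bar>y - clip n y\<bar> \<le> \<bar>y\<bar>" for n y unfolding clip_def by auto
  have clip_id: "clip n y = y" if "\<bar>y\<bar> \<le> real n" for n y using that unfolding clip_def by auto
  have cont_clip: "continuous_on UNIV (\<lambda>x. clip n (g x))" if "continuous_on UNIV g" for n and g :: "'a \<Rightarrow> real"
    unfolding clip_def using that by (intro continuous_intros)
  have Ssets: "S \<in> sets lebesgue" using S by (simp add: fmeasurableD)
  define W where "W n x = clip n (u x / s x)" for n x
  have W_m [measurable]: "W n \<in> borel_measurable (lebesgue_on S)" for n unfolding W_def by measurable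
  have uW: "\<bar>u x - s x * W n x\<bar> \<le> \<bar>u x\<bar>" if "x \<in> S" for x n
  proof -
    have p: "0 < s x" using s(2) that by simp
    have "\<bar>u x - s x * W n x\<bar> = s x * \<bar>u x / s x - W n x\<bar>"
      using p by (simp add: abs_if field_simps)
    also have "\<dots> \<le> s x * \<bar>u x / s x\<bar>"
      unfolding W_def by (intro mult_left_mono clip_abs(2)) (use p in simp)
    also have "\<dots> = \<bar>u x\<bar>" using p by (simp add: abs_divide)
    finally show ?thesis .
  qed
  have uW_sq: "(u x - s x * W n x)\<^sup>2 \<le> (u x)\<^sup>2" if "x \<in> S" for x n
    using uW[OF that] by (simp add: abs_le_square_iff)
  have "(\<lambda>n. LINT x|lebesgue_on S. (u x - s x * W n x)\<^sup>2) \<longlonglongrightarrow> (LINT x|lebesgue_on S. 0)"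
  proof (rule integral_dominated_convergence[where w="\<lambda>x. (u x)\<^sup>2"])
    show "AE x in lebesgue_on S. (\<lambda>n. (u x - s x * W n x)\<^sup>2) \<longlonglongrightarrow> 0"
    proof (intro AE_I2)
      fix x assume "x \<in> space (lebesgue_on S)"
      hence p: "0 < s x" using s(2) by simp
      obtain n0 where "\<bar>u x / s x\<bar> \<le> real n0" using real_arch_simple by blast
      hence "\<forall>\<^sub>F n in sequentially. (u x - s x * W n x)\<^sup>2 = 0"
        using p by (intro eventually_sequentiallyI[of n0]) (simp add: W_def clip_id)
      thus "(\<lambda>n. (u x - s x * W n x)\<^sup>2) \<longlonglongrightarrow> 0" by (rule tendsto_eventually)
    qed
    show "AE x in lebesgue_on S. norm ((u x - s x * W n x)\<^sup>2) \<le> (u x)\<^sup>2" for n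
      using uW_sq by (intro AE_I2) auto
  qed (use u(2) in measurable)
  hence "\<forall>\<^sub>F n in sequentially. (LINT x|lebesgue_on S. (u x - s x * W n x)\<^sup>2) < e / 4"
    using e by (intro order_tendstoD(2)) auto
  then obtain n where n: "(LINT x|lebesgue_on S. (u x - s x * W n x)\<^sup>2) < e / 4"
    unfolding eventually_sequentially by blast
  have i1: "integrable (lebesgue_on S) (\<lambda>x. (u x - s x * W n x)\<^sup>2)"
    by (rule Bochner_Integration.integrable_bound[OF u(2)]) (use uW_sq in \<open>auto intro!: AE_I2\<close>)
  have "W n measurable_on S" using measurable_on_iff_borel_measurable[OF Ssets] W_m by blast
  then obtain Z g where Z: "negligible Z" and g: "\<And>m. continuous_on UNIV (g m)"
    "\<And>x. x \<notin> Z \<Longrightarrow> (\<lambda>m. g m x) \<longlonglongrightarrow> (if x \<in> S then W n x else 0)"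
    unfolding measurable_on_def by blast
  define h where "h m x = clip n (g m x)" for m x
  have ch: "continuous_on UNIV (h m)" for m unfolding h_def[abs_def] by (rule cont_clip[OF g(1)])
  have h_m [measurable]: "h m \<in> borel_measurable (lebesgue_on S)" for m
    by (intro continuous_imp_measurable_on_sets_lebesgue continuous_on_subset[OF ch] Ssets) auto
  have fin: "finite_measure (lebesgue_on S)" by (rule finite_measure_lebesgue_on[OF S])
  have bd: "(s x * W n x - s x * h m x)\<^sup>2 \<le> (2 * real n)\<^sup>2" if "x \<in> S" for x m
  proof -
    have "\<bar>s x * W n x - s x * h m x\<bar> = s x * \<bar>W n x - h m x\<bar>"
      using s(2)[OF that] by (simp add: abs_mult flip: right_diff_distrib)
    also have "\<dots> \<le> 1 * (2 * real n)"
    proof (intro mult_mono)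
      show "\<bar>W n x - h m x\<bar> \<le> 2 * real n"
        using clip_abs(1)[of n "u x / s x"] clip_abs(1)[of n "g m x"] unfolding W_def h_def by linarith
    qed (use s(2)[OF that] in auto)
    finally have "\<bar>s x * W n x - s x * h m x\<bar> \<le> 2 * real n" by simp
    from power_mono[OF this abs_ge_zero, of 2] show ?thesis by simp
  qed
  have "(\<lambda>m. LINT x|lebesgue_on S. (s x * W n x - s x * h m x)\<^sup>2) \<longlonglongrightarrow> (LINT x|lebesgue_on S. 0)"
  proof (rule integral_dominated_convergence[where w="\<lambda>x. (2 * real n)\<^sup>2"])
    show "integrable (lebesgue_on S) (\<lambda>x. (2 * real n)\<^sup>2)"
      using finite_measure.integrable_const[OF fin] by blast
    have "AE x in lebesgue. x \<notin> Z" using Z by (intro AE_not_in) (simp add: negligible_iff_null_sets)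
    hence "AE x in lebesgue_on S. x \<notin> Z" using Ssets by (subst AE_restrict_space_iff) auto
    thus "AE x in lebesgue_on S. (\<lambda>m. (s x * W n x - s x * h m x)\<^sup>2) \<longlonglongrightarrow> 0"
      using AE_space
    proof eventually_elim
      case (elim x)
      hence "(\<lambda>m. g m x) \<longlonglongrightarrow> W n x" using g(2)[of x] by simp
      hence "(\<lambda>m. (s x * W n x - s x * h m x)\<^sup>2) \<longlonglongrightarrow> (s x * W n x - s x * clip n (W n x))\<^sup>2"
        unfolding h_def clip_def by (intro tendsto_intros)
      moreover have "clip n (W n x) = W n x" using clip_abs(1) by (intro clip_id) (simp add: W_def)
      ultimately show ?case by simp
    qed
    show "AE x in lebesgue_on S. norm ((s x * W n x - s x * h m x)\<^sup>2) \<le> (2 * real n)\<^sup>2" for m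
      using bd by (intro AE_I2) auto
  qed measurable
  hence "\<forall>\<^sub>F m in sequentially. (LINT x|lebesgue_on S. (s x * W n x - s x * h m x)\<^sup>2) < e / 4"
    using e by (intro order_tendstoD(2)) auto
  then obtain m where m: "(LINT x|lebesgue_on S. (s x * W n x - s x * h m x)\<^sup>2) < e / 4"
    unfolding eventually_sequentially by blast
  have i2: "integrable (lebesgue_on S) (\<lambda>x. (s x * W n x - s x * h m x)\<^sup>2)"
    using bd by (intro finite_measure.integrable_const_bound[OF fin, of _ "(2 * real n)\<^sup>2"] AE_I2) auto
  have "(LINT x|lebesgue_on S. (u x - s x * h m x)\<^sup>2)
      \<le> (LINT x|lebesgue_on S. 2 * (u x - s x * W n x)\<^sup>2 + 2 * (s x * W n x - s x * h m x)\<^sup>2)"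
  proof (rule integral_mono')
    fix x
    from square_add_le[of "u x - s x * W n x" "s x * W n x - s x * h m x"]
    show "(u x - s x * h m x)\<^sup>2 \<le> 2 * (u x - s x * W n x)\<^sup>2 + 2 * (s x * W n x - s x * h m x)\<^sup>2" by simp
  qed (use i1 i2 in auto)
  also have "\<dots> < e" using i1 i2 n m by simp
  finally show ?thesis using ch by blast
qed

definition inner_L2 :: "('n::finite func) \<Rightarrow> ('n func) \<Rightarrow> real" where
  "inner_L2 u v = (LINT x|lebesgue_on \<Omega>. u x * v x)"

lemma Omega_lmeasurable: "(\<Omega> :: (real ^ 'n::finite) set) \<in> lmeasurable"
  by (simp add: \<Omega>_def)

lemma Omega_sets: "(\<Omega> :: (real ^ 'n::finite) set) \<in> sets lebesgue"
  by (simp add: \<Omega>_def)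

lemma finite_measure_Omega: "finite_measure (lebesgue_on (\<Omega> :: (real ^ 'n::finite) set))"
  by (rule finite_measure_lebesgue_on[OF Omega_lmeasurable])

lemma L2_measurable [measurable_dest]: "u \<in> L2 \<Longrightarrow> u \<in> borel_measurable (lebesgue_on \<Omega>)"
  by (simp add: L2_def)

lemma L2_integrable_sq: "u \<in> L2 \<Longrightarrow> integrable (lebesgue_on \<Omega>) (\<lambda>x. (u x)\<^sup>2)"
  by (simp add: L2_def)

lemma L2_integrable_mult:
  assumes "u \<in> L2" "v \<in> L2"
  shows "integrable (lebesgue_on \<Omega>) (\<lambda>x. u x * v x)"
proof (rule Bochner_Integration.integrable_bound)
  show "integrable (lebesgue_on \<Omega>) (\<lambda>x. (u x)\<^sup>2 + (v x)\<^sup>2)"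
    using assms by (intro Bochner_Integration.integrable_add L2_integrable_sq)
  show "(\<lambda>x. u x * v x) \<in> borel_measurable (lebesgue_on \<Omega>)"
    using assms by (auto simp: L2_def)
  have "\<bar>a * b\<bar> \<le> a\<^sup>2 + b\<^sup>2" for a b :: real
    using sum_squares_bound[of "\<bar>a\<bar>" "\<bar>b\<bar>"] mult_nonneg_nonneg[OF abs_ge_zero[of a] abs_ge_zero[of b]]
    unfolding abs_mult power2_abs by linarith
  thus "AE x in lebesgue_on \<Omega>. norm (u x * v x) \<le> norm ((u x)\<^sup>2 + (v x)\<^sup>2)"
    by (intro AE_I2) simp
qed

lemma bounded_L2:
  assumes "f \<in> borel_measurable (lebesgue_on \<Omega>)" "\<And>x. x \<in> \<Omega> \<Longrightarrow> \<bar>f x\<bar> \<le> C"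
  shows "f \<in> L2"
proof -
  have "integrable (lebesgue_on \<Omega>) (\<lambda>x. (f x)\<^sup>2)"
  proof (rule finite_measure.integrable_const_bound[OF finite_measure_Omega, of _ "C\<^sup>2"])
    show "AE x in lebesgue_on \<Omega>. norm ((f x)\<^sup>2) \<le> C\<^sup>2"
    proof (intro AE_I2)
      fix x :: "real ^ 'a" assume "x \<in> space (lebesgue_on \<Omega>)"
      hence "\<bar>f x\<bar> \<le> C" using assms(2) by simp
      hence "\<bar>f x\<bar>\<^sup>2 \<le> C\<^sup>2" by (rule power_mono) simp
      thus "norm ((f x)\<^sup>2) \<le> C\<^sup>2" by simp
    qed
  qed (use assms(1) in measurable)
  thus ?thesis using assms(1) by (simp add: L2_def)
qed

lemma continuous_measurable_Omega: "continuous_on UNIV f \<Longrightarrow> f \<in> borel_measurable (lebesgue_on \<Omega>)" for f :: "'n::finite func"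
  by (intro continuous_imp_measurable_on_sets_lebesgue Omega_sets) (auto intro: continuous_on_subset)

lemma continuous_L2:
  fixes f :: "'n::finite func"
  assumes "continuous_on UNIV f"
  shows "f \<in> L2"
proof -
  have "compact (f ` cbox 0 1)" by (intro compact_continuous_image continuous_on_subset[OF assms]) auto
  then obtain C where "\<forall>y\<in>f ` cbox 0 1. norm y \<le> C" using compact_imp_bounded bounded_iff by metis
  hence "\<bar>f x\<bar> \<le> C" if "x \<in> \<Omega>" for x using that box_subset_cbox unfolding \<Omega>_def by fastforce
  thus ?thesis using continuous_measurable_Omega[OF assms] by (intro bounded_L2)
qed

lemma semi_inner_L2: "semi_inner (L2 :: ('n::finite func) set) inner_L2"
proof
  show "subspace (L2 :: ('n func) set)"
  proof (rule subspaceI)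
    show "(0 :: 'n func) \<in> L2" by (intro continuous_L2) (simp add: zero_fun_def)
  next
    fix u v :: "'n func" assume uv: "u \<in> L2" "v \<in> L2"
    have "integrable (lebesgue_on \<Omega>) (\<lambda>x. (u x)\<^sup>2 + (v x)\<^sup>2 + 2 * (u x * v x))"
      using uv by (intro Bochner_Integration.integrable_add L2_integrable_sq integrable_mult_right L2_integrable_mult)
    thus "u + v \<in> L2" using uv by (auto simp: L2_def power2_sum plus_fun_def mult.assoc)
  next
    fix c :: real and u :: "'n func" assume "u \<in> L2"
    thus "c *\<^sub>R u \<in> L2" by (auto simp: L2_def scaleR_fun_def power_mult_distrib intro!: borel_measurable_times)
  qed
next
  fix u v :: "'n func"
  show "inner_L2 u v = inner_L2 v u" by (simp add: inner_L2_def mult.commute)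
next
  fix u v w :: "'n func" assume "u \<in> L2" "v \<in> L2" "w \<in> L2"
  thus "inner_L2 (u + v) w = inner_L2 u w + inner_L2 v w"
    by (simp add: inner_L2_def distrib_right Bochner_Integration.integral_add L2_integrable_mult)
next
  fix c :: real and u v :: "'n func"
  show "inner_L2 (c *\<^sub>R u) v = c * inner_L2 u v" by (simp add: inner_L2_def scaleR_fun_def mult.assoc)
next
  fix u :: "'n func"
  show "0 \<le> inner_L2 u u" unfolding inner_L2_def by (intro integral_nonneg_AE AE_I2) simp
qed

interpretation l2: semi_inner "L2 :: ('n::finite func) set" inner_L2
  rewrites "semi_inner.N inner_L2 = L2_norm"
proof -
  show "semi_inner (L2 :: ('n::finite func) set) inner_L2" by (rule semi_inner_L2)
  show "semi_inner.N (inner_L2 :: ('n::finite func) \<Rightarrow> _) = L2_norm"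
    by (rule ext) (simp add: semi_inner.N_def[OF semi_inner_L2] inner_L2_def L2_norm_def power2_eq_square)
qed

lemma L2_norm_bounded_convergence:
  fixes f :: "nat \<Rightarrow> 'n::finite func"
  assumes "\<And>n. f n \<in> borel_measurable (lebesgue_on \<Omega>)" "\<And>n x. x \<in> \<Omega> \<Longrightarrow> \<bar>f n x\<bar> \<le> C"
    "\<And>x. x \<in> \<Omega> \<Longrightarrow> (\<lambda>n. f n x) \<longlonglongrightarrow> 0"
  shows "(\<lambda>n. L2_norm (f n)) \<longlonglongrightarrow> 0"
proof -
  have "(\<lambda>n. LINT x|lebesgue_on \<Omega>. (f n x)\<^sup>2) \<longlonglongrightarrow> (LINT x|lebesgue_on (\<Omega> :: (real^'n) set). 0)"
  proof (rule integral_dominated_convergence[where w="\<lambda>x. C\<^sup>2"])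
    show "integrable (lebesgue_on (\<Omega> :: (real^'n) set)) (\<lambda>x. C\<^sup>2)"
      using finite_measure.integrable_const[OF finite_measure_Omega] by blast
    show "AE x in lebesgue_on \<Omega>. (\<lambda>n. (f n x)\<^sup>2) \<longlonglongrightarrow> 0"
      using tendsto_power[OF assms(3), of _ 2] by (intro AE_I2) simp
    show "AE x in lebesgue_on \<Omega>. norm ((f n x)\<^sup>2) \<le> C\<^sup>2" for n
      using power_mono[OF assms(2), of _ n 2] by (intro AE_I2) simp
  qed (use assms(1) in measurable)
  hence "(\<lambda>n. sqrt (LINT x|lebesgue_on \<Omega>. (f n x)\<^sup>2)) \<longlonglongrightarrow> sqrt 0" by (intro tendsto_real_sqrt) simp
  thus ?thesis by (simp add: L2_norm_def)
qed

lemma L2_norm_le_sup: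
  fixes f :: "'n::finite func"
  assumes "\<And>x. x \<in> \<Omega> \<Longrightarrow> \<bar>f x\<bar> \<le> C" "C \<ge> 0"
  shows "L2_norm f \<le> C * sqrt (measure lebesgue (\<Omega> :: (real ^ 'n) set))"
proof -
  have "(LINT x|lebesgue_on \<Omega>. (f x)\<^sup>2) \<le> (LINT x|lebesgue_on (\<Omega> :: (real ^ 'n) set). C\<^sup>2)"
  proof (rule integral_mono')
    show "integrable (lebesgue_on (\<Omega> :: (real^'n) set)) (\<lambda>x. C\<^sup>2)"
      using finite_measure.integrable_const[OF finite_measure_Omega] by blast
    show "(f x)\<^sup>2 \<le> C\<^sup>2" if "x \<in> space (lebesgue_on \<Omega>)" for x
      using power_mono[OF assms(1), of x 2] that by simp
  qed simp
  also have "\<dots> = C\<^sup>2 * measure lebesgue (\<Omega> :: (real ^ 'n) set)"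
    by (simp add: measure_restrict_space Omega_sets)
  finally have "L2_norm f \<le> sqrt (C\<^sup>2 * measure lebesgue (\<Omega> :: (real ^ 'n) set))"
    unfolding L2_norm_def by (rule real_sqrt_le_mono)
  thus ?thesis using assms(2) by (simp add: real_sqrt_mult)
qed

lemma L2_null_AE:
  fixes u :: "'n::finite func"
  assumes "u \<in> L2" "L2_norm u = 0"
  shows "AE x in lebesgue_on \<Omega>. u x = 0"
proof -
  have "(LINT x|lebesgue_on \<Omega>. (u x)\<^sup>2) = 0"
    using assms(2) by (simp add: L2_norm_def)
  hence "AE x in lebesgue_on \<Omega>. (u x)\<^sup>2 = 0"
    using integral_nonneg_eq_0_iff_AE[OF L2_integrable_sq[OF assms(1)]] by simp
  thus ?thesis by simp
qed

abbreviation sine_product :: "('n::finite \<Rightarrow> nat) \<Rightarrow> 'n func" where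
  "sine_product k \<equiv> prod_fun (\<lambda>i t. sin (real (k i) * pi * t))"

lemma dirichlet_sine_product: "dirichlet_eigenfunction k = (2 powr (real CARD('n) / 2)) *\<^sub>R sine_product k"
  for k :: "'n::finite \<Rightarrow> nat"
  by (rule ext) (simp add: dirichlet_eigenfunction_def prod_fun_def scaleR_fun_def)

lemma smooth_sine_product: "smooth (sine_product k)"
proof (rule smooth_prod_fun)
  fix i
  have "differentiable_times N (\<lambda>t. sin (real (k i) * pi * t))" for N
    by (rule differentiable_times_compose[OF conjunct1[OF differentiable_times_sin_cos]]) (intro differentiable_times_mult differentiable_times_const differentiable_times_ident)
  thus "smooth_real (\<lambda>t. sin (real (k i) * pi * t))" by (simp add: smooth_real_def)
qed

lemma smooth_0: "smooth (0 :: 'n::finite func)"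
  using zero_test by (simp add: test_functions_def)

lemma smooth_dirichlet: "smooth (dirichlet_eigenfunction k)"
  using smooth_linear[OF smooth_0 smooth_sine_product] unfolding dirichlet_sine_product by simp

lemma prod_fun_bound:
  assumes "\<And>i. \<bar>F i (x $ i)\<bar> \<le> C i"
  shows "\<bar>prod_fun F x\<bar> \<le> (\<Prod>i\<in>UNIV. C i)"
  unfolding prod_fun_def abs_prod using assms by (intro prod_mono) auto

definition sine_span :: "('n::finite func) set" where
  "sine_span = span (dirichlet_eigenfunction ` multi_indices)"

lemma sine_product_in_span:
  assumes "k \<in> multi_indices"
  shows "sine_product k \<in> sine_span"
proof -
  have "(1 / (2 powr (real CARD('a) / 2))) *\<^sub>R dirichlet_eigenfunction k \<in> sine_span"
    using assms unfolding sine_span_def by (intro span_scale span_base) auto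
  thus ?thesis by (simp add: dirichlet_sine_product)
qed

lemma sine_span_smooth: "s \<in> sine_span \<Longrightarrow> smooth s"
  unfolding sine_span_def
proof (induction rule: span_induct_alt)
  case (step c x y)
  have "smooth (y + c *\<^sub>R x)" using step smooth_dirichlet by (intro smooth_linear) auto
  thus ?case by (subst add.commute)
qed (rule smooth_0)

text \<open>The product formula for \<open>cos (\<pi> x\<^sub>i) sin (k\<^sub>i \<pi> x\<^sub>i)\<close> shifts the index \<open>k\<^sub>i\<close> up and down by one.\<close>

lemma cos_mult_sine_product:
  fixes k :: "'n::finite \<Rightarrow> nat"
  assumes "k \<in> multi_indices"
  shows "(\<lambda>x. cos (pi * x $ i) * sine_product k x) \<in> sine_span"
proof -
  have ki: "k i \<ge> 1" using assms by (simp add: multi_indices_def)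
  have split: "sine_product (k(i := m)) x = sin (real m * pi * x $ i) * (\<Prod>j\<in>UNIV-{i}. sin (real (k j) * pi * x $ j))" for m x
    unfolding prod_fun_def by (subst prod.remove[of UNIV i]) (auto intro!: prod.cong)
  have eq: "cos (pi * x $ i) * sine_product k x
      = (1/2) * sine_product (k(i := k i + 1)) x + (1/2) * sine_product (k(i := k i - 1)) x" for x
  proof -
    have "2 * (cos (pi * x $ i) * sin (real (k i) * pi * x $ i))
        = sin (real (k i + 1) * pi * x $ i) + sin (real (k i - 1) * pi * x $ i)"
      using ki by (simp add: of_nat_diff algebra_simps sin_add sin_diff)
    hence e: "cos (pi * x $ i) * sin (real (k i) * pi * x $ i)
        = (1/2) * (sin (real (k i + 1) * pi * x $ i) + sin (real (k i - 1) * pi * x $ i))"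
    proof -
      have "2 * a = b \<Longrightarrow> a = (1/2) * b" for a b :: real by simp
      thus "2 * (cos (pi * x $ i) * sin (real (k i) * pi * x $ i))
        = sin (real (k i + 1) * pi * x $ i) + sin (real (k i - 1) * pi * x $ i) \<Longrightarrow> ?thesis" .
    qed
    have sp: "sine_product k x = sin (real (k i) * pi * x $ i) * (\<Prod>j\<in>UNIV-{i}. sin (real (k j) * pi * x $ j))"
      using split[of "k i" x] by (simp only: fun_upd_triv)
    have "cos (pi * x $ i) * sine_product k x = (cos (pi * x $ i) * sin (real (k i) * pi * x $ i))
        * (\<Prod>j\<in>UNIV-{i}. sin (real (k j) * pi * x $ j))" unfolding sp by (simp only: mult.assoc)
    also have "\<dots> = (1/2) * (sin (real (k i + 1) * pi * x $ i) * (\<Prod>j\<in>UNIV-{i}. sin (real (k j) * pi * x $ j)))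
        + (1/2) * (sin (real (k i - 1) * pi * x $ i) * (\<Prod>j\<in>UNIV-{i}. sin (real (k j) * pi * x $ j)))"
      unfolding e by (simp only: distrib_right distrib_left mult.assoc)
    finally show ?thesis unfolding split .
  qed
  have m1: "sine_product (k(i := k i + 1)) \<in> sine_span"
    using assms by (intro sine_product_in_span) (auto simp: multi_indices_def)
  have m2: "sine_product (k(i := k i - 1)) \<in> sine_span"
  proof (cases "k i = 1")
    case True
    have "sine_product (k(i := k i - 1)) = 0"
    proof
      fix x
      have "sine_product (k(i := 0)) x = 0" unfolding split by simp
      thus "sine_product (k(i := k i - 1)) x = 0 x" using True by (simp only: zero_fun_apply diff_self_eq_0)
    qed
    thus ?thesis by (simp add: sine_span_def span_zero)
  next
    case False
    hence "1 \<le> k i - 1" using ki by linarith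
    hence "k(i := k i - 1) \<in> multi_indices" using assms unfolding multi_indices_def by simp
    thus ?thesis by (rule sine_product_in_span)
  qed
  have "(1/2) *\<^sub>R sine_product (k(i := k i + 1)) + (1/2) *\<^sub>R sine_product (k(i := k i - 1)) \<in> sine_span"
    using m1 m2 unfolding sine_span_def by (intro span_add span_scale)
  moreover have "(1/2) *\<^sub>R sine_product (k(i := k i + 1)) + (1/2) *\<^sub>R sine_product (k(i := k i - 1))
      = (\<lambda>x. cos (pi * x $ i) * sine_product k x)"
    unfolding eq by (rule ext) (simp add: scaleR_fun_def)
  ultimately show ?thesis by simp
qed

text \<open>Unlike the sine polynomials themselves, their multipliers contain the constants and form a ring, as the
Stone-Weierstrass theorem demands.\<close>

definition multipliers :: "('n::finite func) set" where
  "multipliers = {f. continuous_on UNIV f \<and> (\<forall>s\<in>sine_span. (\<lambda>x. f x * s x) \<in> sine_span)}"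

lemma cos_multiplier: "(\<lambda>x :: real ^ 'n::finite. cos (pi * x $ i)) \<in> multipliers"
proof -
  have "(\<lambda>x. cos (pi * x $ i) * s x) \<in> sine_span" if "s \<in> sine_span" for s :: "'n func"
    using that unfolding sine_span_def
  proof (induction rule: span_induct_alt)
    case base
    show ?case by (simp add: zero_fun_def span_zero flip: zero_fun_def)
  next
    case (step c x y)
    then obtain k where k: "k \<in> multi_indices" "x = dirichlet_eigenfunction k" by auto
    define d where "d = c * 2 powr (real CARD('n) / 2)"
    have "d *\<^sub>R (\<lambda>x. cos (pi * x $ i) * sine_product k x) + (\<lambda>x. cos (pi * x $ i) * y x) \<in> sine_span"
      using cos_mult_sine_product[OF k(1), of i] step unfolding sine_span_def by (intro span_add span_scale)
    moreover have "d *\<^sub>R (\<lambda>x. cos (pi * x $ i) * sine_product k x) + (\<lambda>x. cos (pi * x $ i) * y x)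
      = (\<lambda>z. cos (pi * z $ i) * (c *\<^sub>R x + y) z)"
      by (rule ext) (simp add: k(2) dirichlet_sine_product scaleR_fun_def d_def algebra_simps)
    ultimately show ?case by (simp add: sine_span_def)
  qed
  thus ?thesis by (auto simp: multipliers_def intro!: continuous_intros)
qed

text \<open>Points are separated by \<open>cos (\<pi> x\<^sub>i)\<close>, since the cosine is injective on \<open>[0, \<pi>]\<close>.\<close>

lemma function_ring_multipliers: "function_ring_on multipliers (cbox 0 1 :: (real ^ 'n::finite) set)"
proof
  show "compact (cbox 0 1 :: (real ^ 'n) set)" by simp
next
  fix f :: "'n func" assume "f \<in> multipliers"
  thus "continuous_on (cbox 0 1) f" by (auto simp: multipliers_def intro: continuous_on_subset)
next
  fix f g :: "'n func" assume fg: "f \<in> multipliers" "g \<in> multipliers"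
  have "(\<lambda>x. (f x + g x) * s x) \<in> sine_span" if s: "s \<in> sine_span" for s
  proof -
    have "(\<lambda>x. f x * s x) + (\<lambda>x. g x * s x) \<in> sine_span"
      using fg s unfolding multipliers_def sine_span_def by (intro span_add) auto
    thus ?thesis by (simp add: plus_fun_def distrib_right)
  qed
  thus "(\<lambda>x. f x + g x) \<in> multipliers" using fg by (auto simp: multipliers_def intro!: continuous_intros)
  have "(\<lambda>x. (f x * g x) * s x) \<in> sine_span" if s: "s \<in> sine_span" for s
  proof -
    have "(\<lambda>x. g x * s x) \<in> sine_span" "\<forall>s\<in>sine_span. (\<lambda>x. f x * s x) \<in> sine_span"
      using fg s by (auto simp: multipliers_def)
    from bspec[OF this(2) this(1)] show ?thesis by (simp only: mult.assoc)
  qed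
  thus "(\<lambda>x. f x * g x) \<in> multipliers" using fg by (auto simp: multipliers_def intro!: continuous_intros)
next
  fix c :: real
  have "(\<lambda>x. c * s x) \<in> sine_span" if "s \<in> sine_span" for s :: "'n func"
    using span_scale[of s _ c] that unfolding sine_span_def by (simp add: scaleR_fun_def)
  thus "(\<lambda>_. c) \<in> (multipliers :: ('n func) set)" by (auto simp: multipliers_def)
next
  fix x y :: "real ^ 'n" assume xy: "x \<in> cbox 0 1" "y \<in> cbox 0 1" "x \<noteq> y"
  then obtain i where i: "x $ i \<noteq> y $ i" by (auto simp: vec_eq_iff)
  have "0 \<le> x $ i" "x $ i \<le> 1" "0 \<le> y $ i" "y $ i \<le> 1" using xy by (auto simp: mem_box_cart)
  hence "cos (pi * x $ i) \<noteq> cos (pi * y $ i)"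
    using i cos_inj_pi[of "pi * x $ i" "pi * y $ i"] by (auto simp: mult_le_cancel_left2)
  thus "\<exists>f\<in>multipliers. f x \<noteq> f y" using cos_multiplier by (intro bexI[of _ "\<lambda>x. cos (pi * x $ i)"])
qed

lemma sine_span_L2: "s \<in> sine_span \<Longrightarrow> s \<in> L2"
  by (intro continuous_L2 smooth_continuous sine_span_smooth)

text \<open>Approximate \<open>u\<close> by \<open>s1 h\<close> with \<open>h\<close> continuous, where \<open>s1\<close> is the positive product of the lowest sines, and then
\<open>h\<close> uniformly by a multiplier \<open>F\<close>. The product \<open>F s1\<close> is a sine polynomial.\<close>

theorem sine_span_dense_L2:
  fixes u :: "'n::finite func"
  assumes u: "u \<in> L2" and \<epsilon>: "\<epsilon> > 0"
  shows "\<exists>s\<in>sine_span. L2_norm (u - s) < \<epsilon>"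
proof -
  define s1 :: "'n func" where "s1 = sine_product (\<lambda>_. 1)"
  have s1: "s1 \<in> sine_span" unfolding s1_def by (intro sine_product_in_span) (auto simp: multi_indices_def)
  have s1_pos: "0 < s1 x \<and> s1 x \<le> 1" if "x \<in> \<Omega>" for x
  proof
    have p: "0 < x $ i" "x $ i < 1" for i using that by (auto simp: mem_Omega)
    show "0 < s1 x" unfolding s1_def prod_fun_def using p by (intro prod_pos sin_gt_zero ballI) auto
    show "s1 x \<le> 1" unfolding s1_def prod_fun_def using p
      by (intro prod_le_1 conjI sin_ge_zero) (auto intro: less_imp_le)
  qed
  define V where "V = sqrt (measure lebesgue (\<Omega> :: (real ^ 'n) set))"
  have V: "V \<ge> 0" by (simp add: V_def)
  have "\<exists>h. continuous_on UNIV h \<and> (LINT x|lebesgue_on \<Omega>. (u x - s1 x * h x)\<^sup>2) < (\<epsilon>/2)\<^sup>2"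
    using weighted_L2_approx[OF Omega_lmeasurable L2_measurable[OF u] L2_integrable_sq[OF u]
      L2_measurable[OF sine_span_L2[OF s1]] s1_pos, of "(\<epsilon>/2)\<^sup>2"] \<epsilon> by simp
  then obtain h where h: "continuous_on UNIV h" "(LINT x|lebesgue_on \<Omega>. (u x - s1 x * h x)\<^sup>2) < (\<epsilon>/2)\<^sup>2" by blast
  have "L2_norm (u - (\<lambda>x. s1 x * h x)) < sqrt ((\<epsilon>/2)\<^sup>2)"
    unfolding L2_norm_def using h(2) by (intro real_sqrt_less_mono) simp
  hence n1: "L2_norm (u - (\<lambda>x. s1 x * h x)) < \<epsilon>/2" using \<epsilon> by simp
  interpret R: function_ring_on multipliers "cbox 0 1 :: (real ^ 'n) set" by (rule function_ring_multipliers)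
  obtain F where F: "F \<in> UNIV \<rightarrow> multipliers" "uniform_limit (cbox 0 1) F h sequentially"
    using R.Stone_Weierstrass[OF continuous_on_subset[OF h(1)]] by auto
  define \<delta> where "\<delta> = \<epsilon> / (2 * (V + 1))"
  have \<delta>: "\<delta> > 0" using \<epsilon> V by (simp add: \<delta>_def add_nonneg_pos)
  have "\<forall>\<^sub>F n in sequentially. \<forall>x\<in>cbox 0 1. dist (F n x) (h x) < \<delta>"
    using F(2) \<delta> unfolding uniform_limit_iff by blast
  then obtain n where n: "\<And>x. x \<in> cbox 0 1 \<Longrightarrow> dist (F n x) (h x) < \<delta>"
    unfolding eventually_sequentially by blast
  have Fn: "F n \<in> multipliers" using F(1) by auto
  define s where "s x = F n x * s1 x" for x
  have s: "s \<in> sine_span" using Fn s1 unfolding s_def[abs_def] multipliers_def by blast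
  have "L2_norm ((\<lambda>x. s1 x * h x) - s) \<le> \<delta> * V" unfolding V_def
  proof (rule L2_norm_le_sup)
    fix x :: "real ^ 'n" assume x: "x \<in> \<Omega>"
    hence "dist (F n x) (h x) < \<delta>" using n box_subset_cbox unfolding \<Omega>_def by blast
    hence d: "\<bar>h x - F n x\<bar> \<le> \<delta>" by (simp add: dist_real_def abs_minus_commute)
    have "\<bar>((\<lambda>x. s1 x * h x) - s) x\<bar> = s1 x * \<bar>h x - F n x\<bar>"
    proof -
      have "((\<lambda>x. s1 x * h x) - s) x = s1 x * (h x - F n x)" by (simp add: s_def algebra_simps)
      thus ?thesis using s1_pos[OF x] by (simp only: abs_mult) simp
    qed
    also have "\<dots> \<le> 1 * \<delta>" using s1_pos[OF x] d by (intro mult_mono) auto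
    finally show "\<bar>((\<lambda>x. s1 x * h x) - s) x\<bar> \<le> \<delta>" by simp
  qed (use \<delta> in simp)
  also have "\<dots> \<le> \<epsilon> / 2" unfolding \<delta>_def using V \<epsilon> by (intro half_quotient_mult_le) auto
  finally have n2: "L2_norm ((\<lambda>x. s1 x * h x) - s) \<le> \<epsilon> / 2" .
  have "(\<lambda>x. s1 x * h x) \<in> L2"
    by (intro continuous_L2 continuous_intros h smooth_continuous sine_span_smooth s1)
  hence "L2_norm (u - s) \<le> L2_norm (u - (\<lambda>x. s1 x * h x)) + L2_norm ((\<lambda>x. s1 x * h x) - s)"
    using u sine_span_L2[OF s] by (intro l2.N_diff_triangle)
  thus ?thesis using n1 n2 s by (intro bexI[of _ s]) auto
qed

lemma cut_sine_prod_lim: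
  assumes "x \<in> \<Omega>"
  shows "(\<lambda>n. prod_fun (\<lambda>i. cut_sine n (k i)) x) \<longlonglongrightarrow> sine_product k x"
  unfolding prod_fun_def using assms by (intro tendsto_prod cut_sine_lim) (auto simp: mem_Omega)

lemma test_L2: "\<phi> \<in> test_functions \<Longrightarrow> \<phi> \<in> L2"
  by (intro continuous_L2 smooth_continuous test_smooth)

lemma cut_sine_prod_L2_lim:
  "(\<lambda>n. L2_norm (prod_fun (\<lambda>i. cut_sine n (k i)) - sine_product k)) \<longlonglongrightarrow> 0"
proof (rule L2_norm_bounded_convergence[where C=2])
  show "prod_fun (\<lambda>i. cut_sine n (k i)) - sine_product k \<in> borel_measurable (lebesgue_on \<Omega>)" for n
    by (intro L2_measurable l2.diff_E test_L2 cut_sine_prod_test continuous_L2 smooth_continuous smooth_sine_product)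
  show "\<bar>(prod_fun (\<lambda>i. cut_sine n (k i)) - sine_product k) x\<bar> \<le> 2" for n x
  proof -
    have "\<bar>prod_fun (\<lambda>i. cut_sine n (k i)) x\<bar> \<le> (\<Prod>i\<in>(UNIV :: 'a set). 1)"
      by (intro prod_fun_bound cut_sine_bound)
    moreover have "\<bar>sine_product k x\<bar> \<le> (\<Prod>i\<in>(UNIV :: 'a set). 1)" by (intro prod_fun_bound) simp
    ultimately show ?thesis by simp
  qed
  show "(\<lambda>n. (prod_fun (\<lambda>i. cut_sine n (k i)) - sine_product k) x) \<longlonglongrightarrow> 0" if "x \<in> \<Omega>" for x
    using LIM_zero[OF cut_sine_prod_lim[OF that]] by simp
qed

text \<open>Sine products are \<open>L\<^sup>2\<close> limits of test functions, so \<open>v\<close> is orthogonal to all sine polynomials, and these are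
dense. Applied to differences it shows that weak derivatives are unique up to null functions.\<close>

theorem fundamental_lemma:
  fixes v :: "'n::finite func"
  assumes v: "v \<in> L2" and orth: "\<And>\<phi>. \<phi> \<in> test_functions \<Longrightarrow> inner_L2 v \<phi> = 0"
  shows "L2_norm v = 0"
proof -
  have sp: "inner_L2 (sine_product k) v = 0" for k
  proof -
    have "(\<lambda>n. inner_L2 (prod_fun (\<lambda>i. cut_sine n (k i))) v) \<longlonglongrightarrow> inner_L2 (sine_product k) v"
      by (intro l2.tendsto_form cut_sine_prod_L2_lim test_L2 cut_sine_prod_test v
          continuous_L2 smooth_continuous smooth_sine_product)
    moreover have "inner_L2 (prod_fun (\<lambda>i. cut_sine n (k i))) v = 0" for n
      using orth[OF cut_sine_prod_test] l2.sym[OF v test_L2[OF cut_sine_prod_test]] by metis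
    ultimately show ?thesis by (simp add: LIMSEQ_const_iff)
  qed
  have span0: "s \<in> sine_span \<Longrightarrow> s \<in> L2 \<and> inner_L2 s v = 0" for s
    unfolding sine_span_def
  proof (induction rule: span_induct_alt)
    case base show ?case using l2.zero_E l2.zero_left[OF v] by blast
  next
    case (step c x y)
    then obtain k where x: "x = dirichlet_eigenfunction k" by blast
    have sL: "sine_product k \<in> L2" by (intro continuous_L2 smooth_continuous smooth_sine_product)
    have xL: "x \<in> L2" unfolding x dirichlet_sine_product using sL by (rule l2.scale_E)
    have x0: "inner_L2 x v = 0"
      unfolding x dirichlet_sine_product l2.scale_left[OF sL v] sp by simp
    have y: "y \<in> L2" "inner_L2 y v = 0" using step by auto
    have "inner_L2 (c *\<^sub>R x + y) v = c * inner_L2 x v + inner_L2 y v"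
      by (simp only: l2.add_left[OF l2.scale_E[OF xL] y(1) v] l2.scale_left[OF xL v])
    thus ?case using l2.add_E[OF l2.scale_E[OF xL] y(1)] x0 y(2) by (metis add_0 mult_zero_right)
  qed
  have le: "L2_norm v \<le> \<epsilon>" if e: "\<epsilon> > 0" for \<epsilon>
  proof -
    obtain s where s: "s \<in> sine_span" "L2_norm (v - s) < \<epsilon>" using sine_span_dense_L2[OF v e] by blast
    have sL: "s \<in> L2" "inner_L2 s v = 0" using span0 s(1) by auto
    have "(L2_norm v)\<^sup>2 = inner_L2 (v - s) v" using v sL by (simp add: l2.N_sq l2.diff_left)
    also have "\<dots> \<le> L2_norm (v - s) * L2_norm v"
      using l2.cauchy_schwarz[of "v - s" v] v sL by auto
    finally have "L2_norm v * L2_norm v \<le> L2_norm (v - s) * L2_norm v" by (simp add: power2_eq_square)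
    hence "L2_norm v \<le> L2_norm (v - s) \<or> L2_norm v = 0"
      using l2.N_nonneg[OF v] by (auto simp: mult_le_cancel_right)
    thus ?thesis using s(2) e by auto
  qed
  thus ?thesis using l2.N_nonneg[OF v] field_le_epsilon[of "L2_norm v" 0] by force
qed

section \<open>Weak derivatives and functions vanishing on the boundary\<close>

lemma has_weak_partial_iff:
  "has_weak_partial i u v \<longleftrightarrow> (\<forall>\<phi>\<in>test_functions. inner_L2 u (partial_deriv i \<phi>) = - inner_L2 v \<phi>)"
  by (simp add: has_weak_partial_def inner_L2_def)

lemma smooth_L2: "smooth f \<Longrightarrow> f \<in> L2"
  by (intro continuous_L2 smooth_continuous)

lemma L2_lin: "u \<in> L2 \<Longrightarrow> v \<in> L2 \<Longrightarrow> u + c *\<^sub>R v \<in> L2"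
  by (intro l2.add_E l2.scale_E)

lemma inner_L2_lin: "u \<in> L2 \<Longrightarrow> v \<in> L2 \<Longrightarrow> w \<in> L2 \<Longrightarrow> inner_L2 (u + c *\<^sub>R v) w = inner_L2 u w + c * inner_L2 v w"
  by (simp only: l2.add_left l2.scale_E l2.scale_left)

lemma weak_partial_unique:
  assumes "v \<in> L2" "v' \<in> L2" "has_weak_partial i u v" "has_weak_partial i u v'"
  shows "L2_norm (v - v') = 0"
proof (rule fundamental_lemma)
  show "v - v' \<in> L2" using assms by (intro l2.diff_E)
  fix \<phi> :: "'a func" assume "\<phi> \<in> test_functions"
  thus "inner_L2 (v - v') \<phi> = 0"
    using assms l2.diff_left[OF assms(1,2) test_L2[of \<phi>]] by (simp add: has_weak_partial_iff)
qed

lemma H1_L2: "u \<in> H1 \<Longrightarrow> u \<in> L2"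
  by (simp add: H1_def)

lemma weak_partial_exists: "u \<in> H1 \<Longrightarrow> weak_partial i u \<in> L2 \<and> has_weak_partial i u (weak_partial i u)"
proof -
  assume "u \<in> H1"
  hence "\<exists>v. v \<in> L2 \<and> has_weak_partial i u v" by (auto simp: H1_def)
  from someI_ex[OF this] show ?thesis unfolding weak_partial_def .
qed

lemma weak_partial_L2: "u \<in> H1 \<Longrightarrow> weak_partial i u \<in> L2"
  using weak_partial_exists by blast

lemma weak_partial_eq:
  assumes "u \<in> H1" "v \<in> L2" "has_weak_partial i u v"
  shows "L2_norm (weak_partial i u - v) = 0"
  using weak_partial_exists[OF assms(1), of i] assms by (intro weak_partial_unique[where i=i and u=u]) auto

lemma H1I: "u \<in> L2 \<Longrightarrow> (\<And>i. v i \<in> L2) \<Longrightarrow> (\<And>i. has_weak_partial i u (v i)) \<Longrightarrow> u \<in> H1"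
  by (auto simp: H1_def)

lemma has_weak_partial_linear:
  assumes "u \<in> L2" "u' \<in> L2" "v \<in> L2" "v' \<in> L2" "has_weak_partial i u u'" "has_weak_partial i v v'"
  shows "has_weak_partial i (u + c *\<^sub>R v) (u' + c *\<^sub>R v')"
  unfolding has_weak_partial_iff
proof
  fix \<phi> :: "'a func" assume \<phi>: "\<phi> \<in> test_functions"
  have L: "\<phi> \<in> L2" "partial_deriv i \<phi> \<in> L2" using \<phi> test_L2 test_partial_deriv by blast+
  have "inner_L2 u (partial_deriv i \<phi>) = - inner_L2 u' \<phi>" "inner_L2 v (partial_deriv i \<phi>) = - inner_L2 v' \<phi>"
    using assms(5,6) \<phi> by (auto simp: has_weak_partial_iff)
  thus "inner_L2 (u + c *\<^sub>R v) (partial_deriv i \<phi>) = - inner_L2 (u' + c *\<^sub>R v') \<phi>"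
    unfolding inner_L2_lin[OF assms(1,3) L(2)] inner_L2_lin[OF assms(2,4) L(1)] by simp
qed

text \<open>Weak derivatives do not distinguish functions that agree almost everywhere. This matters for second derivatives,
since \<open>weak_partial\<close> selects an arbitrary representative.\<close>

lemma has_weak_partial_null_cong:
  assumes "u \<in> L2" "u' \<in> L2" "L2_norm (u - u') = 0" "has_weak_partial i u v"
  shows "has_weak_partial i u' v"
  unfolding has_weak_partial_iff
proof
  fix \<phi> :: "'a func" assume \<phi>: "\<phi> \<in> test_functions"
  have "inner_L2 u (partial_deriv i \<phi>) = inner_L2 u' (partial_deriv i \<phi>)"
    by (rule l2.null_cong_left[OF assms(1,2) test_L2[OF test_partial_deriv[OF \<phi>]] assms(3)])
  thus "inner_L2 u' (partial_deriv i \<phi>) = - inner_L2 v \<phi>" using assms(4) \<phi> by (simp add: has_weak_partial_iff)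
qed

lemma H1_lin:
  assumes "u \<in> H1" "v \<in> H1"
  shows "u + c *\<^sub>R v \<in> H1"
    and "L2_norm (weak_partial i (u + c *\<^sub>R v) - (weak_partial i u + c *\<^sub>R weak_partial i v)) = 0"
proof -
  have h: "has_weak_partial i (u + c *\<^sub>R v) (weak_partial i u + c *\<^sub>R weak_partial i v)" for i
    using weak_partial_exists[OF assms(1), of i] weak_partial_exists[OF assms(2), of i]
      has_weak_partial_linear[OF H1_L2[OF assms(1)] _ H1_L2[OF assms(2)]] by blast
  have L: "weak_partial i u + c *\<^sub>R weak_partial i v \<in> L2" for i
    using assms by (intro L2_lin weak_partial_L2)
  show m: "u + c *\<^sub>R v \<in> H1"
    by (rule H1I[OF _ L h]) (intro L2_lin H1_L2 assms)
  show "L2_norm (weak_partial i (u + c *\<^sub>R v) - (weak_partial i u + c *\<^sub>R weak_partial i v)) = 0"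
    by (rule weak_partial_eq[OF m L h])
qed

lemma smooth_has_weak_partial: "smooth v \<Longrightarrow> has_weak_partial i v (partial_deriv i v)"
  by (intro classical_imp_weak_partial smooth_differentiable smooth_continuous smooth_partial_deriv)

lemma smooth_H1: "smooth v \<Longrightarrow> v \<in> H1"
  by (rule H1I[OF smooth_L2 smooth_L2[OF smooth_partial_deriv] smooth_has_weak_partial])

lemma weak_partial_smooth: "smooth v \<Longrightarrow> L2_norm (weak_partial i v - partial_deriv i v) = 0"
  by (intro weak_partial_eq smooth_H1 smooth_L2 smooth_partial_deriv smooth_has_weak_partial)

lemma subspaceI_lin:
  fixes S :: "'v::real_vector set"
  assumes "0 \<in> S" "\<And>u v c. u \<in> S \<Longrightarrow> v \<in> S \<Longrightarrow> u + c *\<^sub>R v \<in> S"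
  shows "subspace S"
proof (rule subspaceI)
  show "0 \<in> S" by fact
  show "x + y \<in> S" if "x \<in> S" "y \<in> S" for x y using assms(2)[OF that, of 1] by (simp only: scaleR_one)
  show "c *\<^sub>R x \<in> S" if "x \<in> S" for c x using assms(2)[OF assms(1) that, of c] by (simp only: add_0)
qed

lemma subspace_H1: "subspace H1"
  by (rule subspaceI_lin[OF smooth_H1[OF smooth_0] H1_lin(1)])

lemma inner_L2_weak_partial_lin:
  assumes "u \<in> H1" "v \<in> H1" "w \<in> L2"
  shows "inner_L2 (weak_partial i (u + c *\<^sub>R v)) w = inner_L2 (weak_partial i u) w + c * inner_L2 (weak_partial i v) w"
proof -
  have "inner_L2 (weak_partial i (u + c *\<^sub>R v)) w = inner_L2 (weak_partial i u + c *\<^sub>R weak_partial i v) w"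
    using assms by (intro l2.null_cong_left H1_lin weak_partial_L2 L2_lin)
  thus ?thesis using assms by (simp only: inner_L2_lin weak_partial_L2)
qed

lemma partial_deriv_0: "partial_deriv i (0 :: 'n::finite func) = 0"
proof -
  have "partial_deriv i (0 + 1 *\<^sub>R 0 :: 'n func) = partial_deriv i 0 + 1 *\<^sub>R partial_deriv i 0"
    by (rule partial_deriv_linear_smooth[OF smooth_0 smooth_0])
  hence "partial_deriv i (0 :: 'n func) = partial_deriv i 0 + partial_deriv i 0"
    by (simp only: scaleR_one scaleR_zero_right add_0_right)
  thus ?thesis by (rule iffD1[OF add_cancel_right_right])
qed

lemma partial_deriv_scale: "smooth f \<Longrightarrow> partial_deriv i (c *\<^sub>R f) = c *\<^sub>R partial_deriv i f"
  using partial_deriv_linear_smooth[OF smooth_0, of f i c] by (simp only: partial_deriv_0 add_0)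

lemma inner_L2_weak_partial_0:
  assumes "w \<in> L2"
  shows "inner_L2 (weak_partial i 0) w = 0"
proof -
  have "inner_L2 (weak_partial i 0) w = inner_L2 (partial_deriv i 0) w"
    by (intro l2.null_cong_left weak_partial_smooth smooth_0 assms weak_partial_L2 smooth_H1 smooth_L2 smooth_partial_deriv)
  thus ?thesis unfolding partial_deriv_0 using assms by (simp only: l2.zero_left)
qed

text \<open>The bilinear form of the norm \<open>H01_norm\<close>. For \<open>\<alpha> = 1\<close> it also gives \<open>H1_norm\<close>.\<close>

definition H1_form :: "real \<Rightarrow> ('n::finite func) \<Rightarrow> ('n func) \<Rightarrow> real" where
  "H1_form \<alpha> u v = (LINT x|lebesgue_on \<Omega>. (\<Sum>i\<in>UNIV. weak_partial i u x * weak_partial i v x) + \<alpha> * (u x * v x))"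

lemma H1_form_split:
  assumes "u \<in> H1" "v \<in> H1"
  shows "H1_form \<alpha> u v = (\<Sum>i\<in>UNIV. inner_L2 (weak_partial i u) (weak_partial i v)) + \<alpha> * inner_L2 u v"
proof -
  have i1: "integrable (lebesgue_on \<Omega>) (\<lambda>x. weak_partial i u x * weak_partial i v x)" for i
    using assms by (intro L2_integrable_mult weak_partial_L2)
  have i2: "integrable (lebesgue_on \<Omega>) (\<lambda>x. u x * v x)"
    using assms by (intro L2_integrable_mult H1_L2)
  have "H1_form \<alpha> u v = (LINT x|lebesgue_on \<Omega>. (\<Sum>i\<in>UNIV. weak_partial i u x * weak_partial i v x))
      + (LINT x|lebesgue_on \<Omega>. \<alpha> * (u x * v x))"
    unfolding H1_form_def using i1 i2
    by (intro Bochner_Integration.integral_add Bochner_Integration.integrable_sum integrable_mult_right)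
  also have "(LINT x|lebesgue_on \<Omega>. (\<Sum>i\<in>UNIV. weak_partial i u x * weak_partial i v x))
      = (\<Sum>i\<in>UNIV. inner_L2 (weak_partial i u) (weak_partial i v))"
    unfolding inner_L2_def using i1 by (intro Bochner_Integration.integral_sum)
  finally show ?thesis by (simp add: inner_L2_def)
qed

lemma H1_form_lin_left:
  assumes "u \<in> H1" "v \<in> H1" "w \<in> H1"
  shows "H1_form \<alpha> (u + c *\<^sub>R v) w = H1_form \<alpha> u w + c * H1_form \<alpha> v w"
proof -
  have "H1_form \<alpha> (u + c *\<^sub>R v) w = (\<Sum>i\<in>UNIV. inner_L2 (weak_partial i u) (weak_partial i w) + c * inner_L2 (weak_partial i v) (weak_partial i w))
      + \<alpha> * (inner_L2 u w + c * inner_L2 v w)"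
    using assms by (simp only: H1_form_split H1_lin inner_L2_weak_partial_lin inner_L2_lin weak_partial_L2 H1_L2)
  also have "\<dots> = H1_form \<alpha> u w + c * H1_form \<alpha> v w"
    using assms by (simp only: H1_form_split sum.distrib) (simp add: sum_distrib_left algebra_simps)
  finally show ?thesis .
qed

lemma H1_form_0_left: "w \<in> H1 \<Longrightarrow> H1_form \<alpha> 0 w = 0"
  by (simp only: H1_form_split smooth_H1[OF smooth_0] inner_L2_weak_partial_0 weak_partial_L2 l2.zero_left H1_L2) simp

lemma H1_form_nonneg: "\<alpha> \<ge> 0 \<Longrightarrow> 0 \<le> H1_form \<alpha> u u"
  unfolding H1_form_def
  by (intro integral_nonneg_AE AE_I2 add_nonneg_nonneg sum_nonneg zero_le_square mult_nonneg_nonneg[OF _ zero_le_square])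

lemma semi_inner_H1_sub:
  assumes "\<alpha> \<ge> 0" "subspace S" "S \<subseteq> H1"
  shows "semi_inner S (H1_form \<alpha>)"
proof
  fix x y z :: "'a func" and c
  show "H1_form \<alpha> x y = H1_form \<alpha> y x" by (simp add: H1_form_def mult.commute)
  assume xyz: "x \<in> S" "y \<in> S"
  hence m: "x \<in> H1" "y \<in> H1" using assms by auto
  show "H1_form \<alpha> (c *\<^sub>R x) y = c * H1_form \<alpha> x y"
    using H1_form_lin_left[OF smooth_H1[OF smooth_0] m, of \<alpha> c] H1_form_0_left[OF m(2), of \<alpha>]
    by (simp only: add_0)
  assume "z \<in> S"
  hence "z \<in> H1" using assms by auto
  from H1_form_lin_left[OF m this, of \<alpha> 1] show "H1_form \<alpha> (x + y) z = H1_form \<alpha> x z + H1_form \<alpha> y z"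
    by (simp only: scaleR_one mult_1)
next
  fix x :: "'a func"
  show "0 \<le> H1_form \<alpha> x x" by (rule H1_form_nonneg[OF assms(1)])
qed (rule assms(2))

lemma H01_norm_form: "H01_norm \<alpha> u = sqrt (H1_form \<alpha> u u)"
  by (simp add: H1_form_def H01_norm_def power2_eq_square)

lemma H01_norm_eq_N:
  assumes "\<alpha> \<ge> 0"
  shows "semi_inner.N (H1_form \<alpha>) = H01_norm \<alpha>"
  using semi_inner.N_def[OF semi_inner_H1_sub[OF assms subspace_H1 order_refl]]
  by (intro ext) (simp only: H01_norm_form)

lemma H1_norm_eq: "u \<in> H1 \<Longrightarrow> H1_norm u = H01_norm 1 u"
proof -
  assume u: "u \<in> H1"
  have "(H1_norm u)\<^sup>2 = H1_form 1 u u"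
    using u by (simp add: H1_norm_def H1_form_split l2.N_sq weak_partial_L2 H1_L2 l2.nonneg sum_nonneg add.commute)
  moreover have "H01_norm 1 u = sqrt (H1_form 1 u u)" by (rule H01_norm_form)
  moreover have "H1_norm u \<ge> 0" by (simp add: H1_norm_def sum_nonneg)
  ultimately show ?thesis using real_sqrt_unique by metis
qed

lemma L2_norm_le_H1_norm: "L2_norm u \<le> H1_norm u"
  unfolding H1_norm_def by (rule real_le_rsqrt) (simp add: sum_nonneg)

lemma weak_partial_norm_le_H1_norm: "L2_norm (weak_partial i u) \<le> H1_norm u"
proof -
  have "(L2_norm (weak_partial i u))\<^sup>2 \<le> (\<Sum>i\<in>UNIV. (L2_norm (weak_partial i u))\<^sup>2)"
    by (rule member_le_sum[where f="\<lambda>i. (L2_norm (weak_partial i u))\<^sup>2"]) auto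
  thus ?thesis unfolding H1_norm_def by (intro real_le_rsqrt) (simp add: add_increasing)
qed

lemma H01_norm_le_H1_norm:
  assumes "u \<in> H1" "\<alpha> \<ge> 0"
  shows "H01_norm \<alpha> u \<le> sqrt (1 + \<alpha>) * H1_norm u"
proof -
  have "H1_form \<alpha> u u = (\<Sum>i\<in>UNIV. (L2_norm (weak_partial i u))\<^sup>2) + \<alpha> * (L2_norm u)\<^sup>2"
    using assms by (simp add: H1_form_split l2.N_sq weak_partial_L2 H1_L2)
  also have "\<dots> \<le> (1 + \<alpha>) * ((L2_norm u)\<^sup>2 + (\<Sum>i\<in>UNIV. (L2_norm (weak_partial i u))\<^sup>2))"
  proof -
    have "0 \<le> \<alpha> * (\<Sum>i\<in>UNIV. (L2_norm (weak_partial i u))\<^sup>2)" using assms(2) by (intro mult_nonneg_nonneg sum_nonneg) auto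
    moreover have "0 \<le> (L2_norm u)\<^sup>2" by simp
    ultimately show ?thesis unfolding distrib_left distrib_right by linarith
  qed
  also have "\<dots> = (1 + \<alpha>) * (H1_norm u)\<^sup>2" by (simp add: H1_norm_def sum_nonneg)
  finally have "sqrt (H1_form \<alpha> u u) \<le> sqrt ((1 + \<alpha>) * (H1_norm u)\<^sup>2)" by (rule real_sqrt_le_mono)
  moreover have "H01_norm \<alpha> u = sqrt (H1_form \<alpha> u u)" by (rule H01_norm_form)
  moreover have "H1_norm u \<ge> 0" by (simp add: H1_norm_def sum_nonneg)
  ultimately show ?thesis by (simp add: real_sqrt_mult)
qed

lemma H01_H1: "u \<in> H01 \<Longrightarrow> u \<in> H1"
  by (simp add: H01_def)

lemma test_H01: "\<phi> \<in> test_functions \<Longrightarrow> \<phi> \<in> H01"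
proof -
  assume \<phi>: "\<phi> \<in> test_functions"
  interpret h: semi_inner "H1 :: ('a func) set" "H1_form 1"
    by (intro semi_inner_H1_sub subspace_H1) auto
  have "H1_norm (\<phi> - \<phi>) = 0"
    using h.N_zero H1_norm_eq[OF h.zero_E] unfolding H01_norm_eq_N[OF zero_le_one] by (simp only: diff_self)
  thus ?thesis using \<phi> by (auto simp: H01_def intro!: smooth_H1 test_smooth exI[of _ "\<lambda>_. \<phi>"] simp del: diff_self)
qed

lemma subspace_H01: "subspace (H01 :: ('n::finite func) set)"
proof (rule subspaceI_lin)
  show "(0 :: 'n func) \<in> H01" by (intro test_H01 zero_test)
  interpret h: semi_inner "H1 :: ('n func) set" "H1_form 1"
    rewrites "semi_inner.N (H1_form 1) = (H01_norm 1 :: ('n func) \<Rightarrow> real)"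
  proof -
    show "semi_inner (H1 :: ('n func) set) (H1_form 1)" by (intro semi_inner_H1_sub subspace_H1) auto
    show "semi_inner.N (H1_form 1) = (H01_norm 1 :: ('n func) \<Rightarrow> real)" by (rule H01_norm_eq_N) simp
  qed
  fix u v :: "'n func" and c assume u: "u \<in> H01" and v: "v \<in> H01"
  obtain \<phi> where \<phi>: "\<And>k. \<phi> k \<in> test_functions" "(\<lambda>k. H1_norm (\<phi> k - u)) \<longlonglongrightarrow> 0" using u by (auto simp: H01_def)
  obtain \<psi> where \<psi>: "\<And>k. \<psi> k \<in> test_functions" "(\<lambda>k. H1_norm (\<psi> k - v)) \<longlonglongrightarrow> 0" using v by (auto simp: H01_def)
  have uv: "u \<in> H1" "v \<in> H1" using u v by (auto intro: H01_H1)
  have pk: "\<phi> k \<in> H1" "\<psi> k \<in> H1" for k using \<phi>(1) \<psi>(1) by (auto intro!: smooth_H1 test_smooth)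
  have "(\<lambda>k. H1_norm ((\<phi> k + c *\<^sub>R \<psi> k) - (u + c *\<^sub>R v))) \<longlonglongrightarrow> 0"
  proof (rule Lim_null_comparison)
    show "(\<lambda>k. H1_norm (\<phi> k - u) + \<bar>c\<bar> * H1_norm (\<psi> k - v)) \<longlonglongrightarrow> 0"
      using tendsto_add[OF \<phi>(2) tendsto_mult_left[OF \<psi>(2), of "\<bar>c\<bar>"]] by simp
    have "norm (H1_norm ((\<phi> k + c *\<^sub>R \<psi> k) - (u + c *\<^sub>R v))) \<le> H1_norm (\<phi> k - u) + \<bar>c\<bar> * H1_norm (\<psi> k - v)" for k
    proof -
      have e: "(\<phi> k + c *\<^sub>R \<psi> k) - (u + c *\<^sub>R v) = (\<phi> k - u) + c *\<^sub>R (\<psi> k - v)"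
        by (simp only: scaleR_right_diff_distrib add_diff_add)
      have m: "\<phi> k - u \<in> H1" "\<psi> k - v \<in> H1" using pk uv by (auto intro: h.diff_E simp del: minus_apply)
      have "H01_norm 1 ((\<phi> k - u) + c *\<^sub>R (\<psi> k - v)) \<le> H01_norm 1 (\<phi> k - u) + \<bar>c\<bar> * H01_norm 1 (\<psi> k - v)"
        using h.N_triangle[OF m(1) h.scale_E[OF m(2), of c]] h.N_scale[OF m(2), of c] by simp
      moreover have "0 \<le> H01_norm 1 ((\<phi> k - u) + c *\<^sub>R (\<psi> k - v))"
        using m by (intro h.N_nonneg h.add_E h.scale_E)
      ultimately show ?thesis unfolding e
        using H1_norm_eq[OF m(1)] H1_norm_eq[OF m(2)] H1_norm_eq[OF h.add_E[OF m(1) h.scale_E[OF m(2), of c]]] by simp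
    qed
    thus "\<forall>\<^sub>F k in sequentially. norm (H1_norm ((\<phi> k + c *\<^sub>R \<psi> k) - (u + c *\<^sub>R v))) \<le> H1_norm (\<phi> k - u) + \<bar>c\<bar> * H1_norm (\<psi> k - v)"
      by simp
  qed
  thus "u + c *\<^sub>R v \<in> H01"
    unfolding H01_def using H1_lin(1)[OF uv] test_linear[OF \<phi>(1) \<psi>(1)]
    by (intro CollectI conjI exI[of _ "\<lambda>k. \<phi> k + c *\<^sub>R \<psi> k"] allI)
qed

lemma semi_inner_H01: "\<alpha> \<ge> 0 \<Longrightarrow> semi_inner H01 (H1_form \<alpha>)"
  by (intro semi_inner_H1_sub subspace_H01) (auto intro: H01_H1)

text \<open>The identity passes from test functions to their \<open>H\<^sup>1\<close> limits. It is the vanishing of \<open>u\<close> on the boundary that admits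
functions \<open>v\<close> without compact support.\<close>

theorem integration_by_parts:
  fixes u v :: "'n::finite func"
  assumes u: "u \<in> H01" and v: "smooth v"
  shows "inner_L2 (weak_partial i u) v = - inner_L2 u (partial_deriv i v)"
proof -
  obtain \<phi> where \<phi>: "\<And>k. \<phi> k \<in> test_functions" "(\<lambda>k. H1_norm (\<phi> k - u)) \<longlonglongrightarrow> 0" using u by (auto simp: H01_def)
  have uH: "u \<in> H1" by (rule H01_H1[OF u])
  have pH: "\<phi> k \<in> H1" for k by (intro smooth_H1 test_smooth \<phi>)
  have vL: "v \<in> L2" "partial_deriv i v \<in> L2" using v by (auto intro!: smooth_L2 smooth_partial_deriv)
  have eq: "inner_L2 (weak_partial i (\<phi> k)) v = - inner_L2 (\<phi> k) (partial_deriv i v)" for k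
  proof -
    have L: "\<phi> k \<in> L2" "partial_deriv i (\<phi> k) \<in> L2" using \<phi>(1) by (auto intro!: test_L2 test_partial_deriv)
    have "inner_L2 (weak_partial i (\<phi> k)) v = inner_L2 (partial_deriv i (\<phi> k)) v"
      by (intro l2.null_cong_left weak_partial_L2 pH L vL weak_partial_smooth test_smooth \<phi>)
    also have "\<dots> = inner_L2 v (partial_deriv i (\<phi> k))" by (rule l2.sym[OF L(2) vL(1)])
    also have "\<dots> = - inner_L2 (partial_deriv i v) (\<phi> k)"
      using smooth_has_weak_partial[OF v, of i] \<phi>(1) by (simp add: has_weak_partial_iff)
    also have "\<dots> = - inner_L2 (\<phi> k) (partial_deriv i v)" by (simp only: l2.sym[OF L(1) vL(2)])
    finally show ?thesis .
  qed
  have "(\<lambda>k. inner_L2 (\<phi> k) (partial_deriv i v)) \<longlonglongrightarrow> inner_L2 u (partial_deriv i v)"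
  proof (rule l2.tendsto_form[OF test_L2[OF \<phi>(1)] H1_L2[OF uH] vL(2)])
    show "(\<lambda>k. L2_norm (\<phi> k - u)) \<longlonglongrightarrow> 0"
    proof (rule Lim_null_comparison[OF always_eventually \<phi>(2)], rule allI)
      show "norm (L2_norm (\<phi> k - u)) \<le> H1_norm (\<phi> k - u)" for k
        using L2_norm_le_H1_norm[of "\<phi> k - u"] l2.N_nonneg[OF l2.diff_E[OF test_L2[OF \<phi>(1)[of k]] H1_L2[OF uH]]]
        unfolding real_norm_def by linarith
    qed
  qed
  moreover have "(\<lambda>k. inner_L2 (weak_partial i (\<phi> k)) v) \<longlonglongrightarrow> inner_L2 (weak_partial i u) v"
  proof (rule LIM_zero_cancel, rule Lim_null_comparison)
    show "(\<lambda>k. H1_norm (\<phi> k - u) * L2_norm v) \<longlonglongrightarrow> 0" by (rule tendsto_mult_left_zero[OF \<phi>(2)])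
    have "norm (inner_L2 (weak_partial i (\<phi> k)) v - inner_L2 (weak_partial i u) v) \<le> H1_norm (\<phi> k - u) * L2_norm v" for k
    proof -
      have d: "\<phi> k - u = \<phi> k + (-1) *\<^sub>R u" by (simp only: scaleR_minus1_left diff_conv_add_uminus)
      have m: "\<phi> k - u \<in> H1" unfolding d by (intro H1_lin pH uH)
      have "inner_L2 (weak_partial i (\<phi> k - u)) v = inner_L2 (weak_partial i (\<phi> k)) v - inner_L2 (weak_partial i u) v"
        unfolding d using inner_L2_weak_partial_lin[OF pH uH vL(1), of i k "-1"] by linarith
      hence "norm (inner_L2 (weak_partial i (\<phi> k)) v - inner_L2 (weak_partial i u) v) = \<bar>inner_L2 (weak_partial i (\<phi> k - u)) v\<bar>"
        by (simp only: real_norm_def)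
      also have "\<dots> \<le> L2_norm (weak_partial i (\<phi> k - u)) * L2_norm v"
        by (intro l2.cauchy_schwarz weak_partial_L2 m vL)
      also have "\<dots> \<le> H1_norm (\<phi> k - u) * L2_norm v"
        by (intro mult_right_mono weak_partial_norm_le_H1_norm l2.N_nonneg vL)
      finally show ?thesis .
    qed
    thus "\<forall>\<^sub>F k in sequentially. norm (inner_L2 (weak_partial i (\<phi> k)) v - inner_L2 (weak_partial i u) v) \<le> H1_norm (\<phi> k - u) * L2_norm v"
      by (intro always_eventually allI)
  qed
  ultimately show ?thesis unfolding eq using tendsto_minus LIMSEQ_unique by blast
qed

section \<open>Dirichlet eigenfunctions\<close>

lemma sine_deriv: "((\<lambda>t. sin (real n * pi * t)) has_real_derivative real n * pi * cos (real n * pi * t)) (at t)"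
  by (auto intro!: derivative_eq_intros)

text \<open>In each partial derivative one factor is a derivative of a cut-off sine, the others are cut-off sines; all are bounded
uniformly in \<open>n\<close> and converge pointwise.\<close>

lemma cut_sine_prod_H1_lim:
  fixes k :: "'n::finite \<Rightarrow> nat"
  shows "(\<lambda>n. H1_norm (prod_fun (\<lambda>i. cut_sine n (k i)) - sine_product k)) \<longlonglongrightarrow> 0"
proof -
  define \<phi> :: "nat \<Rightarrow> 'n func" where "\<phi> n = prod_fun (\<lambda>i. cut_sine n (k i))" for n
  define s :: "'n func" where "s = sine_product k"
  have sm: "smooth (\<phi> n)" "smooth s" for n
    unfolding \<phi>_def s_def by (auto intro!: test_smooth cut_sine_prod_test smooth_sine_product)
  have d: "\<phi> n - s = \<phi> n + (-1) *\<^sub>R s" for n by (simp only: scaleR_minus1_left diff_conv_add_uminus)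
  have smd: "smooth (\<phi> n - s)" for n unfolding d by (intro smooth_linear sm)
  have pd: "partial_deriv i (\<phi> n - s) = partial_deriv i (\<phi> n) - partial_deriv i s" for i n
    unfolding d partial_deriv_linear_smooth[OF sm] by (simp only: scaleR_minus1_left diff_conv_add_uminus)
  have wp: "(\<lambda>n. L2_norm (weak_partial i (\<phi> n - s))) \<longlonglongrightarrow> 0" for i
  proof -
    define C where "C = (\<Prod>l\<in>(UNIV :: 'n set). if l = i then 5 * real (k i) * pi else 1)"
    have p1: "partial_deriv i (\<phi> n) = prod_fun ((\<lambda>l. cut_sine n (k l))(i := cut_sine' n (k i)))" for n
      unfolding \<phi>_def by (rule partial_deriv_prod_fun) (rule cut_sine_derivative)
    have p2: "partial_deriv i s = prod_fun ((\<lambda>l t. sin (real (k l) * pi * t))(i := (\<lambda>t. real (k i) * pi * cos (real (k i) * pi * t))))"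
      unfolding s_def by (rule partial_deriv_prod_fun) (rule sine_deriv)
    have b1: "\<bar>partial_deriv i (\<phi> n) x\<bar> \<le> C" if "x \<in> \<Omega>" for n x
      unfolding p1 C_def using that
      by (intro prod_fun_bound) (auto simp: mem_Omega cut_sine_bound less_imp_le intro!: cut_sine'_bound)
    have b2: "\<bar>partial_deriv i s x\<bar> \<le> C" for x
    proof -
      have "\<bar>real (k i) * pi * cos t\<bar> \<le> 5 * real (k i) * pi" for t
      proof -
        have "\<bar>real (k i) * pi * cos t\<bar> = real (k i) * pi * \<bar>cos t\<bar>" by (simp add: abs_mult)
        also have "\<dots> \<le> real (k i) * pi * 5"
          by (intro mult_left_mono order.trans[OF abs_cos_le_one]) auto
        finally show ?thesis by simp
      qed
      thus ?thesis unfolding p2 C_def by (intro prod_fun_bound) (simp only: fun_upd_def abs_sin_le_one split: if_split, simp)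
    qed
    have "(\<lambda>n. L2_norm (partial_deriv i (\<phi> n) - partial_deriv i s)) \<longlonglongrightarrow> 0"
    proof (rule L2_norm_bounded_convergence[where C="2 * C"])
      show "partial_deriv i (\<phi> n) - partial_deriv i s \<in> borel_measurable (lebesgue_on \<Omega>)" for n
        by (intro L2_measurable l2.diff_E smooth_L2 smooth_partial_deriv sm)
      show "\<bar>(partial_deriv i (\<phi> n) - partial_deriv i s) x\<bar> \<le> 2 * C" if "x \<in> \<Omega>" for n x
        using b1[OF that, of n] b2[of x] by simp
      show "(\<lambda>n. (partial_deriv i (\<phi> n) - partial_deriv i s) x) \<longlonglongrightarrow> 0" if "x \<in> \<Omega>" for x
      proof -
        have "(\<lambda>n. partial_deriv i (\<phi> n) x) \<longlonglongrightarrow> partial_deriv i s x"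
          unfolding p1 p2 unfolding prod_fun_def using that
          by (intro tendsto_prod) (auto simp: mem_Omega intro!: cut_sine_lim)
        thus ?thesis using LIM_zero by fastforce
      qed
    qed
    moreover have "L2_norm (weak_partial i (\<phi> n - s)) = L2_norm (partial_deriv i (\<phi> n) - partial_deriv i s)" for n
      unfolding pd[symmetric]
      by (intro l2.null_cong_N weak_partial_L2 smooth_H1 smd smooth_L2 smooth_partial_deriv weak_partial_smooth)
    ultimately show ?thesis by simp
  qed
  have "(\<lambda>n. L2_norm (\<phi> n - s)) \<longlonglongrightarrow> 0" unfolding \<phi>_def s_def by (rule cut_sine_prod_L2_lim)
  hence "(\<lambda>n. sqrt ((L2_norm (\<phi> n - s))\<^sup>2 + (\<Sum>i\<in>UNIV. (L2_norm (weak_partial i (\<phi> n - s)))\<^sup>2)))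
      \<longlonglongrightarrow> sqrt (0\<^sup>2 + (\<Sum>i\<in>(UNIV :: 'n set). 0\<^sup>2))"
    by (intro tendsto_real_sqrt tendsto_add tendsto_power tendsto_sum wp)
  thus ?thesis by (simp add: H1_norm_def \<phi>_def s_def)
qed

lemma dirichlet_H01: "dirichlet_eigenfunction k \<in> H01"
proof -
  have "sine_product k \<in> H01"
    unfolding H01_def using cut_sine_prod_H1_lim[of k] cut_sine_prod_test[of _ k]
    by (intro CollectI conjI smooth_H1 smooth_sine_product exI[of _ "\<lambda>n. prod_fun (\<lambda>i. cut_sine n (k i))"] allI)
  thus ?thesis unfolding dirichlet_sine_product by (intro subspace_scale[OF subspace_H01])
qed

lemma dirichlet_second_derivative:
  "partial_deriv i (partial_deriv i (dirichlet_eigenfunction k)) = (- ((real (k i) * pi)\<^sup>2)) *\<^sub>R dirichlet_eigenfunction k"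
  for k :: "'n::finite \<Rightarrow> nat"
proof -
  let ?F = "\<lambda>l t. sin (real (k l) * pi * t)"
  let ?G = "\<lambda>t. real (k i) * pi * cos (real (k i) * pi * t)"
  let ?H = "\<lambda>t. - ((real (k i) * pi)\<^sup>2) * sin (real (k i) * pi * t)"
  define D where "D = (\<lambda>l t. real (k l) * pi * cos (real (k l) * pi * t))"
  have p1: "partial_deriv i (sine_product k) = prod_fun (?F(i := ?G))"
    by (rule partial_deriv_prod_fun) (rule sine_deriv)
  have "partial_deriv i (prod_fun (?F(i := ?G))) = prod_fun ((?F(i := ?G))(i := (D(i := ?H)) i))"
  proof (rule partial_deriv_prod_fun[where F'="D(i := ?H)"])
    fix l t
    show "((?F(i := ?G)) l has_real_derivative (D(i := ?H)) l t) (at t)"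
    proof (cases "l = i")
      case True
      have "(?G has_real_derivative ?H t) (at t)"
        by (auto intro!: derivative_eq_intros simp: power2_eq_square)
      thus ?thesis using True by simp
    next
      case False thus ?thesis using sine_deriv[of "k l" t] by (simp add: D_def)
    qed
  qed
  also have "\<dots> = (- ((real (k i) * pi)\<^sup>2)) *\<^sub>R sine_product k"
  proof
    fix x :: "real ^ 'n"
    have "prod_fun (?F(i := ?H)) x = ?H (x $ i) * (\<Prod>j\<in>UNIV - {i}. ?F j (x $ j))"
      unfolding prod_fun_def by (subst prod.remove[of UNIV i]) (auto intro!: prod.cong)
    also have "\<dots> = - ((real (k i) * pi)\<^sup>2) * (?F i (x $ i) * (\<Prod>j\<in>UNIV - {i}. ?F j (x $ j)))"
      by (simp only: mult.assoc)
    also have "?F i (x $ i) * (\<Prod>j\<in>UNIV - {i}. ?F j (x $ j)) = sine_product k x"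
      unfolding prod_fun_def by (subst prod.remove[of UNIV i]) auto
    finally show "prod_fun ((?F(i := ?G))(i := (D(i := ?H)) i)) x = ((- ((real (k i) * pi)\<^sup>2)) *\<^sub>R sine_product k) x"
      by (simp only: fun_upd_same fun_upd_upd scaleR_fun_def real_scaleR_def)
  qed
  finally have E: "partial_deriv i (partial_deriv i (sine_product k)) = (- ((real (k i) * pi)\<^sup>2)) *\<^sub>R sine_product k"
    unfolding p1 .
  show ?thesis unfolding dirichlet_sine_product
    by (simp only: partial_deriv_scale smooth_sine_product smooth_partial_deriv E) (rule scaleR_left_commute)
qed

definition eigval :: "('n::finite \<Rightarrow> nat) \<Rightarrow> real" where
  "eigval k = (\<Sum>i\<in>UNIV. (real (k i) * pi)\<^sup>2)"

lemma eigval_pos: "k \<in> multi_indices \<Longrightarrow> eigval k > 0"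
  unfolding eigval_def by (intro sum_pos) (auto simp: multi_indices_def Suc_le_eq)

text \<open>Two integrations by parts in the direction \<open>i\<close>, in which the eigenfunction reproduces itself.\<close>

lemma inner_L2_weak_partial_dirichlet:
  assumes "u \<in> H01"
  shows "inner_L2 (weak_partial i u) (weak_partial i (dirichlet_eigenfunction k)) = (real (k i) * pi)\<^sup>2 * inner_L2 u (dirichlet_eigenfunction k)"
proof -
  let ?e = "dirichlet_eigenfunction k"
  have uL: "u \<in> L2" "weak_partial i u \<in> L2" using assms by (auto intro: H1_L2 weak_partial_L2 H01_H1)
  have "inner_L2 (weak_partial i u) (weak_partial i ?e) = inner_L2 (weak_partial i u) (partial_deriv i ?e)"
    by (intro l2.null_cong_right uL weak_partial_L2 smooth_H1 smooth_dirichlet smooth_L2 smooth_partial_deriv weak_partial_smooth)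
  also have "\<dots> = - inner_L2 u (partial_deriv i (partial_deriv i ?e))"
    by (intro integration_by_parts assms smooth_partial_deriv smooth_dirichlet)
  also have "\<dots> = (real (k i) * pi)\<^sup>2 * inner_L2 u ?e"
    unfolding dirichlet_second_derivative using uL smooth_L2[OF smooth_dirichlet, of k] by (simp only: l2.scale_right)
  finally show ?thesis .
qed

lemma H1_form_dirichlet:
  assumes "u \<in> H01"
  shows "H1_form \<alpha> u (dirichlet_eigenfunction k) = (eigval k + \<alpha>) * inner_L2 u (dirichlet_eigenfunction k)"
  by (simp only: H1_form_split[OF H01_H1[OF assms] smooth_H1[OF smooth_dirichlet]] inner_L2_weak_partial_dirichlet[OF assms]
      eigval_def sum_distrib_right[symmetric] distrib_right)

text \<open>Eigenfunctions of the symmetric operators \<open>-\<partial>\<^sub>i\<^sup>2\<close> for different eigenvalues are orthogonal, and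
different multi-indices differ in some coordinate.\<close>

lemma dirichlet_orthogonal:
  assumes "k \<noteq> l"
  shows "inner_L2 (dirichlet_eigenfunction k) (dirichlet_eigenfunction l) = 0"
proof -
  let ?e = "dirichlet_eigenfunction k" and ?f = "dirichlet_eigenfunction l"
  obtain i where i: "k i \<noteq> l i" using assms by blast
  have L: "?e \<in> L2" "?f \<in> L2" by (intro smooth_L2 smooth_dirichlet)+
  have W: "weak_partial i ?e \<in> L2" "weak_partial i ?f \<in> L2" by (intro weak_partial_L2 smooth_H1 smooth_dirichlet)+
  have "(real (l i) * pi)\<^sup>2 * inner_L2 ?e ?f = (real (k i) * pi)\<^sup>2 * inner_L2 ?f ?e"
    using inner_L2_weak_partial_dirichlet[OF dirichlet_H01, of i k l] inner_L2_weak_partial_dirichlet[OF dirichlet_H01, of i l k]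
      l2.sym[OF W] by linarith
  hence "((real (l i) * pi)\<^sup>2 - (real (k i) * pi)\<^sup>2) * inner_L2 ?e ?f = 0"
    by (simp add: l2.sym[OF L] left_diff_distrib)
  moreover have "(real (l i) * pi)\<^sup>2 \<noteq> (real (k i) * pi)\<^sup>2"
    using i by (simp add: power_mult_distrib)
  ultimately show ?thesis by simp
qed

text \<open>The eigenfunction is continuous and does not vanish at the point with the coordinates \<open>1 / (2 k\<^sub>i)\<close>.\<close>

lemma dirichlet_norm_pos:
  fixes k :: "'n::finite \<Rightarrow> nat"
  assumes "k \<in> multi_indices"
  shows "inner_L2 (dirichlet_eigenfunction k) (dirichlet_eigenfunction k) > 0"
proof (rule ccontr)
  let ?e = "dirichlet_eigenfunction k :: 'n func"
  have eL: "?e \<in> L2" by (intro smooth_L2 smooth_dirichlet)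
  assume "\<not> ?thesis"
  hence "inner_L2 ?e ?e = 0" using l2.nonneg[OF eL] by linarith
  hence "L2_norm ?e = 0" using l2.N_sq[OF eL] by simp
  hence "AE x in lebesgue_on \<Omega>. ?e x = 0" by (rule L2_null_AE[OF eL])
  hence ae: "AE x in lebesgue. x \<in> \<Omega> \<longrightarrow> ?e x = 0" using Omega_sets by (subst (asm) AE_restrict_space_iff) auto
  define U where "U = {x \<in> \<Omega>. ?e x \<noteq> 0}"
  have "open U"
  proof -
    have "open (\<Omega> \<inter> ?e -` (- {0}))"
      by (intro continuous_open_preimage continuous_on_subset[OF smooth_continuous[OF smooth_dirichlet]])
         (auto simp: \<Omega>_def)
    moreover have "\<Omega> \<inter> ?e -` (- {0}) = U" by (auto simp: U_def)
    ultimately show ?thesis by simp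
  qed
  have "negligible U"
  proof -
    have "U \<in> sets lebesgue" using \<open>open U\<close> by (intro sets_completionI_sets) simp
    moreover have "AE x in lebesgue. x \<notin> U" using ae by (auto simp: U_def elim!: eventually_mono)
    ultimately show ?thesis unfolding negligible_iff_null_sets by (rule iffD2[OF AE_iff_null_sets])
  qed
  hence "U = {}" using \<open>open U\<close> open_not_negligible by blast
  define y :: "real ^ 'n" where "y = (\<chi> i. 1 / (2 * real (k i)))"
  have k1: "k i \<ge> 1" for i using assms by (simp add: multi_indices_def)
  have "0 < y $ i \<and> y $ i < 1" for i
  proof -
    have "1 \<le> real (k i)" using k1[of i] by simp
    thus ?thesis by (simp add: y_def field_simps)
  qed
  hence "y \<in> \<Omega>" by (simp add: mem_Omega)
  moreover have "real (k i) * pi * y $ i = pi / 2" for i using k1[of i] by (simp add: y_def)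
  hence "sin (real (k i) * pi * y $ i) = 1" for i by (simp only: sin_pi_half)
  hence "?e y \<noteq> 0" by (simp add: dirichlet_eigenfunction_def)
  ultimately show False using \<open>U = {}\<close> by (auto simp: U_def)
qed

abbreviation laplacian :: "('n::finite func) \<Rightarrow> 'n func" where
  "laplacian f \<equiv> \<Sum>i\<in>UNIV. partial_deriv i (partial_deriv i f)"

lemma smooth_cong_H1:
  assumes "smooth v" "w \<in> L2" "L2_norm (w - v) = 0"
  shows "w \<in> H1" "L2_norm (weak_partial i w - partial_deriv i v) = 0"
proof -
  have "L2_norm (v - w) = 0" using assms l2.N_diff_commute[OF assms(2) smooth_L2[OF assms(1)]] by simp
  hence h: "has_weak_partial i w (partial_deriv i v)" for i
    by (rule has_weak_partial_null_cong[OF smooth_L2[OF assms(1)] assms(2) _ smooth_has_weak_partial[OF assms(1)]])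
  have L: "partial_deriv i v \<in> L2" for i by (intro smooth_L2 smooth_partial_deriv assms)
  show "w \<in> H1" by (rule H1I[OF assms(2) L h])
  thus "L2_norm (weak_partial i w - partial_deriv i v) = 0" by (intro weak_partial_eq L h)
qed

text \<open>The classical Laplacian represents the weak one. The second weak derivatives are those of the representative
\<open>weak_partial i v\<close>, which agrees with the classical derivative only almost everywhere.\<close>

lemma smooth_H2:
  assumes "smooth v"
  shows "v \<in> H2" "weak_laplacian v \<in> L2"
    "L2_norm (weak_laplacian v - laplacian v) = 0"
proof -
  have c: "weak_partial i v \<in> L2" "L2_norm (weak_partial i v - partial_deriv i v) = 0" for i
    using assms by (auto intro!: weak_partial_L2 smooth_H1 weak_partial_smooth)
  have m: "weak_partial i v \<in> H1" for i
    by (rule smooth_cong_H1(1)[OF smooth_partial_deriv[OF assms] c])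
  have n: "L2_norm (weak_partial j (weak_partial i v) - partial_deriv j (partial_deriv i v)) = 0" for i j
    by (rule smooth_cong_H1(2)[OF smooth_partial_deriv[OF assms] c])
  show "v \<in> H2" using m assms by (auto simp: H2_def intro: smooth_H1)
  have W: "weak_partial i (weak_partial i v) \<in> L2" for i by (intro weak_partial_L2 m)
  have D: "partial_deriv i (partial_deriv i v) \<in> L2" for i by (intro smooth_L2 smooth_partial_deriv assms)
  show "weak_laplacian v \<in> L2" unfolding weak_laplacian_def by (rule l2.sum_E[OF W])
  have "L2_norm (weak_laplacian v - laplacian v)
      = L2_norm (\<Sum>i\<in>UNIV. weak_partial i (weak_partial i v) - partial_deriv i (partial_deriv i v))"
    unfolding weak_laplacian_def sum_subtractf ..
  also have "\<dots> \<le> (\<Sum>i\<in>UNIV. L2_norm (weak_partial i (weak_partial i v) - partial_deriv i (partial_deriv i v)))"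
    by (intro l2.N_sum_le l2.diff_E W D)
  also have "\<dots> = 0" using n by simp
  finally show "L2_norm (weak_laplacian v - laplacian v) = 0"
    using l2.N_nonneg[OF l2.diff_E[OF \<open>weak_laplacian v \<in> L2\<close> l2.sum_E[OF D]]] by (rule order.antisym)
qed

lemma weak_laplacian_dirichlet:
  "L2_norm (weak_laplacian (dirichlet_eigenfunction k) - (- eigval k) *\<^sub>R dirichlet_eigenfunction k) = 0"
proof -
  have "laplacian (dirichlet_eigenfunction k) = (- eigval k) *\<^sub>R dirichlet_eigenfunction k"
    unfolding dirichlet_second_derivative eigval_def scaleR_left.sum[symmetric] by (simp only: sum_negf)
  thus ?thesis using smooth_H2(3)[OF smooth_dirichlet, of k] by simp
qed

section \<open>The enumeration of the eigenfunctions\<close>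

lemma mi_less_irrefl: "\<not> mi_less k k"
  by (simp add: mi_less_def)

lemma mi_less_trans:
  assumes "mi_less k l" "mi_less l m"
  shows "mi_less k m"
proof (cases "(\<Sum>i\<in>UNIV. (k i)\<^sup>2) = (\<Sum>i\<in>UNIV. (l i)\<^sup>2) \<and> (\<Sum>i\<in>UNIV. (l i)\<^sup>2) = (\<Sum>i\<in>UNIV. (m i)\<^sup>2)")
  case True
  then obtain i j where i: "k i < l i" "\<forall>i'<i. k i' = l i'" and j: "l j < m j" "\<forall>j'<j. l j' = m j'"
    using assms unfolding mi_less_def by auto
  have "k (min i j) < m (min i j) \<and> (\<forall>i'<min i j. k i' = m i')"
    using i j by (cases i j rule: linorder_cases) (auto simp: min_def)
  thus ?thesis using True unfolding mi_less_def by auto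
next
  case False
  thus ?thesis using assms unfolding mi_less_def by (auto dest: less_trans)
qed

lemma mi_less_total:
  fixes k l :: "'n::{finite, linorder} \<Rightarrow> nat"
  assumes "k \<noteq> l"
  shows "mi_less k l \<or> mi_less l k"
proof (cases "(\<Sum>i\<in>UNIV. (k i)\<^sup>2) = (\<Sum>i\<in>UNIV. (l i)\<^sup>2)")
  case True
  define D where "D = {i. k i \<noteq> l i}"
  have D: "finite D" "D \<noteq> {}" using assms by (auto simp: D_def)
  define i where "i = Min D"
  have "i \<in> D" unfolding i_def using D by (rule Min_in)
  hence ne: "k i \<noteq> l i" by (simp add: D_def)
  have eq: "k i' = l i'" if "i' < i" for i'
  proof (rule ccontr)
    assume "k i' \<noteq> l i'"
    hence "i \<le> i'" unfolding i_def using D by (intro Min_le) (auto simp: D_def)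
    thus False using that by simp
  qed
  show ?thesis using True ne eq unfolding mi_less_def by (metis linorder_neqE_nat)
next
  case False
  thus ?thesis unfolding mi_less_def by linarith
qed

text \<open>The position of \<open>k\<close> in the enumeration is \<open>mi_rank k + 1\<close>.\<close>

definition mi_rank :: "('n::{finite, linorder} \<Rightarrow> nat) \<Rightarrow> nat" where
  "mi_rank k = card {l \<in> multi_indices. mi_less l k}"

lemma finite_mi_predecessors: "finite {l \<in> multi_indices. mi_less l k}"
  for k :: "'n::{finite, linorder} \<Rightarrow> nat"
proof (rule finite_subset)
  define b where "b = (\<Sum>i\<in>UNIV. (k i)\<^sup>2)"
  show "{l \<in> multi_indices. mi_less l k} \<subseteq> PiE UNIV (\<lambda>_. {..b})"
  proof
    fix l assume "l \<in> {l \<in> multi_indices. mi_less l k}"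
    hence s: "(\<Sum>i\<in>UNIV. (l i)\<^sup>2) \<le> b" by (auto simp: mi_less_def b_def)
    have "l i \<le> b" for i
    proof -
      have "l i \<le> (l i)\<^sup>2" by (cases "l i") (auto simp: power2_eq_square)
      also have "\<dots> \<le> (\<Sum>i\<in>UNIV. (l i)\<^sup>2)" by (rule member_le_sum[where f="\<lambda>i. (l i)\<^sup>2"]) auto
      finally show ?thesis using s by simp
    qed
    thus "l \<in> PiE UNIV (\<lambda>_. {..b})" by auto
  qed
qed (intro finite_PiE; simp)

lemma mi_rank_less:
  assumes "k \<in> multi_indices" "mi_less k l"
  shows "mi_rank k < mi_rank l"
  unfolding mi_rank_def
proof (rule psubset_card_mono[OF finite_mi_predecessors])
  show "{j \<in> multi_indices. mi_less j k} \<subset> {j \<in> multi_indices. mi_less j l}"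
    using assms mi_less_trans mi_less_irrefl by blast
qed

lemma mi_rank_inj: "inj_on mi_rank multi_indices"
  by (rule inj_onI, rule ccontr) (use mi_less_total mi_rank_less in \<open>metis less_irrefl\<close>)

text \<open>The rank is injective on an infinite set, so it is unbounded, and the \<open>mi_rank k\<close> predecessors of \<open>k\<close> take all
the smaller values.\<close>

lemma mi_rank_surj: "\<exists>k\<in>(multi_indices :: ('n::{finite, linorder} \<Rightarrow> nat) set). mi_rank k = r"
proof -
  have "infinite (multi_indices :: ('n \<Rightarrow> nat) set)"
  proof
    assume "finite (multi_indices :: ('n \<Rightarrow> nat) set)"
    moreover have "range (\<lambda>n (_::'n). Suc n) \<subseteq> multi_indices" by (auto simp: multi_indices_def)
    ultimately have "finite (range (\<lambda>n (_::'n). Suc n))" using finite_subset by blast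
    moreover have "inj (\<lambda>n (_::'n). Suc n)" by (rule injI) (metis nat.inject)
    ultimately show False using finite_imageD by blast
  qed
  hence "infinite (mi_rank ` (multi_indices :: ('n \<Rightarrow> nat) set))"
    using finite_imageD[OF _ mi_rank_inj] by blast
  hence "\<not> mi_rank ` (multi_indices :: ('n \<Rightarrow> nat) set) \<subseteq> {..<r}" using finite_subset by blast
  then obtain k :: "'n \<Rightarrow> nat" where k: "k \<in> multi_indices" "\<not> mi_rank k < r" by blast
  show ?thesis
  proof (cases "mi_rank k = r")
    case True thus ?thesis using k by blast
  next
    case False
    define A where "A = {l \<in> multi_indices. mi_less l k}"
    have "mi_rank ` A \<subseteq> {..<mi_rank k}" using mi_rank_less by (auto simp: A_def)
    moreover have "card (mi_rank ` A) = card {..<mi_rank k}"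
      using card_image[OF inj_on_subset[OF mi_rank_inj], of A] by (simp add: mi_rank_def A_def)
    ultimately have "mi_rank ` A = {..<mi_rank k}" by (intro card_subset_eq) auto
    hence "r \<in> mi_rank ` A" using False k(2) by simp
    thus ?thesis by (auto simp: A_def)
  qed
qed

lemma mi_enum_rank:
  assumes "k \<in> multi_indices"
  shows "mi_enum (Suc (mi_rank k)) = k"
  unfolding mi_enum_def mi_rank_def[symmetric]
proof (rule the_equality)
  show "k \<in> multi_indices \<and> Suc (mi_rank k) = Suc (mi_rank k)" using assms by simp
  show "l = k" if "l \<in> multi_indices \<and> Suc (mi_rank l) = Suc (mi_rank k)" for l
    using that assms inj_onD[OF mi_rank_inj, of l k] by simp
qed

lemma mi_enum_props:
  assumes "j \<ge> 1"
  shows "(mi_enum j :: 'n::{finite, linorder} \<Rightarrow> nat) \<in> multi_indices" "Suc (mi_rank (mi_enum j :: 'n \<Rightarrow> nat)) = j"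
proof -
  obtain k :: "'n \<Rightarrow> nat" where k: "k \<in> multi_indices" "mi_rank k = j - 1" using mi_rank_surj by blast
  have "mi_enum j = k" using mi_enum_rank[OF k(1)] k(2) assms by simp
  thus "(mi_enum j :: 'n \<Rightarrow> nat) \<in> multi_indices" "Suc (mi_rank (mi_enum j :: 'n \<Rightarrow> nat)) = j"
    using k assms by auto
qed

lemma eigenfunction_smooth: "smooth (eigenfunction j)"
  unfolding eigenfunction_def by (rule smooth_dirichlet)

lemma eigenfunction_L2: "eigenfunction j \<in> L2"
  by (intro smooth_L2 eigenfunction_smooth)

lemma eigenfunction_H01: "eigenfunction j \<in> H01"
  unfolding eigenfunction_def by (rule dirichlet_H01)

lemma eigenfunction_orthogonal:
  assumes "i \<ge> 1" "j \<ge> 1" "i \<noteq> j"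
  shows "inner_L2 (eigenfunction i :: 'n::{finite, linorder} func) (eigenfunction j) = 0"
proof -
  have "(mi_enum i :: 'n \<Rightarrow> nat) \<noteq> mi_enum j" using mi_enum_props(2)[OF assms(1), where 'n='n] mi_enum_props(2)[OF assms(2), where 'n='n] assms(3) by metis
  thus ?thesis unfolding eigenfunction_def by (rule dirichlet_orthogonal)
qed

lemma eigenfunction_norm_pos: "j \<ge> 1 \<Longrightarrow> inner_L2 (eigenfunction j) (eigenfunction j) > 0"
  unfolding eigenfunction_def by (intro dirichlet_norm_pos mi_enum_props)

text \<open>Each eigenfunction occurs in the enumeration, so sine polynomials are combinations of initial segments of it.\<close>

lemma sine_span_lincomb:
  assumes "s \<in> (sine_span :: ('n::{finite, linorder} func) set)"
  shows "\<exists>P c. s = (\<Sum>j=1..P. c j *\<^sub>R eigenfunction j)"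
  using assms unfolding sine_span_def
proof (induction rule: span_induct_alt)
  case base
  show ?case by (intro exI[of _ 0]) simp
next
  case (step d x y)
  then obtain P c where y: "y = (\<Sum>j=1..P. c j *\<^sub>R eigenfunction j)" by blast
  obtain k where k: "k \<in> multi_indices" "x = dirichlet_eigenfunction k" using step by blast
  define l where "l = Suc (mi_rank k)"
  have x: "x = eigenfunction l" unfolding eigenfunction_def l_def using mi_enum_rank[OF k(1)] k(2) by simp
  define Q where "Q = max P l"
  have "y = (\<Sum>j=1..Q. (if j \<le> P then c j else 0) *\<^sub>R eigenfunction j)"
    unfolding y Q_def by (intro sum.mono_neutral_cong_left) auto
  moreover have "d *\<^sub>R x = (\<Sum>j=1..Q. (if j = l then d else 0) *\<^sub>R eigenfunction j)"
  proof -
    have "(\<Sum>j=1..Q. (if j = l then d else 0) *\<^sub>R eigenfunction j) = (\<Sum>j=1..Q. if j = l then d *\<^sub>R eigenfunction l else (0 :: 'n func))"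
      by (intro sum.cong) auto
    also have "\<dots> = d *\<^sub>R x" by (simp add: x Q_def l_def)
    finally show ?thesis by simp
  qed
  ultimately have "d *\<^sub>R x + y = (\<Sum>j=1..Q. ((if j = l then d else 0) + (if j \<le> P then c j else 0)) *\<^sub>R eigenfunction j)"
    by (simp only: scaleR_add_left sum.distrib)
  thus ?case by (intro exI)
qed

section \<open>Completeness of the eigenfunctions\<close>

lemma orthogonal_basis_L2: "orthogonal_basis (L2 :: ('n::{finite, linorder} func) set) inner_L2 eigenfunction"
proof (intro orthogonal_basis.intro orthogonal_basis_axioms.intro semi_inner_L2)
  fix x :: "'n func" and \<epsilon> :: real assume "x \<in> L2" "\<epsilon> > 0"
  then obtain s where s: "s \<in> sine_span" "L2_norm (x - s) < \<epsilon>" using sine_span_dense_L2 by blast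
  then obtain P c where Pc: "s = (\<Sum>j=1..P. c j *\<^sub>R eigenfunction j)" using sine_span_lincomb by blast
  have "L2_norm (x - (\<Sum>j=1..P. c j *\<^sub>R eigenfunction j)) < \<epsilon>" using s(2) unfolding Pc .
  hence "semi_inner.N inner_L2 (x - (\<Sum>j=1..P. c j *\<^sub>R eigenfunction j)) < \<epsilon>"
    by (simp only: semi_inner.N_def[OF semi_inner_L2] l2.N_def)
  thus "\<exists>P c. semi_inner.N inner_L2 (x - (\<Sum>j=1..P. c j *\<^sub>R eigenfunction j)) < \<epsilon>" by blast
qed (auto intro: eigenfunction_L2 eigenfunction_orthogonal eigenfunction_norm_pos)

interpretation modes: orthogonal_basis "L2 :: ('n::{finite, linorder} func) set" inner_L2 eigenfunction
  rewrites "semi_inner.N inner_L2 = L2_norm"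
proof -
  show "orthogonal_basis (L2 :: ('n::{finite, linorder} func) set) inner_L2 eigenfunction" by (rule orthogonal_basis_L2)
  show "semi_inner.N (inner_L2 :: ('n::{finite, linorder} func) \<Rightarrow> _) = L2_norm"
    by (rule ext) (simp only: semi_inner.N_def[OF semi_inner_L2] l2.N_def)
qed

text \<open>The eigenvalue of \<open>-\<Delta> + \<alpha>\<close> at the \<open>j\<close>-th eigenfunction; the type argument carries the dimension.\<close>

definition shifted_eigval :: "'n::{finite, linorder} itself \<Rightarrow> real \<Rightarrow> nat \<Rightarrow> real" where
  "shifted_eigval _ \<alpha> j = eigval (mi_enum j :: 'n \<Rightarrow> nat) + \<alpha>"

lemma shifted_eigval_pos: "\<alpha> \<ge> 0 \<Longrightarrow> j \<ge> 1 \<Longrightarrow> shifted_eigval TYPE('n::{finite, linorder}) \<alpha> j > 0"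
  using eigval_pos[OF mi_enum_props(1)[of j, where 'n='n]] by (simp add: shifted_eigval_def)

lemma H1_form_eigenfunction:
  fixes u :: "'n::{finite, linorder} func"
  assumes "u \<in> H01"
  shows "H1_form \<alpha> u (eigenfunction j) = shifted_eigval TYPE('n) \<alpha> j * inner_L2 u (eigenfunction j)"
  unfolding eigenfunction_def shifted_eigval_def by (rule H1_form_dirichlet[OF assms])

lemma H1_form_smooth:
  assumes u: "u \<in> H01" and f: "smooth f"
  shows "H1_form \<alpha> u f = inner_L2 u (\<alpha> *\<^sub>R f - laplacian f)"
proof -
  have uL: "u \<in> L2" "weak_partial i u \<in> L2" for i using u by (auto intro: H1_L2 weak_partial_L2 H01_H1)
  have fL: "f \<in> L2" "partial_deriv i (partial_deriv i f) \<in> L2" for i using f by (auto intro!: smooth_L2 smooth_partial_deriv)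
  have "inner_L2 (weak_partial i u) (weak_partial i f) = - inner_L2 u (partial_deriv i (partial_deriv i f))" for i
  proof -
    have "inner_L2 (weak_partial i u) (weak_partial i f) = inner_L2 (weak_partial i u) (partial_deriv i f)"
      by (intro l2.null_cong_right uL weak_partial_L2 smooth_H1 f smooth_L2 smooth_partial_deriv weak_partial_smooth)
    also have "\<dots> = - inner_L2 u (partial_deriv i (partial_deriv i f))"
      by (intro integration_by_parts u smooth_partial_deriv f)
    finally show ?thesis .
  qed
  hence "H1_form \<alpha> u f = \<alpha> * inner_L2 u f - (\<Sum>i\<in>UNIV. inner_L2 (partial_deriv i (partial_deriv i f)) u)"
    by (simp add: H1_form_split[OF H01_H1[OF u] smooth_H1[OF f]] sum_negf l2.sym[OF fL(2) uL(1)])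
  also have "(\<Sum>i\<in>UNIV. inner_L2 (partial_deriv i (partial_deriv i f)) u) = inner_L2 u (laplacian f)"
    unfolding l2.sym[OF uL(1) l2.sum_E[OF fL(2)]] by (rule l2.sum_left[OF fL(2) uL(1), symmetric])
  finally show ?thesis
    by (simp only: l2.diff_right[OF l2.scale_E[OF fL(1)] l2.sum_E[OF fL(2)] uL(1)] l2.scale_right[OF fL(1) uL(1)])
qed

text \<open>Let \<open>r\<close> be the error of the \<open>L\<^sup>2\<close> projection \<open>s\<close>. By the eigenvalue relation \<open>r\<close> is orthogonal to \<open>s\<close> also in
the energy, so its energy is \<open>\<langle>r, \<phi>\<rangle>\<close> in the energy form, which is the \<open>L\<^sup>2\<close> product of \<open>r\<close> and
\<open>-\<Delta>\<phi> + \<alpha>\<phi>\<close>.\<close>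

theorem test_function_sine_approx:
  fixes \<phi> :: "'n::{finite, linorder} func"
  assumes \<phi>: "\<phi> \<in> test_functions" and \<alpha>: "\<alpha> \<ge> 0"
  shows "(\<lambda>P. H01_norm \<alpha> (\<phi> - modes.proj P \<phi>)) \<longlonglongrightarrow> 0"
proof -
  interpret h: semi_inner "H01 :: ('n func) set" "H1_form \<alpha>" by (rule semi_inner_H01[OF \<alpha>])
  have pH: "\<phi> \<in> H01" "\<phi> \<in> L2" by (rule test_H01[OF \<phi>], rule test_L2[OF \<phi>])
  define \<psi> where "\<psi> = \<alpha> *\<^sub>R \<phi> - laplacian \<phi>"
  have \<psi>: "\<psi> \<in> L2" unfolding \<psi>_def
    by (intro l2.diff_E l2.scale_E l2.sum_E pH smooth_L2 smooth_partial_deriv test_smooth \<phi>)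
  have sH: "modes.proj P \<phi> \<in> H01" for P
    unfolding modes.proj_def by (intro h.sum_E h.scale_E eigenfunction_H01)
  have bound: "H01_norm \<alpha> (\<phi> - modes.proj P \<phi>) \<le> sqrt (L2_norm (\<phi> - modes.proj P \<phi>) * L2_norm \<psi>)" for P
  proof -
    let ?s = "modes.proj P \<phi>"
    have d: "\<phi> - ?s \<in> H01" by (rule h.diff_E[OF pH(1) sH])
    have dL: "\<phi> - ?s \<in> L2" by (rule H1_L2[OF H01_H1[OF d]])
    \<comment> \<open>the projection error is orthogonal to the modes in \<open>L\<^sup>2\<close>, hence by the eigenvalue relation also in the energy\<close>
    have o: "inner_L2 (\<phi> - ?s) (eigenfunction j) = 0" if j: "j \<in> {1..P}" for j
    proof -
      have "inner_L2 ?s (eigenfunction j) = modes.coef \<phi> j * inner_L2 (eigenfunction j) (eigenfunction j :: 'n func)"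
        unfolding modes.proj_def by (rule modes.form_lincomb_b[OF j])
      also have "\<dots> = inner_L2 \<phi> (eigenfunction j)" using eigenfunction_norm_pos[of j, where 'a='n] j by (simp add: modes.coef_def)
      finally show ?thesis using l2.diff_left[OF pH(2) modes.proj_E eigenfunction_L2, of P \<phi> j] by simp
    qed
    have "H1_form \<alpha> ?s (\<phi> - ?s) = 0"
    proof -
      have "H1_form \<alpha> ?s (\<phi> - ?s) = (\<Sum>j=1..P. H1_form \<alpha> (modes.coef \<phi> j *\<^sub>R eigenfunction j) (\<phi> - ?s))"
        unfolding modes.proj_def[of P] by (rule h.sum_left) (use d[unfolded modes.proj_def[of P]] eigenfunction_H01 h.scale_E in blast)+
      also have "\<dots> = (\<Sum>j=1..P. 0)"
      proof (intro sum.cong refl)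
        fix j assume j: "j \<in> {1..P}"
        have "H1_form \<alpha> (modes.coef \<phi> j *\<^sub>R eigenfunction j) (\<phi> - ?s) = modes.coef \<phi> j * H1_form \<alpha> (\<phi> - ?s) (eigenfunction j)"
          by (simp only: h.scale_left[OF eigenfunction_H01 d] h.sym[OF eigenfunction_H01 d])
        also have "\<dots> = 0" by (simp only: H1_form_eigenfunction[OF d] o[OF j] mult_zero_right)
        finally show "H1_form \<alpha> (modes.coef \<phi> j *\<^sub>R eigenfunction j) (\<phi> - ?s) = 0" .
      qed
      finally show ?thesis by simp
    qed
    hence "H1_form \<alpha> (\<phi> - ?s) (\<phi> - ?s) = H1_form \<alpha> (\<phi> - ?s) \<phi>"
      using h.diff_left[OF pH(1) sH d, of P] h.sym[OF pH(1) d] by linarith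
    also have "\<dots> = inner_L2 (\<phi> - ?s) \<psi>" unfolding \<psi>_def by (rule H1_form_smooth[OF d test_smooth[OF \<phi>]])
    also have "\<dots> \<le> L2_norm (\<phi> - ?s) * L2_norm \<psi>"
      using l2.cauchy_schwarz[OF dL \<psi>] by linarith
    finally show ?thesis unfolding H01_norm_form by (rule real_sqrt_le_mono)
  qed
  have "(\<lambda>P. sqrt (L2_norm (\<phi> - modes.proj P \<phi>) * L2_norm \<psi>)) \<longlonglongrightarrow> sqrt (0 * L2_norm \<psi>)"
    by (intro tendsto_real_sqrt tendsto_mult tendsto_const modes.proj_tendsto pH)
  hence lim: "(\<lambda>P. sqrt (L2_norm (\<phi> - modes.proj P \<phi>) * L2_norm \<psi>)) \<longlonglongrightarrow> 0" by simp
  show ?thesis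
  proof (rule Lim_null_comparison[OF always_eventually lim], rule allI)
    fix P
    have "0 \<le> H01_norm \<alpha> (\<phi> - modes.proj P \<phi>)"
      unfolding H01_norm_form using h.nonneg[OF h.diff_E[OF pH(1) sH]] by simp
    thus "norm (H01_norm \<alpha> (\<phi> - modes.proj P \<phi>)) \<le> sqrt (L2_norm (\<phi> - modes.proj P \<phi>) * L2_norm \<psi>)"
      using bound[of P] by simp
  qed
qed

text \<open>Functions vanishing on the boundary are by definition \<open>H\<^sup>1\<close> limits of test functions, and the
\<open>H\<^sup>1\<close> norm dominates the energy norm.\<close>

lemma orthogonal_basis_H01:
  assumes \<alpha>: "\<alpha> \<ge> 0"
  shows "orthogonal_basis (H01 :: ('n::{finite, linorder} func) set) (H1_form \<alpha>) eigenfunction"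
proof (intro orthogonal_basis.intro orthogonal_basis_axioms.intro semi_inner_H01[OF \<alpha>])
  fix j :: nat
  show "eigenfunction j \<in> (H01 :: ('n func) set)" by (rule eigenfunction_H01)
  assume j: "j \<ge> 1"
  show "0 < H1_form \<alpha> (eigenfunction j) (eigenfunction j :: 'n func)"
    unfolding H1_form_eigenfunction[OF eigenfunction_H01]
    by (intro mult_pos_pos shifted_eigval_pos \<alpha> j eigenfunction_norm_pos)
  fix i :: nat assume "i \<ge> 1" "i \<noteq> j"
  thus "H1_form \<alpha> (eigenfunction i) (eigenfunction j :: 'n func) = 0"
    unfolding H1_form_eigenfunction[OF eigenfunction_H01] using eigenfunction_orthogonal[of i j, where 'n='n] j by simp
next
  interpret h: semi_inner "H01 :: ('n func) set" "H1_form \<alpha>"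
    rewrites "semi_inner.N (H1_form \<alpha>) = (H01_norm \<alpha> :: ('n func) \<Rightarrow> real)"
  proof -
    show "semi_inner (H01 :: ('n func) set) (H1_form \<alpha>)" by (rule semi_inner_H01[OF \<alpha>])
    show "semi_inner.N (H1_form \<alpha>) = (H01_norm \<alpha> :: ('n func) \<Rightarrow> real)" by (rule H01_norm_eq_N[OF \<alpha>])
  qed
  fix x :: "'n func" and \<epsilon> :: real assume x: "x \<in> H01" and \<epsilon>: "\<epsilon> > 0"
  obtain \<phi> where \<phi>: "\<And>k. \<phi> k \<in> test_functions" "(\<lambda>k. H1_norm (\<phi> k - x)) \<longlonglongrightarrow> 0" using x by (auto simp: H01_def)
  have "(\<lambda>k. sqrt (1 + \<alpha>) * H1_norm (\<phi> k - x)) \<longlonglongrightarrow> 0" by (rule tendsto_mult_right_zero[OF \<phi>(2)])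
  hence "\<forall>\<^sub>F k in sequentially. sqrt (1 + \<alpha>) * H1_norm (\<phi> k - x) < \<epsilon> / 2"
    using \<epsilon> by (intro order_tendstoD(2)) auto
  then obtain k where k: "sqrt (1 + \<alpha>) * H1_norm (\<phi> k - x) < \<epsilon> / 2" unfolding eventually_sequentially by blast
  have pk: "\<phi> k \<in> H01" by (rule test_H01[OF \<phi>(1)])
  have "H01_norm \<alpha> (\<phi> k - x) < \<epsilon> / 2"
    using H01_norm_le_H1_norm[OF H01_H1[OF h.diff_E[OF pk x]] \<alpha>] k by linarith
  hence n1: "H01_norm \<alpha> (x - \<phi> k) < \<epsilon> / 2" by (simp only: h.N_diff_commute[OF x pk])
  have "\<forall>\<^sub>F P in sequentially. H01_norm \<alpha> (\<phi> k - modes.proj P (\<phi> k)) < \<epsilon> / 2"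
    using test_function_sine_approx[OF \<phi>(1) \<alpha>, of k] \<epsilon> by (intro order_tendstoD(2)) auto
  then obtain P where n2: "H01_norm \<alpha> (\<phi> k - modes.proj P (\<phi> k)) < \<epsilon> / 2" unfolding eventually_sequentially by blast
  have "modes.proj P (\<phi> k) \<in> H01" unfolding modes.proj_def by (intro h.sum_E h.scale_E eigenfunction_H01)
  from h.N_diff_triangle[OF x pk this] n1 n2 have "H01_norm \<alpha> (x - modes.proj P (\<phi> k)) < \<epsilon>" by linarith
  hence "semi_inner.N (H1_form \<alpha>) (x - (\<Sum>j=1..P. modes.coef (\<phi> k) j *\<^sub>R eigenfunction j)) < \<epsilon>"
    unfolding H01_norm_eq_N[OF \<alpha>] modes.proj_def .
  thus "\<exists>P c. semi_inner.N (H1_form \<alpha>) (x - (\<Sum>j=1..P. c j *\<^sub>R eigenfunction j)) < \<epsilon>" by blast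
qed

section \<open>Energy-valued integrals tested against a state\<close>

definition energy_form :: "real \<Rightarrow> 'n::finite state \<Rightarrow> 'n state \<Rightarrow> real" where
  "energy_form \<alpha> \<Phi> \<Psi> = H1_form \<alpha> (fst \<Phi>) (fst \<Psi>) + inner_L2 (snd \<Phi>) (snd \<Psi>)"

lemma semi_inner_energy:
  assumes "\<alpha> \<ge> 0"
  shows "semi_inner (energy_space :: 'n::finite state set) (energy_form \<alpha>)"
proof -
  interpret h: semi_inner "H01 :: ('n func) set" "H1_form \<alpha>" by (rule semi_inner_H01[OF assms])
  show ?thesis
  proof
    show "subspace (energy_space :: 'n state set)"
      unfolding energy_space_def by (rule subspace_Times[OF h.subspace_E l2.subspace_E])
  next
    fix x y z :: "'n state" and c :: real assume "x \<in> energy_space" "y \<in> energy_space"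
    hence xy: "fst x \<in> H01" "snd x \<in> L2" "fst y \<in> H01" "snd y \<in> L2" by (auto simp: energy_space_def)
    show "energy_form \<alpha> x y = energy_form \<alpha> y x"
      unfolding energy_form_def h.sym[OF xy(1,3)] l2.sym[OF xy(2,4)] ..
    show "energy_form \<alpha> (c *\<^sub>R x) y = c * energy_form \<alpha> x y"
      unfolding energy_form_def fst_scaleR snd_scaleR h.scale_left[OF xy(1,3)] l2.scale_left[OF xy(2,4)] by (rule distrib_left[symmetric])
    assume "z \<in> energy_space"
    hence z: "fst z \<in> H01" "snd z \<in> L2" by (auto simp: energy_space_def)
    show "energy_form \<alpha> (x + y) z = energy_form \<alpha> x z + energy_form \<alpha> y z"
      unfolding energy_form_def fst_add snd_add h.add_left[OF xy(1,3) z(1)] l2.add_left[OF xy(2,4) z(2)] by linarith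
  next
    fix x :: "'n state" assume "x \<in> energy_space"
    hence "fst x \<in> H01" "snd x \<in> L2" by (auto simp: energy_space_def)
    thus "0 \<le> energy_form \<alpha> x x" unfolding energy_form_def by (intro add_nonneg_nonneg h.nonneg l2.nonneg)
  qed
qed

lemma energy_norm_form:
  assumes "\<alpha> \<ge> 0"
  shows "energy_norm \<alpha> \<Phi> = sqrt (energy_form \<alpha> \<Phi> \<Phi>)"
proof -
  have "0 \<le> H1_form \<alpha> (fst \<Phi>) (fst \<Phi>)" by (rule H1_form_nonneg[OF assms])
  moreover have "0 \<le> inner_L2 (snd \<Phi>) (snd \<Phi>)" unfolding inner_L2_def by (intro integral_nonneg_AE AE_I2 zero_le_square)
  ultimately show ?thesis unfolding energy_norm_def H01_norm_form energy_form_def l2.N_def by simp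
qed

lemma energy_norm_eq_N: "\<alpha> \<ge> 0 \<Longrightarrow> semi_inner.N (energy_form \<alpha>) = energy_norm \<alpha>"
  by (rule ext) (simp only: semi_inner.N_def[OF semi_inner_energy] energy_norm_form)

lemma energy_interp:
  assumes "\<alpha> \<ge> 0"
  shows "semi_inner (energy_space :: 'n::finite state set) (energy_form \<alpha>)"
    "semi_inner.N (energy_form \<alpha>) = (energy_norm \<alpha> :: 'n state \<Rightarrow> real)"
  by (rule semi_inner_energy[OF assms], rule energy_norm_eq_N[OF assms])

lemma H01_norm_0: "H01_norm \<alpha> 0 = 0"
  unfolding H01_norm_form using H1_form_0_left[OF smooth_H1[OF smooth_0], of \<alpha>] by simp

lemma energy_norm_snd: "energy_norm \<alpha> (0, v) = L2_norm v"
  by (simp add: energy_norm_def H01_norm_0 l2.N_def inner_L2_def)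

text \<open>By completeness of Lebesgue measure. Strong measurability only controls a state-valued function almost everywhere.\<close>

lemma measurable_lebesgue_on_AE:
  fixes f g :: "real \<Rightarrow> real"
  assumes S: "S \<in> sets lebesgue" and f: "f \<in> borel_measurable (lebesgue_on S)"
    and ae: "AE x in lebesgue_on S. f x = g x"
  shows "g \<in> borel_measurable (lebesgue_on S)"
proof -
  have "(\<lambda>x. if x \<in> S then f x else 0) \<in> borel_measurable lebesgue"
    using f S by (simp add: borel_measurable_if)
  moreover have "AE x in lebesgue. x \<in> S \<longrightarrow> f x = g x"
    using ae S by (subst (asm) AE_restrict_space_iff) auto
  hence "AE x in lebesgue. (if x \<in> S then f x else 0) = (if x \<in> S then g x else 0)" by auto
  ultimately have "(\<lambda>x. if x \<in> S then g x else 0) \<in> borel_measurable lebesgue" by (rule borel_measurable_AE)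
  thus ?thesis using S by (simp add: borel_measurable_if)
qed

lemma strongly_measurable_form:
  fixes \<Psi> :: "'n::finite state"
  assumes \<alpha>: "\<alpha> \<ge> 0" and S: "S \<in> sets lebesgue" and h: "strongly_measurable \<alpha> (lebesgue_on S) h" and \<Psi>: "\<Psi> \<in> energy_space"
  shows "(\<lambda>t. energy_form \<alpha> (h t) \<Psi>) \<in> borel_measurable (lebesgue_on S)"
proof -
  interpret e: semi_inner "energy_space :: 'n state set" "energy_form \<alpha>"
    rewrites "semi_inner.N (energy_form \<alpha>) = (energy_norm \<alpha> :: 'n state \<Rightarrow> real)"
    by (rule energy_interp[OF \<alpha>])+
  let ?M = "lebesgue_on S"
  obtain s where s: "\<And>n. simple_function ?M (s n)" "\<And>n. s n ` space ?M \<subseteq> energy_space"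
    "AE t in ?M. (\<lambda>n. energy_norm \<alpha> (h t - s n t)) \<longlonglongrightarrow> 0" and hE: "AE t in ?M. h t \<in> energy_space"
    using h unfolding strongly_measurable_def by blast
  have m: "(\<lambda>t. energy_form \<alpha> (s n t) \<Psi>) \<in> borel_measurable ?M" for n
    by (intro borel_measurable_simple_function simple_function_compose1[OF s(1)])
  have "AE t in ?M. lim (\<lambda>n. energy_form \<alpha> (s n t) \<Psi>) = energy_form \<alpha> (h t) \<Psi>"
    using s(3) hE AE_space
  proof eventually_elim
    case (elim t)
    have sE: "s n t \<in> energy_space" for n using s(2)[of n] elim(3) by blast
    have "energy_norm \<alpha> (s n t - h t) = energy_norm \<alpha> (h t - s n t)" for n
      by (rule e.N_diff_commute[OF sE elim(2)])
    hence "(\<lambda>n. energy_norm \<alpha> (s n t - h t)) \<longlonglongrightarrow> 0" using elim(1) by simp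
    hence "(\<lambda>n. energy_form \<alpha> (s n t) \<Psi>) \<longlonglongrightarrow> energy_form \<alpha> (h t) \<Psi>" by (rule e.tendsto_form[OF sE elim(2) \<Psi>])
    thus ?case by (rule limI)
  qed
  thus ?thesis by (rule measurable_lebesgue_on_AE[OF S borel_measurable_lim_metric[OF m]])
qed

text \<open>The integral commutes with the continuous functional given by \<open>\<Psi>\<close>: apply the functional to the approximating
simple functions. It is additive on \<open>energy_space\<close> only, which contains their values.\<close>

lemma has_energy_integral_form:
  fixes \<Psi> I :: "'n::finite state"
  assumes \<alpha>: "\<alpha> \<ge> 0" and S: "S \<in> sets lebesgue" and h: "has_energy_integral \<alpha> (lebesgue_on S) h I" and \<Psi>: "\<Psi> \<in> energy_space"
  shows "has_bochner_integral (lebesgue_on S) (\<lambda>t. energy_form \<alpha> (h t) \<Psi>) (energy_form \<alpha> I \<Psi>)"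
proof -
  interpret e: semi_inner "energy_space :: 'n state set" "energy_form \<alpha>"
    rewrites "semi_inner.N (energy_form \<alpha>) = (energy_norm \<alpha> :: 'n state \<Rightarrow> real)"
    by (rule energy_interp[OF \<alpha>])+
  let ?M = "lebesgue_on S"
  have I: "I \<in> energy_space" and sm: "strongly_measurable \<alpha> ?M h" using h unfolding has_energy_integral_def by auto
  have hE: "AE t in ?M. h t \<in> energy_space" using sm unfolding strongly_measurable_def by blast
  obtain s where s: "\<And>n. Bochner_Integration.simple_bochner_integrable ?M (s n)" "\<And>n. s n ` space ?M \<subseteq> energy_space"
    "(\<lambda>n. \<integral>\<^sup>+ t. ennreal (energy_norm \<alpha> (h t - s n t)) \<partial>?M) \<longlonglongrightarrow> 0"
    "(\<lambda>n. energy_norm \<alpha> (Bochner_Integration.simple_bochner_integral ?M (s n) - I)) \<longlonglongrightarrow> 0"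
    using h unfolding has_energy_integral_def by blast
  \<comment> \<open>for test states of norm at most \<open>1\<close> the energy norm of the error is itself a majorant; the general case follows by scaling\<close>
  have unit: "has_bochner_integral ?M (\<lambda>t. energy_form \<alpha> (h t) X) (energy_form \<alpha> I X)"
    if X: "X \<in> energy_space" "energy_norm \<alpha> X \<le> 1" for X :: "'n state"
  proof (rule has_bochner_integral.intros[where s="\<lambda>n t. energy_form \<alpha> (s n t) X"])
    show "(\<lambda>t. energy_form \<alpha> (h t) X) \<in> borel_measurable ?M" by (rule strongly_measurable_form[OF \<alpha> S sm X(1)])
    show int: "Bochner_Integration.simple_bochner_integrable ?M (\<lambda>t. energy_form \<alpha> (s n t) X)" for n
      by (rule simple_bochner_integrable_compose2[where p="\<lambda>x y. energy_form \<alpha> x X", OF _ s(1) s(1)]) (rule e.zero_left[OF X(1)])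
    show "(\<lambda>n. \<integral>\<^sup>+ t. ennreal (norm (energy_form \<alpha> (h t) X - energy_form \<alpha> (s n t) X)) \<partial>?M) \<longlonglongrightarrow> 0"
    proof (rule tendsto_sandwich[OF _ _ tendsto_const s(3)])
      show "\<forall>\<^sub>F n in sequentially. (\<integral>\<^sup>+ t. ennreal (norm (energy_form \<alpha> (h t) X - energy_form \<alpha> (s n t) X)) \<partial>?M)
          \<le> (\<integral>\<^sup>+ t. ennreal (energy_norm \<alpha> (h t - s n t)) \<partial>?M)"
      proof (rule always_eventually, rule allI, rule nn_integral_mono_AE)
        fix n
        show "AE t in ?M. ennreal (norm (energy_form \<alpha> (h t) X - energy_form \<alpha> (s n t) X)) \<le> ennreal (energy_norm \<alpha> (h t - s n t))"
          using hE AE_space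
        proof eventually_elim
          case (elim t)
          have sE: "s n t \<in> energy_space" using s(2)[of n] elim(2) by blast
          have "\<bar>energy_form \<alpha> (h t - s n t) X\<bar> \<le> energy_norm \<alpha> (h t - s n t) * energy_norm \<alpha> X"
            by (rule e.cauchy_schwarz[OF e.diff_E[OF elim(1) sE] X(1)])
          also have "\<dots> \<le> energy_norm \<alpha> (h t - s n t) * 1"
            by (intro mult_left_mono X(2) e.N_nonneg e.diff_E elim(1) sE)
          finally show ?case by (intro ennreal_leI) (simp only: e.diff_left[OF elim(1) sE X(1)] real_norm_def mult_1_right)
        qed
      qed
    qed simp
    have fin: "finite (s n ` space ?M)" for n
      using s(1)[of n] by (auto simp: simple_bochner_integrable.simps simple_function_def)
    have eq: "Bochner_Integration.simple_bochner_integral ?M (\<lambda>t. energy_form \<alpha> (s n t) X)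
        = energy_form \<alpha> (Bochner_Integration.simple_bochner_integral ?M (s n)) X" for n
    proof -
      have "Bochner_Integration.simple_bochner_integral ?M (\<lambda>t. energy_form \<alpha> (s n t) X)
          = (\<Sum>y\<in>s n ` space ?M. measure ?M {x\<in>space ?M. s n x = y} *\<^sub>R energy_form \<alpha> y X)"
        by (rule simple_bochner_integral_partition[OF int]) (use s(1)[of n] in \<open>auto simp: simple_bochner_integrable.simps\<close>)
      also have "\<dots> = (\<Sum>y\<in>s n ` space ?M. energy_form \<alpha> (measure ?M {x\<in>space ?M. s n x = y} *\<^sub>R y) X)"
      proof (intro sum.cong refl)
        fix y assume "y \<in> s n ` space ?M"
        hence "y \<in> energy_space" using s(2) by blast
        thus "measure ?M {x\<in>space ?M. s n x = y} *\<^sub>R energy_form \<alpha> y X = energy_form \<alpha> (measure ?M {x\<in>space ?M. s n x = y} *\<^sub>R y) X"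
          by (simp only: e.scale_left[OF _ X(1)] real_scaleR_def)
      qed
      also have "\<dots> = energy_form \<alpha> (\<Sum>y\<in>s n ` space ?M. measure ?M {x\<in>space ?M. s n x = y} *\<^sub>R y) X"
        by (rule e.sum_left[symmetric, OF _ X(1)]) (use s(2) in \<open>blast intro: e.scale_E\<close>)
      finally show ?thesis unfolding simple_bochner_integral_def .
    qed
    have iE: "Bochner_Integration.simple_bochner_integral ?M (s n) \<in> energy_space" for n
      unfolding simple_bochner_integral_def by (rule e.sum_E) (use s(2) in \<open>blast intro: e.scale_E\<close>)
    show "(\<lambda>n. Bochner_Integration.simple_bochner_integral ?M (\<lambda>t. energy_form \<alpha> (s n t) X)) \<longlonglongrightarrow> energy_form \<alpha> I X"
      unfolding eq by (rule e.tendsto_form[OF iE I X(1) s(4)])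
  qed
  define c where "c = energy_norm \<alpha> \<Psi> + 1"
  have c: "c > 0" "energy_norm \<alpha> \<Psi> \<le> c" using e.N_nonneg[OF \<Psi>] by (auto simp: c_def)
  define X where "X = (1 / c) *\<^sub>R \<Psi>"
  have X: "X \<in> energy_space" unfolding X_def by (rule e.scale_E[OF \<Psi>])
  have "energy_norm \<alpha> X = \<bar>1 / c\<bar> * energy_norm \<alpha> \<Psi>" unfolding X_def by (rule e.N_scale[OF \<Psi>])
  also have "\<dots> \<le> 1" using c by (simp add: field_simps)
  finally have "has_bochner_integral ?M (\<lambda>t. energy_form \<alpha> (h t) X) (energy_form \<alpha> I X)" by (rule unit[OF X])
  hence "has_bochner_integral ?M (\<lambda>t. c * energy_form \<alpha> (h t) X) (c * energy_form \<alpha> I X)"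
    by (rule has_bochner_integral_mult_right)
  moreover have "c * energy_form \<alpha> Y X = energy_form \<alpha> Y \<Psi>" if "Y \<in> energy_space" for Y
    unfolding X_def using c by (simp only: e.scale_right[OF \<Psi> that]) simp
  ultimately have hb: "has_bochner_integral ?M (\<lambda>t. c * energy_form \<alpha> (h t) X) (energy_form \<alpha> I \<Psi>)" using I by simp
  have "AE t in ?M. c * energy_form \<alpha> (h t) X = energy_form \<alpha> (h t) \<Psi>"
    using hE by eventually_elim (rule \<open>\<And>Y. Y \<in> energy_space \<Longrightarrow> c * energy_form \<alpha> Y X = energy_form \<alpha> Y \<Psi>\<close>)
  thus ?thesis
    using hb has_bochner_integral_cong_AE[of "\<lambda>t. c * energy_form \<alpha> (h t) X" ?M "\<lambda>t. energy_form \<alpha> (h t) \<Psi>"]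
      strongly_measurable_form[OF \<alpha> S sm \<Psi>] strongly_measurable_form[OF \<alpha> S sm X] by auto
qed

section \<open>Scalar Duhamel integrals\<close>

lemma has_real_derivative_cong_on:
  assumes "(f has_real_derivative D) (at t within A)" "t \<in> A" "\<And>x. x \<in> A \<Longrightarrow> f x = g x"
  shows "(g has_real_derivative D) (at t within A)"
  by (rule has_field_derivative_transform_within[OF assms(1) zero_less_one assms(2)]) (rule assms(3))

lemma abs_sin_diff_le: "\<bar>sin x - sin y\<bar> \<le> \<bar>x - y\<bar>" for x y :: real
proof -
  have "\<bar>sin x - sin y\<bar> = 2 * \<bar>sin ((x - y) / 2)\<bar> * \<bar>cos ((x + y) / 2)\<bar>"
    by (simp add: sin_diff_sin abs_mult)
  also have "\<dots> \<le> 2 * \<bar>(x - y) / 2\<bar> * 1"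
    by (intro mult_mono abs_sin_x_le_abs_x) auto
  finally show ?thesis by simp
qed

text \<open>Extending the kernel \<open>sin (\<nu> r)\<close> by \<open>0\<close> to \<open>r < 0\<close> makes the domain of integration independent of
\<open>t\<close>. The extended kernel is Lipschitz and differentiable except at \<open>0\<close>, so that dominated convergence applies to
its difference quotients even though \<open>h\<close> is merely integrable.\<close>

lemma duhamel_derivative:
  fixes h :: "real \<Rightarrow> real"
  assumes h: "integrable (lebesgue_on {0..T}) h" and \<nu>: "\<nu> > 0" and t: "t \<in> {0..T}"
  shows "((\<lambda>t. LINT s|lebesgue_on {0..t}. sin (\<nu> * (t - s)) * h s) has_real_derivative
     (LINT s|lebesgue_on {0..t}. \<nu> * cos (\<nu> * (t - s)) * h s)) (at t within {0..T})"
proof -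
  define \<phi> where "\<phi> r = sin (\<nu> * max 0 r)" for r
  define \<phi>' where "\<phi>' r = (if r > 0 then \<nu> * cos (\<nu> * r) else 0)" for r
  have [measurable]: "h \<in> borel_measurable (lebesgue_on {0..T})" using h by auto
  have c\<phi>: "continuous_on UNIV \<phi>" unfolding \<phi>_def by (intro continuous_intros)
  have m\<phi>: "(\<lambda>s. \<phi> (r - s)) \<in> borel_measurable (lebesgue_on {0..T})" for r
    by (intro continuous_imp_measurable_on_sets_lebesgue continuous_on_compose2[OF c\<phi>] continuous_intros) auto
  have m\<phi>': "(\<lambda>s. \<phi>' (t - s)) \<in> borel_measurable (lebesgue_on {0..T})"
  proof -
    have "\<phi>' \<in> borel_measurable borel" unfolding \<phi>'_def by measurable
    hence "(\<lambda>s. \<phi>' (t - s)) \<in> borel_measurable borel" by measurable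
    thus ?thesis by (intro measurable_restrict_space1 measurable_completion) simp
  qed
  have restr: "(LINT s|lebesgue_on {0..r}. g s) = (LINT s|lebesgue_on {0..T}. indicator {0..r} s * g s)"
    if "r \<in> {0..T}" for r and g :: "real \<Rightarrow> real"
  proof -
    have "(LINT s|lebesgue_on {0..r}. g s) = (LINT s|lebesgue. indicator {0..r} s *\<^sub>R g s)"
      by (rule integral_restrict_space) auto
    also have "(\<lambda>s. indicator {0..r} s *\<^sub>R g s) = (\<lambda>s. indicator {0..T} s *\<^sub>R (indicator {0..r} s * g s))"
      using that by (auto simp: indicator_def)
    also have "(LINT s|lebesgue. indicator {0..T} s *\<^sub>R (indicator {0..r} s * g s)) = (LINT s|lebesgue_on {0..T}. indicator {0..r} s * g s)"
      by (rule integral_restrict_space[symmetric]) auto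
    finally show ?thesis .
  qed
  define K where "K r = (LINT s|lebesgue_on {0..T}. \<phi> (r - s) * h s)" for r
  have K: "(LINT s|lebesgue_on {0..r}. sin (\<nu> * (r - s)) * h s) = K r" if r: "r \<in> {0..T}" for r
    unfolding restr[OF r] K_def
    by (intro Bochner_Integration.integral_cong refl) (auto simp: \<phi>_def indicator_def max_def)
  have ne: "AE s in lebesgue_on {0..T}. s \<noteq> t"
  proof -
    have "AE s in lebesgue. s \<notin> {t}" by (intro AE_not_in) (simp flip: negligible_iff_null_sets)
    hence "AE s in lebesgue. s \<noteq> t" by simp
    thus ?thesis by (subst AE_restrict_space_iff) auto
  qed
  have D: "(LINT s|lebesgue_on {0..t}. \<nu> * cos (\<nu> * (t - s)) * h s) = (LINT s|lebesgue_on {0..T}. \<phi>' (t - s) * h s)"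
    unfolding restr[OF t]
  proof (rule integral_cong_AE)
    show "AE s in lebesgue_on {0..T}. indicator {0..t} s * (\<nu> * cos (\<nu> * (t - s)) * h s) = \<phi>' (t - s) * h s"
      using ne AE_space by eventually_elim (auto simp: \<phi>'_def indicator_def)
    have a: "(\<lambda>s. \<nu> * cos (\<nu> * (t - s))) \<in> borel_measurable (lebesgue_on {0..T})"
      by (intro continuous_imp_measurable_on_sets_lebesgue continuous_intros) auto
    have b: "indicator {0..t} \<in> borel_measurable (lebesgue_on {0..T})"
      by (intro measurable_restrict_space1 borel_measurable_indicator) simp
    have c: "h \<in> borel_measurable (lebesgue_on {0..T})" by measurable
    show "(\<lambda>s. indicator {0..t} s * (\<nu> * cos (\<nu> * (t - s)) * h s)) \<in> borel_measurable (lebesgue_on {0..T})"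
      by (rule borel_measurable_times[OF b borel_measurable_times[OF a c]])
    show "(\<lambda>s. \<phi>' (t - s) * h s) \<in> borel_measurable (lebesgue_on {0..T})"
      by (intro borel_measurable_times m\<phi>') auto
  qed
  have lip: "\<bar>\<phi> a - \<phi> b\<bar> \<le> \<nu> * \<bar>a - b\<bar>" for a b
  proof -
    have "\<bar>\<phi> a - \<phi> b\<bar> \<le> \<bar>\<nu> * max 0 a - \<nu> * max 0 b\<bar>"
      unfolding \<phi>_def by (rule abs_sin_diff_le)
    also have "\<dots> = \<nu> * \<bar>max 0 a - max 0 b\<bar>" using \<nu> by (simp add: abs_mult flip: right_diff_distrib)
    also have "\<dots> \<le> \<nu> * \<bar>a - b\<bar>" using \<nu> by (intro mult_left_mono) (auto simp: max_def)
    finally show ?thesis .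
  qed
  have d\<phi>: "(\<phi> has_real_derivative \<phi>' r) (at r)" if "r \<noteq> 0" for r
  proof (cases "r > 0")
    case True
    have "((\<lambda>r. sin (\<nu> * r)) has_real_derivative \<phi>' r) (at r)"
      using True by (auto intro!: derivative_eq_intros simp: \<phi>'_def)
    moreover have ev: "eventually (\<lambda>y. sin (\<nu> * y) = \<phi> y) (nhds r)"
      using eventually_nhds_in_open[of "{0<..}" r] True by (auto elim!: eventually_mono simp: \<phi>_def max_def)
    ultimately show ?thesis using iffD1[OF DERIV_cong_ev[OF refl ev refl]] by blast
  next
    case False
    have "((\<lambda>r. 0) has_real_derivative \<phi>' r) (at r)" using False by (simp add: \<phi>'_def)
    moreover have ev: "eventually (\<lambda>y. 0 = \<phi> y) (nhds r)"
      using eventually_nhds_in_open[of "{..<0}" r] False that by (auto elim!: eventually_mono simp: \<phi>_def max_def)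
    ultimately show ?thesis using iffD1[OF DERIV_cong_ev[OF refl ev refl]] by blast
  qed
  have intK: "integrable (lebesgue_on {0..T}) (\<lambda>s. \<phi> (r - s) * h s)" for r
  proof (rule Bochner_Integration.integrable_bound[OF h])
    show "(\<lambda>s. \<phi> (r - s) * h s) \<in> borel_measurable (lebesgue_on {0..T})" by (intro borel_measurable_times m\<phi>) auto
    have "\<bar>\<phi> x\<bar> * \<bar>y\<bar> \<le> 1 * \<bar>y\<bar>" for x y unfolding \<phi>_def by (intro mult_right_mono) auto
    thus "AE s in lebesgue_on {0..T}. norm (\<phi> (r - s) * h s) \<le> norm (h s)" by (intro AE_I2) (simp add: abs_mult)
  qed
  have "(K has_real_derivative (LINT s|lebesgue_on {0..T}. \<phi>' (t - s) * h s)) (at t within {0..T})"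
    unfolding has_field_derivative_iff tendsto_at_iff_sequentially
  proof (intro allI impI)
    fix X :: "nat \<Rightarrow> real" assume X: "\<forall>i. X i \<in> {0..T} - {t}" "X \<longlonglongrightarrow> t"
    have Xt: "X i \<noteq> t" for i using X(1) by auto
    have "(\<lambda>i. LINT s|lebesgue_on {0..T}. (\<phi> (X i - s) - \<phi> (t - s)) / (X i - t) * h s)
        \<longlonglongrightarrow> (LINT s|lebesgue_on {0..T}. \<phi>' (t - s) * h s)"
    proof (rule integral_dominated_convergence[where w="\<lambda>s. \<nu> * \<bar>h s\<bar>"])
      show "(\<lambda>s. \<phi>' (t - s) * h s) \<in> borel_measurable (lebesgue_on {0..T})"
        by (intro borel_measurable_times m\<phi>') auto
      show "(\<lambda>s. (\<phi> (X i - s) - \<phi> (t - s)) / (X i - t) * h s) \<in> borel_measurable (lebesgue_on {0..T})" for i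
        by (intro borel_measurable_times borel_measurable_divide borel_measurable_diff m\<phi>) auto
      show "integrable (lebesgue_on {0..T}) (\<lambda>s. \<nu> * \<bar>h s\<bar>)" using h by auto
      show "AE s in lebesgue_on {0..T}. (\<lambda>i. (\<phi> (X i - s) - \<phi> (t - s)) / (X i - t) * h s) \<longlonglongrightarrow> \<phi>' (t - s) * h s"
        using ne
      proof eventually_elim
        case (elim s)
        have "((\<lambda>y. (\<phi> y - \<phi> (t - s)) / (y - (t - s))) \<longlongrightarrow> \<phi>' (t - s)) (at (t - s))"
          using d\<phi>[of "t - s"] elim by (simp add: has_field_derivative_iff)
        moreover have "filterlim (\<lambda>i. X i - s) (at (t - s)) sequentially"
          unfolding filterlim_at using Xt tendsto_diff[OF X(2) tendsto_const[of s]] by simp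
        ultimately have "(\<lambda>i. (\<phi> (X i - s) - \<phi> (t - s)) / ((X i - s) - (t - s))) \<longlonglongrightarrow> \<phi>' (t - s)"
          by (rule filterlim_compose)
        hence "(\<lambda>i. (\<phi> (X i - s) - \<phi> (t - s)) / (X i - t)) \<longlonglongrightarrow> \<phi>' (t - s)" by simp
        thus ?case by (intro tendsto_mult tendsto_const)
      qed
      show "AE s in lebesgue_on {0..T}. norm ((\<phi> (X i - s) - \<phi> (t - s)) / (X i - t) * h s) \<le> \<nu> * \<bar>h s\<bar>" for i
      proof (intro AE_I2)
        fix s
        have "\<bar>\<phi> (X i - s) - \<phi> (t - s)\<bar> \<le> \<nu> * \<bar>X i - t\<bar>" using lip[of "X i - s" "t - s"] by simp
        hence "\<bar>\<phi> (X i - s) - \<phi> (t - s)\<bar> / \<bar>X i - t\<bar> \<le> \<nu>" using Xt[of i] by (simp add: divide_le_eq)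
        from mult_right_mono[OF this, of "\<bar>h s\<bar>"]
        show "norm ((\<phi> (X i - s) - \<phi> (t - s)) / (X i - t) * h s) \<le> \<nu> * \<bar>h s\<bar>" by (simp add: abs_mult abs_divide)
      qed
    qed
    moreover have "(LINT s|lebesgue_on {0..T}. (\<phi> (X i - s) - \<phi> (t - s)) / (X i - t) * h s) = (K (X i) - K t) / (X i - t)" for i
    proof -
      have "(LINT s|lebesgue_on {0..T}. (\<phi> (X i - s) - \<phi> (t - s)) / (X i - t) * h s)
          = (LINT s|lebesgue_on {0..T}. (\<phi> (X i - s) * h s - \<phi> (t - s) * h s) / (X i - t))"
        by (intro Bochner_Integration.integral_cong refl) (simp add: left_diff_distrib)
      also have "\<dots> = (K (X i) - K t) / (X i - t)"
        unfolding K_def by (simp add: Bochner_Integration.integral_diff[OF intK intK])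
      finally show ?thesis .
    qed
    ultimately show "((\<lambda>y. (K y - K t) / (y - t)) \<circ> X) \<longlonglongrightarrow> (LINT s|lebesgue_on {0..T}. \<phi>' (t - s) * h s)"
      by (simp only: o_def)
  qed
  thus ?thesis unfolding D
    by (rule has_real_derivative_cong_on[OF _ t]) (simp add: K)
qed

section \<open>The wave group on a single mode\<close>

context
  fixes \<alpha> :: real and S :: "real \<Rightarrow> 'n::{finite, linorder} state \<Rightarrow> 'n state"
  assumes \<alpha>: "\<alpha> \<ge> 0" and group: "wave_group \<alpha> S"
begin

interpretation e: semi_inner "energy_space :: 'n::{finite, linorder} state set" "energy_form \<alpha>"
  rewrites "semi_inner.N (energy_form \<alpha>) = (energy_norm \<alpha> :: 'n::{finite, linorder} state \<Rightarrow> real)"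
  by (rule energy_interp[OF \<alpha>])+

lemma group_E: "\<Phi> \<in> energy_space \<Longrightarrow> S t \<Phi> \<in> energy_space"
  using group unfolding wave_group_def by blast

lemma group_norm: "\<Phi> \<in> energy_space \<Longrightarrow> energy_norm \<alpha> (S t \<Phi>) = energy_norm \<alpha> \<Phi>"
  using group unfolding wave_group_def by blast

lemma group_add: "\<Phi> \<in> energy_space \<Longrightarrow> \<Psi> \<in> energy_space \<Longrightarrow> energy_norm \<alpha> (S t (\<Phi> + \<Psi>) - (S t \<Phi> + S t \<Psi>)) = 0"
proof -
  assume "\<Phi> \<in> energy_space" "\<Psi> \<in> energy_space"
  hence "energy_norm \<alpha> (S t (\<Phi> + 1 *\<^sub>R \<Psi>) - (S t \<Phi> + 1 *\<^sub>R S t \<Psi>)) = 0"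
    using group unfolding wave_group_def by blast
  thus ?thesis by (simp only: scaleR_one)
qed

lemma group_0: "\<Phi> \<in> energy_space \<Longrightarrow> energy_norm \<alpha> (S 0 \<Phi> - \<Phi>) = 0"
  using group unfolding wave_group_def by blast

lemma group_compose: "\<Phi> \<in> energy_space \<Longrightarrow> energy_norm \<alpha> (S (s + t) \<Phi> - S s (S t \<Phi>)) = 0"
  using group unfolding wave_group_def by blast

lemma group_generator: "\<Phi> \<in> wave_domain \<Longrightarrow>
    ((\<lambda>h. energy_norm \<alpha> ((1 / h) *\<^sub>R (S h \<Phi> - \<Phi>) - (- wave_op \<alpha> \<Phi>))) \<longlongrightarrow> 0) (at 0)"
  using group unfolding wave_group_def by blast

text \<open>Polarisation.\<close>

lemma group_unitary:
  assumes "\<Phi> \<in> energy_space" "\<Psi> \<in> energy_space"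
  shows "energy_form \<alpha> (S t \<Phi>) (S t \<Psi>) = energy_form \<alpha> \<Phi> \<Psi>"
proof -
  have pol: "2 * energy_form \<alpha> X Y = (energy_norm \<alpha> (X + Y))\<^sup>2 - (energy_norm \<alpha> X)\<^sup>2 - (energy_norm \<alpha> Y)\<^sup>2"
    if "X \<in> energy_space" "Y \<in> energy_space" for X Y :: "'n state"
    using e.quadratic[OF that, of 1] that by (simp only: e.N_sq e.add_E scaleR_one) simp
  have "energy_norm \<alpha> (S t \<Phi> + S t \<Psi>) = energy_norm \<alpha> (S t (\<Phi> + \<Psi>))"
    by (rule e.null_cong_N[symmetric]) (intro group_E e.add_E assms group_add)+
  also have "\<dots> = energy_norm \<alpha> (\<Phi> + \<Psi>)" by (intro group_norm e.add_E assms)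
  finally have "2 * energy_form \<alpha> (S t \<Phi>) (S t \<Psi>) = 2 * energy_form \<alpha> \<Phi> \<Psi>"
    by (simp only: pol[OF group_E group_E] pol assms group_norm)
  thus ?thesis by simp
qed

lemma group_adjoint:
  assumes "\<Phi> \<in> energy_space" "\<Psi> \<in> energy_space"
  shows "energy_form \<alpha> (S t \<Phi>) \<Psi> = energy_form \<alpha> \<Phi> (S (- t) \<Psi>)"
proof -
  have E: "S t (S (- t) \<Psi>) \<in> energy_space" "S 0 \<Psi> \<in> energy_space" "S t \<Phi> \<in> energy_space" by (intro group_E assms)+
  have "energy_form \<alpha> \<Phi> (S (- t) \<Psi>) = energy_form \<alpha> (S t \<Phi>) (S t (S (- t) \<Psi>))"
    by (intro group_unitary[symmetric] assms group_E)
  also have "\<dots> = energy_form \<alpha> (S t \<Phi>) (S 0 \<Psi>)"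
    using e.null_cong_right[OF E(2) E(1) E(3)] group_compose[OF assms(2), of t "- t"] by simp
  also have "\<dots> = energy_form \<alpha> (S t \<Phi>) \<Psi>" by (rule e.null_cong_right[OF E(2) assms(2) E(3) group_0[OF assms(2)]])
  finally show ?thesis by simp
qed

text \<open>Moving \<open>S t\<close> to the other side with the adjoint reduces the derivative at \<open>t\<close> to the one at \<open>0\<close>, which is
given by the generator. The state \<open>\<Xi>\<close> stands for any representative of \<open>-A \<Psi>\<close>.\<close>

lemma group_form_derivative:
  assumes X: "X \<in> energy_space" and \<Psi>: "\<Psi> \<in> wave_domain" "\<Psi> \<in> energy_space"
    and \<Xi>: "\<Xi> \<in> energy_space" "wave_op \<alpha> \<Psi> \<in> energy_space" "energy_norm \<alpha> (- wave_op \<alpha> \<Psi> - \<Xi>) = 0"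
  shows "((\<lambda>t. energy_form \<alpha> X (S t \<Psi>)) has_real_derivative energy_form \<alpha> X (S t \<Xi>)) (at t)"
proof -
  define Y where "Y = S (- t) X"
  have Y: "Y \<in> energy_space" unfolding Y_def by (rule group_E[OF X])
  have adj: "energy_form \<alpha> X (S t Z) = energy_form \<alpha> Y Z" if "Z \<in> energy_space" for Z
    using group_adjoint[OF X that, of "- t"] by (simp add: Y_def)
  have shift: "energy_form \<alpha> X (S (t + h) \<Psi>) = energy_form \<alpha> Y (S h \<Psi>)" for h
    using e.null_cong_right[OF group_E[OF \<Psi>(2)] group_E[OF group_E[OF \<Psi>(2)]] X group_compose[OF \<Psi>(2)], of t h]
      adj[OF group_E[OF \<Psi>(2)], of h] by simp
  have nW: "- wave_op \<alpha> \<Psi> \<in> energy_space" by (rule e.minus_E[OF \<Xi>(2)])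
  have DE: "(1 / h) *\<^sub>R (S h \<Psi> - \<Psi>) \<in> energy_space" for h by (intro e.scale_E e.diff_E group_E \<Psi>)
  have "((\<lambda>h. energy_form \<alpha> ((1 / h) *\<^sub>R (S h \<Psi> - \<Psi>)) Y) \<longlongrightarrow> energy_form \<alpha> (- wave_op \<alpha> \<Psi>) Y) (at 0)"
    by (rule e.tendsto_form[OF DE nW Y group_generator[OF \<Psi>(1)]])
  moreover have "energy_form \<alpha> ((1 / h) *\<^sub>R (S h \<Psi> - \<Psi>)) Y = (energy_form \<alpha> X (S (t + h) \<Psi>) - energy_form \<alpha> X (S t \<Psi>)) / h" for h
  proof -
    have "energy_form \<alpha> ((1 / h) *\<^sub>R (S h \<Psi> - \<Psi>)) Y = (1 / h) * (energy_form \<alpha> Y (S h \<Psi>) - energy_form \<alpha> Y \<Psi>)"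
      by (simp only: e.scale_left[OF e.diff_E[OF group_E[OF \<Psi>(2)] \<Psi>(2)] Y] e.diff_left[OF group_E[OF \<Psi>(2)] \<Psi>(2) Y]
          e.sym[OF Y group_E[OF \<Psi>(2)]] e.sym[OF Y \<Psi>(2)])
    thus ?thesis by (simp only: shift adj[OF \<Psi>(2)]) simp
  qed
  moreover have "energy_form \<alpha> (- wave_op \<alpha> \<Psi>) Y = energy_form \<alpha> X (S t \<Xi>)"
    using e.null_cong_left[OF nW \<Xi>(1) Y \<Xi>(3)] e.sym[OF Y \<Xi>(1)] adj[OF \<Xi>(1)] by simp
  ultimately show ?thesis unfolding DERIV_def by simp
qed

abbreviation (input) eig :: "nat \<Rightarrow> 'n::{finite, linorder} func" where "eig \<equiv> eigenfunction"

lemma zero_pair_E: "v \<in> L2 \<Longrightarrow> (0, v) \<in> energy_space"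
  unfolding energy_space_def using subspace_0[OF subspace_H01] by (intro SigmaI)

lemma pair_zero_E: "u \<in> H01 \<Longrightarrow> (u, 0) \<in> energy_space"
  unfolding energy_space_def using l2.zero_E by (intro SigmaI)

lemma weak_laplacian_eigenfunction:
  "L2_norm (weak_laplacian (eig j) - (- eigval (mi_enum j :: 'n \<Rightarrow> nat)) *\<^sub>R eig j) = 0"
  unfolding eigenfunction_def by (rule weak_laplacian_dirichlet)

text \<open>The generator maps \<open>(e\<^sub>j, 0)\<close> to a multiple of \<open>(0, e\<^sub>j)\<close>, up to a null function.\<close>

lemma wave_op_position:
  shows "(eig j, 0) \<in> wave_domain" "wave_op \<alpha> (eig j, 0) \<in> energy_space"
    "energy_norm \<alpha> (- wave_op \<alpha> (eig j, 0) - (- shifted_eigval TYPE('n) \<alpha> j) *\<^sub>R (0, eig j)) = 0"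
proof -
  let ?w = "weak_laplacian (eig j)"
  have W: "?w \<in> L2" by (rule smooth_H2(2)[OF eigenfunction_smooth])
  show "(eig j, 0) \<in> wave_domain"
    unfolding wave_domain_def using smooth_H2(1)[OF eigenfunction_smooth] eigenfunction_H01 subspace_0[OF subspace_H01]
    by (intro SigmaI IntI)
  have op: "wave_op \<alpha> (eig j, 0) = (0, - ?w + \<alpha> *\<^sub>R eig j)" by (simp only: wave_op_def split minus_zero)
  show "wave_op \<alpha> (eig j, 0) \<in> energy_space"
    unfolding op by (intro zero_pair_E l2.add_E l2.minus_E l2.scale_E W eigenfunction_L2)
  have "- wave_op \<alpha> (eig j, 0) - (- shifted_eigval TYPE('n) \<alpha> j) *\<^sub>R (0, eig j)
      = (0, ?w - (- eigval (mi_enum j :: 'n \<Rightarrow> nat)) *\<^sub>R eig j)"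
    unfolding op shifted_eigval_def by (rule prod_eqI) (simp_all add: scaleR_fun_def fun_eq_iff algebra_simps)
  thus "energy_norm \<alpha> (- wave_op \<alpha> (eig j, 0) - (- shifted_eigval TYPE('n) \<alpha> j) *\<^sub>R (0, eig j)) = 0"
    using weak_laplacian_eigenfunction[of j] by (simp only: energy_norm_snd)
qed

text \<open>The generator maps \<open>(0, e\<^sub>j)\<close> to \<open>(e\<^sub>j, 0)\<close>, up to a null function.\<close>

lemma wave_op_velocity:
  shows "(0, eig j) \<in> wave_domain" "wave_op \<alpha> (0, eig j) \<in> energy_space"
    "energy_norm \<alpha> (- wave_op \<alpha> (0, eig j) - (eig j, 0)) = 0"
proof -
  let ?w = "weak_laplacian (0 :: 'n func)"
  have W: "?w \<in> L2" by (rule smooth_H2(2)[OF smooth_0])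
  show "(0, eig j) \<in> wave_domain"
    unfolding wave_domain_def using smooth_H2(1)[OF smooth_0] eigenfunction_H01 subspace_0[OF subspace_H01]
    by (intro SigmaI IntI)
  have op: "wave_op \<alpha> (0, eig j) = (- eig j, - ?w + \<alpha> *\<^sub>R 0)" by (simp only: wave_op_def split)
  show "wave_op \<alpha> (0, eig j) \<in> energy_space"
    unfolding op energy_space_def
    by (intro SigmaI subspace_neg[OF subspace_H01] eigenfunction_H01 l2.add_E l2.minus_E l2.scale_E W l2.zero_E)
  have "L2_norm (?w - laplacian 0) = 0" by (rule smooth_H2(3)[OF smooth_0])
  hence n: "L2_norm ?w = 0" by (simp only: partial_deriv_0 sum.neutral_const diff_zero)
  have "- wave_op \<alpha> (0, eig j) - (eig j, 0) = (0, ?w)"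
    unfolding op by (rule prod_eqI) (simp_all add: scaleR_fun_def fun_eq_iff)
  thus "energy_norm \<alpha> (- wave_op \<alpha> (0, eig j) - (eig j, 0)) = 0" using n by (simp only: energy_norm_snd)
qed

lemma energy_form_position: "X \<in> energy_space \<Longrightarrow> energy_form \<alpha> X (eig j, 0) = shifted_eigval TYPE('n) \<alpha> j * inner_L2 (fst X) (eig j)"
proof -
  assume X: "X \<in> energy_space"
  hence x: "fst X \<in> H01" "snd X \<in> L2" by (auto simp: energy_space_def)
  have "inner_L2 (snd X) 0 = 0" using l2.sym[OF x(2) l2.zero_E] l2.zero_left[OF x(2)] by simp
  thus ?thesis unfolding energy_form_def by (simp only: fst_conv snd_conv H1_form_eigenfunction[OF x(1)] add_0_right)
qed

lemma energy_form_velocity: "X \<in> energy_space \<Longrightarrow> energy_form \<alpha> X (0, eig j) = inner_L2 (snd X) (eig j)"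
proof -
  assume X: "X \<in> energy_space"
  hence x: "fst X \<in> H01" by (auto simp: energy_space_def)
  interpret h: semi_inner "H01 :: ('n func) set" "H1_form \<alpha>" by (rule semi_inner_H01[OF \<alpha>])
  have "H1_form \<alpha> (fst X) 0 = 0" using h.sym[OF x h.zero_E] h.zero_left[OF x] by simp
  thus ?thesis unfolding energy_form_def by (simp only: fst_conv snd_conv add_0_left)
qed

text \<open>With \<open>Y t = \<langle>X, S t (e\<^sub>j, 0)\<rangle>\<close> and \<open>Z t = \<langle>X, S t (0, e\<^sub>j)\<rangle>\<close> the generator gives \<open>Y' = -\<nu>\<^sup>2 Z\<close> and
\<open>Z' = Y\<close>. In the rotating frame the pair \<open>(Y, \<nu> Z)\<close> is constant, and the group itself is obtained by passing to the
adjoint, that is, to \<open>-t\<close>.\<close>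

theorem group_modes:
  assumes X: "X \<in> energy_space" and j: "j \<ge> 1"
  defines "\<nu> \<equiv> sqrt (shifted_eigval TYPE('n) \<alpha> j)"
  shows "inner_L2 (fst (S t X)) (eig j) = cos (\<nu> * t) * inner_L2 (fst X) (eig j) + sin (\<nu> * t) / \<nu> * inner_L2 (snd X) (eig j)"
    and "inner_L2 (snd (S t X)) (eig j) = cos (\<nu> * t) * inner_L2 (snd X) (eig j) - \<nu> * sin (\<nu> * t) * inner_L2 (fst X) (eig j)"
proof -
  define l where "l = shifted_eigval TYPE('n) \<alpha> j"
  have l: "l > 0" unfolding l_def by (rule shifted_eigval_pos[OF \<alpha> j])
  have \<nu>: "\<nu> > 0" "\<nu> * \<nu> = l" using l by (auto simp: \<nu>_def l_def)
  have p: "(eig j, 0) \<in> energy_space" by (rule pair_zero_E[OF eigenfunction_H01])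
  have v: "(0, eig j) \<in> energy_space" by (rule zero_pair_E[OF eigenfunction_L2])
  define Y where "Y t = energy_form \<alpha> X (S t (eig j, 0))" for t
  define Z where "Z t = energy_form \<alpha> X (S t (0, eig j))" for t
  have scale: "energy_form \<alpha> X (S t ((- l) *\<^sub>R (0, eig j))) = - l * Z t" for t
  proof -
    have "energy_form \<alpha> X (S t ((- l) *\<^sub>R (0, eig j))) = energy_form \<alpha> (S (- t) X) ((- l) *\<^sub>R (0, eig j))"
      using group_adjoint[OF X e.scale_E[OF v], of "- t" "- l"] by simp
    also have "\<dots> = - l * energy_form \<alpha> (S (- t) X) (0, eig j)" by (rule e.scale_right[OF v group_E[OF X]])
    also have "energy_form \<alpha> (S (- t) X) (0, eig j) = Z t" using group_adjoint[OF X v, of "- t"] by (simp add: Z_def)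
    finally show ?thesis .
  qed
  have dY: "(Y has_real_derivative - l * Z t) (at t)" for t
    using group_form_derivative[OF X wave_op_position(1) p e.scale_E[OF v] wave_op_position(2,3), of t]
    unfolding l_def[symmetric] scale Y_def[abs_def] .
  have dZ: "(Z has_real_derivative Y t) (at t)" for t
    using group_form_derivative[OF X wave_op_velocity(1) v p wave_op_velocity(2,3), of t]
    unfolding Y_def[symmetric] Z_def[abs_def] .
  \<comment> \<open>the two components of the pair in the rotating frame are constant\<close>
  have c1: "Y t * cos (\<nu> * t) + \<nu> * Z t * sin (\<nu> * t) = Y 0" for t
  proof -
    have "((\<lambda>t. Y t * cos (\<nu> * t) + \<nu> * Z t * sin (\<nu> * t)) has_real_derivative 0) (at t)" for t
    proof -
      have A: "((\<lambda>t. Y t * cos (\<nu> * t) + \<nu> * Z t * sin (\<nu> * t)) has_real_derivative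
        (- l * Z t) * cos (\<nu> * t) + Y t * (- sin (\<nu> * t) * \<nu>) + (\<nu> * Y t * sin (\<nu> * t) + \<nu> * Z t * (cos (\<nu> * t) * \<nu>))) (at t)"
        by (auto intro!: derivative_eq_intros dY dZ)
      have B: "(- l * Z t) * cos (\<nu> * t) + Y t * (- sin (\<nu> * t) * \<nu>) + (\<nu> * Y t * sin (\<nu> * t) + \<nu> * Z t * (cos (\<nu> * t) * \<nu>)) = 0"
        unfolding \<nu>(2)[symmetric] by (simp add: algebra_simps)
      show ?thesis by (rule DERIV_cong[OF A B])
    qed
    from DERIV_isconst_all[OF allI[OF this], of t 0] show ?thesis by simp
  qed
  have c2: "\<nu> * Z t * cos (\<nu> * t) - Y t * sin (\<nu> * t) = \<nu> * Z 0" for t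
  proof -
    have "((\<lambda>t. \<nu> * Z t * cos (\<nu> * t) - Y t * sin (\<nu> * t)) has_real_derivative 0) (at t)" for t
    proof -
      have A: "((\<lambda>t. \<nu> * Z t * cos (\<nu> * t) - Y t * sin (\<nu> * t)) has_real_derivative
        (\<nu> * Y t * cos (\<nu> * t) + \<nu> * Z t * (- sin (\<nu> * t) * \<nu>)) - ((- l * Z t) * sin (\<nu> * t) + Y t * (cos (\<nu> * t) * \<nu>))) (at t)"
        by (auto intro!: derivative_eq_intros dY dZ)
      have B: "(\<nu> * Y t * cos (\<nu> * t) + \<nu> * Z t * (- sin (\<nu> * t) * \<nu>)) - ((- l * Z t) * sin (\<nu> * t) + Y t * (cos (\<nu> * t) * \<nu>)) = 0"
        unfolding \<nu>(2)[symmetric] by (simp add: algebra_simps)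
      show ?thesis by (rule DERIV_cong[OF A B])
    qed
    from DERIV_isconst_all[OF allI[OF this], of t 0] show ?thesis by simp
  qed
  have sc: "sin (\<nu> * t) * sin (\<nu> * t) = 1 - cos (\<nu> * t) * cos (\<nu> * t)" for t
    using sin_cos_squared_add[of "\<nu> * t"] by (simp add: power2_eq_square)
  have Yt: "Y t = Y 0 * cos (\<nu> * t) - \<nu> * Z 0 * sin (\<nu> * t)" for t
  proof -
    have "Y 0 * cos (\<nu> * t) - \<nu> * Z 0 * sin (\<nu> * t)
        = (Y t * cos (\<nu> * t) + \<nu> * Z t * sin (\<nu> * t)) * cos (\<nu> * t) - (\<nu> * Z t * cos (\<nu> * t) - Y t * sin (\<nu> * t)) * sin (\<nu> * t)"
      unfolding c1 c2 ..
    also have "\<dots> = Y t * (cos (\<nu> * t) * cos (\<nu> * t)) + Y t * (sin (\<nu> * t) * sin (\<nu> * t))" by (simp add: algebra_simps)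
    also have "\<dots> = Y t" unfolding sc by (simp add: algebra_simps)
    finally show ?thesis by simp
  qed
  have Zt: "\<nu> * Z t = Y 0 * sin (\<nu> * t) + \<nu> * Z 0 * cos (\<nu> * t)" for t
  proof -
    have "Y 0 * sin (\<nu> * t) + \<nu> * Z 0 * cos (\<nu> * t)
        = (Y t * cos (\<nu> * t) + \<nu> * Z t * sin (\<nu> * t)) * sin (\<nu> * t) + (\<nu> * Z t * cos (\<nu> * t) - Y t * sin (\<nu> * t)) * cos (\<nu> * t)"
      unfolding c1 c2 ..
    also have "\<dots> = \<nu> * Z t * (cos (\<nu> * t) * cos (\<nu> * t)) + \<nu> * Z t * (sin (\<nu> * t) * sin (\<nu> * t))" by (simp add: algebra_simps)
    also have "\<dots> = \<nu> * Z t" unfolding sc by (simp add: algebra_simps)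
    finally show ?thesis by simp
  qed
  have Y0: "Y 0 = l * inner_L2 (fst X) (eig j)"
    unfolding Y_def l_def energy_form_position[OF X, symmetric] by (rule e.null_cong_right[OF group_E[OF p] p X group_0[OF p]])
  have Z0: "Z 0 = inner_L2 (snd X) (eig j)"
    unfolding Z_def energy_form_velocity[OF X, symmetric] by (rule e.null_cong_right[OF group_E[OF v] v X group_0[OF v]])
  have a1: "l * inner_L2 (fst (S t X)) (eig j) = Y (- t)"
    unfolding Y_def l_def energy_form_position[OF group_E[OF X], symmetric] by (rule group_adjoint[OF X p])
  have a2: "inner_L2 (snd (S t X)) (eig j) = Z (- t)"
    unfolding Z_def energy_form_velocity[OF group_E[OF X], symmetric] by (rule group_adjoint[OF X v])
  have "l * inner_L2 (fst (S t X)) (eig j) = l * (cos (\<nu> * t) * inner_L2 (fst X) (eig j) + sin (\<nu> * t) / \<nu> * inner_L2 (snd X) (eig j))"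
    unfolding a1 Yt[of "- t"] Y0 Z0 using \<nu>(1) unfolding \<nu>(2)[symmetric] by (simp add: field_simps)
  thus "inner_L2 (fst (S t X)) (eig j) = cos (\<nu> * t) * inner_L2 (fst X) (eig j) + sin (\<nu> * t) / \<nu> * inner_L2 (snd X) (eig j)" using l by simp
  have "\<nu> * inner_L2 (snd (S t X)) (eig j) = \<nu> * (cos (\<nu> * t) * inner_L2 (snd X) (eig j) - \<nu> * sin (\<nu> * t) * inner_L2 (fst X) (eig j))"
    unfolding a2 Zt[of "- t"] Y0 Z0 unfolding \<nu>(2)[symmetric] by (simp add: field_simps)
  thus "inner_L2 (snd (S t X)) (eig j) = cos (\<nu> * t) * inner_L2 (snd X) (eig j) - \<nu> * sin (\<nu> * t) * inner_L2 (fst X) (eig j)" using \<nu>(1) by simp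
qed

end

section \<open>Modes of a mild solution\<close>

text \<open>The control is given on the open interval, the mild formula integrates over closed ones.\<close>

lemma AE_open_imp_closed_subinterval:
  fixes T :: real
  assumes "AE s in lebesgue_on {0<..<T}. P s" "t \<in> {0..T}"
  shows "AE s in lebesgue_on {0..t}. P s"
proof -
  have "AE s in lebesgue. s \<in> {0<..<T} \<longrightarrow> P s" using assms(1) by (subst (asm) AE_restrict_space_iff) auto
  moreover have "AE s in lebesgue. s \<notin> {0, T}" by (intro AE_not_in) (simp flip: negligible_iff_null_sets)
  ultimately have "AE s in lebesgue. s \<in> {0..t} \<longrightarrow> P s" by eventually_elim (use assms(2) in auto)
  thus ?thesis by (subst AE_restrict_space_iff) auto
qed

lemma integrable_mult_bounded:
  fixes f g :: "real \<Rightarrow> real"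
  assumes "integrable M f" "g \<in> borel_measurable M" "\<And>x. \<bar>g x\<bar> \<le> 1"
  shows "integrable M (\<lambda>x. g x * f x)"
proof (rule Bochner_Integration.integrable_bound[OF assms(1)])
  show "(\<lambda>x. g x * f x) \<in> borel_measurable M" using assms by auto
  have "\<bar>g x\<bar> * \<bar>f x\<bar> \<le> 1 * \<bar>f x\<bar>" for x using assms(3) by (intro mult_right_mono) auto
  thus "AE x in M. norm (g x * f x) \<le> norm (f x)" by (intro AE_I2) (simp add: abs_mult)
qed

text \<open>Testing the mild formula with \<open>(e\<^sub>j, 0)\<close> and \<open>(0, e\<^sub>j)\<close> expresses both coefficients by Duhamel integrals of the
same scalar forcing \<open>h\<close>, with kernels \<open>sin (\<nu> (t - s)) / \<nu>\<close> and \<open>cos (\<nu> (t - s))\<close>; the second kernel is the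
derivative of the first.\<close>

theorem mild_solution_modes:
  fixes S :: "real \<Rightarrow> 'n::{finite, linorder} state \<Rightarrow> 'n state" and f :: "real \<Rightarrow> 'n::{finite, linorder} func"
  assumes \<alpha>: "\<alpha> \<ge> 0" and group: "wave_group \<alpha> S" and T: "T > 0" and \<Phi>0: "\<Phi>\<^sub>0 \<in> energy_space"
    and g: "\<forall>u \<in> (H01 :: ('n::{finite, linorder} func) set). g \<circ> u \<in> L2"
    and f: "local_control \<omega> f \<in> L2_energy \<alpha> T"
    and mild: "mild_solution \<alpha> S T \<Phi>\<^sub>0 (local_control \<omega> f) (\<lambda>(u, z). (0, g \<circ> u)) \<Phi>"
    and j: "j \<ge> 1" and t: "t \<in> {0..T}"
  shows "((\<lambda>t. inner_L2 (fst (\<Phi> t)) (eigenfunction j)) has_real_derivative inner_L2 (snd (\<Phi> t)) (eigenfunction j)) (at t within {0..T})"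
proof -
  interpret e: semi_inner "energy_space :: 'n state set" "energy_form \<alpha>"
    rewrites "semi_inner.N (energy_form \<alpha>) = (energy_norm \<alpha> :: 'n state \<Rightarrow> real)"
    by (rule energy_interp[OF \<alpha>])+
  note modes = group_modes[OF \<alpha> group _ j]
  let ?e = "eigenfunction j :: 'n func"
  define l where "l = shifted_eigval TYPE('n) \<alpha> j"
  define \<nu> where "\<nu> = sqrt l"
  have l: "l > 0" unfolding l_def by (rule shifted_eigval_pos[OF \<alpha> j])
  have \<nu>: "\<nu> > 0" "\<nu> * \<nu> = l" using l by (auto simp: \<nu>_def)
  have p: "(?e, 0) \<in> energy_space" by (rule pair_zero_E[OF \<alpha> group eigenfunction_H01])
  have v: "(0, ?e) \<in> energy_space" by (rule zero_pair_E[OF \<alpha> group eigenfunction_L2])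
  note posf = energy_form_position[OF \<alpha> group, of _ j, folded l_def]
  note velf = energy_form_velocity[OF \<alpha> group, of _ j]
  define H where "H s = local_control \<omega> f s + (\<lambda>(u, z). (0, g \<circ> u)) (\<Phi> s)" for s
  define h where "h s = inner_L2 (snd (H s)) ?e" for s
  have \<Phi>E: "\<Phi> s \<in> energy_space" if "s \<in> {0..T}" for s
    using mild that unfolding mild_solution_def continuous_energy_def by blast
  have FE: "AE s in lebesgue_on {0<..<T}. local_control \<omega> f s \<in> energy_space"
    using f unfolding L2_energy_def strongly_measurable_def by blast
  have H: "AE s in lebesgue_on {0..r}. H s \<in> energy_space \<and> fst (H s) = 0" if r: "r \<in> {0..T}" for r
    using AE_open_imp_closed_subinterval[OF FE r] AE_space
    proof eventually_elim
      case (elim s)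
      have "\<Phi> s \<in> energy_space" using elim(2) r by (intro \<Phi>E) auto
      hence "g \<circ> fst (\<Phi> s) \<in> L2" using g by (auto simp: energy_space_def)
      hence G: "(0, g \<circ> fst (\<Phi> s)) \<in> energy_space" by (rule zero_pair_E[OF \<alpha> group])
      have "H s = local_control \<omega> f s + (0, g \<circ> fst (\<Phi> s))" unfolding H_def case_prod_unfold ..
      hence "H s \<in> energy_space" using e.add_E[OF elim(1) G] by (simp only:)
      moreover have "fst (H s) = 0" unfolding H_def local_control_def by (simp add: case_prod_unfold fun_eq_iff)
      ultimately show ?case by blast
    qed
  have key: "integrable (lebesgue_on {0..r}) (\<lambda>s. sin (\<nu> * (r - s)) * h s)
      \<and> integrable (lebesgue_on {0..r}) (\<lambda>s. cos (\<nu> * (r - s)) * h s)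
      \<and> inner_L2 (fst (\<Phi> r)) ?e = inner_L2 (fst (S r \<Phi>\<^sub>0)) ?e - (LINT s|lebesgue_on {0..r}. sin (\<nu> * (r - s)) * h s) / \<nu>
      \<and> inner_L2 (snd (\<Phi> r)) ?e = inner_L2 (snd (S r \<Phi>\<^sub>0)) ?e - (LINT s|lebesgue_on {0..r}. cos (\<nu> * (r - s)) * h s)"
    if r: "r \<in> {0..T}" for r
  proof -
    let ?M = "lebesgue_on {0..r}"
    obtain I where I: "has_energy_integral \<alpha> ?M (\<lambda>s. S (r - s) (H s)) I"
      "energy_norm \<alpha> (\<Phi> r - (S r \<Phi>\<^sub>0 - I)) = 0"
      using mild r unfolding mild_solution_def H_def by blast
    have IE: "I \<in> energy_space" using I(1) unfolding has_energy_integral_def by blast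
    have SE: "S r \<Phi>\<^sub>0 \<in> energy_space" by (rule group_E[OF \<alpha> group \<Phi>0])
    have sets: "{0..r} \<in> sets lebesgue" by simp
    have form: "energy_form \<alpha> (\<Phi> r) \<Psi> = energy_form \<alpha> (S r \<Phi>\<^sub>0) \<Psi> - energy_form \<alpha> I \<Psi>" if "\<Psi> \<in> energy_space" for \<Psi>
      using e.null_cong_left[OF \<Phi>E[OF r] e.diff_E[OF SE IE] that I(2)] e.diff_left[OF SE IE that] by simp
    have hb1: "has_bochner_integral ?M (\<lambda>s. energy_form \<alpha> (S (r - s) (H s)) (?e, 0)) (energy_form \<alpha> I (?e, 0))"
      by (rule has_energy_integral_form[OF \<alpha> sets I(1) p])
    have hb2: "has_bochner_integral ?M (\<lambda>s. energy_form \<alpha> (S (r - s) (H s)) (0, ?e)) (energy_form \<alpha> I (0, ?e))"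
      by (rule has_energy_integral_form[OF \<alpha> sets I(1) v])
    have eq1: "AE s in ?M. energy_form \<alpha> (S (r - s) (H s)) (?e, 0) = \<nu> * (sin (\<nu> * (r - s)) * h s)"
      using H[OF r]
    proof eventually_elim
      case (elim s)
      hence E: "H s \<in> energy_space" and z: "fst (H s) = 0" by auto
      have "energy_form \<alpha> (S (r - s) (H s)) (?e, 0) = l * (cos (\<nu> * (r - s)) * inner_L2 0 ?e + sin (\<nu> * (r - s)) / \<nu> * h s)"
        unfolding posf[OF group_E[OF \<alpha> group E]] modes(1)[OF E, folded l_def, folded \<nu>_def] z h_def ..
      also have "inner_L2 0 ?e = 0" by (rule l2.zero_left[OF eigenfunction_L2])
      also have "l * (cos (\<nu> * (r - s)) * 0 + sin (\<nu> * (r - s)) / \<nu> * h s) = \<nu> * (sin (\<nu> * (r - s)) * h s)"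
        using \<nu>(1) unfolding \<nu>(2)[symmetric] by simp
      finally show ?case .
    qed
    have eq2: "AE s in ?M. energy_form \<alpha> (S (r - s) (H s)) (0, ?e) = cos (\<nu> * (r - s)) * h s"
      using H[OF r]
    proof eventually_elim
      case (elim s)
      hence E: "H s \<in> energy_space" and z: "fst (H s) = 0" by auto
      have "energy_form \<alpha> (S (r - s) (H s)) (0, ?e) = cos (\<nu> * (r - s)) * h s - \<nu> * sin (\<nu> * (r - s)) * inner_L2 0 ?e"
        unfolding velf[OF group_E[OF \<alpha> group E]] modes(2)[OF E, folded l_def, folded \<nu>_def] z h_def ..
      also have "inner_L2 0 ?e = 0" by (rule l2.zero_left[OF eigenfunction_L2])
      finally show ?case by (simp only: mult_zero_right diff_zero)
    qed
    have m1: "(\<lambda>s. \<nu> * (sin (\<nu> * (r - s)) * h s)) \<in> borel_measurable ?M"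
      by (rule measurable_lebesgue_on_AE[OF sets borel_measurable_has_bochner_integral[OF hb1] eq1])
    have m2: "(\<lambda>s. cos (\<nu> * (r - s)) * h s) \<in> borel_measurable ?M"
      by (rule measurable_lebesgue_on_AE[OF sets borel_measurable_has_bochner_integral[OF hb2] eq2])
    have hb1': "has_bochner_integral ?M (\<lambda>s. \<nu> * (sin (\<nu> * (r - s)) * h s)) (energy_form \<alpha> I (?e, 0))"
      using has_bochner_integral_cong_AE[OF borel_measurable_has_bochner_integral[OF hb1] m1 eq1] hb1 by blast
    have hb2': "has_bochner_integral ?M (\<lambda>s. cos (\<nu> * (r - s)) * h s) (energy_form \<alpha> I (0, ?e))"
      using has_bochner_integral_cong_AE[OF borel_measurable_has_bochner_integral[OF hb2] m2 eq2] hb2 by blast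
    have i1: "integrable ?M (\<lambda>s. sin (\<nu> * (r - s)) * h s)"
      using integrable.intros[OF hb1'] \<nu>(1) by simp
    have i2: "integrable ?M (\<lambda>s. cos (\<nu> * (r - s)) * h s)" by (rule integrable.intros[OF hb2'])
    have "energy_form \<alpha> I (?e, 0) = \<nu> * (LINT s|?M. sin (\<nu> * (r - s)) * h s)"
      using has_bochner_integral_integral_eq[OF hb1'] by simp
    hence "l * inner_L2 (fst (\<Phi> r)) ?e = l * inner_L2 (fst (S r \<Phi>\<^sub>0)) ?e - \<nu> * (LINT s|?M. sin (\<nu> * (r - s)) * h s)"
      using form[OF p] unfolding posf[OF \<Phi>E[OF r]] posf[OF SE] by (simp only:)
    moreover have "l * x = l * y - \<nu> * k \<Longrightarrow> x = y - k / \<nu>" for x y k :: real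
    proof -
      assume "l * x = l * y - \<nu> * k"
      hence "\<nu> * (\<nu> * x) = \<nu> * (\<nu> * y - k)" unfolding \<nu>(2)[symmetric] by (simp add: algebra_simps)
      hence "\<nu> * x = \<nu> * y - k" using \<nu>(1) by simp
      thus "x = y - k / \<nu>" using \<nu>(1) by (simp add: field_simps)
    qed
    ultimately have e1: "inner_L2 (fst (\<Phi> r)) ?e = inner_L2 (fst (S r \<Phi>\<^sub>0)) ?e - (LINT s|?M. sin (\<nu> * (r - s)) * h s) / \<nu>"
      by blast
    have "energy_form \<alpha> I (0, ?e) = (LINT s|?M. cos (\<nu> * (r - s)) * h s)"
      using has_bochner_integral_integral_eq[OF hb2'] by simp
    hence e2: "inner_L2 (snd (\<Phi> r)) ?e = inner_L2 (snd (S r \<Phi>\<^sub>0)) ?e - (LINT s|?M. cos (\<nu> * (r - s)) * h s)"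
      using form[OF v] unfolding velf[OF \<Phi>E[OF r]] velf[OF SE] by simp
    show ?thesis using i1 i2 e1 e2 by blast
  qed
  \<comment> \<open>the two integrands at time \<open>T\<close> determine \<open>h\<close> because \<open>sin\<^sup>2 + cos\<^sup>2 = 1\<close>\<close>
  have hint: "integrable (lebesgue_on {0..T}) h"
  proof -
    have Tm: "T \<in> {0..T}" using T by simp
    have sm: "(\<lambda>s. sin (\<nu> * (T - s))) \<in> borel_measurable (lebesgue_on {0..T})"
      "(\<lambda>s. cos (\<nu> * (T - s))) \<in> borel_measurable (lebesgue_on {0..T})"
      by (intro continuous_imp_measurable_on_sets_lebesgue continuous_intros; simp)+
    have "integrable (lebesgue_on {0..T}) (\<lambda>s. sin (\<nu> * (T - s)) * (sin (\<nu> * (T - s)) * h s) + cos (\<nu> * (T - s)) * (cos (\<nu> * (T - s)) * h s))"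
    proof (rule Bochner_Integration.integrable_add)
      show "integrable (lebesgue_on {0..T}) (\<lambda>s. sin (\<nu> * (T - s)) * (sin (\<nu> * (T - s)) * h s))"
        using key[OF Tm] by (intro integrable_mult_bounded[where f="\<lambda>s. sin (\<nu> * (T - s)) * h s"] sm) auto
      show "integrable (lebesgue_on {0..T}) (\<lambda>s. cos (\<nu> * (T - s)) * (cos (\<nu> * (T - s)) * h s))"
        using key[OF Tm] by (intro integrable_mult_bounded[where f="\<lambda>s. cos (\<nu> * (T - s)) * h s"] sm) auto
    qed
    moreover have "sin x * (sin x * y) + cos x * (cos x * y) = y" for x y :: real
      using sin_cos_squared_add[of x] by (simp add: power2_eq_square flip: mult.assoc distrib_right)
    ultimately show ?thesis by simp
  qed
  have dK: "((\<lambda>t. LINT s|lebesgue_on {0..t}. sin (\<nu> * (t - s)) * h s) has_real_derivative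
     (LINT s|lebesgue_on {0..t}. \<nu> * cos (\<nu> * (t - s)) * h s)) (at t within {0..T})"
    by (rule duhamel_derivative[OF hint \<nu>(1) t])
  define u0 where "u0 = inner_L2 (fst \<Phi>\<^sub>0) ?e"
  define z0 where "z0 = inner_L2 (snd \<Phi>\<^sub>0) ?e"
  have U: "inner_L2 (fst (S r \<Phi>\<^sub>0)) ?e = cos (\<nu> * r) * u0 + sin (\<nu> * r) / \<nu> * z0" for r
    unfolding u0_def z0_def \<nu>_def l_def by (rule modes(1)[OF \<Phi>0])
  have V: "inner_L2 (snd (S r \<Phi>\<^sub>0)) ?e = cos (\<nu> * r) * z0 - \<nu> * sin (\<nu> * r) * u0" for r
    unfolding u0_def z0_def \<nu>_def l_def by (rule modes(2)[OF \<Phi>0])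
  have "((\<lambda>r. cos (\<nu> * r) * u0 + sin (\<nu> * r) / \<nu> * z0) has_real_derivative cos (\<nu> * t) * z0 - \<nu> * sin (\<nu> * t) * u0) (at t within {0..T})"
    using \<nu>(1) by (auto intro!: derivative_eq_intros simp: field_simps)
  from DERIV_diff[OF this DERIV_cdivide[OF dK, of \<nu>]]
  have "((\<lambda>r. cos (\<nu> * r) * u0 + sin (\<nu> * r) / \<nu> * z0 - (LINT s|lebesgue_on {0..r}. sin (\<nu> * (r - s)) * h s) / \<nu>)
      has_real_derivative inner_L2 (snd (\<Phi> t)) ?e) (at t within {0..T})"
  proof (rule DERIV_cong)
    have "(LINT s|lebesgue_on {0..t}. \<nu> * cos (\<nu> * (t - s)) * h s) = \<nu> * (LINT s|lebesgue_on {0..t}. cos (\<nu> * (t - s)) * h s)"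
      by (simp add: mult.assoc)
    thus "cos (\<nu> * t) * z0 - \<nu> * sin (\<nu> * t) * u0 - (LINT s|lebesgue_on {0..t}. \<nu> * cos (\<nu> * (t - s)) * h s) / \<nu> = inner_L2 (snd (\<Phi> t)) ?e"
      using key[OF t] V[of t] \<nu>(1) by simp
  qed
  thus ?thesis
    by (rule has_real_derivative_cong_on[OF _ t]) (use key U in simp)
qed

section \<open>Approximation of the state\<close>

lemma H01_norm_le_energy: "\<alpha> \<ge> 0 \<Longrightarrow> H01_norm \<alpha> (fst \<Phi>) \<le> energy_norm \<alpha> \<Phi>"
  unfolding energy_norm_def by (rule real_le_rsqrt) simp

lemma L2_norm_le_energy: "L2_norm (snd \<Phi>) \<le> energy_norm \<alpha> \<Phi>"
  unfolding energy_norm_def by (rule real_le_rsqrt) simp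

lemma continuous_energy_components:
  assumes \<alpha>: "\<alpha> \<ge> 0" and c: "continuous_energy \<alpha> T \<Phi>" and t: "t \<in> {0..T}"
  shows "((\<lambda>s. H01_norm \<alpha> (fst (\<Phi> s) - fst (\<Phi> t))) \<longlongrightarrow> 0) (at t within {0..T})"
    and "((\<lambda>s. L2_norm (snd (\<Phi> s) - snd (\<Phi> t))) \<longlongrightarrow> 0) (at t within {0..T})"
proof -
  have lim: "((\<lambda>s. energy_norm \<alpha> (\<Phi> s - \<Phi> t)) \<longlongrightarrow> 0) (at t within {0..T})"
    using c t unfolding continuous_energy_def by blast
  have n1: "norm (H01_norm \<alpha> u) = H01_norm \<alpha> u" for u :: "'a func"
    using H1_form_nonneg[OF \<alpha>, of u] by (simp add: H01_norm_form)
  have n2: "norm (L2_norm u) = L2_norm u" for u :: "'a func" by (simp add: L2_norm_def)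
  show "((\<lambda>s. H01_norm \<alpha> (fst (\<Phi> s) - fst (\<Phi> t))) \<longlongrightarrow> 0) (at t within {0..T})"
    by (rule Lim_null_comparison[OF always_eventually lim], unfold n1, rule allI)
       (rule H01_norm_le_energy[OF \<alpha>, of "\<Phi> _ - \<Phi> t", unfolded fst_diff])
  show "((\<lambda>s. L2_norm (snd (\<Phi> s) - snd (\<Phi> t))) \<longlongrightarrow> 0) (at t within {0..T})"
    by (rule Lim_null_comparison[OF always_eventually lim], unfold n2, rule allI)
       (rule L2_norm_le_energy[of "\<Phi> _ - \<Phi> t", unfolded snd_diff])
qed

lemma continuous_mode:
  assumes c: "continuous_energy \<alpha> T \<Phi>" and \<alpha>: "\<alpha> \<ge> 0" and w: "w \<in> L2"
  shows "continuous_on {0..T} (\<lambda>t. inner_L2 (snd (\<Phi> t)) w)"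
  unfolding continuous_on_def
proof
  fix t assume t: "t \<in> {0..T}"
  have E: "snd (\<Phi> s) \<in> L2" if "s \<in> {0..T}" for s
    using c that unfolding continuous_energy_def energy_space_def by fastforce
  show "((\<lambda>t. inner_L2 (snd (\<Phi> t)) w) \<longlongrightarrow> inner_L2 (snd (\<Phi> t)) w) (at t within {0..T})"
  proof (rule LIM_zero_cancel, rule Lim_null_comparison)
    show "((\<lambda>s. L2_norm (snd (\<Phi> s) - snd (\<Phi> t)) * L2_norm w) \<longlongrightarrow> 0) (at t within {0..T})"
      by (rule tendsto_mult_left_zero[OF continuous_energy_components(2)[OF \<alpha> c t]])
    have "norm (inner_L2 (snd (\<Phi> s)) w - inner_L2 (snd (\<Phi> t)) w) \<le> L2_norm (snd (\<Phi> s) - snd (\<Phi> t)) * L2_norm w" if s: "s \<in> {0..T}" for s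
      unfolding l2.diff_left[OF E[OF s] E[OF t] w, symmetric] real_norm_def
      by (rule l2.cauchy_schwarz[OF l2.diff_E[OF E[OF s] E[OF t]] w])
    thus "\<forall>\<^sub>F s in at t within {0..T}. norm (inner_L2 (snd (\<Phi> s)) w - inner_L2 (snd (\<Phi> t)) w) \<le> L2_norm (snd (\<Phi> s) - snd (\<Phi> t)) * L2_norm w"
      unfolding eventually_at_filter by (intro always_eventually) blast
  qed
qed

lemma sum_fun_apply: "(\<Sum>i\<in>I. f i) x = (\<Sum>i\<in>I. f i x)" for f :: "'i \<Rightarrow> 'a \<Rightarrow> real"
  by (induction I rule: infinite_finite_induct) auto

lemma networks_params:
  assumes "\<And>j. j \<in> {1..P} \<Longrightarrow> h j \<in> networks \<sigma>"
  shows "\<exists>m0. \<forall>m\<ge>m0. \<exists>\<theta>. \<forall>j\<in>{1..P}. net \<sigma> m \<theta> j = h j"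
proof -
  have "\<forall>j\<in>{1..P}. \<exists>m0. \<forall>m::nat\<ge>m0. \<exists>A W B. h j = (\<lambda>t. \<Sum>i=1..m. A i * \<sigma> (W i * t + B i))"
    using networks_width[OF assms] by blast
  from bchoice[OF this] obtain m0 where m0: "\<forall>j\<in>{1..P}. \<forall>m::nat\<ge>m0 j. \<exists>A W B. h j = (\<lambda>t. \<Sum>i=1..m. A i * \<sigma> (W i * t + B i))" by blast
  show ?thesis
  proof (rule exI[of _ "Max (insert 0 (m0 ` {1..P}))"], intro allI impI)
    fix m assume m: "m \<ge> Max (insert 0 (m0 ` {1..P}))"
    have "\<forall>j\<in>{1..P}. \<exists>p. h j = (\<lambda>t. \<Sum>i=1..m. fst p i * \<sigma> (fst (snd p) i * t + snd (snd p) i))"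
    proof
      fix j assume j: "j \<in> {1..P}"
      have "m0 j \<le> Max (insert 0 (m0 ` {1..P}))" using j by (intro Max_ge) auto
      then obtain A W B where "h j = (\<lambda>t. \<Sum>i=1..m. A i * \<sigma> (W i * t + B i))" using m0 j m by (meson order.trans)
      thus "\<exists>p. h j = (\<lambda>t. \<Sum>i=1..m. fst p i * \<sigma> (fst (snd p) i * t + snd (snd p) i))"
        by (intro exI[of _ "(A, W, B)"]) simp
    qed
    from bchoice[OF this] obtain \<theta> where \<theta>: "\<forall>j\<in>{1..P}. h j = (\<lambda>t. \<Sum>i=1..m. fst (\<theta> j) i * \<sigma> (fst (snd (\<theta> j)) i * t + snd (snd (\<theta> j)) i))" by blast
    show "\<exists>\<theta>. \<forall>j\<in>{1..P}. net \<sigma> m \<theta> j = h j"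
      using \<theta> by (intro exI[of _ \<theta>]) (auto simp: net_def case_prod_unfold intro!: ext)
  qed
qed

text \<open>For displacement and velocity the coefficients of the projections are \<open>\<langle>u, e\<^sub>j\<rangle> / \<langle>e\<^sub>j, e\<^sub>j\<rangle>\<close> and
\<open>\<langle>z, e\<^sub>j\<rangle> / \<langle>e\<^sub>j, e\<^sub>j\<rangle>\<close>, with the same \<open>L\<^sup>2\<close> products although the first projection is orthogonal in the energy.
So the second coefficient is the derivative of the first and one network serves both.\<close>

theorem state_approx:
  fixes \<Phi> :: "real \<Rightarrow> 'n::{finite, linorder} state"
  assumes \<alpha>: "\<alpha> \<ge> 0" and T: "T > 0" and c: "continuous_energy \<alpha> T \<Phi>"
    and modes: "\<And>j t. j \<ge> 1 \<Longrightarrow> t \<in> {0..T} \<Longrightarrow>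
      ((\<lambda>t. inner_L2 (fst (\<Phi> t)) (eigenfunction j)) has_real_derivative inner_L2 (snd (\<Phi> t)) (eigenfunction j)) (at t within {0..T})"
    and \<sigma>: "C2_fun \<sigma>" "\<nexists>p. \<sigma> = poly p" and \<epsilon>: "\<epsilon> > 0"
  shows "\<exists>P0. \<forall>P\<ge>P0. \<exists>a. (\<forall>j. a j \<in> networks \<sigma>) \<and>
    (\<forall>t\<in>{0..T}. energy_norm \<alpha> (\<Phi> t - ((\<Sum>j=1..P. a j t *\<^sub>R eigenfunction j), (\<Sum>j=1..P. deriv (a j) t *\<^sub>R eigenfunction j))) \<le> \<epsilon>)"
proof -
  interpret h: orthogonal_basis "H01 :: ('n func) set" "H1_form \<alpha>" eigenfunction
    rewrites "semi_inner.N (H1_form \<alpha>) = (H01_norm \<alpha> :: ('n func) \<Rightarrow> real)"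
    by (rule orthogonal_basis_H01[OF \<alpha>], rule H01_norm_eq_N[OF \<alpha>])
  have uE: "fst (\<Phi> t) \<in> H01" and zE: "snd (\<Phi> t) \<in> L2" if "t \<in> {0..T}" for t
    using c that unfolding continuous_energy_def energy_space_def by fastforce+
  let ?n = "\<lambda>j. inner_L2 (eigenfunction j) (eigenfunction j :: 'n func)"
  have coef: "h.coef (fst (\<Phi> t)) j = inner_L2 (fst (\<Phi> t)) (eigenfunction j) / ?n j" if "t \<in> {0..T}" "j \<ge> 1" for t j
    unfolding h.coef_def H1_form_eigenfunction[OF uE[OF that(1)]] H1_form_eigenfunction[OF eigenfunction_H01]
    using shifted_eigval_pos[OF \<alpha> that(2), where 'n='n] by simp
  obtain P1 where P1: "\<forall>P\<ge>P1. \<forall>t\<in>{0..T}. H01_norm \<alpha> (fst (\<Phi> t) - h.proj P (fst (\<Phi> t))) < \<epsilon> / 4"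
    using h.proj_close_uniform[OF compact_Icc uE continuous_energy_components(1)[OF \<alpha> c], of "\<epsilon> / 4"] \<epsilon> by auto
  obtain P2 where P2: "\<forall>P\<ge>P2. \<forall>t\<in>{0..T}. L2_norm (snd (\<Phi> t) - modes.proj P (snd (\<Phi> t))) < \<epsilon> / 4"
    using modes.proj_close_uniform[OF compact_Icc zE continuous_energy_components(2)[OF \<alpha> c], of "\<epsilon> / 4"] \<epsilon> by auto
  show ?thesis
  proof (intro exI[of _ "max P1 P2"] allI impI)
    fix P assume P: "P \<ge> max P1 P2"
    define C where "C = (\<Sum>j=1..P. H01_norm \<alpha> (eigenfunction j :: 'n func) + L2_norm (eigenfunction j :: 'n func))"
    have nn: "0 \<le> H01_norm \<alpha> (eigenfunction j :: 'n func)" "0 \<le> L2_norm (eigenfunction j :: 'n func)" for j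
      by (rule h.N_nonneg[OF eigenfunction_H01], rule l2.N_nonneg[OF eigenfunction_L2])
    have C: "C \<ge> 0" unfolding C_def by (intro sum_nonneg add_nonneg_nonneg nn)
    define \<delta> where "\<delta> = \<epsilon> / (2 * (C + 1))"
    have \<delta>: "\<delta> > 0" using \<epsilon> C by (simp add: \<delta>_def)
    have \<delta>C: "\<delta> * C \<le> \<epsilon> / 2" unfolding \<delta>_def using C \<epsilon> by (intro half_quotient_mult_le) auto
    have "\<exists>a\<in>networks \<sigma>. j \<ge> 1 \<longrightarrow> (\<forall>t\<in>{0..T}. \<bar>inner_L2 (fst (\<Phi> t)) (eigenfunction j) / ?n j - a t\<bar> \<le> \<delta>
        \<and> \<bar>inner_L2 (snd (\<Phi> t)) (eigenfunction j) / ?n j - deriv a t\<bar> \<le> \<delta>)" for j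
    proof (cases "j \<ge> 1")
      case True
      have "\<exists>a\<in>networks \<sigma>. \<forall>t\<in>{0..T}. \<bar>inner_L2 (fst (\<Phi> t)) (eigenfunction j) / ?n j - a t\<bar> \<le> \<delta>
          \<and> \<bar>inner_L2 (snd (\<Phi> t)) (eigenfunction j) / ?n j - deriv a t\<bar> \<le> \<delta>"
      proof (rule C1_approx_networks[OF \<sigma> T _ _ \<delta>])
        show "((\<lambda>t. inner_L2 (fst (\<Phi> t)) (eigenfunction j) / ?n j) has_real_derivative inner_L2 (snd (\<Phi> t)) (eigenfunction j) / ?n j) (at t within {0..T})"
          if "t \<in> {0..T}" for t by (rule DERIV_cdivide[OF modes[OF True that]])
        show "continuous_on {0..T} (\<lambda>t. inner_L2 (snd (\<Phi> t)) (eigenfunction j) / ?n j)"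
          using eigenfunction_norm_pos[OF True, where 'a='n]
          by (intro continuous_on_divide continuous_mode[OF c \<alpha> eigenfunction_L2] continuous_on_const) auto
      qed
      thus ?thesis by blast
    next
      case False
      thus ?thesis using ridge_in_networks by blast
    qed
    then obtain a where a: "\<And>j. a j \<in> networks \<sigma>"
      "\<And>j t. j \<ge> 1 \<Longrightarrow> t \<in> {0..T} \<Longrightarrow> \<bar>inner_L2 (fst (\<Phi> t)) (eigenfunction j) / ?n j - a j t\<bar> \<le> \<delta>"
      "\<And>j t. j \<ge> 1 \<Longrightarrow> t \<in> {0..T} \<Longrightarrow> \<bar>inner_L2 (snd (\<Phi> t)) (eigenfunction j) / ?n j - deriv (a j) t\<bar> \<le> \<delta>"
      by metis
    have "energy_norm \<alpha> (\<Phi> t - ((\<Sum>j=1..P. a j t *\<^sub>R eigenfunction j), (\<Sum>j=1..P. deriv (a j) t *\<^sub>R eigenfunction j))) \<le> \<epsilon>"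
      if t: "t \<in> {0..T}" for t
    proof -
      let ?u = "fst (\<Phi> t)" and ?z = "snd (\<Phi> t)"
      let ?A = "\<Sum>j=1..P. a j t *\<^sub>R eigenfunction j :: 'n func"
      let ?D = "\<Sum>j=1..P. deriv (a j) t *\<^sub>R eigenfunction j :: 'n func"
      have u1: "H01_norm \<alpha> (h.proj P ?u - ?A) \<le> (\<Sum>j=1..P. \<delta> * H01_norm \<alpha> (eigenfunction j :: 'n func))"
      proof -
        have eq: "h.proj P ?u - ?A = (\<Sum>j=1..P. (h.coef ?u j - a j t) *\<^sub>R eigenfunction j)"
          unfolding h.proj_def by (simp only: sum_subtractf scaleR_left_diff_distrib)
        have "H01_norm \<alpha> (h.proj P ?u - ?A) \<le> (\<Sum>j=1..P. H01_norm \<alpha> ((h.coef ?u j - a j t) *\<^sub>R eigenfunction j :: 'n func))"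
          unfolding eq by (rule h.N_sum_le[OF h.scale_E[OF eigenfunction_H01]])
        also have "\<dots> \<le> (\<Sum>j=1..P. \<delta> * H01_norm \<alpha> (eigenfunction j :: 'n func))"
        proof (rule sum_mono)
          fix j assume "j \<in> {1..P}"
          hence j: "j \<ge> 1" by simp
          show "H01_norm \<alpha> ((h.coef ?u j - a j t) *\<^sub>R eigenfunction j :: 'n func) \<le> \<delta> * H01_norm \<alpha> (eigenfunction j :: 'n func)"
            unfolding h.N_scale[OF eigenfunction_H01] coef[OF t j] by (intro mult_right_mono a(2) j t nn)
        qed
        finally show ?thesis .
      qed
      have z1: "L2_norm (modes.proj P ?z - ?D) \<le> (\<Sum>j=1..P. \<delta> * L2_norm (eigenfunction j :: 'n func))"
      proof -
        have eq: "modes.proj P ?z - ?D = (\<Sum>j=1..P. (modes.coef ?z j - deriv (a j) t) *\<^sub>R eigenfunction j)"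
          unfolding modes.proj_def by (simp only: sum_subtractf scaleR_left_diff_distrib)
        have "L2_norm (modes.proj P ?z - ?D) \<le> (\<Sum>j=1..P. L2_norm ((modes.coef ?z j - deriv (a j) t) *\<^sub>R eigenfunction j :: 'n func))"
          unfolding eq by (rule l2.N_sum_le[OF l2.scale_E[OF eigenfunction_L2]])
        also have "\<dots> \<le> (\<Sum>j=1..P. \<delta> * L2_norm (eigenfunction j :: 'n func))"
        proof (rule sum_mono)
          fix j assume "j \<in> {1..P}"
          hence j: "j \<ge> 1" by simp
          show "L2_norm ((modes.coef ?z j - deriv (a j) t) *\<^sub>R eigenfunction j :: 'n func) \<le> \<delta> * L2_norm (eigenfunction j :: 'n func)"
            unfolding l2.N_scale[OF eigenfunction_L2] modes.coef_def by (intro mult_right_mono a(3) j t nn)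
        qed
        finally show ?thesis .
      qed
      have AE: "?A \<in> H01" by (rule h.lincomb_E)
      have DE: "?D \<in> L2" by (rule modes.lincomb_E)
      have "H01_norm \<alpha> (?u - ?A) \<le> H01_norm \<alpha> (?u - h.proj P ?u) + H01_norm \<alpha> (h.proj P ?u - ?A)"
        by (rule h.N_diff_triangle[OF uE[OF t] h.proj_E AE])
      moreover have "H01_norm \<alpha> (?u - h.proj P ?u) < \<epsilon> / 4" using P1 P t by auto
      ultimately have n1: "H01_norm \<alpha> (?u - ?A) \<le> \<epsilon> / 4 + (\<Sum>j=1..P. \<delta> * H01_norm \<alpha> (eigenfunction j :: 'n func))"
        using u1 by linarith
      have "L2_norm (?z - ?D) \<le> L2_norm (?z - modes.proj P ?z) + L2_norm (modes.proj P ?z - ?D)"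
        by (rule l2.N_diff_triangle[OF zE[OF t] modes.proj_E DE])
      moreover have "L2_norm (?z - modes.proj P ?z) < \<epsilon> / 4" using P2 P t by auto
      ultimately have n2: "L2_norm (?z - ?D) \<le> \<epsilon> / 4 + (\<Sum>j=1..P. \<delta> * L2_norm (eigenfunction j :: 'n func))"
        using z1 by linarith
      have "(\<Sum>j=1..P. \<delta> * H01_norm \<alpha> (eigenfunction j :: 'n func)) + (\<Sum>j=1..P. \<delta> * L2_norm (eigenfunction j :: 'n func)) = \<delta> * C"
        unfolding C_def sum_distrib_left by (simp only: sum.distrib distrib_left)
      moreover have "energy_norm \<alpha> (\<Phi> t - (?A, ?D)) \<le> H01_norm \<alpha> (?u - ?A) + L2_norm (?z - ?D)"
        unfolding energy_norm_def fst_diff snd_diff fst_conv snd_conv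
        by (rule sqrt_sum_squares_le_sum) (intro h.N_nonneg h.diff_E uE t AE, intro l2.N_nonneg l2.diff_E zE t DE)
      ultimately show ?thesis using n1 n2 \<delta>C by linarith
    qed
    thus "\<exists>a. (\<forall>j. a j \<in> networks \<sigma>) \<and>
      (\<forall>t\<in>{0..T}. energy_norm \<alpha> (\<Phi> t - ((\<Sum>j=1..P. a j t *\<^sub>R eigenfunction j), (\<Sum>j=1..P. deriv (a j) t *\<^sub>R eigenfunction j))) \<le> \<epsilon>)"
      using a(1) by blast
  qed
qed

section \<open>Approximation of the control\<close>

text \<open>Approximate \<open>F\<close> in the mean by a continuous function, and that one uniformly by a network.\<close>

lemma interval_L2_approx_networks:
  fixes F :: "real \<Rightarrow> real"
  assumes T: "T > 0" and F: "F \<in> borel_measurable (lebesgue_on {0<..<T})" "integrable (lebesgue_on {0<..<T}) (\<lambda>t. (F t)\<^sup>2)"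
    and \<sigma>: "continuous_on UNIV \<sigma>" "\<nexists>p. \<sigma> = poly p" and \<eta>: "\<eta> > 0"
  shows "\<exists>c\<in>networks \<sigma>. integrable (lebesgue_on {0<..<T}) (\<lambda>t. (F t - c t)\<^sup>2) \<and>
    (LINT t|lebesgue_on {0<..<T}. (F t - c t)\<^sup>2) < \<eta>"
proof -
  let ?M = "lebesgue_on {0<..<T}"
  have lm: "{0<..<T} \<in> lmeasurable" by simp
  have fin: "finite_measure ?M" by (rule finite_measure_lebesgue_on[OF lm])
  obtain h where h: "continuous_on UNIV h" "(LINT t|?M. (F t - 1 * h t)\<^sup>2) < \<eta> / 4"
    using weighted_L2_approx[OF lm F, of "\<lambda>_. 1" "\<eta> / 4"] \<eta> by auto
  have hm: "h \<in> borel_measurable ?M"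
    by (intro continuous_imp_measurable_on_sets_lebesgue continuous_on_subset[OF h(1)]) auto
  define \<delta> where "\<delta> = sqrt (\<eta> / (4 * T))"
  have \<delta>: "\<delta> > 0" "\<delta>\<^sup>2 = \<eta> / (4 * T)" using \<eta> T by (auto simp: \<delta>_def)
  obtain c where c: "c \<in> networks \<sigma>" "\<forall>t\<in>{0..T}. \<bar>h t - c t\<bar> \<le> \<delta>"
    using continuous_approx_networks[OF \<sigma> continuous_on_subset[OF h(1)] \<delta>(1)] by blast
  have cc: "continuous_on UNIV c" using c(1)
  proof (induction rule: networks_induct)
    case zero show ?case by simp
  next
    case (step d w b k)
    show ?case by (intro continuous_intros continuous_on_compose2[OF \<sigma>(1)] step) auto
  qed
  have cm: "c \<in> borel_measurable ?M"
    by (intro continuous_imp_measurable_on_sets_lebesgue continuous_on_subset[OF cc]) auto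
  obtain C where C: "\<And>t. t \<in> {0..T} \<Longrightarrow> \<bar>h t\<bar> \<le> C"
  proof -
    have "compact (h ` {0..T})" by (intro compact_continuous_image continuous_on_subset[OF h(1)]) auto
    then obtain C where "\<forall>y\<in>h ` {0..T}. norm y \<le> C" using compact_imp_bounded bounded_iff by metis
    thus ?thesis using that[of C] by simp
  qed
  have ih: "integrable ?M (\<lambda>t. (h t)\<^sup>2)"
  proof (rule finite_measure.integrable_const_bound[OF fin, of _ "C\<^sup>2"])
    show "AE t in ?M. norm ((h t)\<^sup>2) \<le> C\<^sup>2"
    proof (intro AE_I2)
      fix t assume "t \<in> space ?M"
      hence "\<bar>h t\<bar> \<le> C" by (intro C) auto
      from power_mono[OF this abs_ge_zero, of 2] show "norm ((h t)\<^sup>2) \<le> C\<^sup>2" by simp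
    qed
  qed (use hm in measurable)
  have i1: "integrable ?M (\<lambda>t. (F t - h t)\<^sup>2)"
  proof (rule Bochner_Integration.integrable_bound)
    show "integrable ?M (\<lambda>t. 2 * (F t)\<^sup>2 + 2 * (h t)\<^sup>2)"
      using F(2) ih by (intro Bochner_Integration.integrable_add integrable_mult_right)
    show "(\<lambda>t. (F t - h t)\<^sup>2) \<in> borel_measurable ?M" using F(1) hm by measurable
    show "AE t in ?M. norm ((F t - h t)\<^sup>2) \<le> norm (2 * (F t)\<^sup>2 + 2 * (h t)\<^sup>2)"
      using square_add_le[of "F _" "- h _"] by (intro AE_I2) simp
  qed
  have i2: "integrable ?M (\<lambda>t. 2 * (F t - h t)\<^sup>2 + 2 * \<delta>\<^sup>2)"
    using i1 finite_measure.integrable_const[OF fin] by (intro Bochner_Integration.integrable_add integrable_mult_right) auto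
  have le: "(F t - c t)\<^sup>2 \<le> 2 * (F t - h t)\<^sup>2 + 2 * \<delta>\<^sup>2" if "t \<in> {0<..<T}" for t
  proof -
    have "\<bar>h t - c t\<bar> \<le> \<delta>" using c(2) that by auto
    from power_mono[OF this abs_ge_zero, of 2] have "(h t - c t)\<^sup>2 \<le> \<delta>\<^sup>2" by simp
    thus ?thesis using square_add_le[of "F t - h t" "h t - c t"] by simp
  qed
  have i3: "integrable ?M (\<lambda>t. (F t - c t)\<^sup>2)"
  proof (rule Bochner_Integration.integrable_bound[OF i2])
    show "(\<lambda>t. (F t - c t)\<^sup>2) \<in> borel_measurable ?M" using F(1) cm by measurable
    show "AE t in ?M. norm ((F t - c t)\<^sup>2) \<le> norm (2 * (F t - h t)\<^sup>2 + 2 * \<delta>\<^sup>2)"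
      using le by (intro AE_I2) simp
  qed
  have "(LINT t|?M. (F t - c t)\<^sup>2) \<le> (LINT t|?M. 2 * (F t - h t)\<^sup>2 + 2 * \<delta>\<^sup>2)"
    using le by (intro integral_mono i3 i2) auto
  also have "\<dots> = 2 * (LINT t|?M. (F t - h t)\<^sup>2) + 2 * \<delta>\<^sup>2 * measure ?M (space ?M)"
    by (subst Bochner_Integration.integral_add[OF integrable_mult_right[OF i1] finite_measure.integrable_const[OF fin]]) simp
  also have "measure ?M (space ?M) = T" using T by (simp add: measure_restrict_space)
  also have "2 * (LINT t|?M. (F t - h t)\<^sup>2) + 2 * \<delta>\<^sup>2 * T < \<eta>"
    using h(2) T \<delta>(2) by simp
  finally show ?thesis using i3 c(1) by blast
qed

lemma L2_norm_indicator_le: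
  fixes v :: "'n::finite func"
  assumes "v \<in> L2"
  shows "L2_norm (\<lambda>x. indicator \<omega> x * v x) \<le> L2_norm v"
proof -
  have "(LINT x|lebesgue_on \<Omega>. (indicator \<omega> x * v x)\<^sup>2) \<le> (LINT x|lebesgue_on \<Omega>. (v x)\<^sup>2)"
    by (rule integral_mono'[OF L2_integrable_sq[OF assms]]) (auto simp: indicator_def)
  thus ?thesis unfolding L2_norm_def by (rule real_sqrt_le_mono)
qed

text \<open>At almost every time the squared error is the sum of the truncation error \<open>R P t\<close>, which decreases to \<open>0\<close> under the
integrable bound \<open>\<parallel>F t\<parallel>\<^sup>2\<close>, and of the weighted errors of finitely many coefficients.\<close>

theorem control_approx:
  fixes f :: "real \<Rightarrow> 'n::{finite, linorder} func"
  assumes \<alpha>: "\<alpha> \<ge> 0" and T: "T > 0" and f: "local_control \<omega> f \<in> L2_energy \<alpha> T"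
    and \<sigma>: "continuous_on UNIV \<sigma>" "\<nexists>p. \<sigma> = poly p" and \<epsilon>: "\<epsilon> > 0"
  shows "\<exists>P0. \<forall>P\<ge>P0. \<exists>c. (\<forall>j. c j \<in> networks \<sigma>) \<and>
    L2_energy_norm \<alpha> T (\<lambda>t. local_control \<omega> f t - local_control \<omega> (\<lambda>t x. \<Sum>j=1..P. c j t * eigenfunction j x) t) < \<epsilon>"
proof -
  let ?M = "lebesgue_on {0<..<T}"
  let ?e = "eigenfunction :: nat \<Rightarrow> 'n func"
  let ?n = "\<lambda>j. inner_L2 (?e j) (?e j)"
  define F where "F t = (\<lambda>x. indicator \<omega> x * f t x)" for t
  have lc: "local_control \<omega> f t = (0, F t)" for t by (simp add: local_control_def F_def)
  have sm: "strongly_measurable \<alpha> ?M (local_control \<omega> f)"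
    and "integrable ?M (\<lambda>t. (energy_norm \<alpha> (local_control \<omega> f t))\<^sup>2)"
    using f unfolding L2_energy_def by blast+
  hence isq: "integrable ?M (\<lambda>t. (L2_norm (F t))\<^sup>2)" unfolding lc energy_norm_snd by blast
  have FE: "AE t in ?M. F t \<in> L2"
    using sm unfolding strongly_measurable_def lc energy_space_def by auto
  have sets: "{0<..<T} \<in> sets lebesgue" by simp
  have coefm: "(\<lambda>t. modes.coef (F t) j) \<in> borel_measurable ?M" if j: "j \<ge> 1" for j
  proof -
    have v: "(0, ?e j) \<in> energy_space"
      unfolding energy_space_def using subspace_0[OF subspace_H01] eigenfunction_L2 by (intro SigmaI)
    have "energy_form \<alpha> (local_control \<omega> f t) (0, ?e j) = inner_L2 (F t) (?e j)" for t
      unfolding lc energy_form_def fst_conv snd_conv H1_form_0_left[OF smooth_H1[OF smooth_0]] by simp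
    hence "(\<lambda>t. inner_L2 (F t) (?e j)) \<in> borel_measurable ?M"
      using strongly_measurable_form[OF \<alpha> sets sm v] by simp
    thus ?thesis unfolding modes.coef_def by (intro borel_measurable_divide) auto
  qed
  have resid: "(L2_norm (F t - modes.proj P (F t)))\<^sup>2 = (L2_norm (F t))\<^sup>2 - (\<Sum>j=1..P. (modes.coef (F t) j)\<^sup>2 * ?n j)"
    if "F t \<in> L2" for t P
    unfolding modes.N_diff_proj[OF that] l2.N_sq[OF that] ..
  have Fm: "(\<lambda>t. (L2_norm (F t))\<^sup>2) \<in> borel_measurable ?M" using isq by auto
  define R where "R P t = (L2_norm (F t))\<^sup>2 - (\<Sum>j=1..P. (modes.coef (F t) j)\<^sup>2 * ?n j)" for P t
  have Rm: "R P \<in> borel_measurable ?M" for P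
    unfolding R_def by (intro borel_measurable_diff Fm borel_measurable_sum borel_measurable_times borel_measurable_power coefm) auto
  have R_bounds: "0 \<le> R P t \<and> R P t \<le> (L2_norm (F t))\<^sup>2" if "F t \<in> L2" for P t
  proof
    show "0 \<le> R P t" unfolding R_def resid[OF that, symmetric] by simp
    show "R P t \<le> (L2_norm (F t))\<^sup>2" unfolding R_def
      by (simp add: sum_nonneg l2.nonneg eigenfunction_L2)
  qed
  have iR: "integrable ?M (R P)" for P
    by (rule Bochner_Integration.integrable_bound[OF isq Rm]) (use FE R_bounds in \<open>auto elim!: eventually_mono\<close>)
  have "(\<lambda>P. LINT t|?M. R P t) \<longlonglongrightarrow> (LINT t|?M. 0)"
  proof (rule integral_dominated_convergence[where w="\<lambda>t. (L2_norm (F t))\<^sup>2"])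
    show "AE t in ?M. (\<lambda>P. R P t) \<longlonglongrightarrow> 0"
      using FE
    proof eventually_elim
      case (elim t)
      have "(\<lambda>P. (L2_norm (F t - modes.proj P (F t)))\<^sup>2) \<longlonglongrightarrow> 0\<^sup>2"
        by (intro tendsto_power modes.proj_tendsto elim)
      thus ?case unfolding R_def resid[OF elim, symmetric] by simp
    qed
    show "AE t in ?M. norm (R P t) \<le> (L2_norm (F t))\<^sup>2" for P
      using FE by eventually_elim (use R_bounds in auto)
  qed (use Rm isq in auto)
  hence "\<forall>\<^sub>F P in sequentially. (LINT t|?M. R P t) < \<epsilon>\<^sup>2 / 2"
    using \<epsilon> by (intro order_tendstoD(2)) auto
  then obtain P0 where P0: "\<And>P. P \<ge> P0 \<Longrightarrow> (LINT t|?M. R P t) < \<epsilon>\<^sup>2 / 2"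
    unfolding eventually_sequentially by blast
  show ?thesis
  proof (rule exI[of _ P0], intro allI impI)
    fix P assume P: "P \<ge> P0"
    define S where "S = (\<Sum>j=1..P. ?n j)"
    have S: "S \<ge> 0" unfolding S_def by (intro sum_nonneg l2.nonneg eigenfunction_L2)
    \<comment> \<open>the weights \<open>\<langle>e\<^sub>j, e\<^sub>j\<rangle>\<close> of the coefficient errors sum up to \<open>S\<close>\<close>
    define \<eta> where "\<eta> = \<epsilon>\<^sup>2 / (2 * (S + 1))"
    have \<eta>: "\<eta> > 0" using \<epsilon> S by (simp add: \<eta>_def)
    have \<eta>S: "\<eta> * S \<le> \<epsilon>\<^sup>2 / 2" unfolding \<eta>_def using S by (intro half_quotient_mult_le) auto
    have "\<exists>c\<in>networks \<sigma>. j \<ge> 1 \<longrightarrow> integrable ?M (\<lambda>t. (modes.coef (F t) j - c t)\<^sup>2) \<and>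
        (LINT t|?M. (modes.coef (F t) j - c t)\<^sup>2) < \<eta>" for j
    proof (cases "j \<ge> 1")
      case True
      have nj: "?n j > 0" by (rule eigenfunction_norm_pos[OF True])
      have "integrable ?M (\<lambda>t. (modes.coef (F t) j)\<^sup>2)"
      proof (rule Bochner_Integration.integrable_bound[OF integrable_divide[OF isq, of "?n j"]])
        show "(\<lambda>t. (modes.coef (F t) j)\<^sup>2) \<in> borel_measurable ?M" by (intro borel_measurable_power coefm True)
        show "AE t in ?M. norm ((modes.coef (F t) j)\<^sup>2) \<le> norm ((L2_norm (F t))\<^sup>2 / ?n j)"
          using FE
        proof eventually_elim
          case (elim t)
          have "(modes.coef (F t) j)\<^sup>2 * ?n j \<le> (\<Sum>j=1..j. (modes.coef (F t) j)\<^sup>2 * ?n j)"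
            using True by (intro member_le_sum[where f="\<lambda>j. (modes.coef (F t) j)\<^sup>2 * ?n j"] mult_nonneg_nonneg l2.nonneg eigenfunction_L2) auto
          also have "\<dots> \<le> (L2_norm (F t))\<^sup>2" using R_bounds[OF elim, of j] unfolding R_def by linarith
          finally show ?case using nj by (simp add: pos_le_divide_eq)
        qed
      qed
      from interval_L2_approx_networks[OF T coefm[OF True] this \<sigma> \<eta>] show ?thesis by blast
    next
      case False
      thus ?thesis using ridge_in_networks by blast
    qed
    hence "\<forall>j. \<exists>c. c \<in> networks \<sigma> \<and> (j \<ge> 1 \<longrightarrow> integrable ?M (\<lambda>t. (modes.coef (F t) j - c t)\<^sup>2) \<and>
        (LINT t|?M. (modes.coef (F t) j - c t)\<^sup>2) < \<eta>)" by blast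
    from choice[OF this] obtain c where "\<forall>j. c j \<in> networks \<sigma> \<and> (j \<ge> 1 \<longrightarrow>
        integrable ?M (\<lambda>t. (modes.coef (F t) j - c j t)\<^sup>2) \<and> (LINT t|?M. (modes.coef (F t) j - c j t)\<^sup>2) < \<eta>)" by blast
    hence c: "\<And>j. c j \<in> networks \<sigma>"
      "\<And>j. j \<ge> 1 \<Longrightarrow> integrable ?M (\<lambda>t. (modes.coef (F t) j - c j t)\<^sup>2)"
      "\<And>j. j \<ge> 1 \<Longrightarrow> (LINT t|?M. (modes.coef (F t) j - c j t)\<^sup>2) < \<eta>"
      by blast+
    define B where "B t = R P t + (\<Sum>j=1..P. (modes.coef (F t) j - c j t)\<^sup>2 * ?n j)" for t
    have iB: "integrable ?M B" unfolding B_def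
      by (intro Bochner_Integration.integrable_add iR Bochner_Integration.integrable_sum integrable_mult_left c(2)) auto
    have "(LINT t|?M. B t) = (LINT t|?M. R P t) + (\<Sum>j=1..P. (LINT t|?M. (modes.coef (F t) j - c j t)\<^sup>2) * ?n j)"
    proof -
      have i: "integrable ?M (\<lambda>t. (modes.coef (F t) j - c j t)\<^sup>2 * ?n j)" if "j \<in> {1..P}" for j
        using that by (intro integrable_mult_left c(2)) auto
      have "(LINT t|?M. B t) = (LINT t|?M. R P t) + (LINT t|?M. (\<Sum>j=1..P. (modes.coef (F t) j - c j t)\<^sup>2 * ?n j))"
        unfolding B_def by (rule Bochner_Integration.integral_add[OF iR Bochner_Integration.integrable_sum[OF i]])
      thus ?thesis using Bochner_Integration.integral_sum[of "{1..P}" ?M "\<lambda>j t. (modes.coef (F t) j - c j t)\<^sup>2 * ?n j", OF i] by simp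
    qed
    also have "\<dots> < \<epsilon>\<^sup>2"
    proof -
      have "(\<Sum>j=1..P. (LINT t|?M. (modes.coef (F t) j - c j t)\<^sup>2) * ?n j) \<le> (\<Sum>j=1..P. \<eta> * ?n j)"
        by (intro sum_mono mult_right_mono less_imp_le[OF c(3)] l2.nonneg eigenfunction_L2) auto
      also have "\<dots> = \<eta> * S" by (simp only: S_def sum_distrib_left)
      finally show ?thesis using P0[OF P] \<eta>S by linarith
    qed
    finally have B: "(LINT t|?M. B t) < \<epsilon>\<^sup>2" .
    let ?d = "\<lambda>t. local_control \<omega> f t - local_control \<omega> (\<lambda>t x. \<Sum>j=1..P. c j t * eigenfunction j x) t"
    have le: "AE t in ?M. (energy_norm \<alpha> (?d t))\<^sup>2 \<le> B t"
      using FE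
    proof eventually_elim
      case (elim t)
      let ?s = "\<Sum>j=1..P. c j t *\<^sub>R ?e j"
      have sL: "?s \<in> L2" by (rule modes.lincomb_E)
      have "?d t = (0, \<lambda>x. indicator \<omega> x * (F t - ?s) x)"
        by (rule prod_eqI) (auto simp: local_control_def F_def fun_eq_iff sum_fun_apply scaleR_fun_def indicator_def)
      hence "energy_norm \<alpha> (?d t) = L2_norm (\<lambda>x. indicator \<omega> x * (F t - ?s) x)" by (simp only: energy_norm_snd)
      also have "\<dots> \<le> L2_norm (F t - ?s)" by (rule L2_norm_indicator_le[OF l2.diff_E[OF elim sL]])
      finally have le: "energy_norm \<alpha> (?d t) \<le> L2_norm (F t - ?s)" .
      have "0 \<le> energy_norm \<alpha> (?d t)" unfolding energy_norm_def by simp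
      from power_mono[OF le this, of 2] have "(energy_norm \<alpha> (?d t))\<^sup>2 \<le> (L2_norm (F t - ?s))\<^sup>2" .
      also have "\<dots> = B t"
        unfolding modes.N_diff_lincomb[OF elim] B_def R_def l2.N_sq[OF elim]
        by (simp only: power2_commute[of "c _ t"])
      finally show ?case .
    qed
    have "(LINT t|?M. (energy_norm \<alpha> (?d t))\<^sup>2) \<le> (LINT t|?M. B t)"
    proof (rule integral_mono_AE'[OF iB le])
      show "AE t in ?M. 0 \<le> B t" using le by eventually_elim (rule order.trans[OF zero_le_power2])
    qed
    hence "sqrt (LINT t|?M. (energy_norm \<alpha> (?d t))\<^sup>2) < sqrt (\<epsilon>\<^sup>2)" using B by (intro real_sqrt_less_mono) linarith
    hence "L2_energy_norm \<alpha> T ?d < \<epsilon>" unfolding L2_energy_norm_def using \<epsilon> by simp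
    thus "\<exists>c. (\<forall>j. c j \<in> networks \<sigma>) \<and> L2_energy_norm \<alpha> T
        (\<lambda>t. local_control \<omega> f t - local_control \<omega> (\<lambda>t x. \<Sum>j=1..P. c j t * eigenfunction j x) t) < \<epsilon>"
      using c(1) by blast
  qed
qed

section \<open>Neural-spectral approximation of state and control\<close>

text \<open>State and control use the same truncation order and the same width. Both can be enlarged freely:
the two approximation theorems hold for all sufficiently large orders, and a network may be padded with
zero output weights.\<close>

theorem theorem14:
  fixes \<omega> :: "(real ^ 'n::{finite, linorder}) set"
    and T \<alpha> L\<^sub>g \<epsilon> :: real
    and S :: "real \<Rightarrow> 'n state \<Rightarrow> 'n state"
    and \<Phi>\<^sub>0 \<Phi>\<^sub>T :: "'n state"
    and \<Phi> :: "real \<Rightarrow> 'n state"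
    and f :: "real \<Rightarrow> real ^ 'n::{finite, linorder} \<Rightarrow> real"
    and g \<sigma> :: "real \<Rightarrow> real"
  assumes "open \<omega>" "\<omega> \<noteq> {}" "\<omega> \<subseteq> \<Omega>"
    and "T > 0" "\<alpha> \<ge> 0"
    and "geometric_control_condition \<omega> T"
    and "wave_group \<alpha> S"
    and "\<Phi>\<^sub>0 \<in> energy_space" "\<Phi>\<^sub>T \<in> energy_space"
    and "\<forall>u \<in> (H01 :: (real ^ 'n::{finite, linorder} \<Rightarrow> real) set). g \<circ> u \<in> L2"
    and "\<forall>u \<in> (H01 :: (real ^ 'n::{finite, linorder} \<Rightarrow> real) set). \<forall>v\<in>H01.
           L2_norm ((g \<circ> u) - (g \<circ> v)) \<le> L\<^sub>g * H01_norm \<alpha> (u - v)"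
    and "local_control \<omega> f \<in> L2_energy \<alpha> T"
    and "mild_solution \<alpha> S T \<Phi>\<^sub>0 (local_control \<omega> f) (\<lambda>(u, z). (0, g \<circ> u)) \<Phi>"
    and "energy_norm \<alpha> (\<Phi> 0 - \<Phi>\<^sub>0) = 0" "energy_norm \<alpha> (\<Phi> T - \<Phi>\<^sub>T) = 0"
    and "C2_fun \<sigma>" "\<nexists>p. \<sigma> = poly p"
    and "\<epsilon> > 0"
  shows "\<exists>P\<ge>1. \<exists>m\<ge>1. \<exists>\<theta>\<^sub>a \<theta>\<^sub>c :: params.
           (SUP t\<in>{0..T}. ereal (energy_norm \<alpha> (\<Phi> t - ns_state \<sigma> P m \<theta>\<^sub>a t))) < ereal \<epsilon> \<and>
           L2_energy_norm \<alpha> T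
             (\<lambda>t. local_control \<omega> f t - local_control \<omega> (ns_control \<sigma> P m \<theta>\<^sub>c) t) < \<epsilon>"
proof -
  note T = \<open>T > 0\<close> and \<alpha> = \<open>\<alpha> \<ge> 0\<close> and \<sigma> = \<open>C2_fun \<sigma>\<close> \<open>\<nexists>p. \<sigma> = poly p\<close> and \<epsilon> = \<open>\<epsilon> > 0\<close>
  note mild = \<open>mild_solution \<alpha> S T \<Phi>\<^sub>0 (local_control \<omega> f) (\<lambda>(u, z). (0, g \<circ> u)) \<Phi>\<close>
  note f = \<open>local_control \<omega> f \<in> L2_energy \<alpha> T\<close>
  have \<sigma>c: "continuous_on UNIV \<sigma>"
    using \<sigma>(1) unfolding C2_fun_def by (metis DERIV_continuous_on)
  have c: "continuous_energy \<alpha> T \<Phi>" using mild unfolding mild_solution_def by blast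
  have modes: "((\<lambda>t. inner_L2 (fst (\<Phi> t)) (eigenfunction j)) has_real_derivative inner_L2 (snd (\<Phi> t)) (eigenfunction j)) (at t within {0..T})"
    if "j \<ge> 1" "t \<in> {0..T}" for j t
    by (rule mild_solution_modes[OF \<alpha> \<open>wave_group \<alpha> S\<close> T \<open>\<Phi>\<^sub>0 \<in> energy_space\<close>
          \<open>\<forall>u \<in> (H01 :: ('n func) set). g \<circ> u \<in> L2\<close> f mild that])
  obtain P1 where P1: "\<And>P. P \<ge> P1 \<Longrightarrow> \<exists>a. (\<forall>j. a j \<in> networks \<sigma>) \<and>
    (\<forall>t\<in>{0..T}. energy_norm \<alpha> (\<Phi> t - ((\<Sum>j=1..P. a j t *\<^sub>R eigenfunction j), (\<Sum>j=1..P. deriv (a j) t *\<^sub>R eigenfunction j))) \<le> \<epsilon> / 2)"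
    using state_approx[OF \<alpha> T c modes \<sigma>, of "\<epsilon> / 2"] \<epsilon> by auto
  obtain P2 where P2: "\<And>P. P \<ge> P2 \<Longrightarrow> \<exists>c. (\<forall>j. c j \<in> networks \<sigma>) \<and>
    L2_energy_norm \<alpha> T (\<lambda>t. local_control \<omega> f t - local_control \<omega> (\<lambda>t x. \<Sum>j=1..P. c j t * eigenfunction j x) t) < \<epsilon>"
    using control_approx[OF \<alpha> T f \<sigma>c \<sigma>(2) \<epsilon>] by blast
  define P where "P = max 1 (max P1 P2)"
  have PP: "P \<ge> P1" "P \<ge> P2" by (simp_all add: P_def)
  obtain a where a: "\<And>j. a j \<in> networks \<sigma>"
    "\<And>t. t \<in> {0..T} \<Longrightarrow> energy_norm \<alpha> (\<Phi> t - ((\<Sum>j=1..P. a j t *\<^sub>R eigenfunction j), (\<Sum>j=1..P. deriv (a j) t *\<^sub>R eigenfunction j))) \<le> \<epsilon> / 2"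
    using P1[OF PP(1)] by blast
  obtain c where c: "\<And>j. c j \<in> networks \<sigma>"
    "L2_energy_norm \<alpha> T (\<lambda>t. local_control \<omega> f t - local_control \<omega> (\<lambda>t x. \<Sum>j=1..P. c j t * eigenfunction j x) t) < \<epsilon>"
    using P2[OF PP(2)] by blast
  obtain m1 where m1: "\<And>m. m \<ge> m1 \<Longrightarrow> \<exists>\<theta>. \<forall>j\<in>{1..P}. net \<sigma> m \<theta> j = a j"
    using networks_params[of P a \<sigma>] a(1) by blast
  obtain m2 where m2: "\<And>m. m \<ge> m2 \<Longrightarrow> \<exists>\<theta>. \<forall>j\<in>{1..P}. net \<sigma> m \<theta> j = c j"
    using networks_params[of P c \<sigma>] c(1) by blast
  define m where "m = max 1 (max m1 m2)"
  have mm: "m \<ge> m1" "m \<ge> m2" by (simp_all add: m_def)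
  obtain \<theta>a where \<theta>a: "\<forall>j\<in>{1..P}. net \<sigma> m \<theta>a j = a j" using m1[OF mm(1)] by blast
  obtain \<theta>c where \<theta>c: "\<forall>j\<in>{1..P}. net \<sigma> m \<theta>c j = c j" using m2[OF mm(2)] by blast
  have state: "ns_state \<sigma> P m \<theta>a t = ((\<Sum>j=1..P. a j t *\<^sub>R eigenfunction j), (\<Sum>j=1..P. deriv (a j) t *\<^sub>R eigenfunction j))" for t
    unfolding ns_state_def using \<theta>a
    by (intro prod_eqI ext) (simp_all only: fst_conv snd_conv sum_fun_apply scaleR_fun_def real_scaleR_def cong: sum.cong)
  have control: "ns_control \<sigma> P m \<theta>c = (\<lambda>t x. \<Sum>j=1..P. c j t * eigenfunction j x)"
    unfolding ns_control_def using \<theta>c by (intro ext sum.cong) auto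
  have "(SUP t\<in>{0..T}. ereal (energy_norm \<alpha> (\<Phi> t - ns_state \<sigma> P m \<theta>a t))) \<le> ereal (\<epsilon> / 2)"
    unfolding state using a(2) by (intro SUP_least) simp
  also have "\<dots> < ereal \<epsilon>" using \<epsilon> by simp
  finally have "(SUP t\<in>{0..T}. ereal (energy_norm \<alpha> (\<Phi> t - ns_state \<sigma> P m \<theta>a t))) < ereal \<epsilon>" .
  moreover have "L2_energy_norm \<alpha> T (\<lambda>t. local_control \<omega> f t - local_control \<omega> (ns_control \<sigma> P m \<theta>c) t) < \<epsilon>"
    unfolding control by (rule c(2))
  moreover have "P \<ge> 1" "m \<ge> 1" by (auto simp: P_def m_def)
  ultimately show ?thesis by blast
qed

end
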